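(* Let $k\ge2$, $d\in\mathbb Z_+$, and let $f_i\in\mathcal L_k$, $i=1,\dots,d$, with $\mu^k(f_i>0)>0$ for each $i$. Assume that there exists a probability measure $m$ equivalent to $\mu$, with $\psi=d\mu/dm\in(0,\infty)$ $m$-a.e., such that $f_i\cdot(\psi^{\otimes k})^{1/\alpha}\in\mathcal L_{k,+}^\alpha(m)$ for $1\le i\le d$. Then the random vector $(I_k^e(f_1),\dots,I_k^e(f_d))$ belongs to $\mathrm{MRV}_d(\alpha)$; more specifically, for every $\boldsymbol x=(x_1,\dots,x_d)\in(0,\infty)^d$, $$\lim_{t\to\infty}t^\alpha(\ln t)^{-(k-1)}\,\mathbb P\Bigl(\bigl(I_k^e(f_i)\bigr)_{i=1,\dots,d}\in[\boldsymbol 0,t\boldsymbol x]^c\Bigr)=k\,\alpha^{k-1}(k!)^{-2}\int_{E^k}\bigvee_{i=1}^d\frac{\widetilde f_i^{\,\alpha}(\boldsymbol u)}{x_i^\alpha}\,\mu^k(d\boldsymbol u).$$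
   Context: $\mathbb Z_+=\{1,2,\dots\}$, $\alpha\in(0,\infty)$, $\bigvee$ denotes supremum. $(E,\mathcal E)$ is a Borel space (there is a measurable bijection, with measurable inverse, onto a Borel subset of $[0,1]$) and $\mu$ is a nonzero $\sigma$-finite measure on it. Notation: $\ln_+x=\ln(x\vee1)$; $\psi^{\otimes k}(x_1,\dots,x_k)=\psi(x_1)\cdots\psi(x_k)$; $[\boldsymbol 0,t\boldsymbol x]=\prod_{i=1}^d[0,tx_i]$ and ${}^c$ is complement. The max-symmetrization of $f$ is $\widetilde f(u_1,\dots,u_k)=\bigvee_\pi f(u_{\pi(1)},\dots,u_{\pi(k)})$ over all permutations $\pi$ of $\{1,\dots,k\}$. For a measure $\nu$ on $E$, $\mathcal L_{k,+}^\alpha(\nu)$ is the class of $h\in\mathcal L_k$ with $\int_{E^k}h^\alpha(1+(\ln_+h)^{k-1})\,d\nu^k<\infty$ if $k>2$, and $\int_{E^2}h^\alpha\bigl(1+(\ln_+h)\cdot\ln_+|\ln h|\bigr)\,d\nu^2<\infty$ if $k=2$. A random vector $\boldsymbol X$ in $[0,\infty)^d$ belongs to $\mathrm{MRV}_d(\alpha)$ (multivariate regularly varying with index $\alpha$) if there is a function $\nu:(0,\infty)^d\to(0,\infty)$ with $\lim_{t\to\infty}\mathbb P(\boldsymbol X\in[\boldsymbol 0,t\boldsymbol x]^c)/\mathbb P(\boldsymbol X\in[\boldsymbol 0,t\boldsymbol 1]^c)=\nu(\boldsymbol x)$ for all $\boldsymbol x\in(0,\infty)^d$, where $\boldsymbol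 1=(1,\dots,1)$, and $\nu(c\boldsymbol x)=c^{-\alpha}\nu(\boldsymbol x)$ for $c>0$. $M_\alpha=(M_\alpha(A))_{A\in\mathcal E}$ is an independently scattered $\alpha$-Fréchet random sup measure with control measure $\mu$: $[0,\infty]$-valued random variables such that (i) $M_\alpha(A_1),\dots,M_\alpha(A_n)$ are independent for disjoint $A_i\in\mathcal E$; (ii) $\mathbb P(M_\alpha(A)\le x)=\exp\{-\mu(A)x^{-\alpha}\}$, $x\in(0,\infty)$ (so $M_\alpha(A)=\infty$ a.s. if $\mu(A)=\infty$); (iii) $M_\alpha(\bigcup_{j\ge1}A_j)=\bigvee_{j\ge1}M_\alpha(A_j)$ a.s. for $A_j\in\mathcal E$. Off-diagonal space: $D^{(k)}=\{(x_1,\dots,x_k)\in E^k:x_i=x_j\text{ for some }i\ne j\}$, $E^{(k)}=E^k\setminus D^{(k)}$, $\mathcal E^{(k)}=\{A\cap E^{(k)}:A\in\mathcal E^k\}$. $\mathcal L_k$ is the class of measurable $f:E^k\to[0,\infty]$ vanishing on $D^{(k)}$. Product random sup measure $M_\alpha^{(k)}$ on $\mathcal E^{(k)}$: when the control measure is finite, $M_\alpha^{(k)}(A_1\times\cdots\times A_k)=M_\alpha(A_1)\cdots M_\alpha(A_k)$ for pairwise disjoint $A_i\in\mathcal E$; $M_\alpha^{(k)}(\bigcup_{i=1}^mB_i)=\bigvee_{i=1}^mM_\alpha^{(k)}(B_i)$ for such off-diagonal rectangles $B_i$; and for $A\in\mathcal E^{(k)}$, $M_\alpha^{(k)}(A)$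 is the $L^\gamma$-limit ($\gamma\in(0,\alpha)$) of $M_\alpha^{(k)}(A_n)$ for finite unions $A_n$ of off-diagonal rectangles with $\mu^k(A_n\Delta A)\to0$. For $\sigma$-finite $\mu$, take $E_n\uparrow E$ with $\mu(E_n)\in(0,\infty)$, let $M_{\alpha,E_n}(\cdot)=M_\alpha(\cdot\cap E_n)$ and $M_\alpha^{(k)}(A)=\bigvee_nM_{\alpha,E_n}^{(k)}(A)$. All of this is a.s. independent of choices. Multiple extremal integral: for simple $f=\sum_{i=1}^Na_i\mathbf 1_{A_i}$ with $a_i\in(0,\infty)$ and disjoint $A_i\in\mathcal E^{(k)}$, $I_k^e(f)=\bigvee_{i=1}^Na_iM_\alpha^{(k)}(A_i)$. For $f\in\mathcal L_k$, $I_k^e(f)$ is the a.s. limit of $I_k^e(f_n)$ for any such simple $f_n\le f_{n+1}$ with $f_n\to f$ $\mu^k$-a.e. (a.s. independent of the choice). Equivalently in law (LePage representation), jointly over $f\in\mathcal L_k$ and $k\in\mathbb Z_+$ and for any probability measure $m$ equivalent to $\mu$ with $\psi=d\mu/dm\in(0,\infty)$ $m$-a.e., $I_k^e(f)\overset d=\bigvee_{\boldsymbol j}f(T_{j_1},\dots,T_{j_k})\prod_{r=1}^k\Gamma_{j_r}^{-1/\alpha}\psi(T_{j_r})^{1/\alpha}$, the supremum being over $\boldsymbol j\in\mathbb Z_+^k$ with distinct entries, $(\Gamma_i)$ the arrival times of a standard Poisson process, and $(T_i)$ i.i.d. with law $m$ independent of $(\Gamma_i)$. *)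

theory Defs
  imports "HOL-Probability.Probability"
begin

text \<open>
  The space \<open>E\<close> with its \<open>\<sigma>\<close>-field is carried by the measure \<open>\<mu>\<close>.
  Points of \<open>E\<^sup>k\<close> are functions \<open>u :: nat \<Rightarrow> 'a\<close> in \<open>space (kpow k \<mu>)\<close>, with coordinates
  indexed by \<open>{..<k}\<close> rather than \<open>{1..k}\<close>.
\<close>

abbreviation kpow :: "nat \<Rightarrow> 'a measure \<Rightarrow> (nat \<Rightarrow> 'a) measure" where
  "kpow k \<mu> \<equiv> PiM {..<k} (\<lambda>_. \<mu>)"

definition borel_space :: "'a measure \<Rightarrow> bool" where
  "borel_space M \<longleftrightarrow> (\<exists>(\<phi> :: 'a \<Rightarrow> real) B.
     B \<in> sets borel \<and> B \<subseteq> {0..1} \<and> bij_betw \<phi> (space M) B \<and>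
     \<phi> \<in> measurable M (restrict_space borel B) \<and>
     the_inv_into (space M) \<phi> \<in> measurable (restrict_space borel B) M)"

text \<open>Real powers on \<open>[0,\<infinity>]\<close>, only used with exponent \<open>a > 0\<close>; note \<open>0 powr a = 0\<close>.\<close>

definition epowr :: "ennreal \<Rightarrow> real \<Rightarrow> ennreal" where
  "epowr x a = (if x = \<infinity> then \<infinity> else ennreal (enn2real x powr a))"

definition ln_plus :: "real \<Rightarrow> real" where
  "ln_plus x = ln (max x 1)"

definition offdiag :: "nat \<Rightarrow> 'a measure \<Rightarrow> (nat \<Rightarrow> 'a) set" where
  "offdiag k \<mu> = {u \<in> space (kpow k \<mu>). inj_on u {..<k}}"

definition offdiag_sets :: "nat \<Rightarrow> 'a measure \<Rightarrow> (nat \<Rightarrow> 'a) set set" where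
  "offdiag_sets k \<mu> = {A \<inter> offdiag k \<mu> | A. A \<in> sets (kpow k \<mu>)}"

definition offdiag_rects :: "nat \<Rightarrow> 'a measure \<Rightarrow> (nat \<Rightarrow> 'a) set set" where
  "offdiag_rects k \<mu> = {Pi\<^sub>E {..<k} A | A.
     (\<forall>i<k. A i \<in> sets \<mu>) \<and> disjoint_family_on A {..<k}}"

definition offdiag_rect_unions :: "nat \<Rightarrow> 'a measure \<Rightarrow> (nat \<Rightarrow> 'a) set set" where
  "offdiag_rect_unions k \<mu> = {\<Union>\<B> | \<B>. finite \<B> \<and> \<B> \<subseteq> offdiag_rects k \<mu>}"

definition L_class :: "nat \<Rightarrow> 'a measure \<Rightarrow> ((nat \<Rightarrow> 'a) \<Rightarrow> ennreal) set" where
  "L_class k \<mu> = {f \<in> borel_measurable (kpow k \<mu>).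
     \<forall>u \<in> space (kpow k \<mu>) - offdiag k \<mu>. f u = 0}"

text \<open>
  The integrands \<open>h\<^sup>\<alpha> (1 + (ln\<^sub>+ h)\<^sup>k\<^sup>-\<^sup>1)\<close> for \<open>k > 2\<close> and
  \<open>h\<^sup>\<alpha> (1 + ln\<^sub>+ h \<cdot> ln\<^sub>+ \<bar>ln h\<bar>)\<close> for \<open>k = 2\<close>, with value \<open>\<infinity>\<close> at \<open>h = \<infinity>\<close>.
  At \<open>h = 0\<close> the value is \<open>0\<close>, so HOL's \<open>ln 0 = 0\<close> is harmless.
\<close>

definition L_plus_integrand :: "nat \<Rightarrow> real \<Rightarrow> ennreal \<Rightarrow> ennreal" where
  "L_plus_integrand k \<alpha> h =
     (if h = \<infinity> then \<infinity>
      else let r = enn2real h in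
        ennreal (r powr \<alpha> *
          (1 + (if k = 2 then ln_plus r * ln_plus \<bar>ln r\<bar> else ln_plus r ^ (k - 1)))))"

definition L_plus_class ::
  "nat \<Rightarrow> real \<Rightarrow> 'a measure \<Rightarrow> ((nat \<Rightarrow> 'a) \<Rightarrow> ennreal) set" where
  "L_plus_class k \<alpha> \<nu> = {h \<in> L_class k \<nu>.
     (\<integral>\<^sup>+ u. L_plus_integrand k \<alpha> (h u) \<partial>kpow k \<nu>) < \<infinity>}"

definition max_sym :: "nat \<Rightarrow> ((nat \<Rightarrow> 'a) \<Rightarrow> ennreal) \<Rightarrow> (nat \<Rightarrow> 'a) \<Rightarrow> ennreal" where
  "max_sym k f u = (SUP \<pi>\<in>{\<pi>. \<pi> permutes {..<k}}. f (u \<circ> \<pi>))"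

definition MRV :: "'w measure \<Rightarrow> real \<Rightarrow> ('w \<Rightarrow> real ^ 'd::finite) \<Rightarrow> bool" where
  "MRV P \<alpha> X \<longleftrightarrow>
     X \<in> borel_measurable P \<and> (AE w in P. \<forall>i. 0 \<le> X w $ i) \<and>
     (\<exists>\<nu> :: real ^ 'd \<Rightarrow> real.
        (\<forall>x. (\<forall>i. 0 < x $ i) \<longrightarrow> 0 < \<nu> x \<and>
           ((\<lambda>t. measure P {w \<in> space P. X w \<notin> cbox 0 (t *\<^sub>R x)} /
                 measure P {w \<in> space P. X w \<notin> cbox 0 (t *\<^sub>R 1)}) \<longlongrightarrow> \<nu> x) at_top) \<and>
        (\<forall>x c. (\<forall>i. 0 < x $ i) \<longrightarrow> 0 < c \<longrightarrow> \<nu> (c *\<^sub>R x) = c powr (- \<alpha>) * \<nu> x))"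

definition frechet_sup_measure ::
  "'w measure \<Rightarrow> 'a measure \<Rightarrow> real \<Rightarrow> ('a set \<Rightarrow> 'w \<Rightarrow> ennreal) \<Rightarrow> bool" where
  "frechet_sup_measure P \<mu> \<alpha> M \<longleftrightarrow>
     (\<forall>A\<in>sets \<mu>. M A \<in> borel_measurable P) \<and>
     (\<forall>n (A :: nat \<Rightarrow> 'a set). (\<forall>i<n. A i \<in> sets \<mu>) \<longrightarrow> disjoint_family_on A {..<n} \<longrightarrow>
        prob_space.indep_vars P (\<lambda>_. borel) (\<lambda>i. M (A i)) {..<n}) \<and>
     (\<forall>A\<in>sets \<mu>. \<forall>x>0. measure P {w \<in> space P. M A w \<le> ennreal x} =
        (if emeasure \<mu> A = \<infinity> then 0 else exp (- (measure \<mu> A * x powr (- \<alpha>))))) \<and>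
     (\<forall>A :: nat \<Rightarrow> 'a set. (\<forall>j. A j \<in> sets \<mu>) \<longrightarrow>
        (AE w in P. M (\<Union>j. A j) w = (SUP j. M (A j) w)))"

text \<open>
  \<open>N\<close> is (a version of) the \<open>k\<close>-fold product of the random sup measure \<open>M\<close>, for a finite control
  measure \<open>\<mu>\<close>.  In \<open>ennreal\<close>, subtraction truncates at \<open>0\<close>, so \<open>max (X - Y) (Y - X)\<close> is
  \<open>\<bar>X - Y\<bar>\<close> for finite \<open>X\<close>, \<open>Y\<close>.
\<close>

definition product_sup_measure_finite ::
  "'w measure \<Rightarrow> 'a measure \<Rightarrow> real \<Rightarrow> nat \<Rightarrow> ('a set \<Rightarrow> 'w \<Rightarrow> ennreal) \<Rightarrow>
   ((nat \<Rightarrow> 'a) set \<Rightarrow> 'w \<Rightarrow> ennreal) \<Rightarrow> bool" where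
  "product_sup_measure_finite P \<mu> \<alpha> k M N \<longleftrightarrow>
     (\<forall>A\<in>offdiag_sets k \<mu>. N A \<in> borel_measurable P) \<and>
     (\<forall>A. (\<forall>i<k. A i \<in> sets \<mu>) \<longrightarrow> disjoint_family_on A {..<k} \<longrightarrow>
        (AE w in P. N (Pi\<^sub>E {..<k} A) w = (\<Prod>i<k. M (A i) w))) \<and>
     (\<forall>\<B>. finite \<B> \<longrightarrow> \<B> \<subseteq> offdiag_rects k \<mu> \<longrightarrow>
        (AE w in P. N (\<Union>\<B>) w = (SUP B\<in>\<B>. N B w))) \<and>
     (\<forall>A\<in>offdiag_sets k \<mu>. \<forall>S :: nat \<Rightarrow> (nat \<Rightarrow> 'a) set.
        (\<forall>n. S n \<in> offdiag_rect_unions k \<mu>) \<longrightarrow>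
        (\<lambda>n. emeasure (kpow k \<mu>) (sym_diff (S n) A)) \<longlonglongrightarrow> 0 \<longrightarrow>
        (\<forall>\<gamma>. 0 < \<gamma> \<longrightarrow> \<gamma> < \<alpha> \<longrightarrow>
           (\<lambda>n. \<integral>\<^sup>+ w. epowr (max (N (S n) w - N A w) (N A w - N (S n) w)) \<gamma> \<partial>P) \<longlonglongrightarrow> 0))"

text \<open>
  For \<open>\<sigma>\<close>-finite \<open>\<mu>\<close>: \<open>M (\<cdot> \<inter> E n)\<close> has control measure \<open>density \<mu> (indicator (E n))\<close>, and
  \<open>N' n\<close> is its product random sup measure.  The choice of the exhaustion and of the versions
  only affects \<open>N\<close> on null sets.
\<close>

definition product_sup_measure ::
  "'w measure \<Rightarrow> 'a measure \<Rightarrow> real \<Rightarrow> nat \<Rightarrow> ('a set \<Rightarrow> 'w \<Rightarrow> ennreal) \<Rightarrow>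
   ((nat \<Rightarrow> 'a) set \<Rightarrow> 'w \<Rightarrow> ennreal) \<Rightarrow> bool" where
  "product_sup_measure P \<mu> \<alpha> k M N \<longleftrightarrow>
     (\<forall>A\<in>offdiag_sets k \<mu>. N A \<in> borel_measurable P) \<and>
     (\<exists>(E :: nat \<Rightarrow> 'a set) N'.
        (\<forall>n. E n \<in> sets \<mu> \<and> 0 < emeasure \<mu> (E n) \<and> emeasure \<mu> (E n) < \<infinity>) \<and>
        incseq E \<and> (\<Union>n. E n) = space \<mu> \<and>
        (\<forall>n. product_sup_measure_finite P (density \<mu> (indicator (E n))) \<alpha> k
               (\<lambda>A. M (A \<inter> E n)) (N' n)) \<and>
        (\<forall>A\<in>offdiag_sets k \<mu>. AE w in P. N A w = (SUP n. N' n A w)))"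

text \<open>A simple function \<open>\<Sum>i<n. a i * indicator (A i)\<close> is given by its data \<open>n\<close>, \<open>a\<close>, \<open>A\<close>.\<close>

definition simple_data ::
  "nat \<Rightarrow> 'a measure \<Rightarrow> nat \<Rightarrow> (nat \<Rightarrow> real) \<Rightarrow> (nat \<Rightarrow> (nat \<Rightarrow> 'a) set) \<Rightarrow> bool" where
  "simple_data k \<mu> n a A \<longleftrightarrow>
     (\<forall>i<n. 0 < a i \<and> A i \<in> offdiag_sets k \<mu>) \<and> disjoint_family_on A {..<n}"

definition simple_fun ::
  "nat \<Rightarrow> (nat \<Rightarrow> real) \<Rightarrow> (nat \<Rightarrow> (nat \<Rightarrow> 'a) set) \<Rightarrow> (nat \<Rightarrow> 'a) \<Rightarrow> ennreal" where
  "simple_fun n a A u = (\<Sum>i<n. ennreal (a i) * indicator (A i) u)"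

definition simple_extremal_integral ::
  "((nat \<Rightarrow> 'a) set \<Rightarrow> 'w \<Rightarrow> ennreal) \<Rightarrow> nat \<Rightarrow> (nat \<Rightarrow> real) \<Rightarrow>
   (nat \<Rightarrow> (nat \<Rightarrow> 'a) set) \<Rightarrow> 'w \<Rightarrow> ennreal" where
  "simple_extremal_integral N n a A w = (SUP i\<in>{..<n}. ennreal (a i) * N (A i) w)"

text \<open>The random variable \<open>I\<close> is (a version of) the multiple extremal integral of \<open>f\<close> with
  respect to the product random sup measure \<open>N\<close>.\<close>

definition is_extremal_integral ::
  "'w measure \<Rightarrow> 'a measure \<Rightarrow> nat \<Rightarrow> ((nat \<Rightarrow> 'a) set \<Rightarrow> 'w \<Rightarrow> ennreal) \<Rightarrow>
   ((nat \<Rightarrow> 'a) \<Rightarrow> ennreal) \<Rightarrow> ('w \<Rightarrow> ennreal) \<Rightarrow> bool" where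
  "is_extremal_integral P \<mu> k N f I \<longleftrightarrow>
     I \<in> borel_measurable P \<and>
     (\<forall>(n :: nat \<Rightarrow> nat) a A.
        (\<forall>j. simple_data k \<mu> (n j) (a j) (A j)) \<longrightarrow>
        (\<forall>j. \<forall>u\<in>space (kpow k \<mu>).
           simple_fun (n j) (a j) (A j) u \<le> simple_fun (n (Suc j)) (a (Suc j)) (A (Suc j)) u) \<longrightarrow>
        (AE u in kpow k \<mu>. (\<lambda>j. simple_fun (n j) (a j) (A j) u) \<longlonglongrightarrow> f u) \<longrightarrow>
        (AE w in P. (\<lambda>j. simple_extremal_integral N (n j) (a j) (A j) w) \<longlonglongrightarrow> I w))"

definition equivalent_prob_density ::
  "'a measure \<Rightarrow> 'a measure \<Rightarrow> ('a \<Rightarrow> ennreal) \<Rightarrow> bool" where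
  "equivalent_prob_density \<mu> m \<psi> \<longleftrightarrow>
     prob_space m \<and> sets m = sets \<mu> \<and>
     absolutely_continuous m \<mu> \<and> absolutely_continuous \<mu> m \<and>
     \<psi> \<in> borel_measurable m \<and> density m \<psi> = \<mu> \<and> (AE x in m. 0 < \<psi> x \<and> \<psi> x < \<infinity>)"

end

theory Submission
  imports Defs "HOL-Real_Asymp.Real_Asymp"
begin

text \<open>
  Let \<open>Z\<^sub>i\<close> be the \<open>\<alpha>\<close>-th powers of the masses that \<open>M\<close> gives to finitely many disjoint cells; they are
  independent with \<open>P(Z\<^sub>i > x) = 1 - exp(-\<mu>\<^sub>i/x)\<close>.  A product of \<open>k\<close> of them has tail
  \<open>\<mu>\<^sub>1\<cdots>\<mu>\<^sub>k (ln s)\<^sup>k\<^sup>-\<^sup>1 / ((k-1)! s)\<close>, and two different products exceed \<open>s\<close> together with negligible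
  probability, so the tail of a maximum \<open>J\<close> of such products with coefficients is a sum over
  \<open>k\<close>-element sets of cells.

  General integrands are reached through \<open>|J(f) - J(g)| \<le> J(|f - g|)\<close> and a maximal inequality for
  \<open>J\<close> that does not depend on the fineness of the cells: for a weight \<open>\<rho> \<le> \<psi>\<close> with integrable
  reciprocal, the event that some \<open>Z\<^sub>i/\<rho>\<^sub>i\<close> exceeds \<open>s\<close> has probability \<open>O(1/s)\<close>, and off this event a
  union bound gives at most a constant times \<open>(ln s)\<^sup>k\<^sup>-\<^sup>1/s\<close> times the integral of
  \<open>f\<^sup>\<alpha> (1 + ln\<^sub>+(f\<^sup>\<alpha> \<rho>\<^sup>\<otimes>\<^sup>k))\<^sup>k\<^sup>-\<^sup>1\<close>, which the hypothesis on \<open>f\<^sub>i\<close> makes finite.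
\<close>

section \<open>Tails of products of independent variables\<close>

text \<open>A second obstacle is that \<mu> may be infinite, so the largest mass over fine cells
  need not have any tail bound. Division by \<rho> replaces the control measure by \<mu>/\<rho>,
  which is finite. For \<rho> = \<psi> it would be the probability measure m, and f^\<alpha> times
  the product of the \<psi> is the \<alpha>-th power of the function in the hypothesis. The density
  itself cannot serve, because the weight has to be constant on cells; hence a \<rho> with countably
  many values. The integral in the maximal inequality acts as a gauge for integrands: closeness in
  this gauge bounds the tail of the difference at all large levels s at once, in the normalisation
  of the theorem. This uniformity in s permits the interchange of the limit in s with the
  approximation of f.\<close>

lemma ln_plus_nonneg [simp]: "0 \<le> ln_plus x"
  by (simp add: ln_plus_def)

lemma ln_plus_mono: "x \<le> y \<Longrightarrow> ln_plus x \<le> ln_plus y"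
  by (simp add: ln_plus_def)

lemma ln_plus_eq: "1 \<le> x \<Longrightarrow> ln_plus x = ln x"
  by (simp add: ln_plus_def max_def)

lemma ln_plus_measurable [measurable]: "ln_plus \<in> borel_measurable borel"
  unfolding ln_plus_def by measurable

section \<open>Upper bounds for products of independent factors with tails of order 1/x\<close>

context prob_space
begin

lemma indep_set_commute:
  assumes "indep_set A B"
  shows "indep_set B A"
proof (rule indep_setI)
  fix a b assume "a \<in> B" "b \<in> A"
  from indep_setD[OF assms this(2,1)] show "prob (a \<inter> b) = prob a * prob b"
    by (simp add: Int_commute mult.commute)
qed (use assms in \<open>auto dest: indep_setD_ev1 indep_setD_ev2\<close>)

lemma indep_var_commute:
  assumes "indep_var S X T Y"
  shows "indep_var T Y S X"
  using assms unfolding indep_var_eq by (simp add: indep_set_commute)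

text \<open>The joint law is the product of the marginals, so the probability can be integrated one
  variable at a time (Tonelli).\<close>

lemma indep_var_emeasure:
  fixes W Z :: "'a \<Rightarrow> real"
  assumes ind: "indep_var borel W borel Z" and Q[measurable]: "Q \<in> sets (borel \<Otimes>\<^sub>M borel)"
  shows "emeasure M {\<omega>\<in>space M. (W \<omega>, Z \<omega>) \<in> Q} =
    (\<integral>\<^sup>+\<omega>. emeasure M {\<omega>'\<in>space M. (W \<omega>, Z \<omega>') \<in> Q} \<partial>M)"
proof -
  have [measurable]: "W \<in> borel_measurable M" "Z \<in> borel_measurable M"
    using ind by (auto dest: indep_var_rv1 indep_var_rv2)
  interpret Z: prob_space "distr M borel Z" by (rule prob_space_distr) simp
  have "emeasure M {\<omega>\<in>space M. (W \<omega>, Z \<omega>) \<in> Q} = emeasure (distr M (borel \<Otimes>\<^sub>M borel) (\<lambda>x. (W x, Z x))) Q"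
    by (subst emeasure_distr) (auto intro!: arg_cong[where f="emeasure M"])
  also have "\<dots> = emeasure (distr M borel W \<Otimes>\<^sub>M distr M borel Z) Q"
    using ind unfolding indep_var_distribution_eq by simp
  also have "\<dots> = (\<integral>\<^sup>+ x. emeasure (distr M borel Z) (Pair x -` Q) \<partial>distr M borel W)"
    by (rule Z.emeasure_pair_measure_alt) simp
  also have "\<dots> = (\<integral>\<^sup>+ x. emeasure M {\<omega>'\<in>space M. (x, Z \<omega>') \<in> Q} \<partial>distr M borel W)"
    by (intro nn_integral_cong, subst emeasure_distr) (auto intro!: arg_cong[where f="emeasure M"] sets_Pair1)
  also have "\<dots> = (\<integral>\<^sup>+\<omega>. emeasure M {\<omega>'\<in>space M. (W \<omega>, Z \<omega>') \<in> Q} \<partial>M)"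
    by (rule nn_integral_distr) measurable
  finally show ?thesis .
qed

text \<open>Condition on \<open>W\<close>. The value at \<open>W = 0\<close> is set by hand: HOL's
  \<open>\<tau> / 0 = 0\<close> would turn the inner event into \<open>Z > 0\<close>, whereas the
  product is then 0 and does not exceed \<open>\<tau>\<close>.\<close>

lemma prob_mult_gt:
  fixes W Z :: "'a \<Rightarrow> real"
  assumes ind: "indep_var borel W borel Z" and W: "\<And>\<omega>. 0 \<le> W \<omega>" and "0 < \<tau>"
  shows "emeasure M {\<omega>\<in>space M. W \<omega> * Z \<omega> > \<tau>} =
    (\<integral>\<^sup>+\<omega>. (if W \<omega> = 0 then 0 else emeasure M {\<omega>'\<in>space M. Z \<omega>' > \<tau> / W \<omega>}) \<partial>M)"
proof -
  have "emeasure M {\<omega>\<in>space M. W \<omega> * Z \<omega> > \<tau>} = emeasure M {\<omega>\<in>space M. (W \<omega>, Z \<omega>) \<in> {z\<in>space (borel \<Otimes>\<^sub>M borel). fst z * snd z > \<tau>}}"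
    by (simp add: space_pair_measure)
  also have "\<dots> = (\<integral>\<^sup>+\<omega>. emeasure M {\<omega>'\<in>space M. (W \<omega>, Z \<omega>') \<in> {z\<in>space (borel \<Otimes>\<^sub>M borel). fst z * snd z > \<tau>}} \<partial>M)"
    by (intro indep_var_emeasure ind) measurable
  also have "\<dots> = (\<integral>\<^sup>+\<omega>. (if W \<omega> = 0 then 0 else emeasure M {\<omega>'\<in>space M. Z \<omega>' > \<tau> / W \<omega>}) \<partial>M)"
  proof (intro nn_integral_cong, goal_cases)
    case (1 \<omega>)
    show ?case
    proof (cases "W \<omega> = 0")
      case False
      then have "W \<omega> > 0" using W[of \<omega>] by simp
      then show ?thesis
        by (auto simp: field_simps space_pair_measure intro!: arg_cong[where f="emeasure M"])
    qed (use assms in simp)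
  qed
  finally show ?thesis .
qed

text \<open>The tail bound is used for one factor only. After conditioning it is linear in the other
  factor, which therefore enters through its mean.\<close>

lemma prob_mult_gt_le:
  fixes W Z :: "'a \<Rightarrow> real"
  assumes ind: "indep_var borel W borel Z" and W: "\<And>\<omega>. 0 \<le> W \<omega>" and \<tau>: "0 < \<tau>"
    and tail: "\<And>x. 0 < x \<Longrightarrow> prob {\<omega>\<in>space M. Z \<omega> > x} \<le> p / x"
  shows "emeasure M {\<omega>\<in>space M. W \<omega> * Z \<omega> > \<tau>} \<le> ennreal (p / \<tau>) * (\<integral>\<^sup>+\<omega>. ennreal (W \<omega>) \<partial>M)"
proof -
  have [measurable]: "W \<in> borel_measurable M"
    using ind by (auto dest: indep_var_rv1 indep_var_rv2)
  have p: "0 \<le> p" using tail[of 1] measure_nonneg[of M] by (metis div_by_1 order_trans zero_less_one)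
  have "emeasure M {\<omega>\<in>space M. W \<omega> * Z \<omega> > \<tau>} =
    (\<integral>\<^sup>+\<omega>. (if W \<omega> = 0 then 0 else emeasure M {\<omega>'\<in>space M. Z \<omega>' > \<tau> / W \<omega>}) \<partial>M)"
    by (rule prob_mult_gt) fact+
  also have "\<dots> \<le> (\<integral>\<^sup>+\<omega>. ennreal (p / \<tau>) * ennreal (W \<omega>) \<partial>M)"
  proof (intro nn_integral_mono, goal_cases)
    case (1 \<omega>)
    show ?case
    proof (cases "W \<omega> = 0")
      case False
      then have pos: "W \<omega> > 0" using W[of \<omega>] by simp
      then have "prob {\<omega>'\<in>space M. Z \<omega>' > \<tau> / W \<omega>} \<le> p / (\<tau> / W \<omega>)"
        using \<tau> by (intro tail) simp
      then show ?thesis using False pos p \<tau>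
        by (simp add: emeasure_eq_measure ennreal_mult[symmetric])
    qed simp
  qed
  also have "\<dots> = ennreal (p / \<tau>) * (\<integral>\<^sup>+\<omega>. ennreal (W \<omega>) \<partial>M)"
    by (rule nn_integral_cmult) measurable
  finally show ?thesis .
qed

text \<open>This is the layer-cake formula: Tonelli's theorem for the region under the graph of the
  truncated variable.\<close>

lemma nn_integral_min_tail:
  assumes [measurable]: "W \<in> borel_measurable M" and W: "\<And>\<omega>. 0 \<le> W \<omega>" and T: "0 \<le> T"
  shows "(\<integral>\<^sup>+\<omega>. ennreal (min (W \<omega>) T) \<partial>M) =
    (\<integral>\<^sup>+y. ennreal (prob {\<omega>\<in>space M. W \<omega> > y} * indicator {0..T} y) \<partial>lborel)"
proof -
  have "(\<integral>\<^sup>+\<omega>. ennreal (min (W \<omega>) T) \<partial>M) =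
      (\<integral>\<^sup>+\<omega>. (\<integral>\<^sup>+y. indicator {(\<omega>, y). 0 \<le> y \<and> y < W \<omega> \<and> y \<le> T} (\<omega>, y) \<partial>lborel) \<partial>M)"
  proof (intro nn_integral_cong, goal_cases)
    case (1 \<omega>)
    have "(\<integral>\<^sup>+y. indicator {(\<omega>, y). 0 \<le> y \<and> y < W \<omega> \<and> y \<le> T} (\<omega>, y) \<partial>lborel) =
        (\<integral>\<^sup>+y. indicator (if T < W \<omega> then {0..T} else {0..<W \<omega>}) y \<partial>lborel)"
      by (intro nn_integral_cong) (auto split: split_indicator)
    also have "\<dots> = ennreal (min (W \<omega>) T)"
      using T W[of \<omega>] by auto
    finally show ?case by simp
  qed
  also have "\<dots> = (\<integral>\<^sup>+y. (\<integral>\<^sup>+\<omega>. indicator {(\<omega>, y). 0 \<le> y \<and> y < W \<omega> \<and> y \<le> T} (\<omega>, y) \<partial>M) \<partial>lborel)"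
  proof -
    interpret pair_sigma_finite M lborel ..
    show ?thesis
      by (rule Fubini[symmetric, where f="indicator {(\<omega>, y). 0 \<le> y \<and> y < W \<omega> \<and> y \<le> T}"]) measurable
  qed
  also have "\<dots> = (\<integral>\<^sup>+y. ennreal (prob {\<omega>\<in>space M. W \<omega> > y} * indicator {0..T} y) \<partial>lborel)"
  proof (intro nn_integral_cong, goal_cases)
    case (1 y)
    have "(\<integral>\<^sup>+\<omega>. indicator {(\<omega>, y). 0 \<le> y \<and> y < W \<omega> \<and> y \<le> T} (\<omega>, y) \<partial>M) =
       (\<integral>\<^sup>+\<omega>. indicator {0..T} y * indicator {\<omega>\<in>space M. W \<omega> > y} \<omega> \<partial>M)"
      by (intro nn_integral_cong) (auto split: split_indicator)
    also have "\<dots> = indicator {0..T} y * emeasure M {\<omega>\<in>space M. W \<omega> > y}"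
      by (subst nn_integral_cmult_indicator) auto
    finally show ?case
      by (simp add: emeasure_eq_measure split: split_indicator)
  qed
  finally show ?thesis .
qed

text \<open>In the layer-cake integral the levels below \<open>a\<close> contribute at most
  \<open>a * (p / a) = p\<close>, and those between \<open>a\<close> and \<open>b\<close> the
  integral of \<open>p / y\<close>, hence the logarithm. Without the cut at \<open>b\<close> the
  bound would diverge.\<close>

lemma truncated_expectation_le:
  assumes [measurable]: "Z \<in> borel_measurable M" and Z: "\<And>\<omega>. 0 \<le> Z \<omega>"
    and tail: "\<And>x. 0 < x \<Longrightarrow> prob {\<omega>\<in>space M. Z \<omega> > x} \<le> p / x"
    and ab: "0 < a" "a \<le> b"
  shows "(\<integral>\<^sup>+\<omega>. ennreal (if a < Z \<omega> \<and> Z \<omega> \<le> b then Z \<omega> else 0) \<partial>M) \<le> ennreal (p * (1 + ln (b / a)))"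
proof -
  have p: "0 \<le> p" using tail[of 1] measure_nonneg[of M] by (metis div_by_1 order_trans zero_less_one)
  have "(\<integral>\<^sup>+\<omega>. ennreal (if a < Z \<omega> \<and> Z \<omega> \<le> b then Z \<omega> else 0) \<partial>M) \<le>
    (\<integral>\<^sup>+\<omega>. ennreal (min (if Z \<omega> \<le> a then 0 else Z \<omega>) b) \<partial>M)"
    using ab Z by (intro nn_integral_mono) (auto intro!: ennreal_leI)
  also have "\<dots> = (\<integral>\<^sup>+y. ennreal (prob {\<omega>\<in>space M. (if Z \<omega> \<le> a then 0 else Z \<omega>) > y} * indicator {0..b} y) \<partial>lborel)"
    using ab Z by (intro nn_integral_min_tail) auto
  also have "\<dots> \<le> (\<integral>\<^sup>+y. ennreal (p / a) * indicator {0..a} y + ennreal (p / y) * indicator {a..b} y \<partial>lborel)"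
  proof (intro nn_integral_mono, goal_cases)
    case (1 y)
    consider "y < 0 \<or> y > b" | "0 \<le> y" "y \<le> a" | "a < y" "y \<le> b" by linarith
    then show ?case
    proof cases
      case 2
      have "prob {\<omega>\<in>space M. (if Z \<omega> \<le> a then 0 else Z \<omega>) > y} \<le> prob {\<omega>\<in>space M. Z \<omega> > a}"
        using 2 by (intro finite_measure_mono) auto
      also have "\<dots> \<le> p / a" using ab by (intro tail) simp
      finally have "ennreal (prob {\<omega>\<in>space M. (if Z \<omega> \<le> a then 0 else Z \<omega>) > y}) \<le> ennreal (p / a)"
        by (rule ennreal_leI)
      then have "ennreal (prob {\<omega>\<in>space M. (if Z \<omega> \<le> a then 0 else Z \<omega>) > y}) \<le>
          ennreal (p / a) + ennreal (p / y) * indicator {a..b} y"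
        by (rule order_trans) simp
      then show ?thesis using 2 ab by (simp del: if_split)
    next
      case 3
      have "prob {\<omega>\<in>space M. (if Z \<omega> \<le> a then 0 else Z \<omega>) > y} \<le> prob {\<omega>\<in>space M. Z \<omega> > y}"
        using 3 ab by (intro finite_measure_mono) (auto split: if_splits)
      also have "\<dots> \<le> p / y" using ab 3 by (intro tail) simp
      finally have "ennreal (prob {\<omega>\<in>space M. (if Z \<omega> \<le> a then 0 else Z \<omega>) > y}) \<le> ennreal (p / y)"
        by (rule ennreal_leI)
      then show ?thesis using 3 ab by (simp split: split_indicator)
    qed auto
  qed
  also have "\<dots> = (\<integral>\<^sup>+y. ennreal (p / a) * indicator {0..a} y \<partial>lborel) + (\<integral>\<^sup>+y. ennreal (p / y) * indicator {a..b} y \<partial>lborel)"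
    by (intro nn_integral_add) auto
  also have "(\<integral>\<^sup>+y. ennreal (p / a) * indicator {0..a} y \<partial>lborel) = ennreal p"
    using ab p by (subst nn_integral_cmult_indicator) (auto simp: ennreal_mult[symmetric])
  also have "(\<integral>\<^sup>+y. ennreal (p / y) * indicator {a..b} y \<partial>lborel) = ennreal (p * ln b - p * ln a)"
    using ab p by (intro nn_integral_FTC_Icc) (auto intro!: derivative_eq_intros)
  also have "ennreal p + ennreal (p * ln b - p * ln a) = ennreal (p * (1 + ln (b / a)))"
    using ab p by (subst ennreal_plus[symmetric]) (auto simp: ln_div algebra_simps mult_left_mono)
  finally show ?thesis .
qed

text \<open>On the event every factor exceeds \<open>\<tau> / s ^ (card T - 1)\<close>, because the
  others are at most \<open>s\<close>. So all factors but one may be cut to a bounded window, where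
  their means grow only logarithmically, and the last factor supplies \<open>1 / \<tau>\<close>
  through its tail.\<close>

lemma truncated_product_tail:
  fixes Z :: "'i \<Rightarrow> 'a \<Rightarrow> real"
  assumes T: "finite T" "T \<noteq> {}" and ind: "indep_vars (\<lambda>_. borel) Z T"
    and Z: "\<And>i \<omega>. 0 \<le> Z i \<omega>"
    and tail: "\<And>i x. i \<in> T \<Longrightarrow> 0 < x \<Longrightarrow> prob {\<omega>\<in>space M. Z i \<omega> > x} \<le> p i / x"
    and s: "0 < s" and \<tau>: "0 < \<tau>"
  shows "prob {\<omega>\<in>space M. (\<Prod>i\<in>T. Z i \<omega>) > \<tau> \<and> (\<forall>i\<in>T. Z i \<omega> \<le> s)} \<le>
    (\<Prod>i\<in>T. p i) / \<tau> * (1 + ln_plus (s ^ card T / \<tau>)) ^ (card T - 1)"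
proof -
  have p: "0 \<le> p i" if "i \<in> T" for i
    using tail[OF that, of 1] measure_nonneg[of M] by (metis div_by_1 order_trans zero_less_one)
  have meas[measurable]: "Z i \<in> borel_measurable M" if "i \<in> T" for i
    using ind that by (auto simp: indep_vars_def)
  obtain i0 where i0: "i0 \<in> T" using T by auto
  define T' where "T' = T - {i0}"
  have T': "finite T'" "i0 \<notin> T'" "T = insert i0 T'" "card T' = card T - 1"
    using T i0 by (auto simp: T'_def)
  have cT: "0 < card T" using T by (simp add: card_gt_0_iff)
  define a where "a = \<tau> / s ^ (card T - 1)"
  have a: "0 < a" using s \<tau> by (simp add: a_def)
  have sT: "s ^ card T = s * s ^ (card T - 1)" using cT by (metis power_eq_if less_numeral_extra(3))
  show ?thesis
  proof (cases "a \<le> s")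
    \<comment> \<open>If \<open>a > s\<close>, even the product of \<open>card T\<close> factors
      equal to \<open>s\<close> is smaller than \<open>\<tau>\<close>, so the event is
      empty.\<close>
    case False
    have "{\<omega>\<in>space M. (\<Prod>i\<in>T. Z i \<omega>) > \<tau> \<and> (\<forall>i\<in>T. Z i \<omega> \<le> s)} = {}"
    proof (safe, goal_cases)
      case (1 \<omega>)
      then have "(\<Prod>i\<in>T. Z i \<omega>) \<le> (\<Prod>i\<in>T. s)" using Z by (intro prod_mono) auto
      also have "\<dots> = s * s ^ (card T - 1)" by (simp add: sT)
      also have "\<dots> < \<tau>" using False s by (simp add: a_def field_simps)
      finally show ?case using 1 by simp
    qed
    then show ?thesis using p \<tau> by (simp only: measure_empty) (intro mult_nonneg_nonneg divide_nonneg_pos prod_nonneg zero_le_power add_nonneg_nonneg; simp)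
  next
    case True
    \<comment> \<open>The distinguished factor \<open>i0\<close> stays untruncated because its tail
      is used. The other factors are set to 0 outside the window, which loses nothing on the
      event.\<close>
    define X where "X i \<omega> = (if i = i0 then Z i \<omega> else if a < Z i \<omega> \<and> Z i \<omega> \<le> s then Z i \<omega> else 0)" for i \<omega>
    have indX: "indep_vars (\<lambda>_. borel) X T"
    proof -
      have "indep_vars (\<lambda>_. borel) (\<lambda>i \<omega>. (if i = i0 then (\<lambda>x. x) else (\<lambda>x. if a < x \<and> x \<le> s then x else 0)) (Z i \<omega>)) T"
        by (rule indep_vars_compose2[OF ind]) auto
      also have "(\<lambda>i \<omega>. (if i = i0 then (\<lambda>x. x) else (\<lambda>x. if a < x \<and> x \<le> s then x else 0)) (Z i \<omega>)) = X"
        by (auto simp: X_def fun_eq_iff)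
      finally show ?thesis .
    qed
    have X0: "0 \<le> X i \<omega>" for i \<omega> using Z by (simp add: X_def)
    have mX[measurable]: "X i \<in> borel_measurable M" if "i \<in> T" for i
      using indX that by (auto simp: indep_vars_def)
    define W where "W \<omega> = (\<Prod>i\<in>T'. X i \<omega>)" for \<omega>
    have "indep_var borel (X i0) borel W"
      unfolding W_def using T' indX by (intro indep_vars_prod) auto
    then have indWX: "indep_var borel W borel (X i0)" by (rule indep_var_commute)
    have W0: "0 \<le> W \<omega>" for \<omega> by (simp add: W_def X0 prod_nonneg)
    have sub: "{\<omega>\<in>space M. (\<Prod>i\<in>T. Z i \<omega>) > \<tau> \<and> (\<forall>i\<in>T. Z i \<omega> \<le> s)} \<subseteq> {\<omega>\<in>space M. W \<omega> * X i0 \<omega> > \<tau>}"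
    proof (safe, goal_cases)
      case (1 \<omega>)
      have "a < Z i \<omega>" if "i \<in> T" for i
      proof -
        have "\<tau> < (\<Prod>i\<in>T. Z i \<omega>)" by fact
        also have "\<dots> = Z i \<omega> * (\<Prod>i\<in>T - {i}. Z i \<omega>)" using T that by (simp add: prod.remove)
        also have "\<dots> \<le> Z i \<omega> * (\<Prod>i\<in>T - {i}. s)" using Z 1 by (intro mult_left_mono prod_mono) auto
        also have "\<dots> = Z i \<omega> * s ^ (card T - 1)" using T that by simp
        finally show ?thesis using s by (simp add: a_def field_simps)
      qed
      then have "W \<omega> = (\<Prod>i\<in>T'. Z i \<omega>)"
        unfolding W_def using 1 T' by (intro prod.cong) (auto simp: X_def)
      then have "W \<omega> * X i0 \<omega> = (\<Prod>i\<in>T. Z i \<omega>)" using T' by (simp add: X_def mult.commute)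
      then show ?case using 1 by simp
    qed
    have mW[measurable]: "W \<in> borel_measurable M"
      using indWX by (auto dest: indep_var_rv1)
    have "ennreal (prob {\<omega>\<in>space M. (\<Prod>i\<in>T. Z i \<omega>) > \<tau> \<and> (\<forall>i\<in>T. Z i \<omega> \<le> s)}) \<le> ennreal (prob {\<omega>\<in>space M. W \<omega> * X i0 \<omega> > \<tau>})"
      using i0 by (intro ennreal_leI finite_measure_mono sub) measurable
    also have "\<dots> = emeasure M {\<omega>\<in>space M. W \<omega> * X i0 \<omega> > \<tau>}" by (simp add: emeasure_eq_measure)
    also have "\<dots> \<le> ennreal (p i0 / \<tau>) * (\<integral>\<^sup>+\<omega>. ennreal (W \<omega>) \<partial>M)"
      using i0 tail by (intro prob_mult_gt_le indWX W0 \<tau>) (simp add: X_def)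
    also have "(\<integral>\<^sup>+\<omega>. ennreal (W \<omega>) \<partial>M) = (\<integral>\<^sup>+\<omega>. (\<Prod>i\<in>T'. ennreal (X i \<omega>)) \<partial>M)"
      by (simp add: W_def prod_ennreal X0)
    also have "\<dots> = (\<Prod>i\<in>T'. \<integral>\<^sup>+\<omega>. ennreal (X i \<omega>) \<partial>M)"
    proof (rule indep_vars_nn_integral)
      show "indep_vars (\<lambda>_. borel) (\<lambda>i \<omega>. ennreal (X i \<omega>)) T'"
        by (rule indep_vars_compose2[OF indep_vars_subset[OF indX]]) (auto simp: T')
    qed (use T' in auto)
    also have "\<dots> \<le> (\<Prod>i\<in>T'. ennreal (p i * (1 + ln (s / a))))"
    proof (intro prod_mono_ennreal)
      fix i assume i: "i \<in> T'"
      then have "i \<in> T" "i \<noteq> i0" by (auto simp: T')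
      then show "(\<integral>\<^sup>+\<omega>. ennreal (X i \<omega>) \<partial>M) \<le> ennreal (p i * (1 + ln (s / a)))"
        unfolding X_def using truncated_expectation_le[of "Z i" "p i" a s] Z tail a True by simp
    qed
    also have "\<dots> = ennreal (\<Prod>i\<in>T'. p i * (1 + ln (s / a)))"
      using p T' True a s by (intro prod_ennreal) (auto intro!: mult_nonneg_nonneg)
    finally have "ennreal (prob {\<omega>\<in>space M. (\<Prod>i\<in>T. Z i \<omega>) > \<tau> \<and> (\<forall>i\<in>T. Z i \<omega> \<le> s)}) \<le>
        ennreal (p i0 / \<tau>) * ennreal (\<Prod>i\<in>T'. p i * (1 + ln (s / a)))"
      by (simp add: mult_left_mono)
    also have "\<dots> = ennreal (p i0 / \<tau> * (\<Prod>i\<in>T'. p i * (1 + ln (s / a))))"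
      using p i0 \<tau> by (intro ennreal_mult'[symmetric]) simp
    finally have "prob {\<omega>\<in>space M. (\<Prod>i\<in>T. Z i \<omega>) > \<tau> \<and> (\<forall>i\<in>T. Z i \<omega> \<le> s)} \<le>
        p i0 / \<tau> * (\<Prod>i\<in>T'. p i * (1 + ln (s / a)))"
    proof (subst (asm) ennreal_le_iff)
      show "0 \<le> p i0 / \<tau> * (\<Prod>i\<in>T'. p i * (1 + ln (s / a)))"
        using p i0 \<tau> T' True a s by (intro mult_nonneg_nonneg divide_nonneg_pos prod_nonneg) auto
    qed
    also have "\<dots> = (\<Prod>i\<in>T. p i) / \<tau> * (1 + ln (s / a)) ^ (card T - 1)"
      using T' by (simp add: prod.distrib)
    also have "s / a = s ^ card T / \<tau>" by (simp add: a_def sT)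
    also have "ln (s ^ card T / \<tau>) = ln_plus (s ^ card T / \<tau>)"
      using True a s \<tau> by (intro ln_plus_eq[symmetric]) (simp add: a_def sT field_simps)
    finally show ?thesis .
  qed
qed

end

text \<open>A sandwich whose bounding functions may change with \<open>e\<close>: only their limits
  have to come within \<open>e\<close> of \<open>L\<close>, so slack constants can be chosen after
  \<open>e\<close> is known.\<close>

lemma tendsto_squeeze_eps:
  fixes f :: "'b \<Rightarrow> real"
  assumes lower: "\<And>e. 0 < e \<Longrightarrow> \<exists>g l. (g \<longlongrightarrow> l) F \<and> L - e < l \<and> eventually (\<lambda>x. g x \<le> f x) F"
    and upper: "\<And>e. 0 < e \<Longrightarrow> \<exists>g l. (g \<longlongrightarrow> l) F \<and> l < L + e \<and> eventually (\<lambda>x. f x \<le> g x) F"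
  shows "(f \<longlongrightarrow> L) F"
proof (rule order_tendstoI)
  fix a assume "a < L"
  then obtain g l where "(g \<longlongrightarrow> l) F" "L - (L - a) < l" "eventually (\<lambda>x. g x \<le> f x) F"
    using lower[of "L - a"] by auto
  then have "eventually (\<lambda>x. a < g x) F" by (intro order_tendstoD(1)) auto
  with \<open>eventually (\<lambda>x. g x \<le> f x) F\<close> show "eventually (\<lambda>x. a < f x) F"
    by eventually_elim simp
next
  fix a assume "L < a"
  then obtain g l where "(g \<longlongrightarrow> l) F" "l < L + (a - L)" "eventually (\<lambda>x. f x \<le> g x) F"
    using upper[of "a - L"] by auto
  then have "eventually (\<lambda>x. g x < a) F" by (intro order_tendstoD(2)) auto
  with \<open>eventually (\<lambda>x. f x \<le> g x) F\<close> show "eventually (\<lambda>x. f x < a) F"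
    by eventually_elim simp
qed

section \<open>Slow variation of the logarithm and truncated integrals\<close>

lemma ln_mult_ratio_tendsto:
  fixes a :: real
  assumes "0 < a"
  shows "((\<lambda>t. (ln (a * t) / ln t) ^ n) \<longlongrightarrow> 1) at_top"
proof -
  have "((\<lambda>t. ln (a * t) / ln t) \<longlongrightarrow> 1) at_top"
    using assms by real_asymp
  from tendsto_power[OF this, of n] show ?thesis by simp
qed

lemma filterlim_scale_at_top: "0 < (a::real) \<Longrightarrow> filterlim (\<lambda>t. a * t) at_top at_top"
  by real_asymp

text \<open>A tail of order \<open>ln x ^ n / x\<close> is regularly varying of index -1: since the
  logarithm varies slowly, rescaling the argument by \<open>b\<close> only multiplies the limit by
  \<open>b\<close>.\<close>

lemma tail_asymp_scale:
  fixes g :: "real \<Rightarrow> real"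
  assumes lim: "((\<lambda>x. x / ln x ^ n * g x) \<longlongrightarrow> L) at_top" and b: "0 < b"
  shows "((\<lambda>x. x / ln x ^ n * g (x / b)) \<longlongrightarrow> b * L) at_top"
proof -
  have "((\<lambda>x. b * ((1/b * x) / ln (1/b * x) ^ n * g (1/b * x)) * (ln (1/b * x) / ln x) ^ n) \<longlongrightarrow> b * L * 1) at_top"
    using b by (intro tendsto_intros ln_mult_ratio_tendsto filterlim_compose[OF lim] filterlim_scale_at_top) simp_all
  moreover have "eventually (\<lambda>x. b * ((1/b * x) / ln (1/b * x) ^ n * g (1/b * x)) * (ln (1/b * x) / ln x) ^ n =
      x / ln x ^ n * g (x / b)) at_top"
  proof -
    have "eventually (\<lambda>x. 1 < 1/b * x) at_top" using b by real_asymp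
    then show ?thesis
      using eventually_gt_at_top[of 1]
    proof eventually_elim
      case (elim x)
      then have "ln (1/b*x) \<noteq> 0" "ln x \<noteq> 0" by auto
      then show ?case using b by (simp add: field_simps power_divide)
    qed
  qed
  ultimately show ?thesis by (simp add: tendsto_cong)
qed

text \<open>The direct half of Karamata's theorem for \<open>G y\<close> of order
  \<open>ln y ^ n / y\<close>: an antiderivative of \<open>ln y ^ n / y\<close> is
  \<open>ln y ^ (n + 1) / (n + 1)\<close>, and a bounded initial interval does not matter in the
  limit. The division by \<open>Suc n\<close> later builds up a factorial.\<close>

lemma tail_integral_asymp:
  fixes G :: "real \<Rightarrow> real"
  assumes [measurable]: "G \<in> borel_measurable borel" and G: "\<And>y. 0 \<le> G y" "\<And>y. G y \<le> 1" and L: "0 \<le> L"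
    and lim: "((\<lambda>y. y / ln y ^ n * G y) \<longlongrightarrow> L) at_top"
  shows "((\<lambda>T. enn2real (\<integral>\<^sup>+y. ennreal (G y * indicator {0..T} y) \<partial>lborel) / ln T ^ Suc n) \<longlongrightarrow> L / Suc n) at_top"
    (is "((\<lambda>T. enn2real (?H T) / _) \<longlongrightarrow> _) _")
proof -
  have fin: "?H T < \<infinity>" for T
  proof -
    have "?H T \<le> (\<integral>\<^sup>+y. indicator {0..T} y \<partial>lborel)"
      using G by (intro nn_integral_mono) (auto split: split_indicator)
    also have "\<dots> < \<infinity>" by (simp add: emeasure_lborel_Icc_eq)
    finally show ?thesis .
  qed
  have FTC: "(\<integral>\<^sup>+y. ennreal (q * (ln y ^ n / y)) * indicator {a..b} y \<partial>lborel) =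
      ennreal (q / Suc n * ln b ^ Suc n - q / Suc n * ln a ^ Suc n)"
    if "0 \<le> q" "1 \<le> a" "a \<le> b" for a b q :: real
  proof (rule nn_integral_FTC_Icc)
    fix x assume "x \<in> {a..b}"
    then have x: "1 \<le> x" using that by auto
    have "DERIV ln x :> 1 / x"
      using x by (auto intro!: derivative_eq_intros)
    from DERIV_cmult[OF DERIV_power[OF this, of "Suc n"], of "q / Suc n"]
    show "DERIV (\<lambda>x. q / Suc n * ln x ^ Suc n) x :> q * (ln x ^ n / x)"
      by (simp del: of_nat_Suc)
    show "0 \<le> q * (ln x ^ n / x)" using x that by simp
  qed (use that in auto)
  have limq: "((\<lambda>T. (C + (q / Suc n * ln T ^ Suc n - q / Suc n * ln a ^ Suc n)) / ln T ^ Suc n) \<longlongrightarrow> q / Suc n) at_top"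
    for C q a :: real
  proof -
    have "((\<lambda>T. (C - q / Suc n * ln a ^ Suc n) / ln T ^ Suc n + q / Suc n) \<longlongrightarrow> 0 + q / Suc n) at_top"
      by (intro tendsto_add tendsto_const real_tendsto_divide_at_top filterlim_pow_at_top ln_at_top) auto
    moreover have "eventually (\<lambda>T. (C - q / Suc n * ln a ^ Suc n) / ln T ^ Suc n + q / Suc n =
       (C + (q / Suc n * ln T ^ Suc n - q / Suc n * ln a ^ Suc n)) / ln T ^ Suc n) at_top"
      using eventually_gt_at_top[of 1]
      by eventually_elim (simp add: add_divide_distrib diff_divide_distrib)
    ultimately show ?thesis by (simp add: tendsto_cong)
  qed
  show ?thesis
  proof (rule tendsto_squeeze_eps)
    fix e :: real assume e: "0 < e"
    \<comment> \<open>The maximum with 0 keeps the minorant nonnegative when \<open>L\<close> is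
      small, as an integral of \<open>ennreal\<close> values requires.\<close>
    define q where "q = max 0 (L - e / 2)"
    have q: "0 \<le> q" "L / Suc n - e < q / Suc n"
    proof -
      have "L - e < L - e / 2" using e by simp
      also have "\<dots> \<le> q" by (simp add: q_def)
      finally have "(L - e) / Suc n < q / Suc n" by (simp add: divide_strict_right_mono)
      moreover have "e / Suc n \<le> e" using e by (simp add: field_simps)
      ultimately show "L / Suc n - e < q / Suc n" by (simp add: diff_divide_distrib)
    qed (simp add: q_def)
    have "eventually (\<lambda>y. q * (ln y ^ n / y) \<le> G y) at_top"
    proof (cases "L - e / 2 \<le> 0")
      case True
      then show ?thesis using G by (simp add: q_def max_def)
    next
      case False
      have "eventually (\<lambda>y. L - e / 2 < y / ln y ^ n * G y) at_top"
        using lim e by (intro order_tendstoD(1)) auto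
      then show ?thesis using eventually_gt_at_top[of 1]
        by eventually_elim (use False in \<open>simp add: q_def max_def field_simps\<close>)
    qed
    then obtain a where a: "1 \<le> a" "\<And>y. a \<le> y \<Longrightarrow> q * (ln y ^ n / y) \<le> G y"
      unfolding eventually_at_top_linorder by (metis max.bounded_iff max.cobounded2 order_trans linorder_le_cases)
    have "eventually (\<lambda>T. (0 + (q / Suc n * ln T ^ Suc n - q / Suc n * ln a ^ Suc n)) / ln T ^ Suc n
        \<le> enn2real (?H T) / ln T ^ Suc n) at_top"
      using eventually_gt_at_top[of 1] eventually_ge_at_top[of a]
    proof eventually_elim
      case (elim T)
      have "(\<integral>\<^sup>+y. ennreal (q * (ln y ^ n / y)) * indicator {a..T} y \<partial>lborel) \<le> ?H T"
        using a by (intro nn_integral_mono) (auto split: split_indicator intro!: ennreal_leI)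
      then have "ennreal (q / Suc n * ln T ^ Suc n - q / Suc n * ln a ^ Suc n) \<le> ?H T"
        using FTC[OF q(1) a(1)] elim by simp
      then have "q / Suc n * ln T ^ Suc n - q / Suc n * ln a ^ Suc n \<le> enn2real (?H T)"
        using fin[of T] by (metis enn2real_ennreal enn2real_mono enn2real_nonneg infinity_ennreal_def linorder_le_cases order_trans)
      then show ?case using elim by (intro divide_right_mono) auto
    qed
    then show "\<exists>g l. (g \<longlongrightarrow> l) at_top \<and> L / Suc n - e < l \<and> (\<forall>\<^sub>F T in at_top. g T \<le> enn2real (?H T) / ln T ^ Suc n)"
      using limq[of 0 q a] q by blast
  next
    fix e :: real assume e: "0 < e"
    define q where "q = L + e / 2"
    have q: "0 \<le> q" "q / Suc n < L / Suc n + e"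
    proof -
      have "q / Suc n = L / Suc n + (e/2) / Suc n" by (simp add: q_def add_divide_distrib)
      also have "(e/2) / Suc n \<le> e / 2" using e by (simp add: field_simps)
      finally show "q / Suc n < L / Suc n + e" using e by simp
    qed (use L e in \<open>simp add: q_def\<close>)
    have "eventually (\<lambda>y. y / ln y ^ n * G y < L + e / 2) at_top"
      using lim e by (intro order_tendstoD(2)) auto
    then have "eventually (\<lambda>y. G y \<le> q * (ln y ^ n / y)) at_top" using eventually_gt_at_top[of 1]
      by eventually_elim (simp add: q_def field_simps)
    then obtain a where a: "1 \<le> a" "\<And>y. a \<le> y \<Longrightarrow> G y \<le> q * (ln y ^ n / y)"
      unfolding eventually_at_top_linorder by (metis max.bounded_iff max.cobounded2 order_trans linorder_le_cases)
    have "eventually (\<lambda>T. enn2real (?H T) / ln T ^ Suc n \<le>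
        (a + (q / Suc n * ln T ^ Suc n - q / Suc n * ln a ^ Suc n)) / ln T ^ Suc n) at_top"
      using eventually_gt_at_top[of 1] eventually_ge_at_top[of a]
    proof eventually_elim
      case (elim T)
      have mono: "q / Suc n * ln a ^ Suc n \<le> q / Suc n * ln T ^ Suc n"
        using a(1) elim q(1) by (intro mult_left_mono power_mono) auto
      \<comment> \<open>Below \<open>a\<close> only \<open>G y \<le> 1\<close> is available; it
        costs the additive constant \<open>a\<close>.\<close>
      have "?H T \<le> (\<integral>\<^sup>+y. indicator {0..a} y + ennreal (q * (ln y ^ n / y)) * indicator {a..T} y \<partial>lborel)"
      proof (intro nn_integral_mono, goal_cases)
        case (1 y)
        have "ennreal (G y) \<le> 1" using G by simp
        moreover have "a \<le> y \<Longrightarrow> ennreal (G y) \<le> ennreal (q * (ln y ^ n / y))" using a by (intro ennreal_leI)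
        ultimately show ?case by (auto split: split_indicator intro: order_trans)
      qed
      also have "\<dots> = (\<integral>\<^sup>+y. indicator {0..a} y \<partial>lborel) + (\<integral>\<^sup>+y. ennreal (q * (ln y ^ n / y)) * indicator {a..T} y \<partial>lborel)"
        by (intro nn_integral_add) auto
      also have "\<dots> = ennreal a + ennreal (q / Suc n * ln T ^ Suc n - q / Suc n * ln a ^ Suc n)"
        using FTC[OF q(1) a(1)] elim a(1) by simp
      also have "\<dots> = ennreal (a + (q / Suc n * ln T ^ Suc n - q / Suc n * ln a ^ Suc n))"
        using a(1) mono by (subst ennreal_plus) auto
      finally have "enn2real (?H T) \<le> a + (q / Suc n * ln T ^ Suc n - q / Suc n * ln a ^ Suc n)"
        using a(1) mono by (intro enn2real_leI) auto
      then show ?case using elim by (intro divide_right_mono) auto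
    qed
    then show "\<exists>g l. (g \<longlongrightarrow> l) at_top \<and> l < L / Suc n + e \<and> (\<forall>\<^sub>F T in at_top. enn2real (?H T) / ln T ^ Suc n \<le> g T)"
      using limq[of a q a] q by blast
  qed
qed

section \<open>Exact tail asymptotics of products and of their maxima\<close>

context prob_space
begin

text \<open>Conditioning on \<open>W\<close> gives the probability as the mean of
  \<open>1 - exp (- x)\<close> with \<open>x = c * W / t\<close>. This function lies between
  \<open>min x d / (1 + d)\<close> and \<open>min x 1\<close>, so the tail is squeezed between
  multiples of truncated means of \<open>W\<close> at heights proportional to \<open>t\<close>.
  These grow like \<open>ln t ^ (n + 1)\<close>, and the proportionality factor does not matter. The
  mean of \<open>W\<close> itself is infinite when \<open>L > 0\<close>, so no moment bound could
  replace the truncation.\<close>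

lemma product_tail_step:
  fixes W Z :: "'a \<Rightarrow> real"
  assumes ind: "indep_var borel W borel Z" and W: "\<And>\<omega>. 0 \<le> W \<omega>" and c: "0 \<le> c"
    and cdf: "\<And>x. 0 < x \<Longrightarrow> prob {\<omega>\<in>space M. Z \<omega> > x} = 1 - exp (- (c / x))"
    and L: "0 \<le> L" and lim: "((\<lambda>y. y / ln y ^ n * prob {\<omega>\<in>space M. W \<omega> > y}) \<longlongrightarrow> L) at_top"
  shows "((\<lambda>t. t / ln t ^ Suc n * prob {\<omega>\<in>space M. W \<omega> * Z \<omega> > t}) \<longlongrightarrow> L * c / Suc n) at_top"
proof (cases "c = 0")
  \<comment> \<open>The case of a null cell: \<open>Z\<close> is almost surely at most 0, and the
    truncation heights used below would divide by 0.\<close>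
  case True
  have "prob {\<omega>\<in>space M. W \<omega> * Z \<omega> > t} = 0" if "0 < t" for t
  proof -
    have "emeasure M {\<omega>\<in>space M. W \<omega> * Z \<omega> > t} \<le> ennreal (0 / t) * (\<integral>\<^sup>+\<omega>. ennreal (W \<omega>) \<partial>M)"
      using that True cdf by (intro prob_mult_gt_le ind W) auto
    then show ?thesis by (simp add: emeasure_eq_measure)
  qed
  then have "eventually (\<lambda>t. t / ln t ^ Suc n * prob {\<omega>\<in>space M. W \<omega> * Z \<omega> > t} = 0) at_top"
    by (intro eventually_mono[OF eventually_gt_at_top[of 0]]) simp
  then show ?thesis using True by (simp add: tendsto_eventually)
next
  case False
  then have c: "0 < c" using c by simp
  have [measurable]: "W \<in> borel_measurable M"
    using ind by (auto dest: indep_var_rv1 indep_var_rv2)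
  define h where "h T = enn2real (\<integral>\<^sup>+\<omega>. ennreal (min (W \<omega>) T) \<partial>M)" for T
  have h: "(\<integral>\<^sup>+\<omega>. ennreal (min (W \<omega>) T) \<partial>M) = ennreal (h T)" if "0 \<le> T" for T
  proof -
    have "(\<integral>\<^sup>+\<omega>. ennreal (min (W \<omega>) T) \<partial>M) \<le> (\<integral>\<^sup>+\<omega>. ennreal T \<partial>M)"
      by (intro nn_integral_mono ennreal_leI) simp
    also have "\<dots> < \<infinity>" by (simp add: emeasure_space_1)
    finally show ?thesis by (simp add: h_def)
  qed
  have limh: "((\<lambda>T. h T / ln T ^ Suc n) \<longlongrightarrow> L / Suc n) at_top"
  proof -
    have [measurable]: "(\<lambda>y. prob {\<omega>\<in>space M. W \<omega> > y}) \<in> borel_measurable borel"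
      by measurable
    have "((\<lambda>T. enn2real (\<integral>\<^sup>+y. ennreal (prob {\<omega>\<in>space M. W \<omega> > y} * indicator {0..T} y) \<partial>lborel) / ln T ^ Suc n)
        \<longlongrightarrow> L / Suc n) at_top"
      by (rule tail_integral_asymp) (use L lim in auto)
    moreover have "eventually (\<lambda>T. enn2real (\<integral>\<^sup>+y. ennreal (prob {\<omega>\<in>space M. W \<omega> > y} * indicator {0..T} y) \<partial>lborel) / ln T ^ Suc n
       = h T / ln T ^ Suc n) at_top"
      using eventually_ge_at_top[of 0]
      by eventually_elim (simp add: h_def nn_integral_min_tail W)
    ultimately show ?thesis by (simp only: tendsto_cong)
  qed
  have eq: "emeasure M {\<omega>\<in>space M. W \<omega> * Z \<omega> > t} = (\<integral>\<^sup>+\<omega>. ennreal (1 - exp (- (c * W \<omega> / t))) \<partial>M)" if t: "0 < t" for t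
  proof -
    have "emeasure M {\<omega>\<in>space M. W \<omega> * Z \<omega> > t} = (\<integral>\<^sup>+\<omega>. (if W \<omega> = 0 then 0 else emeasure M {\<omega>'\<in>space M. Z \<omega>' > t / W \<omega>}) \<partial>M)"
      by (intro prob_mult_gt ind W t)
    also have "\<dots> = (\<integral>\<^sup>+\<omega>. ennreal (1 - exp (- (c * W \<omega> / t))) \<partial>M)"
    proof (intro nn_integral_cong, goal_cases)
      case (1 \<omega>)
      show ?case
      proof (cases "W \<omega> = 0")
        case False
        then have "0 < W \<omega>" using W[of \<omega>] by simp
        then show ?thesis using t by (simp add: emeasure_eq_measure cdf)
      qed simp
    qed
    finally show ?thesis .
  qed
  have cancel: "1 < t \<Longrightarrow> t / A * (B / t * x) = B * (x / A)" for t A B x :: real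
    by (cases "A = 0") (simp_all add: field_simps)
  have lim_scaled: "((\<lambda>t. C * (h (a * t) / ln t ^ Suc n)) \<longlongrightarrow> C * (L / Suc n)) at_top" if a: "0 < a" for C a
  proof -
    have "((\<lambda>t. C * (h (a * t) / ln (a * t) ^ Suc n) * (ln (a * t) / ln t) ^ Suc n) \<longlongrightarrow> C * (L / Suc n) * 1) at_top"
      by (intro tendsto_intros ln_mult_ratio_tendsto filterlim_compose[OF limh] filterlim_scale_at_top a)
    moreover have "eventually (\<lambda>t. C * (h (a * t) / ln (a * t) ^ Suc n) * (ln (a * t) / ln t) ^ Suc n = C * (h (a * t) / ln t ^ Suc n)) at_top"
    proof -
      have "eventually (\<lambda>t. 1 < a * t) at_top" using a by real_asymp
      then show ?thesis using eventually_gt_at_top[of 1]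
      proof eventually_elim
        case (elim t)
        then have "ln (a * t) \<noteq> 0" "ln t \<noteq> 0" by auto
        then show ?case by (simp add: power_divide)
      qed
    qed
    ultimately show ?thesis by (simp add: tendsto_cong)
  qed
  show ?thesis
  proof (rule tendsto_squeeze_eps)
    fix e :: real assume e: "0 < e"
    \<comment> \<open>The lower bound loses the factor \<open>1 / (1 + d)\<close>; \<open>d\<close>
      is taken so small that the loss stays below \<open>e\<close>.\<close>
    have "((\<lambda>d. c / (1 + d) * (L / Suc n)) \<longlongrightarrow> c / (1 + 0) * (L / Suc n)) (at_right 0)"
      by (intro tendsto_intros) auto
    then have "eventually (\<lambda>d. L * c / Suc n - e < c / (1 + d) * (L / Suc n)) (at_right 0)"
      using e by (intro order_tendstoD(1)) (auto simp: mult.commute)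
    moreover have "eventually (\<lambda>d. 0 < (d::real)) (at_right 0)" by (simp add: eventually_at_right_less)
    ultimately have "eventually (\<lambda>d. 0 < d \<and> L * c / Suc n - e < c / (1 + d) * (L / Suc n)) (at_right 0)"
      by eventually_elim simp
    then obtain d where d: "0 < d" "L * c / Suc n - e < c / (1 + d) * (L / Suc n)"
      using eventually_happens'[OF trivial_limit_at_right_real] by blast
    have "eventually (\<lambda>t. c / (1 + d) * (h (d / c * t) / ln t ^ Suc n) \<le> t / ln t ^ Suc n * prob {\<omega>\<in>space M. W \<omega> * Z \<omega> > t}) at_top"
      using eventually_gt_at_top[of 1]
    proof eventually_elim
      case (elim t)
      have "ennreal (c / (1 + d) / t * h (d / c * t)) = ennreal (c / (1 + d) / t) * (\<integral>\<^sup>+\<omega>. ennreal (min (W \<omega>) (d / c * t)) \<partial>M)"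
        using elim c d by (subst h, simp, intro ennreal_mult') simp
      also have "\<dots> = (\<integral>\<^sup>+\<omega>. ennreal (c / (1 + d) / t) * ennreal (min (W \<omega>) (d / c * t)) \<partial>M)"
        by (rule nn_integral_cmult[symmetric]) measurable
      also have "\<dots> \<le> (\<integral>\<^sup>+\<omega>. ennreal (1 - exp (- (c * W \<omega> / t))) \<partial>M)"
      proof (intro nn_integral_mono, goal_cases)
        case (1 \<omega>)
        define x where "x = c * W \<omega> / t"
        have x: "0 \<le> x" using elim c W by (simp add: x_def)
        have "c / t * min (W \<omega>) (d / c * t) = min x d"
          using elim c d by (auto simp: x_def min_def field_simps)
        then have "c / (1 + d) / t * min (W \<omega>) (d / c * t) = min x d / (1 + d)"
          by (metis divide_divide_eq_left mult.commute times_divide_eq_left)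
        also have "\<dots> \<le> x / (1 + x)"
        proof (cases "x \<le> d")
          case True
          then show ?thesis using x d by (simp add: min_def divide_left_mono)
        next
          case False
          then show ?thesis using x d by (simp add: min_def field_simps)
        qed
        also have "\<dots> \<le> 1 - exp (- x)"
        proof -
          have "exp (- x) \<le> 1 / (1 + x)"
            using exp_ge_add_one_self[of x] x by (simp add: exp_minus inverse_eq_divide frac_le)
          then show ?thesis using x by (simp add: field_simps)
        qed
        finally show ?case
          using elim c d W by (subst ennreal_mult[symmetric]) (auto intro!: ennreal_leI simp: x_def)
      qed
      also have "\<dots> = ennreal (prob {\<omega>\<in>space M. W \<omega> * Z \<omega> > t})"
        using elim by (simp add: eq[symmetric] emeasure_eq_measure)
      finally have "c / (1 + d) / t * h (d / c * t) \<le> prob {\<omega>\<in>space M. W \<omega> * Z \<omega> > t}"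
        by (simp add: ennreal_le_iff)
      then have "t / ln t ^ Suc n * (c / (1 + d) / t * h (d / c * t)) \<le> t / ln t ^ Suc n * prob {\<omega>\<in>space M. W \<omega> * Z \<omega> > t}"
        using elim by (intro mult_left_mono) auto
      then show ?case using elim by (simp only: cancel)
    qed
    then show "\<exists>g l. (g \<longlongrightarrow> l) at_top \<and> L * c / Suc n - e < l \<and>
        (\<forall>\<^sub>F t in at_top. g t \<le> t / ln t ^ Suc n * prob {\<omega>\<in>space M. W \<omega> * Z \<omega> > t})"
      using lim_scaled[of "d / c" "c / (1 + d)"] c d by (meson divide_pos_pos)
  next
    fix e :: real assume e: "0 < e"
    have "eventually (\<lambda>t. t / ln t ^ Suc n * prob {\<omega>\<in>space M. W \<omega> * Z \<omega> > t} \<le> c * (h (1 / c * t) / ln t ^ Suc n)) at_top"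
      using eventually_gt_at_top[of 1]
    proof eventually_elim
      case (elim t)
      have "ennreal (prob {\<omega>\<in>space M. W \<omega> * Z \<omega> > t}) = (\<integral>\<^sup>+\<omega>. ennreal (1 - exp (- (c * W \<omega> / t))) \<partial>M)"
        using elim by (simp add: eq[symmetric] emeasure_eq_measure)
      also have "\<dots> \<le> (\<integral>\<^sup>+\<omega>. ennreal (c / t) * ennreal (min (W \<omega>) (1 / c * t)) \<partial>M)"
      proof (intro nn_integral_mono, goal_cases)
        case (1 \<omega>)
        define x where "x = c * W \<omega> / t"
        have x: "0 \<le> x" using elim c W by (simp add: x_def)
        have "1 - exp (- x) \<le> min x 1" using exp_ge_add_one_self[of "-x"] by (simp add: min_def)
        also have "\<dots> = c / t * min (W \<omega>) (1 / c * t)"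
          using elim c by (auto simp: x_def min_def field_simps)
        finally show ?case
          using elim c W by (subst ennreal_mult[symmetric]) (auto intro!: ennreal_leI simp: x_def)
      qed
      also have "\<dots> = ennreal (c / t) * (\<integral>\<^sup>+\<omega>. ennreal (min (W \<omega>) (1 / c * t)) \<partial>M)"
        by (rule nn_integral_cmult) measurable
      also have "\<dots> = ennreal (c / t * h (1 / c * t))"
        using elim c by (subst h, simp, intro ennreal_mult'[symmetric]) simp
      finally have "prob {\<omega>\<in>space M. W \<omega> * Z \<omega> > t} \<le> c / t * h (1 / c * t)"
        using elim c by (subst (asm) ennreal_le_iff) (auto simp: h_def)
      then have "t / ln t ^ Suc n * prob {\<omega>\<in>space M. W \<omega> * Z \<omega> > t} \<le> t / ln t ^ Suc n * (c / t * h (1 / c * t))"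
        using elim by (intro mult_left_mono) auto
      then show ?case using elim by (simp only: cancel)
    qed
    moreover have "c * (L / Suc n) < L * c / Suc n + e" using e by (simp add: mult.commute)
    ultimately show "\<exists>g l. (g \<longlongrightarrow> l) at_top \<and> l < L * c / Suc n + e \<and>
        (\<forall>\<^sub>F t in at_top. t / ln t ^ Suc n * prob {\<omega>\<in>space M. W \<omega> * Z \<omega> > t} \<le> g t)"
      using lim_scaled[of "1 / c" c] c by (meson divide_pos_pos zero_less_one)
  qed
qed

text \<open>Each further factor contributes one logarithm and divides the constant by the next
  integer, which builds up \<open>fact (card T - 1)\<close>. The base case is the convergence of
  \<open>s * (1 - exp (- (c i / s)))\<close> to \<open>c i\<close>.\<close>

lemma product_tail_asymp:
  fixes Z :: "'i \<Rightarrow> 'a \<Rightarrow> real"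
  assumes T: "finite T" "T \<noteq> {}" and ind: "indep_vars (\<lambda>_. borel) Z T"
    and Z: "\<And>i \<omega>. 0 \<le> Z i \<omega>" and c: "\<And>i. 0 \<le> c i"
    and cdf: "\<And>i x. i \<in> T \<Longrightarrow> 0 < x \<Longrightarrow> prob {\<omega>\<in>space M. Z i \<omega> > x} = 1 - exp (- (c i / x))"
  shows "((\<lambda>s. s / ln s ^ (card T - 1) * prob {\<omega>\<in>space M. (\<Prod>i\<in>T. Z i \<omega>) > s}) \<longlongrightarrow>
    (\<Prod>i\<in>T. c i) / fact (card T - 1)) at_top"
  using T ind cdf
proof (induction T rule: finite_ne_induct)
  case (singleton i)
  have "((\<lambda>s. s * (1 - exp (- (c i / s)))) \<longlongrightarrow> c i) at_top"
  proof (cases "c i = 0")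
    case False
    then have "0 < c i" using c[of i] by simp
    then show ?thesis by real_asymp
  qed simp
  moreover have "eventually (\<lambda>s. s * (1 - exp (- (c i / s))) = s * prob {\<omega>\<in>space M. Z i \<omega> > s}) at_top"
    using eventually_gt_at_top[of 0] by eventually_elim (simp add: singleton)
  ultimately show ?case by (simp add: tendsto_cong)
next
  case (insert i T)
  have "indep_var borel (Z i) borel (\<lambda>\<omega>. \<Prod>i\<in>T. Z i \<omega>)"
    using insert by (intro indep_vars_prod) auto
  then have "indep_var borel (\<lambda>\<omega>. \<Prod>i\<in>T. Z i \<omega>) borel (Z i)" by (rule indep_var_commute)
  then have "((\<lambda>s. s / ln s ^ Suc (card T - 1) * prob {\<omega>\<in>space M. (\<Prod>i\<in>T. Z i \<omega>) * Z i \<omega> > s}) \<longlongrightarrow>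
     (\<Prod>i\<in>T. c i) / fact (card T - 1) * c i / Suc (card T - 1)) at_top"
    using insert.prems c Z
    by (intro product_tail_step insert.IH prod_nonneg divide_nonneg_pos) (auto intro: indep_vars_subset)
  moreover have "Suc (card T - 1) = card T" using insert by (simp add: card_gt_0_iff)
  moreover have "fact (card T) = (fact (card T - 1) * real (card T))"
    using insert by (subst fact_reduce) (auto simp: card_gt_0_iff)
  ultimately show ?case using insert by (simp add: mult.commute)
qed

text \<open>For \<open>j \<in> T' - T\<close>, either \<open>Z j > K\<close>, which is independent of the product over \<open>T\<close> and
  unlikely for large \<open>K\<close>, or the product over the \<open>k - 1\<close> indices in \<open>T' - {j}\<close> exceeds \<open>s / K\<close>,
  which costs a factor \<open>ln s\<close>.\<close>

lemma product_tail_pair_negligible: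
  fixes Z :: "'i \<Rightarrow> 'a \<Rightarrow> real"
  assumes S: "finite S" and ind: "indep_vars (\<lambda>_. borel) Z S"
    and Z: "\<And>i \<omega>. 0 \<le> Z i \<omega>" and c: "\<And>i. 0 \<le> c i"
    and cdf: "\<And>i x. i \<in> S \<Longrightarrow> 0 < x \<Longrightarrow> prob {\<omega>\<in>space M. Z i \<omega> > x} = 1 - exp (- (c i / x))"
    and T: "T \<subseteq> S" "T' \<subseteq> S" "card T = k" "card T' = k" "T \<noteq> T'" and k: "2 \<le> k"
  shows "((\<lambda>s. s / ln s ^ (k - 1) * prob {\<omega>\<in>space M. (\<Prod>i\<in>T. Z i \<omega>) > s \<and> (\<Prod>i\<in>T'. Z i \<omega>) > s}) \<longlongrightarrow> 0) at_top"
proof -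
  have fin: "finite T" "finite T'" using T S by (auto intro: finite_subset)
  have "\<not> T' \<subseteq> T" using T fin by (metis card_subset_eq)
  then obtain j where j: "j \<in> T'" "j \<notin> T" by auto
  have meas[measurable]: "Z i \<in> borel_measurable M" if "i \<in> S" for i
    using ind that by (auto simp: indep_vars_def)
  have measP: "(\<lambda>\<omega>. \<Prod>i\<in>A. Z i \<omega>) \<in> borel_measurable M" if "A \<subseteq> S" for A
    using that by (intro borel_measurable_prod) auto
  note [measurable] = measP[OF T(1)] measP[OF T(2)]
  have mT'j[measurable]: "(\<lambda>\<omega>. \<Prod>i\<in>T' - {j}. Z i \<omega>) \<in> borel_measurable M" by (rule measP) (use T in auto)
  have jS: "j \<in> S" using j T by auto
  have [measurable]: "Z j \<in> borel_measurable M" by (rule meas[OF jS])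
  have T'j: "T' - {j} \<noteq> {}" "card (T' - {j}) = k - 1" "finite (T' - {j})"
  proof -
    show "card (T' - {j}) = k - 1" using T j fin by simp
    then show "T' - {j} \<noteq> {}" using k by (metis card.empty diff_is_0_eq not_less_eq_eq numeral_2_eq_2 One_nat_def)
  qed (use fin in simp)
  define C where "C = (\<Prod>i\<in>T. c i) / fact (k - 1)"
  have C: "0 \<le> C" using c by (simp add: C_def prod_nonneg)
  have limT: "((\<lambda>s. s / ln s ^ (k - 1) * prob {\<omega>\<in>space M. (\<Prod>i\<in>T. Z i \<omega>) > s}) \<longlongrightarrow> C) at_top"
    using product_tail_asymp[OF fin(1) _ indep_vars_subset[OF ind T(1)] Z c cdf] T k by (force simp: C_def)
  have limT': "((\<lambda>s. s / ln s ^ (k - 2) * prob {\<omega>\<in>space M. (\<Prod>i\<in>T'-{j}. Z i \<omega>) > s}) \<longlongrightarrow> (\<Prod>i\<in>T'-{j}. c i) / fact (k - 2)) at_top"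
  proof -
    have "k - 1 - 1 = k - 2" by simp
    then show ?thesis
      using product_tail_asymp[OF T'j(3,1) indep_vars_subset[OF ind] Z c cdf] T T'j(2) by (simp add: subset_iff)
  qed
  have neg: "((\<lambda>s. s / ln s ^ (k - 1) * prob {\<omega>\<in>space M. (\<Prod>i\<in>T'-{j}. Z i \<omega>) > s / K}) \<longlongrightarrow> 0) at_top" if K: "0 < K" for K
  proof -
    have "((\<lambda>s. 1 / ln s * (s / ln s ^ (k - 2) * prob {\<omega>\<in>space M. (\<Prod>i\<in>T'-{j}. Z i \<omega>) > s / K})) \<longlongrightarrow>
        0 * (K * ((\<Prod>i\<in>T'-{j}. c i) / fact (k - 2)))) at_top"
      by (intro tendsto_mult tail_asymp_scale[OF limT' K]) real_asymp
    moreover have "1 / ln s * (s / ln s ^ (k - 2) * x) = s / ln s ^ (k - 1) * x" for s x :: real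
    proof -
      have "k - 1 = Suc (k - 2)" using k by simp
      then show ?thesis by simp
    qed
    ultimately show ?thesis by (simp only: mult_zero_left)
  qed
  have indj: "indep_var borel (Z j) borel (\<lambda>\<omega>. \<Prod>i\<in>T. Z i \<omega>)"
    using fin j jS T by (intro indep_vars_prod indep_vars_subset[OF ind]) auto
  have bound: "prob {\<omega>\<in>space M. (\<Prod>i\<in>T. Z i \<omega>) > s \<and> (\<Prod>i\<in>T'. Z i \<omega>) > s} \<le>
      c j / K * prob {\<omega>\<in>space M. (\<Prod>i\<in>T. Z i \<omega>) > s} + prob {\<omega>\<in>space M. (\<Prod>i\<in>T'-{j}. Z i \<omega>) > s / K}"
    if K: "0 < K" for s K
  proof -
    have "prob {\<omega>\<in>space M. (\<Prod>i\<in>T. Z i \<omega>) > s \<and> (\<Prod>i\<in>T'. Z i \<omega>) > s} \<le>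
      prob ({\<omega>\<in>space M. Z j \<omega> > K \<and> (\<Prod>i\<in>T. Z i \<omega>) > s} \<union> {\<omega>\<in>space M. (\<Prod>i\<in>T'-{j}. Z i \<omega>) > s / K})"
    proof (intro finite_measure_mono subsetI)
      fix \<omega> assume w: "\<omega> \<in> {\<omega>\<in>space M. (\<Prod>i\<in>T. Z i \<omega>) > s \<and> (\<Prod>i\<in>T'. Z i \<omega>) > s}"
      have eq: "(\<Prod>i\<in>T'. Z i \<omega>) = Z j \<omega> * (\<Prod>i\<in>T'-{j}. Z i \<omega>)" using fin j by (simp add: prod.remove)
      show "\<omega> \<in> {\<omega>\<in>space M. Z j \<omega> > K \<and> (\<Prod>i\<in>T. Z i \<omega>) > s} \<union> {\<omega>\<in>space M. (\<Prod>i\<in>T'-{j}. Z i \<omega>) > s / K}"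
      proof (cases "Z j \<omega> > K")
        case False
        then have "Z j \<omega> * (\<Prod>i\<in>T'-{j}. Z i \<omega>) \<le> K * (\<Prod>i\<in>T'-{j}. Z i \<omega>)"
          using Z by (intro mult_right_mono prod_nonneg) auto
        then have "s < K * (\<Prod>i\<in>T'-{j}. Z i \<omega>)" using w eq by simp
        then show ?thesis using K w by (simp add: field_simps)
      qed (use w in auto)
    qed measurable
    also have "\<dots> \<le> prob {\<omega>\<in>space M. Z j \<omega> > K \<and> (\<Prod>i\<in>T. Z i \<omega>) > s} + prob {\<omega>\<in>space M. (\<Prod>i\<in>T'-{j}. Z i \<omega>) > s / K}"
      by (intro measure_Un_le) measurable
    also have "prob {\<omega>\<in>space M. Z j \<omega> > K \<and> (\<Prod>i\<in>T. Z i \<omega>) > s} = prob {\<omega>\<in>space M. Z j \<omega> > K} * prob {\<omega>\<in>space M. (\<Prod>i\<in>T. Z i \<omega>) > s}"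
    proof -
      have "{\<omega>\<in>space M. Z j \<omega> > K \<and> (\<Prod>i\<in>T. Z i \<omega>) > s} = (\<lambda>x. (Z j x, \<Prod>i\<in>T. Z i x)) -` ({K<..} \<times> {s<..}) \<inter> space M"
        "{\<omega>\<in>space M. Z j \<omega> > K} = Z j -` {K<..} \<inter> space M"
        "{\<omega>\<in>space M. (\<Prod>i\<in>T. Z i \<omega>) > s} = (\<lambda>\<omega>. \<Prod>i\<in>T. Z i \<omega>) -` {s<..} \<inter> space M" by auto
      then show ?thesis using indep_varD[OF indj, of "{K<..}" "{s<..}"] by simp
    qed
    also have "prob {\<omega>\<in>space M. Z j \<omega> > K} = 1 - exp (- (c j / K))" by (rule cdf) (use jS K in auto)
    also have "\<dots> \<le> c j / K" using exp_ge_add_one_self[of "- (c j / K)"] by simp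
    finally show ?thesis by (simp add: mult_right_mono)
  qed
  show ?thesis
  proof (rule tendsto_squeeze_eps)
    fix e :: real assume "0 < e"
    have "eventually (\<lambda>s. (0::real) \<le> s / ln s ^ (k - 1) * prob {\<omega>\<in>space M. (\<Prod>i\<in>T. Z i \<omega>) > s \<and> (\<Prod>i\<in>T'. Z i \<omega>) > s}) at_top"
      using eventually_gt_at_top[of 1] by eventually_elim simp
    then show "\<exists>g l. (g \<longlongrightarrow> l) at_top \<and> 0 - e < l \<and> (\<forall>\<^sub>F s in at_top. g s \<le> s / ln s ^ (k - 1) * prob {\<omega>\<in>space M. (\<Prod>i\<in>T. Z i \<omega>) > s \<and> (\<Prod>i\<in>T'. Z i \<omega>) > s})"
      using \<open>0 < e\<close> by (intro exI[of _ "\<lambda>_. 0"] exI[of _ 0]) auto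
  next
    fix e :: real assume e: "0 < e"
    \<comment> \<open>\<open>K\<close> makes the independent part \<open>c j / K * C\<close> smaller
      than \<open>e\<close>; adding 1 keeps \<open>K\<close> positive when \<open>c j * C\<close>
      vanishes.\<close>
    define K where "K = (c j * C + 1) / e"
    have K: "0 < K" "c j / K * C < e"
    proof -
      have *: "0 \<le> c j * C" using c C by simp
      then show "0 < K" using e by (simp add: K_def)
      then show "c j / K * C < e" using e * by (simp add: K_def field_simps)
    qed
    have "((\<lambda>s. c j / K * (s / ln s ^ (k - 1) * prob {\<omega>\<in>space M. (\<Prod>i\<in>T. Z i \<omega>) > s}) +
        s / ln s ^ (k - 1) * prob {\<omega>\<in>space M. (\<Prod>i\<in>T'-{j}. Z i \<omega>) > s / K}) \<longlongrightarrow> c j / K * C + 0) at_top"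
      by (intro tendsto_intros limT neg K)
    moreover have "eventually (\<lambda>s. s / ln s ^ (k - 1) * prob {\<omega>\<in>space M. (\<Prod>i\<in>T. Z i \<omega>) > s \<and> (\<Prod>i\<in>T'. Z i \<omega>) > s} \<le>
       c j / K * (s / ln s ^ (k - 1) * prob {\<omega>\<in>space M. (\<Prod>i\<in>T. Z i \<omega>) > s}) +
        s / ln s ^ (k - 1) * prob {\<omega>\<in>space M. (\<Prod>i\<in>T'-{j}. Z i \<omega>) > s / K}) at_top"
      using eventually_gt_at_top[of 1]
    proof eventually_elim
      case (elim s)
      have "s / ln s ^ (k - 1) * prob {\<omega>\<in>space M. (\<Prod>i\<in>T. Z i \<omega>) > s \<and> (\<Prod>i\<in>T'. Z i \<omega>) > s} \<le>
        s / ln s ^ (k - 1) * (c j / K * prob {\<omega>\<in>space M. (\<Prod>i\<in>T. Z i \<omega>) > s} + prob {\<omega>\<in>space M. (\<Prod>i\<in>T'-{j}. Z i \<omega>) > s / K})"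
        using elim by (intro mult_left_mono bound K) auto
      then show ?case by (simp add: algebra_simps)
    qed
    ultimately show "\<exists>g l. (g \<longlongrightarrow> l) at_top \<and> l < 0 + e \<and> (\<forall>\<^sub>F s in at_top. s / ln s ^ (k - 1) * prob {\<omega>\<in>space M. (\<Prod>i\<in>T. Z i \<omega>) > s \<and> (\<Prod>i\<in>T'. Z i \<omega>) > s} \<le> g s)"
      using K by force
  qed
qed

text \<open>Inclusion-exclusion, one set at a time: the overlap of the new event with the earlier
  ones is covered by pairwise intersections, which are negligible, so the tail constants add
  up.\<close>

lemma max_product_tail_asymp:
  fixes Z :: "'i \<Rightarrow> 'a \<Rightarrow> real"
  assumes S: "finite S" and ind: "indep_vars (\<lambda>_. borel) Z S"
    and Z: "\<And>i \<omega>. 0 \<le> Z i \<omega>" and c: "\<And>i. 0 \<le> c i"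
    and cdf: "\<And>i x. i \<in> S \<Longrightarrow> 0 < x \<Longrightarrow> prob {\<omega>\<in>space M. Z i \<omega> > x} = 1 - exp (- (c i / x))"
    and fam: "finite \<T>" "\<And>T. T \<in> \<T> \<Longrightarrow> T \<subseteq> S \<and> card T = k" and k: "2 \<le> k" and b: "\<And>T. 0 \<le> b T"
  shows "((\<lambda>s. s / ln s ^ (k - 1) * prob {\<omega>\<in>space M. \<exists>T\<in>\<T>. b T * (\<Prod>i\<in>T. Z i \<omega>) > s}) \<longlongrightarrow>
    (\<Sum>T\<in>\<T>. b T * (\<Prod>i\<in>T. c i)) / fact (k - 1)) at_top"
  using fam
proof (induction \<T> rule: finite_induct)
  case empty
  then show ?case by simp
next
  case (insert T \<T>)
  have meas: "Z i \<in> borel_measurable M" if "i \<in> S" for i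
    using ind that by (auto simp: indep_vars_def)
  have measP: "(\<lambda>\<omega>. \<Prod>i\<in>A. Z i \<omega>) \<in> borel_measurable M" if "A \<subseteq> S" for A
    using that meas by (intro borel_measurable_prod) auto
  define E where "E T s = {\<omega>\<in>space M. b T * (\<Prod>i\<in>T. Z i \<omega>) > s}" for T s
  have E: "E T s \<in> events" if "T \<subseteq> S" for T s
    unfolding E_def using measP[OF that] by measurable
  have U: "(\<Union>T\<in>\<T>. E T s) \<in> events" for s
    using insert by (intro sets.finite_UN E) auto
  have TS: "T \<subseteq> S" "card T = k" using insert by auto
  have lim1: "((\<lambda>s. s / ln s ^ (k - 1) * prob (E T s)) \<longlongrightarrow> b T * ((\<Prod>i\<in>T. c i) / fact (k - 1))) at_top"
  proof (cases "b T = 0")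
    case True
    have "eventually (\<lambda>s. s / ln s ^ (k - 1) * prob (E T s) = 0) at_top"
      using eventually_gt_at_top[of 0] by eventually_elim (simp add: E_def True)
    then show ?thesis using True by (simp add: tendsto_eventually)
  next
    case False
    then have bT: "0 < b T" using b[of T] by simp
    have "finite T" "T \<noteq> {}" using TS S k by (auto intro: finite_subset)
    then have "((\<lambda>s. s / ln s ^ (k - 1) * prob {\<omega>\<in>space M. (\<Prod>i\<in>T. Z i \<omega>) > s}) \<longlongrightarrow> (\<Prod>i\<in>T. c i) / fact (k - 1)) at_top"
      using product_tail_asymp[OF _ _ indep_vars_subset[OF ind TS(1)] Z c cdf] TS by (force)
    from tail_asymp_scale[OF this bT] show ?thesis
      using bT by (simp add: E_def field_simps)
  qed
  have lim2: "((\<lambda>s. s / ln s ^ (k - 1) * prob (E T s \<inter> E T' s)) \<longlongrightarrow> 0) at_top" if T': "T' \<in> \<T>" for T'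
  proof -
    \<comment> \<open>A common bound of the two coefficients, shifted to be positive, reduces the
      intersection to the event that both unweighted products exceed \<open>s / B\<close>.\<close>
    define B where "B = max (b T) (b T') + 1"
    have B: "0 < B" "b T \<le> B" "b T' \<le> B" using b[of T] by (auto simp: B_def)
    have T'S: "T' \<subseteq> S" "card T' = k" "T \<noteq> T'" using insert T' by auto
    have "((\<lambda>s. s / ln s ^ (k - 1) * prob {\<omega>\<in>space M. (\<Prod>i\<in>T. Z i \<omega>) > s \<and> (\<Prod>i\<in>T'. Z i \<omega>) > s}) \<longlongrightarrow> 0) at_top"
      by (rule product_tail_pair_negligible[OF S ind Z c cdf]) (use TS T'S k in auto)
    from tail_asymp_scale[OF this B(1)]
    have lim0: "((\<lambda>s. s / ln s ^ (k - 1) * prob {\<omega>\<in>space M. (\<Prod>i\<in>T. Z i \<omega>) > s / B \<and> (\<Prod>i\<in>T'. Z i \<omega>) > s / B}) \<longlongrightarrow> 0) at_top"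
      by simp
    show ?thesis
    proof (rule tendsto_sandwich[OF _ _ tendsto_const lim0])
      show "\<forall>\<^sub>F s in at_top. 0 \<le> s / ln s ^ (k - 1) * prob (E T s \<inter> E T' s)"
        using eventually_gt_at_top[of 1] by eventually_elim simp
      show "\<forall>\<^sub>F s in at_top. s / ln s ^ (k - 1) * prob (E T s \<inter> E T' s) \<le>
         s / ln s ^ (k - 1) * prob {\<omega>\<in>space M. (\<Prod>i\<in>T. Z i \<omega>) > s / B \<and> (\<Prod>i\<in>T'. Z i \<omega>) > s / B}"
        using eventually_gt_at_top[of 1]
      proof eventually_elim
        case (elim s)
        have *: "s / B < (\<Prod>i\<in>A. Z i \<omega>)" if "s < b A * (\<Prod>i\<in>A. Z i \<omega>)" "b A \<le> B" for A \<omega>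
        proof -
          have "b A * (\<Prod>i\<in>A. Z i \<omega>) \<le> B * (\<Prod>i\<in>A. Z i \<omega>)"
            using that Z by (intro mult_right_mono prod_nonneg) auto
          then show ?thesis using that B by (simp add: field_simps)
        qed
        have "prob (E T s \<inter> E T' s) \<le> prob {\<omega>\<in>space M. (\<Prod>i\<in>T. Z i \<omega>) > s / B \<and> (\<Prod>i\<in>T'. Z i \<omega>) > s / B}"
        proof (intro finite_measure_mono)
          show "{\<omega>\<in>space M. (\<Prod>i\<in>T. Z i \<omega>) > s / B \<and> (\<Prod>i\<in>T'. Z i \<omega>) > s / B} \<in> events"
            using measP[OF TS(1)] measP[OF T'S(1)] by measurable
        qed (use * B in \<open>auto simp: E_def\<close>)
        then show ?case using elim by (intro mult_left_mono) auto
      qed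
    qed
  qed
  have lim3: "((\<lambda>s. s / ln s ^ (k - 1) * prob (E T s \<inter> (\<Union>T\<in>\<T>. E T s))) \<longlongrightarrow> 0) at_top"
  proof (rule tendsto_sandwich[OF _ _ tendsto_const])
    show "((\<lambda>s. \<Sum>T'\<in>\<T>. s / ln s ^ (k - 1) * prob (E T s \<inter> E T' s)) \<longlongrightarrow> 0) at_top"
      by (intro tendsto_null_sum lim2)
    show "\<forall>\<^sub>F s in at_top. 0 \<le> s / ln s ^ (k - 1) * prob (E T s \<inter> (\<Union>T\<in>\<T>. E T s))"
      using eventually_gt_at_top[of 1] by eventually_elim simp
    show "\<forall>\<^sub>F s in at_top. s / ln s ^ (k - 1) * prob (E T s \<inter> (\<Union>T\<in>\<T>. E T s)) \<le> (\<Sum>T'\<in>\<T>. s / ln s ^ (k - 1) * prob (E T s \<inter> E T' s))"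
      using eventually_gt_at_top[of 1]
    proof eventually_elim
      case (elim s)
      have "prob (E T s \<inter> (\<Union>T\<in>\<T>. E T s)) = prob (\<Union>T'\<in>\<T>. E T s \<inter> E T' s)" by simp
      also have "\<dots> \<le> (\<Sum>T'\<in>\<T>. prob (E T s \<inter> E T' s))"
        using insert TS by (intro finite_measure_subadditive_finite) (auto intro!: E)
      finally have "s / ln s ^ (k - 1) * prob (E T s \<inter> (\<Union>T\<in>\<T>. E T s)) \<le> s / ln s ^ (k - 1) * (\<Sum>T'\<in>\<T>. prob (E T s \<inter> E T' s))"
        using elim by (intro mult_left_mono) auto
      then show ?case by (simp add: sum_distrib_left)
    qed
  qed
  have eq: "prob {\<omega>\<in>space M. \<exists>T\<in>insert T \<T>. b T * (\<Prod>i\<in>T. Z i \<omega>) > s} =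
      prob (E T s) + prob (\<Union>T\<in>\<T>. E T s) - prob (E T s \<inter> (\<Union>T\<in>\<T>. E T s))" for s
  proof -
    have "{\<omega>\<in>space M. \<exists>T\<in>insert T \<T>. b T * (\<Prod>i\<in>T. Z i \<omega>) > s} = E T s \<union> (\<Union>T\<in>\<T>. E T s)"
      by (auto simp: E_def)
    then show ?thesis using measure_Un3[OF fmeasurableI fmeasurableI, of "E T s" M "\<Union>T\<in>\<T>. E T s"] E[OF TS(1)] U
      by (simp add: emeasure_eq_measure)
  qed
  have UE: "(\<Union>T\<in>\<T>. E T s) = {\<omega>\<in>space M. \<exists>T\<in>\<T>. b T * (\<Prod>i\<in>T. Z i \<omega>) > s}" for s
    by (auto simp: E_def)
  have "((\<lambda>s. s / ln s ^ (k - 1) * prob (E T s) + s / ln s ^ (k - 1) * prob (\<Union>T\<in>\<T>. E T s)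
     - s / ln s ^ (k - 1) * prob (E T s \<inter> (\<Union>T\<in>\<T>. E T s))) \<longlongrightarrow>
     b T * ((\<Prod>i\<in>T. c i) / fact (k - 1)) + (\<Sum>T\<in>\<T>. b T * (\<Prod>i\<in>T. c i)) / fact (k - 1) - 0) at_top"
    by (intro tendsto_diff tendsto_add lim1 lim3) (unfold UE, rule insert.IH, use insert in auto)
  then show ?case
    unfolding eq using insert by (simp add: algebra_simps add_divide_distrib)
qed

end

section \<open>Product measures and the integrand of the maximal inequality\<close>

text \<open>Both sides agree on rectangles, where the integral of a product factorises. Uniqueness
  of the product measure, for which the density must be sigma-finite, does the rest.\<close>

lemma PiM_density:
  assumes \<mu>: "sigma_finite_measure \<mu>" and f[measurable]: "f \<in> borel_measurable \<mu>"
    and d: "sigma_finite_measure (density \<mu> f)" and I: "finite I"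
  shows "PiM I (\<lambda>_. density \<mu> f) = density (PiM I (\<lambda>_. \<mu>)) (\<lambda>u. \<Prod>i\<in>I. f (u i))"
proof -
  interpret product_sigma_finite "\<lambda>_. \<mu>" using \<mu> by (simp add: product_sigma_finite_def)
  interpret d: product_sigma_finite "\<lambda>_. density \<mu> f" using d by (simp add: product_sigma_finite_def)
  show ?thesis
  proof (rule d.PiM_eqI[symmetric])
    show "sets (density (PiM I (\<lambda>_. \<mu>)) (\<lambda>u. \<Prod>i\<in>I. f (u i))) = sets (PiM I (\<lambda>_. density \<mu> f))"
      by (simp cong: sets_PiM_cong)
    fix A assume "\<And>i. i \<in> I \<Longrightarrow> A i \<in> sets (density \<mu> f)"
    then have A[measurable]: "\<And>i. i \<in> I \<Longrightarrow> A i \<in> sets \<mu>" by simp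
    have "emeasure (density (PiM I (\<lambda>_. \<mu>)) (\<lambda>u. \<Prod>i\<in>I. f (u i))) (Pi\<^sub>E I A) =
        (\<integral>\<^sup>+u. (\<Prod>i\<in>I. f (u i)) * indicator (Pi\<^sub>E I A) u \<partial>PiM I (\<lambda>_. \<mu>))"
      using I by (intro emeasure_density) (auto intro!: sets_PiM_I_finite A)
    also have "\<dots> = (\<integral>\<^sup>+u. (\<Prod>i\<in>I. f (u i) * indicator (A i) (u i)) \<partial>PiM I (\<lambda>_. \<mu>))"
    proof (intro nn_integral_cong)
      fix u assume "u \<in> space (PiM I (\<lambda>_. \<mu>))"
      then have "indicator (Pi\<^sub>E I A) u = (\<Prod>i\<in>I. indicator (A i) (u i) :: ennreal)"
      proof (cases "u \<in> Pi\<^sub>E I A")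
        case True
        then show ?thesis by (auto simp: PiE_def Pi_def)
      next
        case False
        then obtain i where "i \<in> I" "u i \<notin> A i"
          using \<open>u \<in> space _\<close> by (auto simp: space_PiM PiE_def)
        then have "(\<Prod>i\<in>I. indicator (A i) (u i) :: ennreal) = 0"
          using I by (intro prod_zero bexI[of _ i]) auto
        then show ?thesis using False by simp
      qed
      then show "(\<Prod>i\<in>I. f (u i)) * indicator (Pi\<^sub>E I A) u = (\<Prod>i\<in>I. f (u i) * indicator (A i) (u i))"
        by (simp add: prod.distrib)
    qed
    also have "\<dots> = (\<Prod>i\<in>I. \<integral>\<^sup>+x. f x * indicator (A i) x \<partial>\<mu>)"
      by (intro product_nn_integral_prod I) measurable
    also have "\<dots> = (\<Prod>i\<in>I. emeasure (density \<mu> f) (A i))"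
      by (intro prod.cong refl) (simp add: emeasure_density)
    finally show "emeasure (density (PiM I (\<lambda>_. \<mu>)) (\<lambda>u. \<Prod>i\<in>I. f (u i))) (Pi\<^sub>E I A) = (\<Prod>i\<in>I. emeasure (density \<mu> f) (A i))" .
  qed (fact I)
qed

lemma space_kpow_comp:
  assumes "\<pi> permutes I" "u \<in> space (PiM I (\<lambda>_. \<mu>))"
  shows "u \<circ> \<pi> \<in> space (PiM I (\<lambda>_. \<mu>))" "u \<circ> \<pi> = (\<lambda>i\<in>I. u (\<pi> i))"
  using assms by (auto simp: space_PiM PiE_def extensional_def permutes_in_image permutes_not_in Pi_def fun_eq_iff)

lemma measurable_comp_permute:
  assumes "\<pi> permutes I"
  shows "(\<lambda>u. u \<circ> \<pi>) \<in> measurable (PiM I (\<lambda>_. \<mu>)) (PiM I (\<lambda>_. \<mu>))"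
proof -
  have "(\<lambda>u. \<lambda>i\<in>I. u (\<pi> i)) \<in> measurable (PiM I (\<lambda>_. \<mu>)) (PiM I (\<lambda>_. \<mu>))"
    using assms by (intro measurable_restrict measurable_component_singleton) (simp add: permutes_in_image)
  then show ?thesis
    using space_kpow_comp(2)[OF assms] by (subst measurable_cong) auto
qed

text \<open>The preimage of a box is the box with its sides permuted, and its mass is the same
  product in another order. This lets a symmetrised integrand be integrated one permutation at a
  time.\<close>

lemma distr_PiM_permute:
  assumes \<mu>: "sigma_finite_measure \<mu>" and I: "finite I" and \<pi>: "\<pi> permutes I"
  shows "distr (PiM I (\<lambda>_. \<mu>)) (PiM I (\<lambda>_. \<mu>)) (\<lambda>u. u \<circ> \<pi>) = PiM I (\<lambda>_. \<mu>)"
proof -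
  interpret product_sigma_finite "\<lambda>_. \<mu>" using \<mu> by (simp add: product_sigma_finite_def)
  show ?thesis
  proof (rule PiM_eqI)
    fix A assume A: "\<And>i. i \<in> I \<Longrightarrow> A i \<in> sets \<mu>"
    have inv: "inv \<pi> permutes I" using \<pi> by (rule permutes_inv)
    have "emeasure (distr (PiM I (\<lambda>_. \<mu>)) (PiM I (\<lambda>_. \<mu>)) (\<lambda>u. u \<circ> \<pi>)) (Pi\<^sub>E I A) =
       emeasure (PiM I (\<lambda>_. \<mu>)) ((\<lambda>u. u \<circ> \<pi>) -` Pi\<^sub>E I A \<inter> space (PiM I (\<lambda>_. \<mu>)))"
      using I A by (intro emeasure_distr measurable_comp_permute \<pi> sets_PiM_I_finite) auto
    also have "(\<lambda>u. u \<circ> \<pi>) -` Pi\<^sub>E I A \<inter> space (PiM I (\<lambda>_. \<mu>)) = Pi\<^sub>E I (\<lambda>i. A (inv \<pi> i))"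
    proof (intro set_eqI iffI)
      fix u assume u: "u \<in> (\<lambda>u. u \<circ> \<pi>) -` Pi\<^sub>E I A \<inter> space (PiM I (\<lambda>_. \<mu>))"
      have "u i \<in> A (inv \<pi> i)" if "i \<in> I" for i
      proof -
        have "inv \<pi> i \<in> I" using inv that by (simp add: permutes_in_image)
        then have "(u \<circ> \<pi>) (inv \<pi> i) \<in> A (inv \<pi> i)" using u by auto
        then show ?thesis using \<pi> by (simp add: permutes_inverses)
      qed
      then show "u \<in> Pi\<^sub>E I (\<lambda>i. A (inv \<pi> i))" using u by (auto simp: space_PiM PiE_def)
    next
      fix u assume u: "u \<in> Pi\<^sub>E I (\<lambda>i. A (inv \<pi> i))"
      have "A (inv \<pi> i) \<subseteq> space \<mu>" if "i \<in> I" for i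
        using A[of "inv \<pi> i"] inv that sets.sets_into_space by (auto simp: permutes_in_image)
      then have us: "u \<in> space (PiM I (\<lambda>_. \<mu>))" using u by (auto simp: space_PiM PiE_def Pi_def)
      moreover have "(u \<circ> \<pi>) i \<in> A i" if "i \<in> I" for i
      proof -
        have "\<pi> i \<in> I" using \<pi> that by (simp add: permutes_in_image)
        then have "u (\<pi> i) \<in> A (inv \<pi> (\<pi> i))" using u by auto
        then show ?thesis using \<pi> by (simp add: permutes_inverses)
      qed
      ultimately show "u \<in> (\<lambda>u. u \<circ> \<pi>) -` Pi\<^sub>E I A \<inter> space (PiM I (\<lambda>_. \<mu>))"
        using space_kpow_comp[OF \<pi> us] by (auto simp: space_PiM PiE_def)
    qed
    also have "emeasure (PiM I (\<lambda>_. \<mu>)) (Pi\<^sub>E I (\<lambda>i. A (inv \<pi> i))) = (\<Prod>i\<in>I. emeasure \<mu> (A (inv \<pi> i)))"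
      using inv A I by (intro emeasure_PiM) (auto simp: permutes_in_image)
    also have "\<dots> = (\<Prod>i\<in>I. emeasure \<mu> (A i))"
      using prod.permute[OF inv, of "\<lambda>i. emeasure \<mu> (A i)"] by (simp add: comp_def)
    finally show "emeasure (distr (PiM I (\<lambda>_. \<mu>)) (PiM I (\<lambda>_. \<mu>)) (\<lambda>u. u \<circ> \<pi>)) (Pi\<^sub>E I A) = (\<Prod>i\<in>I. emeasure \<mu> (A i))" .
  qed (use I in auto)
qed

lemma nn_integral_PiM_permute:
  assumes "sigma_finite_measure \<mu>" "finite I" "\<pi> permutes I" "F \<in> borel_measurable (PiM I (\<lambda>_. \<mu>))"
  shows "(\<integral>\<^sup>+u. F (u \<circ> \<pi>) \<partial>PiM I (\<lambda>_. \<mu>)) = (\<integral>\<^sup>+u. F u \<partial>PiM I (\<lambda>_. \<mu>))"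
  using nn_integral_distr[OF measurable_comp_permute[OF assms(3), of \<mu>], of F]
    distr_PiM_permute[OF assms(1-3)] assms(4) by simp

lemma AE_PiM_permute:
  assumes "sigma_finite_measure \<mu>" "finite I" "\<pi> permutes I" "AE u in PiM I (\<lambda>_. \<mu>). Q u"
  shows "AE u in PiM I (\<lambda>_. \<mu>). Q (u \<circ> \<pi>)"
proof (rule AE_distrD[OF measurable_comp_permute[OF assms(3)]])
  show "AE u in distr (PiM I (\<lambda>_. \<mu>)) (PiM I (\<lambda>_. \<mu>)) (\<lambda>u. u \<circ> \<pi>). Q u"
    using assms(4) by (simp only: distr_PiM_permute[OF assms(1-3)])
qed

text \<open>The approximable sets form a sigma-algebra: complements have the same symmetric
  difference, and a countable union is cut to finitely many members by continuity of the finite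
  measure.\<close>

lemma approx_by_algebra:
  assumes "finite_measure L" and alg: "algebra \<Omega> \<A>" and sets: "sets L = sigma_sets \<Omega> \<A>"
    and A: "A \<in> sets L" and e: "0 < e"
  shows "\<exists>S\<in>\<A>. measure L (sym_diff S A) < e"
proof -
  interpret finite_measure L by fact
  interpret algebra \<Omega> \<A> by fact
  have AL: "\<A> \<subseteq> sets L" unfolding sets by auto
  have \<Omega>: "A \<in> sets L \<Longrightarrow> A \<subseteq> \<Omega>" for A
    unfolding sets by (rule sigma_sets_into_sp[OF space_closed])
  have "A \<in> sigma_sets \<Omega> \<A>" using A sets by simp
  then show ?thesis using e
  proof (induction arbitrary: e rule: sigma_sets.induct)
    case (Basic a)
    then show ?case by (intro bexI[of _ a]) auto
  next
    case Empty
    then show ?case by (intro bexI[of _ "{}"]) auto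
  next
    case (Compl a)
    then obtain S where S: "S \<in> \<A>" "measure L (sym_diff S a) < e" by auto
    have "S \<subseteq> \<Omega>" "a \<subseteq> \<Omega>" using S(1) AL \<Omega> Compl(1) sets by auto
    then have "sym_diff (\<Omega> - S) (\<Omega> - a) = sym_diff S a" by auto
    then show ?case using S by (intro bexI[of _ "\<Omega> - S"]) auto
  next
    case (Union a)
    have a[measurable]: "a i \<in> sets L" for i using Union(1) sets by simp
    define U where "U n = (\<Union>i<n. a i)" for n
    have UU: "(\<Union>n. U n) = (\<Union>i. a i)" by (auto simp: U_def)
    have "(\<lambda>n. measure L (U n)) \<longlonglongrightarrow> measure L (\<Union>n. U n)"
      by (rule finite_Lim_measure_incseq) (auto simp: U_def incseq_def intro: order_less_le_trans)
    then have "\<forall>\<^sub>F n in sequentially. measure L (\<Union>n. U n) - e / 2 < measure L (U n)"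
      using Union.prems by (intro order_tendstoD(1)) auto
    then obtain n where n: "measure L (\<Union>n. U n) - e / 2 < measure L (U n)"
      by (auto simp: eventually_sequentially)
    have m1: "measure L ((\<Union>i. a i) - U n) < e / 2"
      using n UU by (subst finite_measure_Diff) (auto simp: U_def)
    \<comment> \<open>Each of the first \<open>n\<close> sets gets a share of the remaining
      \<open>e / 2\<close>; dividing by \<open>n + 1\<close> in place of \<open>n\<close> covers
      \<open>n = 0\<close>.\<close>
    have "\<forall>i. \<exists>S\<in>\<A>. measure L (sym_diff S (a i)) < e / (2 * real (Suc n))"
      using Union.IH Union.prems by simp
    then obtain S where S: "\<And>i. S i \<in> \<A>" "\<And>i. measure L (sym_diff (S i) (a i)) < e / (2 * real (Suc n))"
      by metis
    have [measurable]: "S i \<in> sets L" for i using S AL by auto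
    have "measure L (sym_diff (\<Union>i<n. S i) (\<Union>i. a i)) \<le> measure L (((\<Union>i. a i) - U n) \<union> (\<Union>i<n. sym_diff (S i) (a i)))"
      by (intro finite_measure_mono) (auto simp: U_def)
    also have "\<dots> \<le> measure L ((\<Union>i. a i) - U n) + measure L (\<Union>i<n. sym_diff (S i) (a i))"
      by (intro measure_Un_le) (auto simp: U_def)
    also have "measure L (\<Union>i<n. sym_diff (S i) (a i)) \<le> (\<Sum>i<n. measure L (sym_diff (S i) (a i)))"
      by (intro finite_measure_subadditive_finite) auto
    also have "\<dots> \<le> (\<Sum>i<n. e / (2 * real (Suc n)))"
      using S(2) by (intro sum_mono less_imp_le) auto
    also have "\<dots> \<le> e / 2" using Union.prems by (simp add: field_simps)
    finally have "measure L (sym_diff (\<Union>i<n. S i) (\<Union>i. a i)) < e" using m1 by simp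
    then show ?case using S(1) by (intro bexI[of _ "\<Union>i<n. S i"]) auto
  qed
qed

text \<open>The integrand of the maximal inequality \<open>J_tail_le\<close> below, for \<open>y = F u\<close> and the weight
  \<open>v\<close> of the cell containing \<open>u\<close>.\<close>

definition theta :: "real \<Rightarrow> nat \<Rightarrow> real \<Rightarrow> real \<Rightarrow> real" where
  "theta \<alpha> k y v = \<bar>y\<bar> powr \<alpha> * (1 + ln_plus (\<bar>y\<bar> powr \<alpha> * v)) ^ (k - 1)"

lemma theta_measurable [measurable (raw)]:
  assumes [measurable]: "f \<in> borel_measurable M" "g \<in> borel_measurable M"
  shows "(\<lambda>x. theta \<alpha> k (f x) (g x)) \<in> borel_measurable M"
  unfolding theta_def by measurable

lemma theta_nonneg [simp]: "0 \<le> theta \<alpha> k y v"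
  unfolding theta_def by (intro mult_nonneg_nonneg zero_le_power add_nonneg_nonneg) auto

lemma theta_0 [simp]: "theta \<alpha> k 0 v = 0"
  by (simp add: theta_def)

lemma theta_abs [simp]: "theta \<alpha> k \<bar>y\<bar> v = theta \<alpha> k y v"
  by (simp add: theta_def)

lemma theta_ge_powr: "\<bar>y\<bar> powr \<alpha> \<le> theta \<alpha> k y v"
proof -
  have "\<bar>y\<bar> powr \<alpha> * 1 \<le> \<bar>y\<bar> powr \<alpha> * (1 + ln_plus (\<bar>y\<bar> powr \<alpha> * v)) ^ (k - 1)"
    by (intro mult_left_mono one_le_power) auto
  then show ?thesis by (simp add: theta_def)
qed

lemma theta_mono:
  assumes "\<bar>y\<bar> \<le> \<bar>z\<bar>" "0 \<le> v" "v \<le> v'" "0 < \<alpha>"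
  shows "theta \<alpha> k y v \<le> theta \<alpha> k z v'"
  unfolding theta_def using assms
  by (intro mult_mono power_mono add_left_mono ln_plus_mono powr_mono2 mult_nonneg_nonneg) (auto intro: zero_le_power)

text \<open>The bound \<open>ln_plus (c * x) \<le> ln c + ln_plus x\<close> is weakened to a
  product, so that it can be raised to a power and the part with \<open>c\<close> factored
  out.\<close>

lemma one_plus_ln_plus_mult_le:
  assumes "1 \<le> c"
  shows "1 + ln_plus (c * x) \<le> (1 + ln c) * (1 + ln_plus x)"
proof -
  have "ln_plus (c * x) \<le> ln c + ln_plus x"
  proof (cases "c * x \<le> 1")
    case True
    then show ?thesis using assms by (simp add: ln_plus_def max_def)
  next
    case False
    then have x: "0 < x" using assms by (metis mult_nonneg_nonpos not_le order.trans zero_le_one linorder_not_less)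
    then have "ln_plus (c * x) = ln c + ln x" using False assms by (simp add: ln_plus_eq ln_mult)
    also have "ln x \<le> ln_plus x" using x by (simp add: ln_plus_def)
    finally show ?thesis by simp
  qed
  moreover have "0 \<le> ln c * ln_plus x" using assms by simp
  ultimately show ?thesis by (simp add: algebra_simps)
qed

text \<open>The growth of \<open>theta\<close> when its first argument is multiplied by
  \<open>c \<ge> 1\<close>. At \<open>c = 2\<close> it is the constant of the quasi-triangle
  inequality below.\<close>

definition theta_const :: "real \<Rightarrow> nat \<Rightarrow> real \<Rightarrow> real" where
  "theta_const \<alpha> k c = c powr \<alpha> * (1 + ln (c powr \<alpha>)) ^ (k - 1)"

lemma theta_scale:
  assumes "1 \<le> c" "0 < \<alpha>"
  shows "theta \<alpha> k (c * y) v \<le> theta_const \<alpha> k c * theta \<alpha> k y v"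
proof -
  have c: "1 \<le> c powr \<alpha>" using assms by (simp add: ge_one_powr_ge_zero)
  have "1 + ln_plus (c powr \<alpha> * (\<bar>y\<bar> powr \<alpha> * v)) \<le> (1 + ln (c powr \<alpha>)) * (1 + ln_plus (\<bar>y\<bar> powr \<alpha> * v))"
    using c by (rule one_plus_ln_plus_mult_le)
  then have "(1 + ln_plus (c powr \<alpha> * (\<bar>y\<bar> powr \<alpha> * v))) ^ (k - 1) \<le> ((1 + ln (c powr \<alpha>)) * (1 + ln_plus (\<bar>y\<bar> powr \<alpha> * v))) ^ (k - 1)"
    by (intro power_mono) (auto intro: add_nonneg_nonneg)
  then have "c powr \<alpha> * \<bar>y\<bar> powr \<alpha> * (1 + ln_plus (c powr \<alpha> * (\<bar>y\<bar> powr \<alpha> * v))) ^ (k - 1) \<le>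
     c powr \<alpha> * \<bar>y\<bar> powr \<alpha> * ((1 + ln (c powr \<alpha>)) * (1 + ln_plus (\<bar>y\<bar> powr \<alpha> * v))) ^ (k - 1)"
    by (intro mult_left_mono) auto
  then show ?thesis
    using assms by (simp add: theta_def theta_const_def abs_mult powr_mult power_mult_distrib mult_ac)
qed

lemma theta_const_ge: "1 \<le> c \<Longrightarrow> 0 < \<alpha> \<Longrightarrow> 1 \<le> theta_const \<alpha> k c"
  unfolding theta_const_def using mult_mono[of 1 "c powr \<alpha>" 1 "(1 + ln (c powr \<alpha>)) ^ (k - 1)"]
  by (simp add: ge_one_powr_ge_zero one_le_power)

text \<open>In general \<open>theta\<close> is neither subadditive nor convex in its first argument,
  but the absolute value of \<open>y + z\<close> is at most twice the larger of the two absolute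
  values.\<close>

lemma theta_add:
  assumes "0 < \<alpha>" "0 \<le> v"
  shows "theta \<alpha> k (y + z) v \<le> theta_const \<alpha> k 2 * (theta \<alpha> k y v + theta \<alpha> k z v)"
proof -
  define x where "x = max \<bar>y\<bar> \<bar>z\<bar>"
  have "theta \<alpha> k (y + z) v \<le> theta \<alpha> k (2 * x) v"
    using assms by (intro theta_mono) (auto simp: x_def)
  also have "\<dots> \<le> theta_const \<alpha> k 2 * theta \<alpha> k x v"
    using assms by (intro theta_scale) auto
  also have "\<dots> \<le> theta_const \<alpha> k 2 * (theta \<alpha> k y v + theta \<alpha> k z v)"
    using theta_const_ge[of 2 \<alpha> k] assms by (intro mult_left_mono) (auto simp: x_def max_def)
  finally show ?thesis .
qed

text \<open>The dilation by \<open>s ^ (k - 1)\<close> costs the factor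
  \<open>1 + (k - 1) * ln s\<close>, which is at most \<open>k * ln s\<close> as soon as
  \<open>1 \<le> ln s\<close>. This is the origin of the restriction on \<open>s\<close> in the tail
  bounds.\<close>

lemma one_plus_ln_plus_power_le:
  assumes "1 \<le> ln s" "0 < s" "0 < k"
  shows "1 + ln_plus (h * s ^ (k - 1)) \<le> (1 + ln_plus h) * (real k * ln s)"
proof -
  have s: "1 \<le> s" using assms by (metis ln_ge_zero_iff order_trans zero_le_one)
  have "1 + ln_plus (s ^ (k - 1) * h) \<le> (1 + ln (s ^ (k - 1))) * (1 + ln_plus h)"
    using s by (intro one_plus_ln_plus_mult_le) (simp add: one_le_power)
  also have "1 + ln (s ^ (k - 1)) \<le> real k * ln s"
    using assms s by (simp add: ln_realpow of_nat_diff algebra_simps)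
  finally show ?thesis by (simp add: mult.commute mult_right_mono)
qed

section \<open>Maxima over cells\<close>

lemma less_powr_iff:
  fixes x y a :: real
  assumes "0 \<le> x" "0 < y" "0 < a"
  shows "y < x powr a \<longleftrightarrow> y powr (1 / a) < x"
proof -
  have y: "(y powr (1 / a)) powr a = y" using assms by (simp add: powr_powr)
  show ?thesis
  proof
    assume "y powr (1 / a) < x"
    then have "(y powr (1 / a)) powr a < x powr a" using assms by (intro powr_less_mono2) auto
    then show "y < x powr a" using y by simp
  next
    assume *: "y < x powr a"
    show "y powr (1 / a) < x"
    proof (rule ccontr)
      assume "\<not> y powr (1 / a) < x"
      then have "x powr a \<le> (y powr (1 / a)) powr a" using assms by (intro powr_mono2) auto
      then show False using * y by simp
    qed
  qed
qed

text \<open>Independence of the masses is given for families indexed by an initial segment of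
  \<open>nat\<close>, whereas cells are indexed by pairs; independence moves along an
  injection.\<close>

lemma (in prob_space) indep_vars_reindex:
  assumes h: "inj_on h I" and ind: "indep_vars (\<lambda>_. N) X (h ` I)"
  shows "indep_vars (\<lambda>_. N) (\<lambda>i. X (h i)) I"
proof -
  define F where "F = (\<lambda>i. {X i -` A \<inter> space M | A. A \<in> sets N})"
  have F: "indep_sets F (h ` I)" "\<And>i. i \<in> I \<Longrightarrow> random_variable N (X (h i))"
    using ind by (auto simp: indep_vars_def2 F_def)
  have "indep_sets (\<lambda>i. F (h i)) I"
  proof (rule indep_setsI)
    fix i assume "i \<in> I"
    then show "F (h i) \<subseteq> events" using F(1) by (auto simp: indep_sets_def)
  next
    fix A J assume J: "J \<noteq> {}" "J \<subseteq> I" "finite J" and A: "\<forall>j\<in>J. A j \<in> F (h j)"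
    have inj: "inj_on h J" using h J by (auto intro: inj_on_subset)
    define B where "B j = A (inv_into J h j)" for j
    have B: "B (h j) = A j" if "j \<in> J" for j using inj that by (simp add: B_def)
    have "prob (\<Inter>j\<in>h ` J. B j) = (\<Prod>j\<in>h ` J. prob (B j))"
      using F(1) J A B by (intro indep_setsD) auto
    then show "prob (\<Inter>j\<in>J. A j) = (\<Prod>j\<in>J. prob (A j))"
      using B by (simp add: prod.reindex[OF inj])
  qed
  then show ?thesis using F(2) by (simp add: indep_vars_def2 F_def)
qed

text \<open>\<open>\<phi>\<close> embeds the Borel space in \<open>[0,1]\<close>.  The class \<open>cl x\<close> of a point determines its layer in
  the exhaustion \<open>E\<close> and the value at \<open>x\<close> of a weight, \<open>rho (cl x)\<close>, that will be chosen below the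
  density \<open>\<psi>\<close>; the cells at level \<open>n\<close> are the dyadic intervals of length \<open>2\<^sup>-\<^sup>n\<close> in the coordinate
  \<open>\<phi>\<close>, intersected with the first \<open>n\<close> classes.\<close>

locale extremal_setup = prob_space P for P :: "'w measure" +
  fixes \<mu> :: "'a measure" and \<alpha> :: real and k :: nat and M :: "'a set \<Rightarrow> 'w \<Rightarrow> ennreal"
    and \<phi> :: "'a \<Rightarrow> real" and cl :: "'a \<Rightarrow> nat" and lay :: "nat \<Rightarrow> nat" and rho :: "nat \<Rightarrow> real" and K :: real
    and E :: "nat \<Rightarrow> 'a set" and N' :: "nat \<Rightarrow> (nat \<Rightarrow> 'a) set \<Rightarrow> 'w \<Rightarrow> ennreal"
  assumes sigma_finite: "sigma_finite_measure \<mu>"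
    and \<alpha>: "0 < \<alpha>" and k: "2 \<le> k"
    and frechet: "frechet_sup_measure P \<mu> \<alpha> M"
    and product: "\<And>n. product_sup_measure_finite P (density \<mu> (indicator (E n))) \<alpha> k (\<lambda>A. M (A \<inter> E n)) (N' n)"
    and \<phi>[measurable]: "\<phi> \<in> borel_measurable \<mu>" and \<phi>01: "\<And>x. x \<in> space \<mu> \<Longrightarrow> 0 \<le> \<phi> x \<and> \<phi> x \<le> 1"
    and \<phi>_gen: "\<And>A. A \<in> sets \<mu> \<Longrightarrow> \<exists>B\<in>sets borel. A = {x\<in>space \<mu>. \<phi> x \<in> B}"
    and \<phi>_inj: "inj_on \<phi> (space \<mu>)"
    and cl[measurable]: "cl \<in> measurable \<mu> (count_space UNIV)"
    and E_eq: "\<And>n. E n = {x\<in>space \<mu>. lay (cl x) \<le> n}" and E_fin: "\<And>n. emeasure \<mu> (E n) < \<infinity>"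
    and rho_pos: "\<And>c. 0 < rho c"
    and rho_int: "(\<integral>\<^sup>+x. ennreal (1 / rho (cl x)) \<partial>\<mu>) \<le> ennreal K"
    and rho_bounded: "\<And>n. \<exists>C. \<forall>c. lay c \<le> n \<longrightarrow> rho c \<le> C"
    and K: "0 \<le> K"
begin

section \<open>Cells, tuples of distinct cells, and step functions on them\<close>

definition lab :: "nat \<Rightarrow> 'a \<Rightarrow> int \<times> nat" where
  "lab n x = (\<lfloor>2 ^ n * \<phi> x\<rfloor>, cl x)"

text \<open>The upper end \<open>2 ^ n\<close> is included because \<open>\<phi>\<close> may take
  the value 1.\<close>

definition Idx :: "nat \<Rightarrow> (int \<times> nat) set" where
  "Idx n = {0..2 ^ n} \<times> {..<n}"

definition cell :: "nat \<Rightarrow> int \<times> nat \<Rightarrow> 'a set" where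
  "cell n i = {x\<in>space \<mu>. lab n x = i}"

text \<open>The cells of a tuple are pairwise distinct, so that their product is an off-diagonal
  rectangle. Tuples are extensional, so that agreement on the positions is equality of
  functions.\<close>

definition Sig :: "nat \<Rightarrow> (nat \<Rightarrow> int \<times> nat) set" where
  "Sig n = {\<sigma>\<in>{..<k} \<rightarrow>\<^sub>E Idx n. inj_on \<sigma> {..<k}}"

definition tup :: "nat \<Rightarrow> (nat \<Rightarrow> 'a) \<Rightarrow> nat \<Rightarrow> int \<times> nat" where
  "tup n u = (\<lambda>r\<in>{..<k}. lab n (u r))"

definition G :: "nat \<Rightarrow> ((nat \<Rightarrow> int \<times> nat) \<Rightarrow> real) \<Rightarrow> (nat \<Rightarrow> 'a) \<Rightarrow> real" where
  "G n a u = (if tup n u \<in> Sig n then a (tup n u) else 0)"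

text \<open>The extremal integral of the step function \<open>G n a\<close>, written out as a finite
  maximum. That the product sup measure takes these values on rectangles is shown later.\<close>

definition J :: "nat \<Rightarrow> ((nat \<Rightarrow> int \<times> nat) \<Rightarrow> real) \<Rightarrow> 'w \<Rightarrow> ennreal" where
  "J n a w = (SUP \<sigma>\<in>Sig n. ennreal (a \<sigma>) * (\<Prod>r<k. M (cell n (\<sigma> r)) w))"

definition V :: "(nat \<Rightarrow> 'a) \<Rightarrow> real" where
  "V u = (\<Prod>r<k. rho (cl (u r)))"

text \<open>The gauge in which integrands are compared. It satisfies the triangle inequality only up
  to a constant, and it does not depend on the level of the cells.\<close>

definition Theta :: "((nat \<Rightarrow> 'a) \<Rightarrow> real) \<Rightarrow> ennreal" where
  "Theta F = (\<integral>\<^sup>+u. ennreal (theta \<alpha> k (F u) (V u)) \<partial>kpow k \<mu>)"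

text \<open>The \<open>\<alpha>\<close>-th power of the max-symmetrization of the absolute value,
  for real-valued integrands.\<close>

definition symP :: "((nat \<Rightarrow> 'a) \<Rightarrow> real) \<Rightarrow> (nat \<Rightarrow> 'a) \<Rightarrow> real" where
  "symP F u = Max ((\<lambda>\<pi>. \<bar>F (u \<circ> \<pi>)\<bar> powr \<alpha>) ` {\<pi>. \<pi> permutes {..<k}})"

lemma finite_Idx [simp]: "finite (Idx n)"
  by (simp add: Idx_def)

lemma finite_Sig [simp]: "finite (Sig n)"
  unfolding Sig_def by (intro finite_subset[OF _ finite_PiE[of "{..<k}" "\<lambda>_. Idx n"]]) auto

lemma lab_measurable [measurable]: "lab n \<in> measurable \<mu> (count_space UNIV)"
  unfolding lab_def by measurable

lemma cell_sets [measurable]: "cell n i \<in> sets \<mu>"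
  unfolding cell_def by measurable

text \<open>The class determines the layer, so a cell lies inside one set of the exhaustion.\<close>

lemma cell_finite: "emeasure \<mu> (cell n i) < \<infinity>"
proof -
  have "cell n i \<subseteq> E (lay (snd i))" by (auto simp: cell_def lab_def E_eq)
  moreover have "E (lay (snd i)) \<in> sets \<mu>" unfolding E_eq by measurable
  ultimately have "emeasure \<mu> (cell n i) \<le> emeasure \<mu> (E (lay (snd i)))" by (intro emeasure_mono)
  then show ?thesis using E_fin by (rule order_le_less_trans)
qed

lemma cell_disjoint: "i \<noteq> j \<Longrightarrow> cell n i \<inter> cell n j = {}"
  by (auto simp: cell_def)

lemma SigD:
  assumes "\<sigma> \<in> Sig n"
  shows "\<And>r. r < k \<Longrightarrow> \<sigma> r \<in> Idx n" "inj_on \<sigma> {..<k}" "card (\<sigma> ` {..<k}) = k"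
    "\<sigma> ` {..<k} \<subseteq> Idx n" "\<sigma> \<in> extensional {..<k}"
  using assms by (auto simp: Sig_def card_image PiE_def)

lemma rect_iff:
  assumes "u \<in> space (kpow k \<mu>)" "\<sigma> \<in> Sig n"
  shows "u \<in> Pi\<^sub>E {..<k} (\<lambda>r. cell n (\<sigma> r)) \<longleftrightarrow> tup n u = \<sigma>"
proof
  assume "u \<in> Pi\<^sub>E {..<k} (\<lambda>r. cell n (\<sigma> r))"
  then have "tup n u r = \<sigma> r" for r
    using SigD(5)[OF assms(2)] by (cases "r < k") (auto simp: tup_def cell_def extensional_def)
  then show "tup n u = \<sigma>" by blast
next
  assume "tup n u = \<sigma>"
  then have "\<sigma> r = lab n (u r)" if "r < k" for r using that by (auto simp: tup_def)
  then show "u \<in> Pi\<^sub>E {..<k} (\<lambda>r. cell n (\<sigma> r))"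
    using assms(1) by (auto simp: space_PiM PiE_def cell_def Pi_def)
qed

lemma tup_comp:
  assumes "\<pi> permutes {..<k}"
  shows "tup n (u \<circ> \<pi>) = tup n u \<circ> \<pi>"
proof
  fix r
  show "tup n (u \<circ> \<pi>) r = (tup n u \<circ> \<pi>) r"
    using permutes_in_image[OF assms, of r] permutes_not_in[OF assms, of r]
    by (cases "r < k") (auto simp: tup_def)
qed

lemma Sig_comp:
  assumes "\<pi> permutes {..<k}" "\<sigma> \<in> Sig n"
  shows "\<sigma> \<circ> \<pi> \<in> Sig n" "(\<sigma> \<circ> \<pi>) ` {..<k} = \<sigma> ` {..<k}"
proof -
  have im: "\<pi> ` {..<k} = {..<k}" using assms(1) by (rule permutes_image)
  then show "(\<sigma> \<circ> \<pi>) ` {..<k} = \<sigma> ` {..<k}" by (metis image_comp)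
  have "inj_on (\<sigma> \<circ> \<pi>) {..<k}"
    using assms im by (intro comp_inj_on) (auto simp: Sig_def intro: permutes_inj_on)
  moreover have "\<sigma> \<circ> \<pi> \<in> {..<k} \<rightarrow>\<^sub>E Idx n"
  proof (intro PiE_I)
    fix r assume "r \<in> {..<k}"
    then have "\<pi> r \<in> {..<k}" using im by blast
    then show "(\<sigma> \<circ> \<pi>) r \<in> Idx n" using SigD(1)[OF assms(2)] by simp
  next
    fix r assume "r \<notin> {..<k}"
    then show "(\<sigma> \<circ> \<pi>) r = undefined"
      using SigD(5)[OF assms(2)] permutes_not_in[OF assms(1)] by (auto simp: extensional_def)
  qed
  ultimately show "\<sigma> \<circ> \<pi> \<in> Sig n" by (simp add: Sig_def)
qed

text \<open>Injective tuples with the same set of cells differ by a permutation of the positions,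
  and by exactly one; hence the factor \<open>k!\<close> between sums over tuples and sums over
  sets.\<close>

lemma Sig_same_image:
  assumes \<sigma>: "\<sigma> \<in> Sig n"
  shows "{\<tau>\<in>Sig n. \<tau> ` {..<k} = \<sigma> ` {..<k}} = (\<lambda>\<pi>. \<sigma> \<circ> \<pi>) ` {\<pi>. \<pi> permutes {..<k}}"
    "inj_on (\<lambda>\<pi>. \<sigma> \<circ> \<pi>) {\<pi>. \<pi> permutes {..<k}}"
proof -
  note inj = SigD(2)[OF \<sigma>]
  show "{\<tau>\<in>Sig n. \<tau> ` {..<k} = \<sigma> ` {..<k}} = (\<lambda>\<pi>. \<sigma> \<circ> \<pi>) ` {\<pi>. \<pi> permutes {..<k}}"
  proof (intro set_eqI iffI)
    fix \<tau> assume \<tau>: "\<tau> \<in> {\<tau>\<in>Sig n. \<tau> ` {..<k} = \<sigma> ` {..<k}}"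
    then have \<tau>S: "\<tau> \<in> Sig n" and im: "\<tau> ` {..<k} = \<sigma> ` {..<k}" by auto
    \<comment> \<open>Position \<open>r\<close> is sent to the place where \<open>\<sigma>\<close>
      has the value \<open>\<tau> r\<close>. Outside the index range \<open>\<pi>\<close> is the
      identity, as \<open>permutes\<close> demands.\<close>
    define \<pi> where "\<pi> r = (if r < k then inv_into {..<k} \<sigma> (\<tau> r) else r)" for r
    have "\<sigma> (\<pi> r) = \<tau> r \<and> \<pi> r < k" if "r < k" for r
    proof -
      have "\<tau> r \<in> \<sigma> ` {..<k}" using im that by blast
      then show ?thesis using that f_inv_into_f[of "\<tau> r" \<sigma> "{..<k}"] inv_into_into[of "\<tau> r" \<sigma> "{..<k}"]
        by (simp add: \<pi>_def)
    qed note \<pi> = this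
    have "inj_on \<pi> {..<k}"
      using SigD(2)[OF \<tau>S] \<pi> by (metis (no_types, lifting) inj_on_def lessThan_iff)
    moreover have "\<pi> ` {..<k} \<subseteq> {..<k}" using \<pi> by auto
    ultimately have "bij_betw \<pi> {..<k} {..<k}"
      by (simp add: bij_betw_def endo_inj_surj)
    then have perm: "\<pi> permutes {..<k}" by (rule bij_imp_permutes) (simp add: \<pi>_def)
    have "\<tau> r = (\<sigma> \<circ> \<pi>) r" for r
    proof (cases "r < k")
      case False
      then show ?thesis using SigD(5)[OF \<sigma>] SigD(5)[OF \<tau>S] by (auto simp: \<pi>_def extensional_def)
    qed (use \<pi> in simp)
    then have "\<tau> = \<sigma> \<circ> \<pi>" by blast
    then show "\<tau> \<in> (\<lambda>\<pi>. \<sigma> \<circ> \<pi>) ` {\<pi>. \<pi> permutes {..<k}}" using perm by blast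
  next
    fix \<tau> assume "\<tau> \<in> (\<lambda>\<pi>. \<sigma> \<circ> \<pi>) ` {\<pi>. \<pi> permutes {..<k}}"
    then obtain \<pi> where "\<tau> = \<sigma> \<circ> \<pi>" "\<pi> permutes {..<k}" by blast
    then show "\<tau> \<in> {\<tau>\<in>Sig n. \<tau> ` {..<k} = \<sigma> ` {..<k}}"
      using Sig_comp[OF _ \<sigma>] by (simp only: mem_Collect_eq)
  qed
  show "inj_on (\<lambda>\<pi>. \<sigma> \<circ> \<pi>) {\<pi>. \<pi> permutes {..<k}}"
  proof (intro inj_onI ext, clarsimp)
    fix \<pi> \<pi>' r assume p: "\<pi> permutes {..<k}" "\<pi>' permutes {..<k}" and eq: "\<sigma> \<circ> \<pi> = \<sigma> \<circ> \<pi>'"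
    show "\<pi> r = \<pi>' r"
    proof (cases "r < k")
      case True
      then have "\<pi> r \<in> {..<k}" "\<pi>' r \<in> {..<k}" using p by (auto simp: permutes_in_image[of _ "{..<k}", simplified])
      moreover have "\<sigma> (\<pi> r) = \<sigma> (\<pi>' r)" using eq by (metis comp_apply)
      ultimately show ?thesis using inj by (auto dest: inj_onD)
    next
      case False
      then show ?thesis using p by (simp add: permutes_not_in)
    qed
  qed
qed

lemma card_Sig_same_image:
  assumes "\<sigma> \<in> Sig n"
  shows "card {\<tau>\<in>Sig n. \<tau> ` {..<k} = \<sigma> ` {..<k}} = fact k"
  unfolding Sig_same_image(1)[OF assms] card_image[OF Sig_same_image(2)[OF assms]]
  by (simp add: card_permutations)

lemma Sig_image_exists:
  assumes "T \<subseteq> Idx n" "card T = k"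
  shows "\<exists>\<sigma>\<in>Sig n. \<sigma> ` {..<k} = T"
proof -
  have "finite T" using assms by (auto intro: finite_subset)
  then obtain h where h: "bij_betw h {..<k} T"
    using ex_bij_betw_nat_finite assms(2) by (metis atLeast0LessThan)
  then have "restrict h {..<k} ` {..<k} = T" "inj_on (restrict h {..<k}) {..<k}"
    by (auto simp: bij_betw_def inj_on_def)
  then show ?thesis using assms(1) by (intro bexI[of _ "restrict h {..<k}"]) (auto simp: Sig_def)
qed

text \<open>The rectangles of distinct cells are disjoint and of finite mass, so an integrand that
  depends only on the tuple of cells integrates to a finite sum.\<close>

lemma nn_integral_tup:
  "(\<integral>\<^sup>+u. (if tup n u \<in> Sig n then h (tup n u) else 0) \<partial>kpow k \<mu>) =
    (\<Sum>\<sigma>\<in>Sig n. h \<sigma> * ennreal (\<Prod>r<k. measure \<mu> (cell n (\<sigma> r))))"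
proof -
  interpret product_sigma_finite "\<lambda>_. \<mu>" using sigma_finite by (simp add: product_sigma_finite_def)
  have "(\<integral>\<^sup>+u. (if tup n u \<in> Sig n then h (tup n u) else 0) \<partial>kpow k \<mu>) =
      (\<integral>\<^sup>+u. (\<Sum>\<sigma>\<in>Sig n. h \<sigma> * indicator (Pi\<^sub>E {..<k} (\<lambda>r. cell n (\<sigma> r))) u) \<partial>kpow k \<mu>)"
  proof (intro nn_integral_cong)
    fix u assume u: "u \<in> space (kpow k \<mu>)"
    have "(\<Sum>\<sigma>\<in>Sig n. h \<sigma> * indicator (Pi\<^sub>E {..<k} (\<lambda>r. cell n (\<sigma> r))) u) =
      (\<Sum>\<sigma>\<in>Sig n. if tup n u = \<sigma> then h \<sigma> else 0)"
      by (intro sum.cong refl) (simp add: rect_iff[OF u] indicator_def)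
    then show "(if tup n u \<in> Sig n then h (tup n u) else 0) =
      (\<Sum>\<sigma>\<in>Sig n. h \<sigma> * indicator (Pi\<^sub>E {..<k} (\<lambda>r. cell n (\<sigma> r))) u)" by simp
  qed
  also have "\<dots> = (\<Sum>\<sigma>\<in>Sig n. \<integral>\<^sup>+u. h \<sigma> * indicator (Pi\<^sub>E {..<k} (\<lambda>r. cell n (\<sigma> r))) u \<partial>kpow k \<mu>)"
    by (intro nn_integral_sum) (auto intro!: borel_measurable_times borel_measurable_indicator sets_PiM_I_finite)
  also have "\<dots> = (\<Sum>\<sigma>\<in>Sig n. h \<sigma> * ennreal (\<Prod>r<k. measure \<mu> (cell n (\<sigma> r))))"
  proof (intro sum.cong refl)
    fix \<sigma>
    have "emeasure (kpow k \<mu>) (Pi\<^sub>E {..<k} (\<lambda>r. cell n (\<sigma> r))) = (\<Prod>r<k. emeasure \<mu> (cell n (\<sigma> r)))"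
      by (intro emeasure_PiM) auto
    also have "\<dots> = (\<Prod>r<k. ennreal (measure \<mu> (cell n (\<sigma> r))))"
      using cell_finite by (intro prod.cong refl emeasure_eq_ennreal_measure) (simp add: less_top)
    finally show "(\<integral>\<^sup>+u. h \<sigma> * indicator (Pi\<^sub>E {..<k} (\<lambda>r. cell n (\<sigma> r))) u \<partial>kpow k \<mu>) =
       h \<sigma> * ennreal (\<Prod>r<k. measure \<mu> (cell n (\<sigma> r)))"
      by (subst nn_integral_cmult_indicator) (auto intro!: sets_PiM_I_finite simp: prod_ennreal)
  qed
  finally show ?thesis .
qed

text \<open>The weight sees a point only through its class, which is part of the cell label; so it
  is constant on rectangles.\<close>

lemma V_tup: "V u = (\<Prod>r<k. rho (snd (tup n u r)))"
  unfolding V_def tup_def lab_def by (intro prod.cong) auto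

lemma Theta_G:
  "Theta (G n a) = ennreal (\<Sum>\<sigma>\<in>Sig n. theta \<alpha> k (a \<sigma>) (\<Prod>r<k. rho (snd (\<sigma> r))) * (\<Prod>r<k. measure \<mu> (cell n (\<sigma> r))))"
proof -
  have "Theta (G n a) = (\<integral>\<^sup>+u. (if tup n u \<in> Sig n then ennreal (theta \<alpha> k (a (tup n u)) (\<Prod>r<k. rho (snd (tup n u r)))) else 0) \<partial>kpow k \<mu>)"
    unfolding Theta_def G_def V_tup[of _ n] by (intro nn_integral_cong) auto
  also have "\<dots> = (\<Sum>\<sigma>\<in>Sig n. ennreal (theta \<alpha> k (a \<sigma>) (\<Prod>r<k. rho (snd (\<sigma> r)))) * ennreal (\<Prod>r<k. measure \<mu> (cell n (\<sigma> r))))"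
    by (rule nn_integral_tup)
  also have "\<dots> = ennreal (\<Sum>\<sigma>\<in>Sig n. theta \<alpha> k (a \<sigma>) (\<Prod>r<k. rho (snd (\<sigma> r))) * (\<Prod>r<k. measure \<mu> (cell n (\<sigma> r))))"
    by (simp add: ennreal_mult[symmetric] prod_nonneg sum_ennreal)
  finally show ?thesis .
qed

section \<open>The masses of cells as independent Frechet variables\<close>

lemma M_measurable [measurable]: "A \<in> sets \<mu> \<Longrightarrow> M A \<in> borel_measurable P"
  using frechet by (simp add: frechet_sup_measure_def)

lemma M_cdf:
  assumes "A \<in> sets \<mu>" "emeasure \<mu> A < \<infinity>" "0 < x"
  shows "prob {w\<in>space P. M A w \<le> ennreal x} = exp (- (measure \<mu> A * x powr (- \<alpha>)))"
  using frechet assms by (auto simp: frechet_sup_measure_def)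

text \<open>Let \<open>x\<close> tend to infinity in the distribution function. The result justifies
  the use of \<open>enn2real\<close>, which would send an infinite mass to 0.\<close>

lemma M_AE_finite:
  assumes A[measurable]: "A \<in> sets \<mu>" and fin: "emeasure \<mu> A < \<infinity>"
  shows "AE w in P. M A w < \<infinity>"
proof -
  have "prob {w\<in>space P. M A w = \<infinity>} \<le> 1 - exp (- (measure \<mu> A * x powr (- \<alpha>)))" if "0 < x" for x
  proof -
    have "prob {w\<in>space P. M A w = \<infinity>} \<le> prob (space P - {w\<in>space P. M A w \<le> ennreal x})"
      by (intro finite_measure_mono) (auto simp: top_unique)
    also have "\<dots> = 1 - exp (- (measure \<mu> A * x powr (- \<alpha>)))"
      using that M_cdf[OF A fin] by (subst prob_compl) auto
    finally show ?thesis .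
  qed
  then have "eventually (\<lambda>x. prob {w\<in>space P. M A w = \<infinity>} \<le> 1 - exp (- (measure \<mu> A * x powr (- \<alpha>)))) at_top"
    using eventually_gt_at_top[of 0] by (rule eventually_mono[rotated])
  moreover have "((\<lambda>x. 1 - exp (- (measure \<mu> A * x powr (- \<alpha>)))) \<longlongrightarrow> 1 - exp (- (measure \<mu> A * 0))) at_top"
    using \<alpha> by (intro tendsto_intros tendsto_neg_powr filterlim_ident) auto
  ultimately have "prob {w\<in>space P. M A w = \<infinity>} \<le> 1 - exp (- (measure \<mu> A * 0))"
    by (intro tendsto_lowerbound) auto
  then have "prob {w\<in>space P. M A w = \<infinity>} = 0" by (simp add: measure_le_0_iff)
  then have "AE w in P. \<not> M A w = \<infinity>"
    by (subst AE_iff_measurable[OF _ refl]) (auto simp: emeasure_eq_measure)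
  then show ?thesis by (auto simp: less_top)
qed

text \<open>The power \<open>\<alpha>\<close> turns the Frechet law of index \<open>\<alpha>\<close>
  into that of index 1, so that \<open>\<alpha>\<close> disappears from the tail estimates for
  products.\<close>

lemma M_tail:
  assumes A[measurable]: "A \<in> sets \<mu>" and fin: "emeasure \<mu> A < \<infinity>" and y: "0 < y"
  shows "prob {w\<in>space P. enn2real (M A w) powr \<alpha> > y} = 1 - exp (- (measure \<mu> A / y))"
proof -
  have "prob {w\<in>space P. enn2real (M A w) powr \<alpha> > y} = prob (space P - {w\<in>space P. M A w \<le> ennreal (y powr (1 / \<alpha>))})"
  proof (intro finite_measure_eq_AE)
    show "AE w in P. w \<in> {w\<in>space P. enn2real (M A w) powr \<alpha> > y} \<longleftrightarrow>
      w \<in> space P - {w\<in>space P. M A w \<le> ennreal (y powr (1 / \<alpha>))}"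
      using M_AE_finite[OF A fin]
    proof eventually_elim
      case (elim w)
      then have "M A w = ennreal (enn2real (M A w))" by simp
      then have "M A w \<le> ennreal (y powr (1 / \<alpha>)) \<longleftrightarrow> enn2real (M A w) \<le> y powr (1 / \<alpha>)"
        by (metis ennreal_le_iff powr_ge_zero)
      then show ?case using less_powr_iff[of "enn2real (M A w)" y \<alpha>] y \<alpha> by auto
    qed
  qed auto
  also have "\<dots> = 1 - exp (- (measure \<mu> A * (y powr (1 / \<alpha>)) powr (- \<alpha>)))"
    using y M_cdf[OF A fin] by (subst prob_compl) auto
  also have "(y powr (1 / \<alpha>)) powr (- \<alpha>) = 1 / y"
    using y \<alpha> by (simp add: powr_powr powr_minus field_simps)
  finally show ?thesis by simp
qed

lemma indep_cells: "indep_vars (\<lambda>_. borel) (\<lambda>i. M (cell n i)) (Idx n)"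
proof -
  obtain h where h: "bij_betw h (Idx n) {..<card (Idx n)}"
    using ex_bij_betw_finite_nat[of "Idx n"] by (auto simp: atLeast0LessThan)
  define A where "A j = cell n (inv_into (Idx n) h j)" for j
  have inj: "inj_on (inv_into (Idx n) h) {..<card (Idx n)}"
    using h inj_on_inv_into[of "{..<card (Idx n)}" h "Idx n"] by (simp add: bij_betw_def)
  have "disjoint_family_on A {..<card (Idx n)}"
    unfolding disjoint_family_on_def
  proof (intro ballI impI)
    fix i j assume "i \<in> {..<card (Idx n)}" "j \<in> {..<card (Idx n)}" "i \<noteq> j"
    then have "inv_into (Idx n) h i \<noteq> inv_into (Idx n) h j"
      using inj by (auto dest: inj_onD)
    then show "A i \<inter> A j = {}" unfolding A_def by (rule cell_disjoint)
  qed
  moreover have "\<forall>j<card (Idx n). A j \<in> sets \<mu>" by (simp add: A_def)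
  ultimately have "indep_vars (\<lambda>_. borel) (\<lambda>j. M (A j)) {..<card (Idx n)}"
    using frechet unfolding frechet_sup_measure_def by simp
  then have "indep_vars (\<lambda>_. borel) (\<lambda>j. M (A j)) (h ` Idx n)" using h by (simp add: bij_betw_def)
  then have "indep_vars (\<lambda>_. borel) (\<lambda>i. M (A (h i))) (Idx n)"
    by (rule indep_vars_reindex[rotated]) (use h in \<open>simp add: bij_betw_def\<close>)
  moreover have "M (A (h i)) = M (cell n i)" if "i \<in> Idx n" for i
    using h that by (simp add: A_def bij_betw_def)
  ultimately show ?thesis
    using indep_vars_cong[of "Idx n" "Idx n" "\<lambda>i. M (A (h i))" "\<lambda>i. M (cell n i)" "\<lambda>_. borel" "\<lambda>_. borel"] by simp
qed

definition Z :: "nat \<Rightarrow> int \<times> nat \<Rightarrow> 'w \<Rightarrow> real" where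
  "Z n i w = enn2real (M (cell n i) w) powr \<alpha>"

lemma Z_nonneg [simp]: "0 \<le> Z n i w"
  by (simp add: Z_def)

lemma Z_measurable [measurable]: "Z n i \<in> borel_measurable P"
  unfolding Z_def by measurable

lemma Z_tail: "0 < y \<Longrightarrow> prob {w\<in>space P. Z n i w > y} = 1 - exp (- (measure \<mu> (cell n i) / y))"
  unfolding Z_def by (intro M_tail cell_finite) auto

lemma indep_Z: "indep_vars (\<lambda>_. borel) (Z n) (Idx n)"
  unfolding Z_def by (rule indep_vars_compose2[OF indep_cells]) auto

section \<open>Tails of maxima over cells\<close>

lemma J_measurable [measurable]: "J n a \<in> borel_measurable P"
  unfolding J_def
  by (intro borel_measurable_SUP countable_finite finite_Sig borel_measurable_times_ennreal
      borel_measurable_prod_ennreal) auto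

text \<open>Taking \<open>\<alpha>\<close>-th powers turns the level into \<open>s\<close>. The
  product runs over the set of cells instead of the positions, which is legitimate since
  \<open>\<sigma>\<close> is injective; rearranged tuples thereby share the same product. The
  equivalence can fail only where some mass is infinite.\<close>

lemma J_gt_iff:
  assumes a: "\<And>\<sigma>. 0 \<le> a \<sigma>" and s: "0 < s"
  shows "AE w in P. ennreal (s powr (1 / \<alpha>)) < J n a w \<longleftrightarrow>
    (\<exists>\<sigma>\<in>Sig n. s < a \<sigma> powr \<alpha> * (\<Prod>i\<in>\<sigma> ` {..<k}. Z n i w))"
proof -
  have "AE w in P. \<forall>i\<in>Idx n. M (cell n i) w < \<infinity>"
    by (intro AE_finite_allI M_AE_finite cell_finite) auto
  then show ?thesis
  proof eventually_elim
    case (elim w)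
    have "ennreal (s powr (1 / \<alpha>)) < ennreal (a \<sigma>) * (\<Prod>r<k. M (cell n (\<sigma> r)) w) \<longleftrightarrow>
        s < a \<sigma> powr \<alpha> * (\<Prod>i\<in>\<sigma> ` {..<k}. Z n i w)" if \<sigma>: "\<sigma> \<in> Sig n" for \<sigma>
    proof -
      define q where "q = (\<Prod>r<k. enn2real (M (cell n (\<sigma> r)) w))"
      have "(\<Prod>r<k. M (cell n (\<sigma> r)) w) = (\<Prod>r<k. ennreal (enn2real (M (cell n (\<sigma> r)) w)))"
        using elim SigD(1)[OF \<sigma>] by (intro prod.cong) auto
      also have "\<dots> = ennreal q" by (simp add: prod_ennreal q_def)
      finally have "ennreal (a \<sigma>) * (\<Prod>r<k. M (cell n (\<sigma> r)) w) = ennreal (a \<sigma> * q)"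
        using a by (simp add: ennreal_mult')
      then have "ennreal (s powr (1 / \<alpha>)) < ennreal (a \<sigma>) * (\<Prod>r<k. M (cell n (\<sigma> r)) w) \<longleftrightarrow> s powr (1 / \<alpha>) < a \<sigma> * q"
        by (simp add: ennreal_less_iff)
      also have "\<dots> \<longleftrightarrow> s < (a \<sigma> * q) powr \<alpha>"
        using less_powr_iff[of "a \<sigma> * q" s \<alpha>] s \<alpha> a by (simp add: q_def prod_nonneg)
      also have "(a \<sigma> * q) powr \<alpha> = a \<sigma> powr \<alpha> * (\<Prod>r<k. Z n (\<sigma> r) w)"
        using a by (simp add: powr_mult q_def prod_nonneg prod_powr_distrib Z_def)
      also have "(\<Prod>r<k. Z n (\<sigma> r) w) = (\<Prod>i\<in>\<sigma> ` {..<k}. Z n i w)"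
        by (subst prod.reindex[OF SigD(2)[OF \<sigma>]]) simp
      finally show ?thesis .
    qed
    then show ?case by (simp add: J_def less_SUP_iff)
  qed
qed

text \<open>On the event that no weighted variable \<open>Y i = Z n i / rho (snd i)\<close> exceeds \<open>s\<close> the union
  bound over all \<open>k\<close>-tuples of cells suffices; without this truncation it would diverge as the
  cells are refined.\<close>

lemma J_tail_le:
  assumes a: "\<And>\<sigma>. 0 \<le> a \<sigma>" and s: "0 < s" "1 \<le> ln s"
  shows "ennreal (prob {w\<in>space P. ennreal (s powr (1 / \<alpha>)) < J n a w}) \<le>
    ennreal (K / s) + ennreal ((real k * ln s) ^ (k - 1) / s) * Theta (G n a)"
proof -
  define p where "p i = measure \<mu> (cell n i) / rho (snd i)" for i
  define Y where "Y i w = Z n i w / rho (snd i)" for i w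
  have p0: "0 \<le> p i" for i using rho_pos by (simp add: p_def less_imp_le)
  have Y0: "0 \<le> Y i w" for i w using rho_pos by (simp add: Y_def less_imp_le)
  have [measurable]: "Y i \<in> borel_measurable P" for i unfolding Y_def by measurable
  have Ytail: "prob {w\<in>space P. Y i w > x} \<le> p i / x" if "0 < x" for i x
  proof -
    have "{w\<in>space P. Y i w > x} = {w\<in>space P. Z n i w > x * rho (snd i)}"
      using rho_pos[of "snd i"] by (auto simp: Y_def field_simps)
    then have "prob {w\<in>space P. Y i w > x} = 1 - exp (- (measure \<mu> (cell n i) / (x * rho (snd i))))"
      using that rho_pos by (simp add: Z_tail)
    also have "\<dots> \<le> measure \<mu> (cell n i) / (x * rho (snd i))"
      using exp_ge_add_one_self[of "- (measure \<mu> (cell n i) / (x * rho (snd i)))"] by simp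
    finally show ?thesis by (simp add: p_def mult.commute)
  qed
  have indY: "indep_vars (\<lambda>_. borel) Y (Idx n)"
    unfolding Y_def by (rule indep_vars_compose2[OF indep_Z]) auto
  \<comment> \<open>Summed over the cells, the bounds \<open>p i\<close> stay below the integral of
    the reciprocal weight. This does not involve \<open>n\<close>, so the event of one large
    \<open>Y i\<close> is controlled uniformly in the mesh.\<close>
  have sum_p: "(\<Sum>i\<in>Idx n. p i) \<le> K"
  proof -
    have "ennreal (\<Sum>i\<in>Idx n. p i) = (\<Sum>i\<in>Idx n. ennreal (1 / rho (snd i)) * emeasure \<mu> (cell n i))"
      using p0 rho_pos cell_finite
      by (subst sum_ennreal[symmetric])
        (auto intro!: sum.cong simp: p_def emeasure_eq_ennreal_measure less_top ennreal_mult[symmetric] less_imp_le)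
    also have "\<dots> = (\<Sum>i\<in>Idx n. \<integral>\<^sup>+x. ennreal (1 / rho (snd i)) * indicator (cell n i) x \<partial>\<mu>)"
      by (intro sum.cong refl nn_integral_cmult_indicator[symmetric]) auto
    also have "\<dots> = (\<integral>\<^sup>+x. (\<Sum>i\<in>Idx n. ennreal (1 / rho (snd i)) * indicator (cell n i) x) \<partial>\<mu>)"
      by (intro nn_integral_sum[symmetric]) auto
    also have "\<dots> \<le> (\<integral>\<^sup>+x. ennreal (1 / rho (cl x)) \<partial>\<mu>)"
    proof (intro nn_integral_mono)
      fix x assume x: "x \<in> space \<mu>"
      have "(\<Sum>i\<in>Idx n. ennreal (1 / rho (snd i)) * indicator (cell n i) x) =
         (\<Sum>i\<in>Idx n. if i = lab n x then ennreal (1 / rho (snd i)) else 0)"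
        using x by (intro sum.cong) (auto simp: cell_def)
      also have "\<dots> \<le> ennreal (1 / rho (cl x))" by (simp add: lab_def)
      finally show "(\<Sum>i\<in>Idx n. ennreal (1 / rho (snd i)) * indicator (cell n i) x) \<le> ennreal (1 / rho (cl x))" .
    qed
    also have "\<dots> \<le> ennreal K" by (rule rho_int)
    finally show ?thesis using K by (simp add: ennreal_le_iff)
  qed
  define v where "v \<sigma> = (\<Prod>r<k. rho (snd (\<sigma> r)))" for \<sigma> :: "nat \<Rightarrow> int \<times> nat"
  have v: "0 < v \<sigma>" for \<sigma> using rho_pos by (simp add: v_def prod_pos)
  define A where "A \<sigma> = {w\<in>space P. s < a \<sigma> powr \<alpha> * v \<sigma> * (\<Prod>i\<in>\<sigma> ` {..<k}. Y i w) \<and> (\<forall>i\<in>\<sigma> ` {..<k}. Y i w \<le> s)}" for \<sigma>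
  have Am[measurable]: "A \<sigma> \<in> events" for \<sigma> unfolding A_def by measurable
  \<comment> \<open>The weights cancel: the product of the \<open>p i\<close> brings
    \<open>1 / v \<sigma>\<close> and the level \<open>s / h\<close> brings
    \<open>v \<sigma>\<close>. What remains is the \<open>\<mu>\<close>-mass of the rectangle times
    \<open>theta\<close>, one summand of \<open>Theta (G n a)\<close>.\<close>
  have PA: "prob (A \<sigma>) \<le> (real k * ln s) ^ (k - 1) / s * (theta \<alpha> k (a \<sigma>) (v \<sigma>) * (\<Prod>r<k. measure \<mu> (cell n (\<sigma> r))))"
    if \<sigma>: "\<sigma> \<in> Sig n" for \<sigma>
  proof (cases "a \<sigma> = 0")
    case True
    then have "A \<sigma> = {}" using s by (auto simp: A_def)
    then show ?thesis using True by simp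
  next
    case False
    define h where "h = a \<sigma> powr \<alpha> * v \<sigma>"
    have h: "0 < h" using False v by (simp add: h_def)
    have ne: "\<sigma> ` {..<k} \<noteq> {}" using k by (simp add: lessThan_empty_iff)
    have "A \<sigma> = {w\<in>space P. s / h < (\<Prod>i\<in>\<sigma> ` {..<k}. Y i w) \<and> (\<forall>i\<in>\<sigma> ` {..<k}. Y i w \<le> s)}"
      using h unfolding A_def h_def[symmetric] by (auto simp: field_simps)
    then have "prob (A \<sigma>) \<le> (\<Prod>i\<in>\<sigma> ` {..<k}. p i) / (s / h) * (1 + ln_plus (s ^ card (\<sigma> ` {..<k}) / (s / h))) ^ (card (\<sigma> ` {..<k}) - 1)"
      using truncated_product_tail[OF _ ne indep_vars_subset[OF indY SigD(4)[OF \<sigma>]] Y0 Ytail s(1), of "s / h"] h s by simp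
    also have "(\<Prod>i\<in>\<sigma> ` {..<k}. p i) = (\<Prod>r<k. measure \<mu> (cell n (\<sigma> r))) / v \<sigma>"
      by (subst prod.reindex[OF SigD(2)[OF \<sigma>]]) (simp add: p_def v_def prod_dividef)
    also have "s ^ card (\<sigma> ` {..<k}) / (s / h) = h * s ^ (k - 1)"
    proof -
      have "s ^ k = s * s ^ (k - 1)" using k by (metis Suc_diff_le diff_Suc_1 numeral_2_eq_2 power_Suc Suc_le_D One_nat_def)
      then show ?thesis using s by (simp add: SigD(3)[OF \<sigma>])
    qed
    also have "(\<Prod>r<k. measure \<mu> (cell n (\<sigma> r))) / v \<sigma> / (s / h) = a \<sigma> powr \<alpha> / s * (\<Prod>r<k. measure \<mu> (cell n (\<sigma> r)))"
      using v[of \<sigma>] by (simp add: h_def field_simps)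
    also have "a \<sigma> powr \<alpha> / s * (\<Prod>r<k. measure \<mu> (cell n (\<sigma> r))) * (1 + ln_plus (h * s ^ (k - 1))) ^ (card (\<sigma> ` {..<k}) - 1) \<le>
       a \<sigma> powr \<alpha> / s * (\<Prod>r<k. measure \<mu> (cell n (\<sigma> r))) * ((1 + ln_plus h) * (real k * ln s)) ^ (k - 1)"
      unfolding SigD(3)[OF \<sigma>] using s k
      by (intro mult_left_mono power_mono one_plus_ln_plus_power_le mult_nonneg_nonneg prod_nonneg) (auto intro: add_nonneg_nonneg)
    also have "\<dots> = (real k * ln s) ^ (k - 1) / s * (theta \<alpha> k (a \<sigma>) (v \<sigma>) * (\<Prod>r<k. measure \<mu> (cell n (\<sigma> r))))"
      using a by (simp add: theta_def h_def power_mult_distrib mult_ac)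
    finally show ?thesis .
  qed
  have "AE w in P. ennreal (s powr (1 / \<alpha>)) < J n a w \<longrightarrow> w \<in> (\<Union>i\<in>Idx n. {w\<in>space P. Y i w > s}) \<union> (\<Union>\<sigma>\<in>Sig n. A \<sigma>)"
    using J_gt_iff[where a=a and n=n, OF a s(1)] AE_space
  proof eventually_elim
    case (elim w)
    show ?case
    proof
      assume "ennreal (s powr (1 / \<alpha>)) < J n a w"
      then obtain \<sigma> where \<sigma>: "\<sigma> \<in> Sig n" "s < a \<sigma> powr \<alpha> * (\<Prod>i\<in>\<sigma> ` {..<k}. Z n i w)" using elim by auto
      have "(\<Prod>i\<in>\<sigma> ` {..<k}. Z n i w) = (\<Prod>i\<in>\<sigma> ` {..<k}. rho (snd i) * Y i w)"
        using rho_pos by (intro prod.cong) (auto simp: Y_def less_imp_neq[symmetric])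
      also have "\<dots> = v \<sigma> * (\<Prod>i\<in>\<sigma> ` {..<k}. Y i w)"
        by (simp add: prod.distrib v_def prod.reindex[OF SigD(2)[OF \<sigma>(1)]])
      finally have gt: "s < a \<sigma> powr \<alpha> * v \<sigma> * (\<Prod>i\<in>\<sigma> ` {..<k}. Y i w)" using \<sigma> by (simp add: mult.assoc)
      then show "w \<in> (\<Union>i\<in>Idx n. {w\<in>space P. Y i w > s}) \<union> (\<Union>\<sigma>\<in>Sig n. A \<sigma>)"
      proof (cases "\<exists>i\<in>Idx n. s < Y i w")
        case False
        then have "\<forall>i\<in>\<sigma> ` {..<k}. Y i w \<le> s" using SigD(4)[OF \<sigma>(1)] by (meson not_less subsetD)
        then have "w \<in> A \<sigma>" unfolding A_def using elim gt by blast
        then show ?thesis using \<sigma>(1) by blast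
      qed (use elim in blast)
    qed
  qed
  then have "prob {w\<in>space P. ennreal (s powr (1 / \<alpha>)) < J n a w} \<le>
      prob ((\<Union>i\<in>Idx n. {w\<in>space P. Y i w > s}) \<union> (\<Union>\<sigma>\<in>Sig n. A \<sigma>))"
    by (intro finite_measure_mono_AE sets.Un sets.finite_UN finite_Idx finite_Sig) (auto elim: eventually_mono)
  also have "\<dots> \<le> prob (\<Union>i\<in>Idx n. {w\<in>space P. Y i w > s}) + prob (\<Union>\<sigma>\<in>Sig n. A \<sigma>)"
    by (intro measure_Un_le sets.finite_UN finite_Idx finite_Sig) auto
  also have "prob (\<Union>i\<in>Idx n. {w\<in>space P. Y i w > s}) \<le> (\<Sum>i\<in>Idx n. prob {w\<in>space P. Y i w > s})"
    by (intro finite_measure_subadditive_finite) auto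
  also have "\<dots> \<le> (\<Sum>i\<in>Idx n. p i / s)" using s by (intro sum_mono Ytail)
  also have "\<dots> = (\<Sum>i\<in>Idx n. p i) / s" by (simp add: sum_divide_distrib)
  also have "\<dots> \<le> K / s" using s sum_p by (intro divide_right_mono) auto
  also have "prob (\<Union>\<sigma>\<in>Sig n. A \<sigma>) \<le> (\<Sum>\<sigma>\<in>Sig n. prob (A \<sigma>))"
    by (intro finite_measure_subadditive_finite) auto
  also have "\<dots> \<le> (\<Sum>\<sigma>\<in>Sig n. (real k * ln s) ^ (k - 1) / s * (theta \<alpha> k (a \<sigma>) (v \<sigma>) * (\<Prod>r<k. measure \<mu> (cell n (\<sigma> r)))))"
    by (intro sum_mono PA)
  also have "\<dots> = (real k * ln s) ^ (k - 1) / s * (\<Sum>\<sigma>\<in>Sig n. theta \<alpha> k (a \<sigma>) (v \<sigma>) * (\<Prod>r<k. measure \<mu> (cell n (\<sigma> r))))"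
    by (simp add: sum_distrib_left)
  finally have *: "prob {w\<in>space P. ennreal (s powr (1 / \<alpha>)) < J n a w} \<le>
    K / s + (real k * ln s) ^ (k - 1) / s * (\<Sum>\<sigma>\<in>Sig n. theta \<alpha> k (a \<sigma>) (v \<sigma>) * (\<Prod>r<k. measure \<mu> (cell n (\<sigma> r))))"
    by simp
  have nn: "0 \<le> (\<Sum>\<sigma>\<in>Sig n. theta \<alpha> k (a \<sigma>) (v \<sigma>) * (\<Prod>r<k. measure \<mu> (cell n (\<sigma> r))))"
    by (intro sum_nonneg mult_nonneg_nonneg prod_nonneg) auto
  have "0 \<le> ln s" using s(2) by linarith
  then have "0 \<le> (real k * ln s) ^ (k - 1) / s"
    using s(1) by (intro divide_nonneg_pos zero_le_power mult_nonneg_nonneg of_nat_0_le_iff)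
  then have "ennreal (K / s + (real k * ln s) ^ (k - 1) / s * (\<Sum>\<sigma>\<in>Sig n. theta \<alpha> k (a \<sigma>) (v \<sigma>) * (\<Prod>r<k. measure \<mu> (cell n (\<sigma> r))))) =
      ennreal (K / s) + ennreal ((real k * ln s) ^ (k - 1) / s) * Theta (G n a)"
    unfolding Theta_G v_def[symmetric] using nn K s
    by (subst ennreal_plus) (simp_all only: ennreal_mult mult_nonneg_nonneg divide_nonneg_pos)
  then show ?thesis using ennreal_leI[OF *] by simp
qed

text \<open>\<open>Sig n\<close> is invariant under permutations of the positions, so for a step
  function the symmetrisation picks the largest coefficient among the rearrangements of the
  tuple.\<close>

lemma symP_G:
  assumes a: "\<And>\<sigma>. 0 \<le> a \<sigma>"
  shows "symP (G n a) u = (if tup n u \<in> Sig n then Max ((\<lambda>\<sigma>. a \<sigma> powr \<alpha>) ` {\<sigma>\<in>Sig n. \<sigma> ` {..<k} = tup n u ` {..<k}}) else 0)"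
proof (cases "tup n u \<in> Sig n")
  case True
  have "symP (G n a) u = Max ((\<lambda>\<pi>. a (tup n u \<circ> \<pi>) powr \<alpha>) ` {\<pi>. \<pi> permutes {..<k}})"
    unfolding symP_def using True a
    by (intro arg_cong[where f=Max] image_cong) (auto simp: G_def tup_comp Sig_comp)
  then show ?thesis unfolding Sig_same_image(1)[OF True] image_image using True by simp
next
  case False
  have "tup n (u \<circ> \<pi>) \<notin> Sig n" if \<pi>: "\<pi> permutes {..<k}" for \<pi>
  proof
    assume "tup n (u \<circ> \<pi>) \<in> Sig n"
    then have "tup n u \<circ> \<pi> \<circ> inv \<pi> \<in> Sig n"
      using Sig_comp(1)[OF permutes_inv[OF \<pi>]] tup_comp[OF \<pi>] by simp
    then show False using False permutes_inv_o(1)[OF \<pi>] by (simp add: comp_assoc)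
  qed
  then have "(\<lambda>\<pi>. \<bar>G n a (u \<circ> \<pi>)\<bar> powr \<alpha>) ` {\<pi>. \<pi> permutes {..<k}} = (\<lambda>\<pi>. 0) ` {\<pi>. \<pi> permutes {..<k}}"
    using \<alpha> by (intro image_cong) (auto simp: G_def)
  also have "\<dots> = {0}" using permutes_id by blast
  finally show ?thesis using False by (simp add: symP_def)
qed

text \<open>Among tuples with the same set of cells the products coincide, so only the largest
  coefficient counts; this is how the max-symmetrization enters. The tail constant is a sum over
  sets divided by \<open>fact (k - 1)\<close>, the integral of \<open>symP\<close> is
  \<open>fact k\<close> times the same sum, and
  \<open>1 / (fact k * fact (k - 1)) = k / (fact k)\<^sup>2\<close>.\<close>

lemma J_asymp:
  assumes a: "\<And>\<sigma>. 0 \<le> a \<sigma>"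
  shows "((\<lambda>s. s / ln s ^ (k - 1) * prob {w\<in>space P. ennreal (s powr (1 / \<alpha>)) < J n a w}) \<longlongrightarrow>
    real k / (fact k)\<^sup>2 * enn2real (\<integral>\<^sup>+u. ennreal (symP (G n a) u) \<partial>kpow k \<mu>)) at_top"
    and "(\<integral>\<^sup>+u. ennreal (symP (G n a) u) \<partial>kpow k \<mu>) < \<infinity>"
proof -
  define \<T> where "\<T> = {T. T \<subseteq> Idx n \<and> card T = k}"
  have fT: "finite \<T>" unfolding \<T>_def by simp
  define B where "B T = {\<sigma>\<in>Sig n. \<sigma> ` {..<k} = T}" for T
  \<comment> \<open>The value 0 outside the family makes \<open>b\<close> nonnegative on every set,
    as the asymptotics of maxima requires.\<close>
  define b where "b T = (if T \<in> \<T> then Max ((\<lambda>\<sigma>. a \<sigma> powr \<alpha>) ` B T) else 0)" for T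
  have BT: "finite (B T)" "T \<in> \<T> \<Longrightarrow> B T \<noteq> {}" for T
    using Sig_image_exists[of T n] by (auto simp: B_def \<T>_def)
  have bge: "a \<sigma> powr \<alpha> \<le> b T" if "T \<in> \<T>" "\<sigma> \<in> B T" for \<sigma> T
    using that BT by (auto simp: b_def)
  have bex: "\<exists>\<sigma>\<in>B T. b T = a \<sigma> powr \<alpha>" if "T \<in> \<T>" for T
  proof -
    have "Max ((\<lambda>\<sigma>. a \<sigma> powr \<alpha>) ` B T) \<in> (\<lambda>\<sigma>. a \<sigma> powr \<alpha>) ` B T" using BT that by (intro Max_in) auto
    then show ?thesis using that by (auto simp: b_def)
  qed
  have b0: "0 \<le> b T" for T using bex[of T] by (cases "T \<in> \<T>") (auto simp: b_def)
  define c where "c i = measure \<mu> (cell n i)" for i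
  have c0: "0 \<le> c i" for i by (simp add: c_def)
  have SigT: "\<sigma> ` {..<k} \<in> \<T>" if "\<sigma> \<in> Sig n" for \<sigma> using SigD[OF that] by (simp add: \<T>_def)
  have lim: "((\<lambda>s. s / ln s ^ (k - 1) * prob {w\<in>space P. \<exists>T\<in>\<T>. b T * (\<Prod>i\<in>T. Z n i w) > s}) \<longlongrightarrow>
    (\<Sum>T\<in>\<T>. b T * (\<Prod>i\<in>T. c i)) / fact (k - 1)) at_top"
    by (rule max_product_tail_asymp[OF finite_Idx[of n] indep_Z _ c0 _ fT _ k b0]) (auto simp: Z_tail c_def \<T>_def)
  have "(\<integral>\<^sup>+u. ennreal (symP (G n a) u) \<partial>kpow k \<mu>) =
      (\<integral>\<^sup>+u. (if tup n u \<in> Sig n then ennreal (b (tup n u ` {..<k})) else 0) \<partial>kpow k \<mu>)"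
    using SigT by (intro nn_integral_cong) (auto simp: symP_G[OF a] b_def B_def)
  also have "\<dots> = (\<Sum>\<sigma>\<in>Sig n. ennreal (b (\<sigma> ` {..<k})) * ennreal (\<Prod>r<k. measure \<mu> (cell n (\<sigma> r))))"
    by (rule nn_integral_tup)
  also have "\<dots> = ennreal (\<Sum>\<sigma>\<in>Sig n. b (\<sigma> ` {..<k}) * (\<Prod>r<k. measure \<mu> (cell n (\<sigma> r))))"
    using b0 by (simp add: ennreal_mult[symmetric] prod_nonneg sum_ennreal)
  also have "(\<Sum>\<sigma>\<in>Sig n. b (\<sigma> ` {..<k}) * (\<Prod>r<k. measure \<mu> (cell n (\<sigma> r)))) =
      (\<Sum>\<sigma>\<in>Sig n. b (\<sigma> ` {..<k}) * (\<Prod>i\<in>\<sigma> ` {..<k}. c i))"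
    by (intro sum.cong refl) (simp add: prod.reindex[OF SigD(2)] c_def)
  also have "\<dots> = (\<Sum>T\<in>\<T>. \<Sum>\<sigma>\<in>{\<sigma>\<in>Sig n. \<sigma> ` {..<k} = T}. b (\<sigma> ` {..<k}) * (\<Prod>i\<in>\<sigma> ` {..<k}. c i))"
    using fT SigT by (intro sum.group[symmetric]) auto
  also have "\<dots> = (\<Sum>T\<in>\<T>. fact k * (b T * (\<Prod>i\<in>T. c i)))"
  proof (intro sum.cong refl)
    fix T assume T: "T \<in> \<T>"
    then obtain \<sigma> where \<sigma>: "\<sigma> \<in> Sig n" "\<sigma> ` {..<k} = T"
      using Sig_image_exists[of T n] unfolding \<T>_def by blast
    have "(\<Sum>\<sigma>\<in>{\<sigma>\<in>Sig n. \<sigma> ` {..<k} = T}. b (\<sigma> ` {..<k}) * (\<Prod>i\<in>\<sigma> ` {..<k}. c i)) =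
      (\<Sum>\<sigma>\<in>{\<sigma>\<in>Sig n. \<sigma> ` {..<k} = T}. b T * (\<Prod>i\<in>T. c i))"
      by (intro sum.cong) auto
    also have "\<dots> = fact k * (b T * (\<Prod>i\<in>T. c i))"
      using card_Sig_same_image[OF \<sigma>(1)] \<sigma>(2) by simp
    finally show "(\<Sum>\<sigma>\<in>{\<sigma>\<in>Sig n. \<sigma> ` {..<k} = T}. b (\<sigma> ` {..<k}) * (\<Prod>i\<in>\<sigma> ` {..<k}. c i)) = fact k * (b T * (\<Prod>i\<in>T. c i))" .
  qed
  also have "\<dots> = fact k * (\<Sum>T\<in>\<T>. b T * (\<Prod>i\<in>T. c i))" by (simp add: sum_distrib_left)
  finally have int: "(\<integral>\<^sup>+u. ennreal (symP (G n a) u) \<partial>kpow k \<mu>) = ennreal (fact k * (\<Sum>T\<in>\<T>. b T * (\<Prod>i\<in>T. c i)))" .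
  then show "(\<integral>\<^sup>+u. ennreal (symP (G n a) u) \<partial>kpow k \<mu>) < \<infinity>" by simp
  have "0 \<le> (\<Sum>T\<in>\<T>. b T * (\<Prod>i\<in>T. c i))" using b0 c0 by (intro sum_nonneg mult_nonneg_nonneg prod_nonneg) auto
  then have e: "enn2real (\<integral>\<^sup>+u. ennreal (symP (G n a) u) \<partial>kpow k \<mu>) = fact k * (\<Sum>T\<in>\<T>. b T * (\<Prod>i\<in>T. c i))"
    unfolding int by (intro enn2real_ennreal) simp
  have fk: "fact k = real k * fact (k - 1)" using k by (simp add: fact_reduce)
  have limeq: "real k / (fact k)\<^sup>2 * enn2real (\<integral>\<^sup>+u. ennreal (symP (G n a) u) \<partial>kpow k \<mu>) =
     (\<Sum>T\<in>\<T>. b T * (\<Prod>i\<in>T. c i)) / fact (k - 1)"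
    unfolding e fk using k by (simp add: power2_eq_square field_simps)
  have "eventually (\<lambda>s. s / ln s ^ (k - 1) * prob {w\<in>space P. \<exists>T\<in>\<T>. b T * (\<Prod>i\<in>T. Z n i w) > s} =
     s / ln s ^ (k - 1) * prob {w\<in>space P. ennreal (s powr (1 / \<alpha>)) < J n a w}) at_top"
    using eventually_gt_at_top[of 0]
  proof eventually_elim
    case (elim s)
    have "prob {w\<in>space P. \<exists>T\<in>\<T>. b T * (\<Prod>i\<in>T. Z n i w) > s} = prob {w\<in>space P. ennreal (s powr (1 / \<alpha>)) < J n a w}"
    proof (rule finite_measure_eq_AE)
      show "AE w in P. w \<in> {w\<in>space P. \<exists>T\<in>\<T>. b T * (\<Prod>i\<in>T. Z n i w) > s} \<longleftrightarrow> w \<in> {w\<in>space P. ennreal (s powr (1 / \<alpha>)) < J n a w}"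
        using J_gt_iff[where a=a and n=n, OF a elim]
      proof eventually_elim
        case (elim w)
        have "(\<exists>T\<in>\<T>. b T * (\<Prod>i\<in>T. Z n i w) > s) \<longleftrightarrow> (\<exists>\<sigma>\<in>Sig n. s < a \<sigma> powr \<alpha> * (\<Prod>i\<in>\<sigma> ` {..<k}. Z n i w))"
        proof safe
          fix T assume T: "T \<in> \<T>" "s < b T * (\<Prod>i\<in>T. Z n i w)"
          then obtain \<sigma> where "\<sigma> \<in> B T" "b T = a \<sigma> powr \<alpha>" using bex by blast
          then show "\<exists>\<sigma>\<in>Sig n. s < a \<sigma> powr \<alpha> * (\<Prod>i\<in>\<sigma> ` {..<k}. Z n i w)"
            using T by (intro bexI[of _ \<sigma>]) (auto simp: B_def)
        next
          fix \<sigma> assume \<sigma>: "\<sigma> \<in> Sig n" "s < a \<sigma> powr \<alpha> * (\<Prod>i\<in>\<sigma> ` {..<k}. Z n i w)"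
          have "a \<sigma> powr \<alpha> * (\<Prod>i\<in>\<sigma> ` {..<k}. Z n i w) \<le> b (\<sigma> ` {..<k}) * (\<Prod>i\<in>\<sigma> ` {..<k}. Z n i w)"
            using \<sigma> SigT by (intro mult_right_mono bge prod_nonneg) (auto simp: B_def)
          then show "\<exists>T\<in>\<T>. s < b T * (\<Prod>i\<in>T. Z n i w)" using \<sigma> SigT by (intro bexI[of _ "\<sigma> ` {..<k}"]) auto
        qed
        then show ?case using elim by auto
      qed
      show "{w\<in>space P. \<exists>T\<in>\<T>. b T * (\<Prod>i\<in>T. Z n i w) > s} \<in> events"
        using fT by measurable
    qed auto
    then show ?case by simp
  qed
  from tendsto_cong[OF this] lim limeq
  show "((\<lambda>s. s / ln s ^ (k - 1) * prob {w\<in>space P. ennreal (s powr (1 / \<alpha>)) < J n a w}) \<longlongrightarrow>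
    real k / (fact k)\<^sup>2 * enn2real (\<integral>\<^sup>+u. ennreal (symP (G n a) u) \<partial>kpow k \<mu>)) at_top"
    by simp
qed

end

section \<open>Approximation by maxima over cells\<close>

text \<open>If almost every point lies in all but finitely many \<open>A j\<close>, the sets of
  points that lie in every \<open>A j\<close> from some index on increase to an event of full
  probability.\<close>

lemma (in prob_space) prob_eventually_tendsto_1:
  assumes A[measurable]: "\<And>j. A j \<in> events" and ev: "AE w in M. eventually (\<lambda>j. w \<in> A j) sequentially" and e: "0 < e"
  shows "eventually (\<lambda>j. 1 - e < prob (A j)) sequentially"
proof -
  define B where "B n = {w\<in>space M. \<forall>j\<ge>n. w \<in> A j}" for n
  have [measurable]: "B n \<in> events" for n unfolding B_def by measurable
  have "(\<lambda>n. prob (B n)) \<longlonglongrightarrow> prob (\<Union>n. B n)"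
    by (rule finite_Lim_measure_incseq) (auto simp: B_def incseq_def)
  moreover have "prob (\<Union>n. B n) = 1"
    using ev by (subst prob_eq_1) (auto simp: B_def eventually_sequentially)
  ultimately have "eventually (\<lambda>n. 1 - e < prob (B n)) sequentially"
    using e by (intro order_tendstoD(1)) auto
  then show ?thesis
  proof eventually_elim
    case (elim n)
    have "prob (B n) \<le> prob (A n)" by (intro finite_measure_mono) (auto simp: B_def)
    then show ?case using elim by simp
  qed
qed

lemma tendsto_ln_power_div: "((\<lambda>s. (c * ln s) ^ m / s) \<longlongrightarrow> (0::real)) at_top"
proof -
  have "((\<lambda>s. c ^ m * (ln s ^ m / exp (ln s))) \<longlongrightarrow> c ^ m * 0) at_top"
    by (intro tendsto_intros filterlim_compose[OF tendsto_power_div_exp_0] ln_at_top)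
  moreover have "eventually (\<lambda>s. c ^ m * (ln s ^ m / exp (ln s)) = (c * ln s) ^ m / s) at_top"
    using eventually_gt_at_top[of 0] by eventually_elim (simp add: power_mult_distrib)
  ultimately show ?thesis by (simp add: tendsto_cong)
qed

context extremal_setup
begin

text \<open>There are only countably many tuples of labels, so a preimage is a countable union of
  finite intersections of label events.\<close>

lemma tup_measurable [measurable]: "tup n \<in> measurable (kpow k \<mu>) (count_space UNIV)"
proof (rule measurableI)
  fix T :: "(nat \<Rightarrow> int \<times> nat) set"
  define C :: "(nat \<Rightarrow> int \<times> nat) set" where "C = {..<k} \<rightarrow>\<^sub>E UNIV"
  have "countable C" unfolding C_def by (intro countable_PiE) auto
  have C: "tup n u \<in> C" for u by (auto simp: C_def tup_def)
  have "tup n u = \<tau> \<longleftrightarrow> (\<forall>r\<in>{..<k}. lab n (u r) = \<tau> r)" if "\<tau> \<in> C" for u \<tau>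
    using that by (auto simp: C_def tup_def fun_eq_iff PiE_def extensional_def)
  then have eq: "{u\<in>space (kpow k \<mu>). tup n u = \<tau>} = {u\<in>space (kpow k \<mu>). \<forall>r\<in>{..<k}. lab n (u r) = \<tau> r}"
    if "\<tau> \<in> T \<inter> C" for \<tau> using that by auto
  have "tup n -` T \<inter> space (kpow k \<mu>) = (\<Union>\<tau>\<in>T \<inter> C. {u\<in>space (kpow k \<mu>). tup n u = \<tau>})"
    using C by auto
  also have "\<dots> = (\<Union>\<tau>\<in>T \<inter> C. {u\<in>space (kpow k \<mu>). \<forall>r\<in>{..<k}. lab n (u r) = \<tau> r})"
    by (intro SUP_cong refl eq)
  also have "\<dots> \<in> sets (kpow k \<mu>)"
  proof (intro sets.countable_UN')
    show "countable (T \<inter> C)" using \<open>countable C\<close> by auto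
    have [measurable]: "(\<lambda>u. lab n (u r)) \<in> measurable (kpow k \<mu>) (count_space UNIV)" if "r \<in> {..<k}" for r
      by (rule measurable_compose[OF measurable_component_singleton[OF that] lab_measurable])
    show "(\<lambda>\<tau>. {u\<in>space (kpow k \<mu>). \<forall>r\<in>{..<k}. lab n (u r) = \<tau> r}) ` (T \<inter> C) \<subseteq> sets (kpow k \<mu>)"
      by auto
  qed
  finally show "tup n -` T \<inter> space (kpow k \<mu>) \<in> sets (kpow k \<mu>)" .
qed simp

lemma G_measurable [measurable]: "G n a \<in> borel_measurable (kpow k \<mu>)"
proof -
  have "(\<lambda>u. (\<lambda>\<tau>. if \<tau> \<in> Sig n then a \<tau> else 0) (tup n u)) \<in> borel_measurable (kpow k \<mu>)"
    by (rule measurable_compose[OF tup_measurable]) simp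
  then show ?thesis by (simp add: G_def[abs_def])
qed

lemma V_measurable [measurable]: "V \<in> borel_measurable (kpow k \<mu>)"
proof -
  have "(\<lambda>x. rho (cl x)) \<in> borel_measurable \<mu>" by (rule measurable_compose[OF cl]) simp
  then show ?thesis
    unfolding V_def
    by (intro borel_measurable_prod) (auto intro: measurable_compose[OF measurable_component_singleton])
qed

lemma V_pos: "0 < V u"
  unfolding V_def using rho_pos by (intro prod_pos) auto

section \<open>The gauge as a quasi-norm, and the comparison of cell maxima\<close>

abbreviation D :: real where "D \<equiv> theta_const \<alpha> k 2"

lemma D_ge_1: "1 \<le> D"
  using \<alpha> by (intro theta_const_ge) auto

lemma Theta_mono_AE:
  assumes "AE u in kpow k \<mu>. \<bar>F u\<bar> \<le> \<bar>H u\<bar>"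
  shows "Theta F \<le> Theta H"
  unfolding Theta_def
  using assms \<alpha> V_pos by (intro nn_integral_mono_AE) (auto elim!: eventually_mono intro!: ennreal_leI theta_mono simp: less_imp_le)

lemma Theta_cong_AE:
  assumes "AE u in kpow k \<mu>. \<bar>F u\<bar> = \<bar>H u\<bar>"
  shows "Theta F = Theta H"
  using assms by (intro antisym Theta_mono_AE) (auto elim: eventually_mono)

lemma Theta_uminus: "Theta (\<lambda>u. F u - H u) = Theta (\<lambda>u. H u - F u)"
  by (intro Theta_cong_AE) auto

lemma Theta_add:
  assumes [measurable]: "F \<in> borel_measurable (kpow k \<mu>)" "H \<in> borel_measurable (kpow k \<mu>)"
  shows "Theta (\<lambda>u. F u + H u) \<le> ennreal D * (Theta F + Theta H)"
proof -
  have "Theta (\<lambda>u. F u + H u) \<le> (\<integral>\<^sup>+u. ennreal D * (ennreal (theta \<alpha> k (F u) (V u)) + ennreal (theta \<alpha> k (H u) (V u))) \<partial>kpow k \<mu>)"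
    unfolding Theta_def
  proof (intro nn_integral_mono)
    fix u
    have "theta \<alpha> k (F u + H u) (V u) \<le> D * (theta \<alpha> k (F u) (V u) + theta \<alpha> k (H u) (V u))"
      using V_pos[of u] \<alpha> by (intro theta_add) auto
    also have "ennreal \<dots> = ennreal D * (ennreal (theta \<alpha> k (F u) (V u)) + ennreal (theta \<alpha> k (H u) (V u)))"
      using D_ge_1 by (simp add: ennreal_mult ennreal_plus)
    finally show "ennreal (theta \<alpha> k (F u + H u) (V u)) \<le> ennreal D * (ennreal (theta \<alpha> k (F u) (V u)) + ennreal (theta \<alpha> k (H u) (V u)))"
      by (simp add: ennreal_leI)
  qed
  also have "\<dots> = ennreal D * (Theta F + Theta H)"
    unfolding Theta_def by (subst nn_integral_cmult) (auto simp: nn_integral_add)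
  finally show ?thesis .
qed

text \<open>Scaling is controlled only for factors at least 1; a smaller factor is enlarged to 1 by
  monotonicity.\<close>

lemma Theta_scale:
  assumes [measurable]: "F \<in> borel_measurable (kpow k \<mu>)" and c: "0 \<le> c"
  shows "Theta (\<lambda>u. c * F u) \<le> ennreal (theta_const \<alpha> k (max 1 c)) * Theta F"
proof -
  have "Theta (\<lambda>u. c * F u) \<le> Theta (\<lambda>u. max 1 c * F u)"
    using c by (intro Theta_mono_AE AE_I2) (auto simp: abs_mult intro!: mult_right_mono)
  also have "\<dots> \<le> (\<integral>\<^sup>+u. ennreal (theta_const \<alpha> k (max 1 c)) * ennreal (theta \<alpha> k (F u) (V u)) \<partial>kpow k \<mu>)"
    unfolding Theta_def using \<alpha> theta_const_ge[of "max 1 c" \<alpha> k]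
    by (intro nn_integral_mono) (auto simp: ennreal_mult[symmetric] intro!: ennreal_leI theta_scale)
  also have "\<dots> = ennreal (theta_const \<alpha> k (max 1 c)) * Theta F"
    unfolding Theta_def by (rule nn_integral_cmult) measurable
  finally show ?thesis .
qed

lemma J_mono: "(\<And>\<sigma>. a \<sigma> \<le> b \<sigma>) \<Longrightarrow> J n a w \<le> J n b w"
  unfolding J_def by (intro SUP_mono') (simp add: mult_right_mono ennreal_leI)

text \<open>Written as a sum because subtraction in \<open>ennreal\<close> truncates and the maxima
  may be infinite.\<close>

lemma J_diff:
  assumes "\<And>\<sigma>. 0 \<le> b \<sigma>"
  shows "J n a w \<le> J n b w + J n (\<lambda>\<sigma>. \<bar>a \<sigma> - b \<sigma>\<bar>) w"
  unfolding J_def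
proof (intro SUP_least)
  fix \<sigma> assume \<sigma>: "\<sigma> \<in> Sig n"
  let ?q = "\<Prod>r<k. M (cell n (\<sigma> r)) w"
  have "ennreal (a \<sigma>) \<le> ennreal (b \<sigma> + \<bar>a \<sigma> - b \<sigma>\<bar>)" by (intro ennreal_leI) auto
  also have "\<dots> = ennreal (b \<sigma>) + ennreal \<bar>a \<sigma> - b \<sigma>\<bar>" using assms by (simp add: ennreal_plus)
  finally have "ennreal (a \<sigma>) * ?q \<le> (ennreal (b \<sigma>) + ennreal \<bar>a \<sigma> - b \<sigma>\<bar>) * ?q" by (intro mult_right_mono) auto
  also have "\<dots> = ennreal (b \<sigma>) * ?q + ennreal \<bar>a \<sigma> - b \<sigma>\<bar> * ?q" by (simp add: distrib_right)
  also have "\<dots> \<le> (SUP \<sigma>\<in>Sig n. ennreal (b \<sigma>) * (\<Prod>r<k. M (cell n (\<sigma> r)) w)) +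
      (SUP \<sigma>\<in>Sig n. ennreal \<bar>a \<sigma> - b \<sigma>\<bar> * (\<Prod>r<k. M (cell n (\<sigma> r)) w))"
    using \<sigma> by (intro add_mono SUP_upper) auto
  finally show "ennreal (a \<sigma>) * ?q \<le> \<dots>" .
qed

text \<open>The two inequalities bound the distance of \<open>X\<close> and \<open>J n a\<close>
  without subtraction; where one of them is infinite they force the other to be infinite too. One
  \<open>\<delta>\<close> measures the error in value, in probability and in the gauge.\<close>

abbreviation near :: "real \<Rightarrow> ('w \<Rightarrow> ennreal) \<Rightarrow> ((nat \<Rightarrow> 'a) \<Rightarrow> real) \<Rightarrow> nat \<Rightarrow> ((nat \<Rightarrow> int \<times> nat) \<Rightarrow> real) \<Rightarrow> bool" where
  "near \<delta> X F n a \<equiv> (\<forall>\<sigma>. 0 \<le> a \<sigma>) \<and>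
     prob {w\<in>space P. \<not> (X w \<le> J n a w + ennreal \<delta> \<and> J n a w \<le> X w + ennreal \<delta>)} \<le> \<delta> \<and>
     Theta (\<lambda>u. F u - G n a u) \<le> ennreal \<delta>"

text \<open>Requiring approximants at \<^emph>\<open>every\<close> large level \<open>n\<close> makes any two approximations
  comparable on common cells, so that maxima over cells never have to be refined.\<close>

definition Approx :: "('w \<Rightarrow> ennreal) \<Rightarrow> ((nat \<Rightarrow> 'a) \<Rightarrow> real) \<Rightarrow> bool" where
  "Approx X F \<longleftrightarrow> X \<in> borel_measurable P \<and> F \<in> borel_measurable (kpow k \<mu>) \<and>
     (\<forall>\<delta>>0. \<exists>n0. \<forall>n\<ge>n0. \<exists>a. near \<delta> X F n a)"

lemma ApproxD:
  assumes "Approx X F"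
  shows "X \<in> borel_measurable P" "F \<in> borel_measurable (kpow k \<mu>)"
    and "0 < \<delta> \<Longrightarrow> \<exists>n0. \<forall>n\<ge>n0. \<exists>a. near \<delta> X F n a"
  using assms unfolding Approx_def by blast+

section \<open>Closure of approximability under scaling, finite maxima and limits\<close>

lemma J_0: "J n (\<lambda>_. 0) w = 0"
  unfolding J_def by (intro antisym SUP_least) auto

lemma Approx_0: "Approx (\<lambda>_. 0) (\<lambda>_. 0)"
  unfolding Approx_def
proof (intro conjI allI impI)
  fix \<delta> :: real assume "0 < \<delta>"
  then have *: "(\<forall>\<sigma>. 0 \<le> (\<lambda>_::nat \<Rightarrow> int \<times> nat. 0::real) \<sigma>) \<and>
        prob {w\<in>space P. \<not> (0 \<le> J n (\<lambda>_. 0) w + ennreal \<delta> \<and> J n (\<lambda>_. 0) w \<le> 0 + ennreal \<delta>)} \<le> \<delta> \<and>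
        Theta (\<lambda>u. 0 - G n (\<lambda>_. 0) u) \<le> ennreal \<delta>" for n
    by (simp add: J_0 G_def Theta_def)
  show "\<exists>n0. \<forall>n\<ge>n0. \<exists>a. near \<delta> (\<lambda>w. 0) (\<lambda>u. 0) n a"
    by (intro exI[of _ 0] allI impI exI[of _ "\<lambda>_. 0"], rule *)
qed auto

lemma Approx_cong_AE:
  assumes "Approx X F" and [measurable]: "Y \<in> borel_measurable P" "H \<in> borel_measurable (kpow k \<mu>)"
    and XY: "AE w in P. X w = Y w" and FH: "AE u in kpow k \<mu>. F u = H u"
  shows "Approx Y H"
proof -
  note [measurable] = ApproxD(1,2)[OF assms(1)]
  have "prob {w\<in>space P. \<not> (Y w \<le> J n a w + ennreal \<delta> \<and> J n a w \<le> Y w + ennreal \<delta>)} =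
     prob {w\<in>space P. \<not> (X w \<le> J n a w + ennreal \<delta> \<and> J n a w \<le> X w + ennreal \<delta>)}" for n a \<delta>
  proof (rule finite_measure_eq_AE)
    show "AE w in P. w \<in> {w\<in>space P. \<not> (Y w \<le> J n a w + ennreal \<delta> \<and> J n a w \<le> Y w + ennreal \<delta>)} \<longleftrightarrow>
      w \<in> {w\<in>space P. \<not> (X w \<le> J n a w + ennreal \<delta> \<and> J n a w \<le> X w + ennreal \<delta>)}"
      using XY by eventually_elim auto
  qed measurable
  moreover have "Theta (\<lambda>u. H u - G n a u) = Theta (\<lambda>u. F u - G n a u)" for n a
    using FH by (intro Theta_cong_AE) (auto elim: eventually_mono)
  ultimately show ?thesis using assms(1) unfolding Approx_def by simp
qed

lemma Approx_scale:
  assumes X: "Approx X F" and c: "0 \<le> c"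
  shows "Approx (\<lambda>w. ennreal c * X w) (\<lambda>u. c * F u)"
  unfolding Approx_def
proof (intro conjI allI impI)
  note [measurable] = ApproxD(1,2)[OF X]
  show "(\<lambda>w. ennreal c * X w) \<in> borel_measurable P" "(\<lambda>u. c * F u) \<in> borel_measurable (kpow k \<mu>)" by measurable
  fix \<delta> :: real assume \<delta>: "0 < \<delta>"
  define C where "C = theta_const \<alpha> k (max 1 c)"
  have C: "1 \<le> C" unfolding C_def using \<alpha> by (intro theta_const_ge) auto
  \<comment> \<open>One budget covers three needs: the additive error grows by \<open>c\<close>, the
    gauge by \<open>C\<close>, and the probability not at all.\<close>
  define e where "e = \<delta> / (C + c)"
  have e: "0 < e" "c * e \<le> \<delta>" "C * e \<le> \<delta>" "e \<le> \<delta>"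
  proof -
    have pos: "0 < C + c" using C c by simp
    then show e0: "0 < e" using \<delta> by (simp add: e_def)
    have "(C + c) * e = \<delta>" using pos by (simp add: e_def)
    then have eq: "C * e + c * e = \<delta>" by (simp only: distrib_right)
    have "0 \<le> c * e" "1 * e \<le> C * e" using e0 C c by (auto intro!: mult_right_mono)
    then show "c * e \<le> \<delta>" "C * e \<le> \<delta>" "e \<le> \<delta>" using eq e0 by linarith+
  qed
  from ApproxD(3)[OF X e(1)] obtain n0 where n0: "\<And>n. n \<ge> n0 \<Longrightarrow> \<exists>a. near e X F n a" by blast
  show "\<exists>n0. \<forall>n\<ge>n0. \<exists>a. near \<delta> (\<lambda>w. ennreal c * X w) (\<lambda>u. c * F u) n a"
  proof (intro exI[of _ n0] allI impI)
    fix n assume "n0 \<le> n"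
    with n0 obtain a where a: "\<And>\<sigma>. 0 \<le> a \<sigma>"
        "prob {w\<in>space P. \<not> (X w \<le> J n a w + ennreal e \<and> J n a w \<le> X w + ennreal e)} \<le> e"
        "Theta (\<lambda>u. F u - G n a u) \<le> ennreal e" by blast
    have J: "J n (\<lambda>\<sigma>. c * a \<sigma>) w = ennreal c * J n a w" for w
      unfolding J_def SUP_mult_left_ennreal using c a(1) by (intro SUP_cong refl) (simp add: ennreal_mult mult.assoc)
    have G: "G n (\<lambda>\<sigma>. c * a \<sigma>) u = c * G n a u" for u by (simp add: G_def)
    have mono: "ennreal c * x \<le> ennreal c * y + ennreal \<delta>" if "x \<le> y + ennreal e" for x y
    proof -
      have "ennreal c * x \<le> ennreal c * (y + ennreal e)" using that by (intro mult_left_mono) auto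
      also have "\<dots> = ennreal c * y + ennreal (c * e)" using c e by (simp add: distrib_left ennreal_mult)
      also have "\<dots> \<le> ennreal c * y + ennreal \<delta>" using e by (intro add_left_mono ennreal_leI)
      finally show ?thesis .
    qed
    have "prob {w\<in>space P. \<not> (ennreal c * X w \<le> J n (\<lambda>\<sigma>. c * a \<sigma>) w + ennreal \<delta> \<and> J n (\<lambda>\<sigma>. c * a \<sigma>) w \<le> ennreal c * X w + ennreal \<delta>)}
       \<le> prob {w\<in>space P. \<not> (X w \<le> J n a w + ennreal e \<and> J n a w \<le> X w + ennreal e)}"
      unfolding J using mono by (intro finite_measure_mono) auto
    then have "prob {w\<in>space P. \<not> (ennreal c * X w \<le> J n (\<lambda>\<sigma>. c * a \<sigma>) w + ennreal \<delta> \<and> J n (\<lambda>\<sigma>. c * a \<sigma>) w \<le> ennreal c * X w + ennreal \<delta>)} \<le> \<delta>"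
      using a(2) e by simp
    moreover have "Theta (\<lambda>u. c * F u - G n (\<lambda>\<sigma>. c * a \<sigma>) u) \<le> ennreal \<delta>"
    proof -
      have "Theta (\<lambda>u. c * F u - G n (\<lambda>\<sigma>. c * a \<sigma>) u) = Theta (\<lambda>u. c * (F u - G n a u))"
        unfolding G by (simp add: right_diff_distrib)
      also have "\<dots> \<le> ennreal C * Theta (\<lambda>u. F u - G n a u)"
        unfolding C_def by (rule Theta_scale) (use c in auto)
      also have "\<dots> \<le> ennreal C * ennreal e" using a(3) by (intro mult_left_mono) auto
      also have "\<dots> = ennreal (C * e)" using C e by (simp add: ennreal_mult)
      also have "\<dots> \<le> ennreal \<delta>" using e by (intro ennreal_leI)
      finally show ?thesis .
    qed
    ultimately show "\<exists>a. near \<delta> (\<lambda>w. ennreal c * X w) (\<lambda>u. c * F u) n a"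
      using a(1) c by (intro exI[of _ "\<lambda>\<sigma>. c * a \<sigma>"]) auto
  qed
qed

text \<open>The approximant takes the coefficientwise maximum. That \<open>H\<close> is the
  pointwise maximum of the \<open>F i\<close> is expressed by two conditions, so that
  \<open>H\<close> may be given in another form, such as a sum over disjoint sets.\<close>

lemma Approx_SUP:
  assumes S: "finite S" "S \<noteq> {}" and X: "\<And>i. i \<in> S \<Longrightarrow> Approx (X i) (F i)"
    and H[measurable]: "H \<in> borel_measurable (kpow k \<mu>)"
    and HF: "\<And>u i. u \<in> space (kpow k \<mu>) \<Longrightarrow> i \<in> S \<Longrightarrow> F i u \<le> H u"
      "\<And>u. u \<in> space (kpow k \<mu>) \<Longrightarrow> \<exists>i\<in>S. H u = F i u"
  shows "Approx (\<lambda>w. SUP i\<in>S. X i w) H"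
  unfolding Approx_def
proof (intro conjI allI impI)
  have Xm[measurable]: "X i \<in> borel_measurable P" and Fm[measurable]: "F i \<in> borel_measurable (kpow k \<mu>)" if "i \<in> S" for i
    using ApproxD(1,2)[OF X[OF that]] by auto
  show SUPm: "(\<lambda>w. SUP i\<in>S. X i w) \<in> borel_measurable P"
    using S by (intro borel_measurable_SUP countable_finite) auto
  fix \<delta> :: real assume \<delta>: "0 < \<delta>"
  define e where "e = \<delta> / real (card S)"
  have cS: "1 \<le> card S" using S by (simp add: Suc_le_eq card_gt_0_iff)
  have e: "0 < e" "e \<le> \<delta>" "real (card S) * e = \<delta>"
    using cS \<delta> by (auto simp: e_def field_simps)
  have "\<forall>i\<in>S. \<exists>n0. \<forall>n\<ge>n0. \<exists>a. near e (X i) (F i) n a"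
    using ApproxD(3)[OF X e(1)] by blast
  from bchoice[OF this] obtain n0 where n0: "\<And>i n. i \<in> S \<Longrightarrow> n \<ge> n0 i \<Longrightarrow> \<exists>a. near e (X i) (F i) n a" by blast
  show "\<exists>n0. \<forall>n\<ge>n0. \<exists>a. near \<delta> (\<lambda>w. (SUP i\<in>S. X i w)) H n a"
  proof (intro exI[of _ "Max (n0 ` S)"] allI impI)
    fix n assume "Max (n0 ` S) \<le> n"
    then have "\<forall>i\<in>S. n0 i \<le> n" using S by simp
    then have "\<forall>i\<in>S. \<exists>a. near e (X i) (F i) n a" using n0 by blast
    from bchoice[OF this] obtain A where "\<forall>i\<in>S. near e (X i) (F i) n (A i)" by blast
    then have A: "\<And>i \<sigma>. i \<in> S \<Longrightarrow> 0 \<le> A i \<sigma>"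
        "\<And>i. i \<in> S \<Longrightarrow> prob {w\<in>space P. \<not> (X i w \<le> J n (A i) w + ennreal e \<and> J n (A i) w \<le> X i w + ennreal e)} \<le> e"
        "\<And>i. i \<in> S \<Longrightarrow> Theta (\<lambda>u. F i u - G n (A i) u) \<le> ennreal e" by auto
    define a where "a \<sigma> = Max ((\<lambda>i. A i \<sigma>) ` S)" for \<sigma>
    have age: "A i \<sigma> \<le> a \<sigma>" if "i \<in> S" for i \<sigma> using that S by (simp add: a_def)
    have aex: "\<exists>i\<in>S. a \<sigma> = A i \<sigma>" for \<sigma>
    proof -
      have "a \<sigma> \<in> (\<lambda>i. A i \<sigma>) ` S" unfolding a_def using S by (intro Max_in) auto
      then show ?thesis by auto
    qed
    have a0: "0 \<le> a \<sigma>" for \<sigma> using aex[of \<sigma>] A(1) by auto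
    have J: "J n a w = (SUP i\<in>S. J n (A i) w)" for w
    proof (intro antisym SUP_least)
      show "J n a w \<le> (SUP i\<in>S. J n (A i) w)"
        unfolding J_def
      proof (rule SUP_least)
        fix \<sigma> assume \<sigma>: "\<sigma> \<in> Sig n"
        obtain i where i: "i \<in> S" "a \<sigma> = A i \<sigma>" using aex by blast
        have "ennreal (a \<sigma>) * (\<Prod>r<k. M (cell n (\<sigma> r)) w) \<le> (SUP \<sigma>\<in>Sig n. ennreal (A i \<sigma>) * (\<Prod>r<k. M (cell n (\<sigma> r)) w))"
          unfolding i(2) using \<sigma> by (intro SUP_upper)
        also have "\<dots> \<le> (SUP i\<in>S. SUP \<sigma>\<in>Sig n. ennreal (A i \<sigma>) * (\<Prod>r<k. M (cell n (\<sigma> r)) w))"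
          using i(1) by (intro SUP_upper)
        finally show "ennreal (a \<sigma>) * (\<Prod>r<k. M (cell n (\<sigma> r)) w) \<le> \<dots>" .
      qed
      show "J n (A i) w \<le> J n a w" if "i \<in> S" for i using age[OF that] by (rule J_mono)
    qed
    define Bd where "Bd i = {w\<in>space P. \<not> (X i w \<le> J n (A i) w + ennreal e \<and> J n (A i) w \<le> X i w + ennreal e)}" for i
    have Bd[measurable]: "Bd i \<in> events" if "i \<in> S" for i unfolding Bd_def using that by measurable
    have "prob {w\<in>space P. \<not> ((SUP i\<in>S. X i w) \<le> J n a w + ennreal \<delta> \<and> J n a w \<le> (SUP i\<in>S. X i w) + ennreal \<delta>)} \<le> prob (\<Union>i\<in>S. Bd i)"
    proof (intro finite_measure_mono subsetI)
      fix w assume w: "w \<in> {w\<in>space P. \<not> ((SUP i\<in>S. X i w) \<le> J n a w + ennreal \<delta> \<and> J n a w \<le> (SUP i\<in>S. X i w) + ennreal \<delta>)}"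
      show "w \<in> (\<Union>i\<in>S. Bd i)"
      proof (rule ccontr)
        assume "w \<notin> (\<Union>i\<in>S. Bd i)"
        then have ok: "X i w \<le> J n (A i) w + ennreal e" "J n (A i) w \<le> X i w + ennreal e" if "i \<in> S" for i
          using that w by (auto simp: Bd_def)
        have "(SUP i\<in>S. X i w) \<le> J n a w + ennreal \<delta>"
        proof (rule SUP_least)
          fix i assume i: "i \<in> S"
          have "X i w \<le> J n (A i) w + ennreal e" using ok i by simp
          also have "\<dots> \<le> J n a w + ennreal \<delta>" unfolding J using i e by (intro add_mono SUP_upper ennreal_leI)
          finally show "X i w \<le> J n a w + ennreal \<delta>" .
        qed
        moreover have "J n a w \<le> (SUP i\<in>S. X i w) + ennreal \<delta>"
          unfolding J
        proof (rule SUP_least)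
          fix i assume i: "i \<in> S"
          have "J n (A i) w \<le> X i w + ennreal e" using ok i by simp
          also have "\<dots> \<le> (SUP i\<in>S. X i w) + ennreal \<delta>" using i e by (intro add_mono SUP_upper ennreal_leI)
          finally show "J n (A i) w \<le> (SUP i\<in>S. X i w) + ennreal \<delta>" .
        qed
        ultimately show False using w by auto
      qed
    next
      show "(\<Union>i\<in>S. Bd i) \<in> events" using S by (intro sets.finite_UN) auto
    qed
    also have "\<dots> \<le> (\<Sum>i\<in>S. prob (Bd i))" using S by (intro finite_measure_subadditive_finite) auto
    also have "\<dots> \<le> (\<Sum>i\<in>S. e)" using A(2) by (intro sum_mono) (simp add: Bd_def)
    also have "\<dots> = \<delta>" using e by simp
    finally have 1: "prob {w\<in>space P. \<not> ((SUP i\<in>S. X i w) \<le> J n a w + ennreal \<delta> \<and> J n a w \<le> (SUP i\<in>S. X i w) + ennreal \<delta>)} \<le> \<delta>" .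
    have "Theta (\<lambda>u. H u - G n a u) \<le> (\<integral>\<^sup>+u. (\<Sum>i\<in>S. ennreal (theta \<alpha> k (F i u - G n (A i) u) (V u))) \<partial>kpow k \<mu>)"
      unfolding Theta_def
    proof (intro nn_integral_mono)
      fix u assume u: "u \<in> space (kpow k \<mu>)"
      obtain i where i: "i \<in> S" "H u = F i u" using HF(2)[OF u] by blast
      obtain j where jS: "j \<in> S" "a (tup n u) = A j (tup n u)" using aex by blast
      then have j: "j \<in> S" "G n a u = G n (A j) u" by (simp_all add: G_def)
      have Gle: "G n (A i) u \<le> G n a u" using age[OF i(1)] by (simp add: G_def)
      have Fle: "F j u \<le> H u" using HF(1)[OF u j(1)] .
      \<comment> \<open>Two maxima differ by at most one of the individual differences: if
        \<open>H u\<close> is the larger one, compare at an index where \<open>H\<close> is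
        attained, otherwise at an index where the maximal coefficient is attained.\<close>
      have "\<exists>l\<in>S. \<bar>H u - G n a u\<bar> \<le> \<bar>F l u - G n (A l) u\<bar>"
      proof (cases "G n a u \<le> H u")
        case True
        then show ?thesis using i Gle by (intro bexI[of _ i]) auto
      next
        case False
        then show ?thesis using j Fle by (intro bexI[of _ j]) auto
      qed
      then obtain l where l: "l \<in> S" "\<bar>H u - G n a u\<bar> \<le> \<bar>F l u - G n (A l) u\<bar>" by blast
      have "ennreal (theta \<alpha> k (H u - G n a u) (V u)) \<le> ennreal (theta \<alpha> k (F l u - G n (A l) u) (V u))"
        using l V_pos[of u] \<alpha> by (intro ennreal_leI theta_mono) auto
      also have "\<dots> \<le> (\<Sum>i\<in>S. ennreal (theta \<alpha> k (F i u - G n (A i) u) (V u)))"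
        using l S by (intro member_le_sum) auto
      finally show "ennreal (theta \<alpha> k (H u - G n a u) (V u)) \<le> \<dots>" .
    qed
    also have "\<dots> = (\<Sum>i\<in>S. Theta (\<lambda>u. F i u - G n (A i) u))"
      unfolding Theta_def by (intro nn_integral_sum) auto
    also have "\<dots> \<le> (\<Sum>i\<in>S. ennreal e)" using A(3) by (intro sum_mono) auto
    also have "\<dots> = ennreal \<delta>" using e by (simp add: ennreal_of_nat_eq_real_of_nat ennreal_mult[symmetric])
    finally show "\<exists>a. near \<delta> (\<lambda>w. (SUP i\<in>S. X i w)) H n a" using a0 1 by (intro exI[of _ a]) simp
  qed
qed (fact H)

text \<open>Both variables are replaced by cell maxima of one common level, where the maximal
  inequality applies to the absolute differences of the coefficients; then the approximation error
  tends to 0. The factor 2 in the level absorbs the two additive errors, and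
  \<open>D\<^sup>2\<close> comes from writing \<open>G n a - G n b\<close> as a sum of three
  terms.\<close>

lemma Approx_compare:
  assumes X: "Approx X F" and X': "Approx X' F'" and s: "0 < s" "1 \<le> ln s"
  shows "ennreal (prob {w\<in>space P. \<not> X w \<le> X' w + ennreal (2 * s powr (1 / \<alpha>))}) \<le>
    ennreal (K / s) + ennreal ((real k * ln s) ^ (k - 1) / s) * (ennreal (D\<^sup>2) * Theta (\<lambda>u. F u - F' u))"
    (is "ennreal ?p \<le> ennreal (K / s) + ennreal ?C * _")
proof -
  note [measurable] = ApproxD(1,2)[OF X] ApproxD(1,2)[OF X']
  define t where "t = s powr (1 / \<alpha>)"
  have t: "0 < t" using s by (simp add: t_def)
  have C: "0 < ?C" using s k by (intro divide_pos_pos zero_less_power mult_pos_pos) linarith+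
  define T where "T = Theta (\<lambda>u. F u - F' u)"
  have bound: "ennreal ?p \<le> ennreal (2 * \<delta>) + (ennreal (K / s) + ennreal ?C * (ennreal D * (ennreal \<delta> + ennreal D * (T + ennreal \<delta>))))"
    if \<delta>: "0 < \<delta>" "2 * \<delta> \<le> t" for \<delta>
  proof -
    obtain n1 where n1: "\<And>n. n \<ge> n1 \<Longrightarrow> \<exists>a. near \<delta> X F n a" using ApproxD(3)[OF X \<delta>(1)] by blast
    obtain n2 where n2: "\<And>n. n \<ge> n2 \<Longrightarrow> \<exists>a. near \<delta> X' F' n a" using ApproxD(3)[OF X' \<delta>(1)] by blast
    define n where "n = max n1 n2"
    obtain a where a: "\<And>\<sigma>. 0 \<le> a \<sigma>" "prob {w\<in>space P. \<not> (X w \<le> J n a w + ennreal \<delta> \<and> J n a w \<le> X w + ennreal \<delta>)} \<le> \<delta>"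
        "Theta (\<lambda>u. F u - G n a u) \<le> ennreal \<delta>" using n1[of n] by (auto simp: n_def)
    obtain b where b: "\<And>\<sigma>. 0 \<le> b \<sigma>" "prob {w\<in>space P. \<not> (X' w \<le> J n b w + ennreal \<delta> \<and> J n b w \<le> X' w + ennreal \<delta>)} \<le> \<delta>"
        "Theta (\<lambda>u. F' u - G n b u) \<le> ennreal \<delta>" using n2[of n] by (auto simp: n_def)
    define c where "c \<sigma> = \<bar>a \<sigma> - b \<sigma>\<bar>" for \<sigma>
    have c: "0 \<le> c \<sigma>" for \<sigma> by (simp add: c_def)
    let ?A = "{w\<in>space P. \<not> (X w \<le> J n a w + ennreal \<delta> \<and> J n a w \<le> X w + ennreal \<delta>)}"
    let ?B = "{w\<in>space P. \<not> (X' w \<le> J n b w + ennreal \<delta> \<and> J n b w \<le> X' w + ennreal \<delta>)}"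
    let ?E = "{w\<in>space P. ennreal (s powr (1 / \<alpha>)) < J n c w}"
    have "?p \<le> prob (?A \<union> (?B \<union> ?E))"
    proof (intro finite_measure_mono subsetI)
      fix w assume w: "w \<in> {w\<in>space P. \<not> X w \<le> X' w + ennreal (2 * s powr (1 / \<alpha>))}"
      show "w \<in> ?A \<union> (?B \<union> ?E)"
      proof (rule ccontr)
        assume "w \<notin> ?A \<union> (?B \<union> ?E)"
        then have le: "X w \<le> J n a w + ennreal \<delta>" "J n b w \<le> X' w + ennreal \<delta>" "J n c w \<le> ennreal t"
          using w by (auto simp: t_def not_less)
        have "X w \<le> (J n b w + J n c w) + ennreal \<delta>"
          using le(1) J_diff[of b n a w] b(1) by (simp add: c_def[abs_def] order_trans add_right_mono)
        also have "\<dots> \<le> ((X' w + ennreal \<delta>) + ennreal t) + ennreal \<delta>"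
          using le by (intro add_mono) auto
        also have "\<dots> = X' w + ennreal (\<delta> + t + \<delta>)"
          using \<delta>(1) t by (simp only: ennreal_plus add_nonneg_nonneg less_imp_le add.assoc)
        also have "\<dots> \<le> X' w + ennreal (2 * t)" using \<delta> by (intro add_left_mono ennreal_leI) simp
        finally show False using w by (simp add: t_def)
      qed
    qed measurable
    also have "\<dots> \<le> prob ?A + prob (?B \<union> ?E)" by (intro measure_Un_le) auto
    also have "prob (?B \<union> ?E) \<le> prob ?B + prob ?E" by (intro measure_Un_le) auto
    finally have "?p \<le> 2 * \<delta> + prob ?E" using a(2) b(2) by simp
    then have "ennreal ?p \<le> ennreal (2 * \<delta>) + ennreal (prob ?E)"
      using \<delta> by (simp add: ennreal_plus[symmetric] ennreal_leI del: ennreal_plus)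
    also have "ennreal (prob ?E) \<le> ennreal (K / s) + ennreal ?C * Theta (G n c)"
      by (rule J_tail_le[OF c s])
    also have "Theta (G n c) \<le> ennreal D * (ennreal \<delta> + ennreal D * (T + ennreal \<delta>))"
    proof -
      have 1: "Theta (\<lambda>u. G n a u - F u) \<le> ennreal \<delta>" using a(3) by (subst Theta_uminus)
      have "Theta (\<lambda>u. (F u - F' u) + (F' u - G n b u)) \<le> ennreal D * (T + Theta (\<lambda>u. F' u - G n b u))"
        unfolding T_def by (intro Theta_add) measurable
      also have "\<dots> \<le> ennreal D * (T + ennreal \<delta>)" using b(3) by (intro mult_left_mono add_mono) auto
      finally have 2: "Theta (\<lambda>u. (F u - F' u) + (F' u - G n b u)) \<le> ennreal D * (T + ennreal \<delta>)" .
      have "Theta (G n c) = Theta (\<lambda>u. (G n a u - F u) + ((F u - F' u) + (F' u - G n b u)))"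
        by (intro Theta_cong_AE AE_I2) (auto simp: G_def c_def)
      also have "\<dots> \<le> ennreal D * (Theta (\<lambda>u. G n a u - F u) + Theta (\<lambda>u. (F u - F' u) + (F' u - G n b u)))"
        by (intro Theta_add) measurable
      also have "\<dots> \<le> ennreal D * (ennreal \<delta> + ennreal D * (T + ennreal \<delta>))"
        using 1 2 by (intro mult_left_mono add_mono) auto
      finally show ?thesis .
    qed
    finally show ?thesis by (simp add: add_left_mono mult_left_mono)
  qed
  show ?thesis
  proof (cases "T = \<infinity>")
    \<comment> \<open>An infinite gauge distance makes the right-hand side infinite, because the
      factors in front of it are positive.\<close>
    case True
    have "0 < D\<^sup>2" using D_ge_1 by simp
    then have "ennreal (D\<^sup>2) \<noteq> 0" "ennreal ?C \<noteq> 0"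
      using C by (metis ennreal_eq_0_iff not_le)+
    then have "ennreal ?C * (ennreal (D\<^sup>2) * T) = \<infinity>"
      unfolding True infinity_ennreal_def ennreal_mult_eq_top_iff by simp
    then show ?thesis unfolding T_def[symmetric] by simp
  next
    case False
    then obtain T' where T': "T = ennreal T'" "0 \<le> T'" by (cases T) auto
    have D0: "0 \<le> D" using D_ge_1 by simp
    have Ks: "0 \<le> K / s" using K s by simp
    have le: "?p \<le> 2 * \<delta> + (K / s + ?C * (D * (\<delta> + D * (T' + \<delta>))))" if \<delta>: "0 < \<delta>" "2 * \<delta> \<le> t" for \<delta>
    proof -
      have "ennreal (2 * \<delta>) + (ennreal (K / s) + ennreal ?C * (ennreal D * (ennreal \<delta> + ennreal D * (T + ennreal \<delta>)))) =
          ennreal (2 * \<delta> + (K / s + ?C * (D * (\<delta> + D * (T' + \<delta>)))))"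
        using \<delta>(1) T'(2) D0 Ks less_imp_le[OF C]
        by (simp only: T'(1) ennreal_plus ennreal_mult add_nonneg_nonneg mult_nonneg_nonneg less_imp_le zero_le_numeral)
      then have "ennreal ?p \<le> ennreal (2 * \<delta> + (K / s + ?C * (D * (\<delta> + D * (T' + \<delta>)))))" using bound[OF \<delta>] by simp
      moreover have "0 \<le> 2 * \<delta> + (K / s + ?C * (D * (\<delta> + D * (T' + \<delta>))))"
        using \<delta> T' D0 Ks C by (intro add_nonneg_nonneg mult_nonneg_nonneg) auto
      ultimately show ?thesis by (simp only: ennreal_le_iff)
    qed
    have "((\<lambda>\<delta>. 2 * \<delta> + (K / s + ?C * (D * (\<delta> + D * (T' + \<delta>))))) \<longlongrightarrow> 2 * 0 + (K / s + ?C * (D * (0 + D * (T' + 0))))) (at_right 0)"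
      by (intro tendsto_intros)
    moreover have "eventually (\<lambda>\<delta>. ?p \<le> 2 * \<delta> + (K / s + ?C * (D * (\<delta> + D * (T' + \<delta>))))) (at_right 0)"
      using le t unfolding eventually_at_right_field by (intro exI[of _ "t / 2"]) auto
    ultimately have "?p \<le> 2 * 0 + (K / s + ?C * (D * (0 + D * (T' + 0))))"
      by (intro tendsto_lowerbound) auto
    then have "?p \<le> K / s + ?C * (D\<^sup>2 * T')" by (simp add: power2_eq_square mult.assoc)
    then have "ennreal ?p \<le> ennreal (K / s + ?C * (D\<^sup>2 * T'))" by (rule ennreal_leI)
    also have "\<dots> = ennreal (K / s) + ennreal ?C * (ennreal (D\<^sup>2) * T)"
      using T' D0 Ks C by (simp only: T'(1) ennreal_plus ennreal_mult mult_nonneg_nonneg zero_le_power2 less_imp_le)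
    finally show ?thesis by (simp add: T_def)
  qed
qed

text \<open>Finiteness of \<open>Y\<close> comes from comparing the \<open>X j\<close> with 0: their
  gauges are eventually below a common bound, hence so are their tails, and the limit inherits the
  estimate. With \<open>Y\<close> finite, almost sure convergence gives closeness with high
  probability at one index \<open>j\<close>, and the approximants of that \<open>X j\<close> serve
  for \<open>Y\<close>.\<close>

lemma Approx_limit:
  assumes X: "\<And>j. Approx (X j) (F j)" and Y[measurable]: "Y \<in> borel_measurable P"
    and XY: "AE w in P. (\<lambda>j. X j w) \<longlonglongrightarrow> Y w" and H[measurable]: "H \<in> borel_measurable (kpow k \<mu>)"
    and FH: "(\<lambda>j. Theta (\<lambda>u. H u - F j u)) \<longlonglongrightarrow> 0" and HT: "Theta H < \<infinity>"
  shows "AE w in P. Y w < \<infinity>" "Approx Y H"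
proof -
  have [measurable]: "X j \<in> borel_measurable P" "F j \<in> borel_measurable (kpow k \<mu>)" for j
    using ApproxD(1,2)[OF X] by auto
  have D0: "0 \<le> D" using D_ge_1 by simp
  obtain h where h: "Theta H = ennreal h" "0 \<le> h" using HT by (cases "Theta H") auto
  define B where "B = D\<^sup>2 * (D * (h + 1))"
  have p_le: "prob {w\<in>space P. Y w = \<infinity>} \<le> K / s + (real k * ln s) ^ (k - 1) / s * B" if s: "0 < s" "1 \<le> ln s" for s
  proof (rule field_le_epsilon)
    fix e :: real assume e: "0 < e"
    let ?t = "2 * s powr (1 / \<alpha>)"
    have "eventually (\<lambda>j. 1 - e < prob {w\<in>space P. Y w = \<infinity> \<longrightarrow> \<not> X j w \<le> ennreal ?t}) sequentially"
    proof (intro prob_eventually_tendsto_1 e)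
      show "AE w in P. eventually (\<lambda>j. w \<in> {w\<in>space P. Y w = \<infinity> \<longrightarrow> \<not> X j w \<le> ennreal ?t}) sequentially"
        using XY AE_space
      proof eventually_elim
        case (elim w)
        show ?case
        proof (cases "Y w = \<infinity>")
          case True
          then have "eventually (\<lambda>j. ennreal ?t < X j w) sequentially"
            using elim(1) by (intro order_tendstoD(1)) auto
          then show ?thesis using elim by (auto simp: not_le elim: eventually_mono)
        qed (use elim in auto)
      qed
    qed measurable
    moreover have "eventually (\<lambda>j. Theta (\<lambda>u. H u - F j u) < 1) sequentially"
      using FH by (intro order_tendstoD(2)) auto
    ultimately have "eventually (\<lambda>j. 1 - e < prob {w\<in>space P. Y w = \<infinity> \<longrightarrow> \<not> X j w \<le> ennreal ?t} \<and> Theta (\<lambda>u. H u - F j u) < 1) sequentially"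
      by eventually_elim simp
    then obtain j where j: "1 - e < prob {w\<in>space P. Y w = \<infinity> \<longrightarrow> \<not> X j w \<le> ennreal ?t}" "Theta (\<lambda>u. H u - F j u) < 1"
      by (auto simp: eventually_sequentially)
    let ?A = "{w\<in>space P. Y w = \<infinity> \<longrightarrow> \<not> X j w \<le> ennreal ?t}"
    have "prob {w\<in>space P. Y w = \<infinity>} \<le> prob ((space P - ?A) \<union> {w\<in>space P. \<not> X j w \<le> 0 + ennreal ?t})"
      by (intro finite_measure_mono) auto
    also have "\<dots> \<le> prob (space P - ?A) + prob {w\<in>space P. \<not> X j w \<le> 0 + ennreal ?t}"
      by (intro measure_Un_le) auto
    also have "prob (space P - ?A) \<le> e" using j(1) by (subst prob_compl) auto
    also have "prob {w\<in>space P. \<not> X j w \<le> 0 + ennreal ?t} \<le> K / s + (real k * ln s) ^ (k - 1) / s * B"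
    proof -
      have "Theta (\<lambda>u. F j u - 0) = Theta (\<lambda>u. H u + (F j u - H u))" by simp
      also have "\<dots> \<le> ennreal D * (Theta H + Theta (\<lambda>u. F j u - H u))" by (intro Theta_add) auto
      also have "\<dots> \<le> ennreal D * (ennreal h + 1)"
        using j(2) by (intro mult_left_mono add_mono) (auto simp: h Theta_uminus[of H] less_imp_le)
      also have "\<dots> = ennreal (D * (h + 1))" using h D0 by (simp add: ennreal_mult)
      finally have "ennreal (D\<^sup>2) * Theta (\<lambda>u. F j u - 0) \<le> ennreal (D\<^sup>2) * ennreal (D * (h + 1))" by (intro mult_left_mono) auto
      also have "\<dots> = ennreal B" using h D0 by (simp add: B_def ennreal_mult)
      finally have T: "ennreal (D\<^sup>2) * Theta (\<lambda>u. F j u - 0) \<le> ennreal B" .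
      have C: "0 \<le> (real k * ln s) ^ (k - 1) / s" using s k
        by (intro divide_nonneg_pos zero_le_power mult_nonneg_nonneg) linarith+
      have B: "0 \<le> B" using h D0 by (simp add: B_def)
      have "ennreal (prob {w\<in>space P. \<not> X j w \<le> 0 + ennreal ?t}) \<le>
         ennreal (K / s) + ennreal ((real k * ln s) ^ (k - 1) / s) * (ennreal (D\<^sup>2) * Theta (\<lambda>u. F j u - 0))"
        by (rule Approx_compare[OF X Approx_0 s])
      also have "\<dots> \<le> ennreal (K / s) + ennreal ((real k * ln s) ^ (k - 1) / s) * ennreal B"
        using T by (intro add_left_mono mult_left_mono) auto
      also have "\<dots> = ennreal (K / s + (real k * ln s) ^ (k - 1) / s * B)"
        using C B K s by (subst ennreal_plus) (simp_all only: ennreal_mult mult_nonneg_nonneg divide_nonneg_pos)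
      finally show ?thesis
        using C B K s by (subst (asm) ennreal_le_iff) (simp_all only: add_nonneg_nonneg mult_nonneg_nonneg divide_nonneg_pos)
    qed
    finally show "prob {w\<in>space P. Y w = \<infinity>} \<le> K / s + (real k * ln s) ^ (k - 1) / s * B + e" by simp
  qed
  have "((\<lambda>s. K / s + (real k * ln s) ^ (k - 1) / s * B) \<longlongrightarrow> 0 + 0 * B) at_top"
    by (intro tendsto_intros tendsto_ln_power_div tendsto_divide_0[OF tendsto_const] filterlim_at_top_imp_at_infinity filterlim_ident)
  moreover have "eventually (\<lambda>s. prob {w\<in>space P. Y w = \<infinity>} \<le> K / s + (real k * ln s) ^ (k - 1) / s * B) at_top"
    using eventually_gt_at_top[of 0] eventually_ge_at_top[of "exp 1"]
  proof eventually_elim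
    case (elim s)
    then have "1 \<le> ln s" by (simp add: ln_ge_iff)
    then show ?case using elim p_le by blast
  qed
  ultimately have "prob {w\<in>space P. Y w = \<infinity>} \<le> 0 + 0 * B" by (intro tendsto_lowerbound) auto
  then have "prob {w\<in>space P. Y w = \<infinity>} = 0" by (simp add: measure_le_0_iff)
  then have "AE w in P. \<not> Y w = \<infinity>"
    by (subst AE_iff_measurable[OF _ refl]) (auto simp: emeasure_eq_measure)
  then show fin: "AE w in P. Y w < \<infinity>" by (auto simp: less_top)
  show "Approx Y H"
    unfolding Approx_def
  proof (intro conjI allI impI)
    fix \<delta> :: real assume \<delta>: "0 < \<delta>"
    \<comment> \<open>Two errors \<open>e\<close> pass through the quasi-triangle inequality with
      constant \<open>D\<close>.\<close>
    define e where "e = \<delta> / (2 * D)"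
    have e: "0 < e" "2 * e \<le> \<delta>" "D * (e + e) = \<delta>" using D_ge_1 \<delta> by (auto simp: e_def field_simps)
    have "eventually (\<lambda>j. 1 - e < prob {w\<in>space P. X j w \<le> Y w + ennreal e \<and> Y w \<le> X j w + ennreal e}) sequentially"
    proof (intro prob_eventually_tendsto_1 e)
      show "AE w in P. eventually (\<lambda>j. w \<in> {w\<in>space P. X j w \<le> Y w + ennreal e \<and> Y w \<le> X j w + ennreal e}) sequentially"
        using XY fin AE_space
      proof eventually_elim
        case (elim w)
        \<comment> \<open>The strict inequality fails at \<open>Y w = \<infinity>\<close>, which is
          why finiteness had to be known.\<close>
        have lt: "Y w < Y w + ennreal e" using elim e by (cases "Y w") (auto simp: ennreal_plus[symmetric] ennreal_less_iff simp del: ennreal_plus)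
        then have 1: "eventually (\<lambda>j. X j w < Y w + ennreal e) sequentially"
          using elim by (intro order_tendstoD(2)) auto
        have "(\<lambda>j. X j w + ennreal e) \<longlonglongrightarrow> Y w + ennreal e" using elim by (intro tendsto_intros)
        then have "eventually (\<lambda>j. Y w < X j w + ennreal e) sequentially"
          using lt by (intro order_tendstoD(1)) auto
        with 1 show ?case using elim by (auto elim: eventually_elim2)
      qed
    qed measurable
    moreover have "eventually (\<lambda>j. Theta (\<lambda>u. H u - F j u) < ennreal e) sequentially"
      using FH e by (intro order_tendstoD(2)) auto
    ultimately have "eventually (\<lambda>j. 1 - e < prob {w\<in>space P. X j w \<le> Y w + ennreal e \<and> Y w \<le> X j w + ennreal e} \<and> Theta (\<lambda>u. H u - F j u) < ennreal e) sequentially"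
      by eventually_elim simp
    then obtain j where j: "1 - e < prob {w\<in>space P. X j w \<le> Y w + ennreal e \<and> Y w \<le> X j w + ennreal e}" "Theta (\<lambda>u. H u - F j u) < ennreal e"
      by (auto simp: eventually_sequentially)
    let ?A = "{w\<in>space P. X j w \<le> Y w + ennreal e \<and> Y w \<le> X j w + ennreal e}"
    have PA: "prob (space P - ?A) \<le> e" using j(1) by (subst prob_compl) auto
    from ApproxD(3)[OF X e(1)] obtain n0 where n0: "\<And>n. n \<ge> n0 \<Longrightarrow> \<exists>a. near e (X j) (F j) n a" by blast
    show "\<exists>n0. \<forall>n\<ge>n0. \<exists>a. near \<delta> Y H n a"
    proof (intro exI[of _ n0] allI impI)
      fix n assume "n0 \<le> n"
      then obtain a where a: "\<forall>\<sigma>. 0 \<le> a \<sigma>"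
        "prob {w\<in>space P. \<not> (X j w \<le> J n a w + ennreal e \<and> J n a w \<le> X j w + ennreal e)} \<le> e"
        "Theta (\<lambda>u. F j u - G n a u) \<le> ennreal e" using n0 by blast
      let ?B = "{w\<in>space P. \<not> (X j w \<le> J n a w + ennreal e \<and> J n a w \<le> X j w + ennreal e)}"
      have trans: "x \<le> z + ennreal \<delta>" if "x \<le> y + ennreal e" "y \<le> z + ennreal e" for x y z
      proof -
        have "x \<le> (z + ennreal e) + ennreal e" using that by (meson add_right_mono order_trans)
        also have "\<dots> = z + ennreal (2 * e)" using e by (simp add: add.assoc ennreal_plus[symmetric] del: ennreal_plus)
        also have "\<dots> \<le> z + ennreal \<delta>" using e by (intro add_left_mono ennreal_leI)
        finally show ?thesis .
      qed
      have "prob {w\<in>space P. \<not> (Y w \<le> J n a w + ennreal \<delta> \<and> J n a w \<le> Y w + ennreal \<delta>)} \<le> prob ((space P - ?A) \<union> ?B)"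
        using trans by (intro finite_measure_mono) auto
      also have "\<dots> \<le> prob (space P - ?A) + prob ?B" by (intro measure_Un_le) auto
      also have "\<dots> \<le> \<delta>" using PA a(2) e by simp
      finally have 1: "prob {w\<in>space P. \<not> (Y w \<le> J n a w + ennreal \<delta> \<and> J n a w \<le> Y w + ennreal \<delta>)} \<le> \<delta>" .
      have "Theta (\<lambda>u. H u - G n a u) = Theta (\<lambda>u. (H u - F j u) + (F j u - G n a u))" by simp
      also have "\<dots> \<le> ennreal D * (Theta (\<lambda>u. H u - F j u) + Theta (\<lambda>u. F j u - G n a u))" by (intro Theta_add) measurable
      also have "\<dots> \<le> ennreal D * (ennreal e + ennreal e)" using j(2) a(3) by (intro mult_left_mono add_mono) auto
      also have "\<dots> = ennreal \<delta>" using e D0 by (simp add: ennreal_mult[symmetric] ennreal_plus[symmetric] del: ennreal_plus)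
      finally show "\<exists>a. near \<delta> Y H n a" using a(1) 1 by (intro exI[of _ a]) simp
    qed
  qed auto
qed

section \<open>The product random sup measure\<close>


abbreviation EP :: "nat \<Rightarrow> (nat \<Rightarrow> 'a) set" where
  "EP L \<equiv> Pi\<^sub>E {..<k} (\<lambda>_. E L)"

abbreviation \<mu>E :: "nat \<Rightarrow> 'a measure" where
  "\<mu>E L \<equiv> density \<mu> (indicator (E L))"

lemma E_sets [measurable]: "E L \<in> sets \<mu>"
  unfolding E_eq by measurable

text \<open>Equality of coordinates is tested through the injective real function
  \<open>\<phi>\<close>; the diagonal of an abstract measurable space need not be
  measurable.\<close>

lemma offdiag_measurable [measurable]: "offdiag k \<mu> \<in> sets (kpow k \<mu>)"
proof -
  have "offdiag k \<mu> = {u\<in>space (kpow k \<mu>). \<forall>i\<in>{..<k}. \<forall>j\<in>{..<k}. i \<noteq> j \<longrightarrow> \<phi> (u i) \<noteq> \<phi> (u j)}"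
  proof -
    have "inj_on u {..<k} \<longleftrightarrow> (\<forall>i\<in>{..<k}. \<forall>j\<in>{..<k}. i \<noteq> j \<longrightarrow> \<phi> (u i) \<noteq> \<phi> (u j))" if "u \<in> space (kpow k \<mu>)" for u
    proof -
      have "u i \<in> space \<mu>" if "i < k" for i using that \<open>u \<in> _\<close> by (auto simp: space_PiM)
      then have "\<phi> (u i) = \<phi> (u j) \<longleftrightarrow> u i = u j" if "i < k" "j < k" for i j
        using \<phi>_inj that by (auto dest: inj_onD)
      then show ?thesis by (auto simp: inj_on_def)
    qed
    then show ?thesis by (auto simp: offdiag_def)
  qed
  also have "\<dots> \<in> sets (kpow k \<mu>)"
  proof -
    have meas: "(\<lambda>u. \<phi> (u i)) \<in> borel_measurable (kpow k \<mu>)" if "i \<in> {..<k}" for i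
      by (rule measurable_compose[OF measurable_component_singleton[OF that] \<phi>])
    have "{u\<in>space (kpow k \<mu>). i \<noteq> j \<longrightarrow> \<phi> (u i) \<noteq> \<phi> (u j)} \<in> sets (kpow k \<mu>)" if "i \<in> {..<k}" "j \<in> {..<k}" for i j
      using borel_measurable_neq[OF meas[OF that(1)] meas[OF that(2)]] by (cases "i = j") (simp_all only: simp_thms sets.top Collect_mem_eq)
    then show ?thesis by (intro sets.sets_Collect_finite_All finite_lessThan)
  qed
  finally show ?thesis .
qed

lemma offdiag_sets_eq: "A \<in> offdiag_sets k \<mu> \<longleftrightarrow> A \<in> sets (kpow k \<mu>) \<and> A \<subseteq> offdiag k \<mu>"
  unfolding offdiag_sets_def using offdiag_measurable by blast

lemma sets_kpow_density: "sets (kpow k (density \<mu> f)) = sets (kpow k \<mu>)"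
  by (rule sets_PiM_cong) auto

lemma space_kpow_density: "space (kpow k (density \<mu> f)) = space (kpow k \<mu>)"
  by (simp add: space_PiM)

lemma offdiag_density: "offdiag k (density \<mu> f) = offdiag k \<mu>"
  by (simp add: offdiag_def space_kpow_density)

lemma offdiag_sets_density: "offdiag_sets k (density \<mu> f) = offdiag_sets k \<mu>"
  by (simp add: offdiag_sets_def offdiag_density sets_kpow_density)

lemma offdiag_rects_density: "offdiag_rects k (density \<mu> f) = offdiag_rects k \<mu>"
  by (simp add: offdiag_rects_def)

lemma finite_measure_\<mu>E: "finite_measure (\<mu>E L)"
  using E_fin[of L] by (intro finite_measureI) (simp add: emeasure_density sets.Int_space_eq2)

text \<open>The density of the product is a product of indicators, that is, the indicator of the
  \<open>k\<close>-th power of \<open>E L\<close>.\<close>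

lemma emeasure_kpow_\<mu>E:
  assumes [measurable]: "B \<in> sets (kpow k \<mu>)"
  shows "emeasure (kpow k (\<mu>E L)) B = emeasure (kpow k \<mu>) (B \<inter> EP L)"
proof -
  interpret f: finite_measure "\<mu>E L" by (rule finite_measure_\<mu>E)
  have EP[measurable]: "EP L \<in> sets (kpow k \<mu>)" by (intro sets_PiM_I_finite) auto
  have "emeasure (kpow k (\<mu>E L)) B = emeasure (density (kpow k \<mu>) (\<lambda>u. \<Prod>r<k. indicator (E L) (u r))) B"
    by (subst PiM_density[OF sigma_finite _ f.sigma_finite_measure_axioms]) auto
  also have "\<dots> = (\<integral>\<^sup>+u. (\<Prod>r<k. indicator (E L) (u r)) * indicator B u \<partial>kpow k \<mu>)"
  proof (rule emeasure_density)
    show "(\<lambda>u. \<Prod>r<k. indicator (E L) (u r) :: ennreal) \<in> borel_measurable (kpow k \<mu>)"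
      by (intro borel_measurable_prod_ennreal) (auto intro!: measurable_compose[OF measurable_component_singleton])
  qed measurable
  also have "\<dots> = (\<integral>\<^sup>+u. indicator (B \<inter> EP L) u \<partial>kpow k \<mu>)"
  proof (intro nn_integral_cong)
    fix u assume u: "u \<in> space (kpow k \<mu>)"
    have "(\<Prod>r<k. indicator (E L) (u r) :: ennreal) = indicator (EP L) u"
    proof (cases "u \<in> EP L")
      case False
      then obtain r where "r < k" "u r \<notin> E L" using u by (auto simp: space_PiM PiE_def)
      then have "(\<Prod>r<k. indicator (E L) (u r) :: ennreal) = 0" by (intro prod_zero bexI[of _ r]) auto
      then show ?thesis using False by simp
    qed (auto simp: PiE_def Pi_def)
    then show "(\<Prod>r<k. indicator (E L) (u r)) * indicator B u = (indicator (B \<inter> EP L) u :: ennreal)"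
      by (simp add: indicator_inter_arith mult.commute)
  qed
  also have "\<dots> = emeasure (kpow k \<mu>) (B \<inter> EP L)" by simp
  finally show ?thesis .
qed

lemma finite_kpow_\<mu>E: "finite_measure (kpow k (\<mu>E L))"
proof (rule finite_measureI)
  interpret f: finite_measure "\<mu>E L" by (rule finite_measure_\<mu>E)
  interpret product_sigma_finite "\<lambda>_. \<mu>E L"
    by (simp add: product_sigma_finite_def f.sigma_finite_measure_axioms)
  have "emeasure (kpow k (\<mu>E L)) (space (kpow k (\<mu>E L))) = (\<Prod>r<k. emeasure (\<mu>E L) (space (\<mu>E L)))"
    unfolding space_PiM by (rule emeasure_PiM) auto
  also have "\<dots> \<noteq> \<infinity>"
    unfolding infinity_ennreal_def ennreal_prod_eq_top using f.emeasure_finite by (simp only: infinity_ennreal_def) blast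
  finally show "emeasure (kpow k (\<mu>E L)) (space (kpow k (\<mu>E L))) \<noteq> \<infinity>" .
qed

section \<open>Dyadic refinement: cells generate the product sigma-algebra\<close>

lemma lab_refine:
  assumes "n \<le> n'"
  shows "lab n x = (fst (lab n' x) div 2 ^ (n' - n), snd (lab n' x))"
proof -
  have "(2::real) ^ n' = 2 ^ n * 2 ^ (n' - n)" using assms by (simp flip: power_add)
  then have "2 ^ n * \<phi> x = 2 ^ n' * \<phi> x / real_of_int (2 ^ (n' - n))" by simp
  also have "\<lfloor>\<dots>\<rfloor> = \<lfloor>2 ^ n' * \<phi> x\<rfloor> div 2 ^ (n' - n)" by (rule floor_divide_real_eq_div) simp
  finally show ?thesis by (simp add: lab_def)
qed

text \<open>\<open>T\<close> ranges over arbitrary sets of label tuples and not only over subsets of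
  \<open>Sig n\<close>; otherwise the family would not be closed under complements.\<close>

definition cyl :: "(nat \<Rightarrow> 'a) set set" where
  "cyl = {{u\<in>space (kpow k \<mu>). tup n u \<in> T} | n T. True}"

lemma cylI: "{u\<in>space (kpow k \<mu>). tup n u \<in> T} \<in> cyl"
  by (auto simp: cyl_def)

text \<open>The coarse dyadic index is an integer quotient of the fine one and the class is kept, so
  cells are nested and an event of one level is an event of every finer level.\<close>

lemma cyl_refine:
  assumes "n \<le> n'"
  shows "\<exists>T'. {u\<in>space (kpow k \<mu>). tup n u \<in> T} = {u\<in>space (kpow k \<mu>). tup n' u \<in> T'}"
proof (intro exI[of _ "{\<tau>. (\<lambda>r\<in>{..<k}. (fst (\<tau> r) div 2 ^ (n' - n), snd (\<tau> r))) \<in> T}"] Collect_cong conj_cong refl)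
  fix u
  have "tup n u = (\<lambda>r\<in>{..<k}. (fst (tup n' u r) div 2 ^ (n' - n), snd (tup n' u r)))"
    using lab_refine[OF assms] by (auto simp: tup_def restrict_def)
  then show "tup n u \<in> T \<longleftrightarrow> tup n' u \<in> {\<tau>. (\<lambda>r\<in>{..<k}. (fst (\<tau> r) div 2 ^ (n' - n), snd (\<tau> r))) \<in> T}"
    by simp
qed

lemma algebra_cyl: "algebra (space (kpow k \<mu>)) cyl"
  unfolding algebra_iff_Un
proof (intro conjI ballI)
  show "{} \<in> cyl" using cylI[of 0 "{}"] by simp
  show "cyl \<subseteq> Pow (space (kpow k \<mu>))" by (auto simp: cyl_def)
next
  fix a assume "a \<in> cyl"
  then obtain n T where "a = {u\<in>space (kpow k \<mu>). tup n u \<in> T}" by (auto simp: cyl_def)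
  then have "space (kpow k \<mu>) - a = {u\<in>space (kpow k \<mu>). tup n u \<in> - T}" by auto
  then show "space (kpow k \<mu>) - a \<in> cyl" by (simp only: cylI)
next
  fix a b assume "a \<in> cyl" "b \<in> cyl"
  then obtain n T n' T' where ab: "a = {u\<in>space (kpow k \<mu>). tup n u \<in> T}" "b = {u\<in>space (kpow k \<mu>). tup n' u \<in> T'}"
    by (auto simp: cyl_def)
  obtain S where S: "a = {u\<in>space (kpow k \<mu>). tup (max n n') u \<in> S}"
    using cyl_refine[of n "max n n'" T] ab by auto
  obtain S' where S': "b = {u\<in>space (kpow k \<mu>). tup (max n n') u \<in> S'}"
    using cyl_refine[of n' "max n n'" T'] ab by auto
  have "a \<union> b = {u\<in>space (kpow k \<mu>). tup (max n n') u \<in> S \<union> S'}" unfolding S S' by auto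
  then show "a \<union> b \<in> cyl" by (simp only: cylI)
qed

lemma floor_dyadic_tendsto: "(\<lambda>n. real_of_int \<lfloor>2 ^ n * y\<rfloor> / 2 ^ n) \<longlonglongrightarrow> y"
proof (rule tendsto_sandwich)
  show "\<forall>\<^sub>F n in sequentially. y - 1 / 2 ^ n \<le> real_of_int \<lfloor>2 ^ n * y\<rfloor> / 2 ^ n"
  proof (intro always_eventually allI)
    fix n :: nat
    have "2 ^ n * y - 1 \<le> real_of_int \<lfloor>2 ^ n * y\<rfloor>" by linarith
    then have "(2 ^ n * y - 1) / 2 ^ n \<le> real_of_int \<lfloor>2 ^ n * y\<rfloor> / 2 ^ n" by (intro divide_right_mono) auto
    then show "y - 1 / 2 ^ n \<le> real_of_int \<lfloor>2 ^ n * y\<rfloor> / 2 ^ n" by (simp add: diff_divide_distrib)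
  qed
  show "\<forall>\<^sub>F n in sequentially. real_of_int \<lfloor>2 ^ n * y\<rfloor> / 2 ^ n \<le> y"
  proof (intro always_eventually allI)
    fix n :: nat
    have "real_of_int \<lfloor>2 ^ n * y\<rfloor> / 2 ^ n \<le> 2 ^ n * y / 2 ^ n" by (intro divide_right_mono) auto
    then show "real_of_int \<lfloor>2 ^ n * y\<rfloor> / 2 ^ n \<le> y" by simp
  qed
  show "(\<lambda>n. y - 1 / 2 ^ n) \<longlonglongrightarrow> y" by real_asymp
qed simp

text \<open>\<open>\<phi> (u r)\<close> is the limit of its dyadic roundings, each a function of
  \<open>tup n u\<close>, so every coordinate is measurable for the sigma-algebra of the cylinders,
  since \<open>\<phi>\<close> generates \<open>sets \<mu>\<close>.\<close>

lemma sets_kpow_cyl: "sets (kpow k \<mu>) = sigma_sets (space (kpow k \<mu>)) cyl"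
proof
  have cyl_meas: "cyl \<subseteq> sets (kpow k \<mu>)"
  proof
    fix a assume "a \<in> cyl"
    then obtain n T where "a = {u\<in>space (kpow k \<mu>). tup n u \<in> T}" by (auto simp: cyl_def)
    then have "a = tup n -` T \<inter> space (kpow k \<mu>)" by auto
    then show "a \<in> sets (kpow k \<mu>)" by (simp add: measurable_sets[OF tup_measurable])
  qed
  then show "sigma_sets (space (kpow k \<mu>)) cyl \<subseteq> sets (kpow k \<mu>)" by (rule sets.sigma_sets_subset)
  have cylP: "cyl \<subseteq> Pow (space (kpow k \<mu>))" by (auto simp: cyl_def)
  define S where "S = sigma (space (kpow k \<mu>)) cyl"
  have space_S: "space S = space (kpow k \<mu>)" and sets_S: "sets S = sigma_sets (space (kpow k \<mu>)) cyl"
    using cylP by (auto simp: S_def space_measure_of_conv sets_measure_of)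
  have meas_h: "(\<lambda>u. h (tup n u)) \<in> borel_measurable S" for n and h :: "_ \<Rightarrow> real"
  proof (rule measurableI)
    fix B :: "real set"
    have "(\<lambda>u. h (tup n u)) -` B \<inter> space S = {u\<in>space (kpow k \<mu>). tup n u \<in> h -` B}" by (auto simp: space_S)
    then show "(\<lambda>u. h (tup n u)) -` B \<inter> space S \<in> sets S" unfolding sets_S by (simp only: cylI sigma_sets.Basic)
  qed simp
  have \<phi>S: "(\<lambda>u. \<phi> (u r)) \<in> borel_measurable S" if r: "r \<in> {..<k}" for r
  proof (rule borel_measurable_LIMSEQ_real)
    show "(\<lambda>u. real_of_int (fst (tup n u r)) / 2 ^ n) \<in> borel_measurable S" for n
      using meas_h[of "\<lambda>\<tau>. real_of_int (fst (\<tau> r)) / 2 ^ n" n] by simp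
    show "(\<lambda>n. real_of_int (fst (tup n u r)) / 2 ^ n) \<longlonglongrightarrow> \<phi> (u r)" for u
      using r floor_dyadic_tendsto[of "\<phi> (u r)"] by (simp add: tup_def lab_def)
  qed
  have "(\<lambda>u. u) \<in> measurable S (kpow k \<mu>)"
  proof (rule measurable_PiM_single)
    show "(\<lambda>u. u) \<in> space S \<rightarrow> (\<Pi>\<^sub>E i\<in>{..<k}. space \<mu>)" by (auto simp: space_S space_PiM)
    fix A r assume r: "r \<in> {..<k}" and "A \<in> sets \<mu>"
    then obtain B where B: "B \<in> sets borel" "A = {x\<in>space \<mu>. \<phi> x \<in> B}" using \<phi>_gen by blast
    have "{u\<in>space S. u r \<in> A} = (\<lambda>u. \<phi> (u r)) -` B \<inter> space S"
      using r by (auto simp: B space_S space_PiM)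
    then show "{u\<in>space S. u r \<in> A} \<in> sets S" using measurable_sets[OF \<phi>S[OF r] B(1)] by simp
  qed
  then show "sets (kpow k \<mu>) \<subseteq> sigma_sets (space (kpow k \<mu>)) cyl"
    using measurable_sets[of "\<lambda>u. u" S "kpow k \<mu>"] sets.sets_into_space[of _ "kpow k \<mu>"]
    by (auto simp: sets_S space_S Int_absorb2)
qed

text \<open>Distinct coordinates have distinct values of \<open>\<phi>\<close>, which the dyadic
  intervals separate once \<open>2 ^ n\<close> times the distance exceeds 1; and the finitely many
  classes lie below \<open>n\<close> eventually.\<close>

lemma tup_eventually_Sig:
  assumes "u \<in> offdiag k \<mu>"
  shows "eventually (\<lambda>n. tup n u \<in> Sig n) sequentially"
proof -
  have u: "u r \<in> space \<mu>" if "r < k" for r using assms that by (auto simp: offdiag_def space_PiM)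
  have "eventually (\<lambda>n. cl (u r) < n) sequentially" for r by (rule eventually_gt_at_top)
  then have 1: "eventually (\<lambda>n. \<forall>r\<in>{..<k}. cl (u r) < n) sequentially"
    by (intro eventually_ball_finite) auto
  have "eventually (\<lambda>n. i \<noteq> j \<longrightarrow> lab n (u i) \<noteq> lab n (u j)) sequentially" if "i \<in> {..<k}" "j \<in> {..<k}" for i j
  proof (cases "i = j")
    case False
    have "u i \<noteq> u j" using assms that False by (auto simp: offdiag_def dest: inj_onD)
    then have "\<phi> (u i) \<noteq> \<phi> (u j)" using \<phi>_inj u that by (auto dest: inj_onD)
    then have "0 < \<bar>\<phi> (u i) - \<phi> (u j)\<bar>" by simp
    then have "eventually (\<lambda>n. 1 < 2 ^ n * \<bar>\<phi> (u i) - \<phi> (u j)\<bar>) sequentially" by real_asymp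
    then show ?thesis
    proof eventually_elim
      case (elim n)
      show ?case
      proof (intro impI notI)
        assume "lab n (u i) = lab n (u j)"
        then have "\<lfloor>2 ^ n * \<phi> (u i)\<rfloor> = \<lfloor>2 ^ n * \<phi> (u j)\<rfloor>" by (simp add: lab_def)
        then have "\<bar>2 ^ n * \<phi> (u i) - 2 ^ n * \<phi> (u j)\<bar> < 1" by linarith
        also have "\<bar>2 ^ n * \<phi> (u i) - 2 ^ n * \<phi> (u j)\<bar> = 2 ^ n * \<bar>\<phi> (u i) - \<phi> (u j)\<bar>"
          by (simp add: abs_mult flip: right_diff_distrib)
        finally show False using elim by simp
      qed
    qed
  qed simp
  then have 2: "eventually (\<lambda>n. \<forall>i\<in>{..<k}. \<forall>j\<in>{..<k}. i \<noteq> j \<longrightarrow> lab n (u i) \<noteq> lab n (u j)) sequentially"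
    by (intro eventually_ball_finite ballI) auto
  from 1 2 show ?thesis
  proof eventually_elim
    case (elim n)
    have "lab n (u r) \<in> Idx n" if "r < k" for r
    proof -
      have "0 \<le> \<phi> (u r)" "\<phi> (u r) \<le> 1" using \<phi>01 u that by auto
      then have "0 \<le> 2 ^ n * \<phi> (u r)" "2 ^ n * \<phi> (u r) \<le> 2 ^ n" by auto
      then have "0 \<le> \<lfloor>2 ^ n * \<phi> (u r)\<rfloor>" "\<lfloor>2 ^ n * \<phi> (u r)\<rfloor> \<le> 2 ^ n"
        by (simp, metis floor_mono floor_numeral_power of_int_numeral of_int_power floor_of_int)
      then show ?thesis using elim(1) that by (simp add: Idx_def lab_def)
    qed
    then show ?case using elim(2) by (auto simp: Sig_def tup_def inj_on_def)
  qed
qed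

text \<open>One approximation by a cylinder can be rewritten at every finer level. Restricting it to
  \<open>Sig n\<close> loses points whose cells are not yet distinct or not yet enumerated, and
  inside the off-diagonal set \<open>A\<close> these decrease to the empty set. Taking at each level
  the best subset of \<open>Sig n\<close> turns the statement for every \<open>e\<close> into a
  single sequence.\<close>

lemma exists_cell_approx:
  assumes A: "A \<in> offdiag_sets k \<mu>"
  shows "\<exists>T. (\<forall>n. T n \<subseteq> Sig n) \<and>
    (\<lambda>n. emeasure (kpow k (\<mu>E L)) (sym_diff {u\<in>space (kpow k \<mu>). tup n u \<in> T n} A)) \<longlonglongrightarrow> 0"
proof -
  interpret f: finite_measure "kpow k (\<mu>E L)" by (rule finite_kpow_\<mu>E)
  let ?m = "measure (kpow k (\<mu>E L))"
  let ?S = "\<lambda>n T. {u\<in>space (kpow k \<mu>). tup n u \<in> T}"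
  have A': "A \<in> sets (kpow k \<mu>)" "A \<subseteq> offdiag k \<mu>" using A by (auto simp: offdiag_sets_eq)
  have Sm: "?S n T \<in> sets (kpow k \<mu>)" for n T
    using cylI[of n T] sets_kpow_cyl by auto
  have m: "B \<in> sets (kpow k (\<mu>E L)) \<longleftrightarrow> B \<in> sets (kpow k \<mu>)" for B by (simp add: sets_kpow_density)
  have ev: "\<exists>n0. \<forall>n\<ge>n0. \<exists>T\<subseteq>Sig n. ?m (sym_diff (?S n T) A) < e" if e: "0 < e" for e
  proof -
    have "\<exists>S\<in>cyl. ?m (sym_diff S A) < e / 2"
    proof (rule approx_by_algebra[OF finite_kpow_\<mu>E algebra_cyl])
      show "sets (kpow k (\<mu>E L)) = sigma_sets (space (kpow k \<mu>)) cyl"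
        by (simp add: sets_kpow_density sets_kpow_cyl)
    qed (use A' e m in auto)
    then obtain n1 T1 where T1: "?m (sym_diff (?S n1 T1) A) < e / 2" by (auto simp: cyl_def)
    define B where "B n = {u\<in>A. \<exists>m\<ge>n. tup m u \<notin> Sig m}" for n
    have B_eq: "B n = A - (\<Inter>m\<in>{n..}. ?S m (Sig m))" for n
      using A' sets.sets_into_space[OF A'(1)] by (auto simp: B_def)
    have Bm: "B n \<in> sets (kpow k \<mu>)" for n
      unfolding B_eq using A' Sm by (intro sets.Diff sets.countable_INT') auto
    have "(\<lambda>n. ?m (B n)) \<longlonglongrightarrow> ?m (\<Inter>n. B n)"
    proof (rule f.finite_Lim_measure_decseq)
      show "range B \<subseteq> sets (kpow k (\<mu>E L))" using Bm m by blast
      show "decseq B" unfolding decseq_def B_def by (blast intro: order_trans)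
    qed
    moreover have "(\<Inter>n. B n) = {}"
    proof (rule ccontr)
      assume "(\<Inter>n. B n) \<noteq> {}"
      then obtain u where u: "\<And>n. u \<in> B n" by auto
      then have "u \<in> offdiag k \<mu>" using A' by (auto simp: B_def)
      from tup_eventually_Sig[OF this] obtain n where "\<And>m. m \<ge> n \<Longrightarrow> tup m u \<in> Sig m"
        by (auto simp: eventually_sequentially)
      then show False using u[of n] by (auto simp: B_def)
    qed
    ultimately have "(\<lambda>n. ?m (B n)) \<longlonglongrightarrow> 0" by simp
    then have "eventually (\<lambda>n. ?m (B n) < e / 2) sequentially" using e by (intro order_tendstoD(2)) auto
    then obtain n2 where n2: "\<And>n. n \<ge> n2 \<Longrightarrow> ?m (B n) < e / 2" by (auto simp: eventually_sequentially)
    show ?thesis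
    proof (intro exI[of _ "max n1 n2"] allI impI)
      fix n assume n: "max n1 n2 \<le> n"
      then obtain T' where T': "?S n1 T1 = ?S n T'" using cyl_refine[of n1 n T1] by auto
      have sd: "sym_diff (?S n T') A \<in> sets (kpow k (\<mu>E L))" "B n \<in> sets (kpow k (\<mu>E L))"
        using Sm A' Bm m by auto
      have "?m (sym_diff (?S n (T' \<inter> Sig n)) A) \<le> ?m (sym_diff (?S n T') A \<union> B n)"
      proof (rule f.finite_measure_mono[OF subsetI sets.Un[OF sd]])
        fix u assume u: "u \<in> sym_diff (?S n (T' \<inter> Sig n)) A"
        show "u \<in> sym_diff (?S n T') A \<union> B n"
        proof (cases "tup n u \<in> Sig n")
          case True
          then show ?thesis using u by simp
        next
          case False
          then have "u \<in> A" using u by simp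
          then show ?thesis using False by (auto simp: B_def)
        qed
      qed
      also have "\<dots> \<le> ?m (sym_diff (?S n T') A) + ?m (B n)" using sd by (intro measure_Un_le)
      also have "\<dots> < e / 2 + e / 2" using T1 n2[of n] n unfolding T' by (intro add_strict_mono) auto
      finally show "\<exists>T\<subseteq>Sig n. ?m (sym_diff (?S n T) A) < e" by (intro exI[of _ "T' \<inter> Sig n"]) auto
    qed
  qed
  have "\<forall>n. \<exists>T. T \<subseteq> Sig n \<and> (\<forall>T'\<subseteq>Sig n. ?m (sym_diff (?S n T) A) \<le> ?m (sym_diff (?S n T') A))"
  proof
    fix n
    have "finite (Pow (Sig n))" "Pow (Sig n) \<noteq> {}" by auto
    from arg_min_if_finite(1)[OF this, of "\<lambda>T. ?m (sym_diff (?S n T) A)"]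
      arg_min_least[OF this, of _ "\<lambda>T. ?m (sym_diff (?S n T) A)"]
    show "\<exists>T. T \<subseteq> Sig n \<and> (\<forall>T'\<subseteq>Sig n. ?m (sym_diff (?S n T) A) \<le> ?m (sym_diff (?S n T') A))"
      by (intro exI[of _ "arg_min_on (\<lambda>T. ?m (sym_diff (?S n T) A)) (Pow (Sig n))"]) auto
  qed
  from choice[OF this] obtain T where T: "\<And>n. T n \<subseteq> Sig n"
      "\<And>n T'. T' \<subseteq> Sig n \<Longrightarrow> ?m (sym_diff (?S n (T n)) A) \<le> ?m (sym_diff (?S n T') A)" by blast
  have "(\<lambda>n. ?m (sym_diff (?S n (T n)) A)) \<longlonglongrightarrow> 0"
  proof (rule LIMSEQ_I)
    fix e :: real assume "0 < e"
    from ev[OF this] obtain n0 where n0: "\<And>n. n \<ge> n0 \<Longrightarrow> \<exists>T\<subseteq>Sig n. ?m (sym_diff (?S n T) A) < e" by blast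
    show "\<exists>n0. \<forall>n\<ge>n0. norm (?m (sym_diff (?S n (T n)) A) - 0) < e"
    proof (intro exI[of _ n0] allI impI)
      fix n assume "n0 \<le> n"
      then obtain T' where "T' \<subseteq> Sig n" "?m (sym_diff (?S n T') A) < e" using n0 by blast
      then show "norm (?m (sym_diff (?S n (T n)) A) - 0) < e" using T(2)[of T' n] by simp
    qed
  qed
  then have "(\<lambda>n. ennreal (?m (sym_diff (?S n (T n)) A))) \<longlonglongrightarrow> ennreal 0" by (intro tendsto_ennrealI)
  then have "(\<lambda>n. emeasure (kpow k (\<mu>E L)) (sym_diff (?S n (T n)) A)) \<longlonglongrightarrow> 0"
    by (simp add: f.emeasure_eq_measure)
  then show ?thesis using T(1) by blast
qed

lemma rects_Union:
  assumes "T \<subseteq> Sig n"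
  shows "{u\<in>space (kpow k \<mu>). tup n u \<in> T} = \<Union>((\<lambda>\<sigma>. Pi\<^sub>E {..<k} (\<lambda>r. cell n (\<sigma> r))) ` T)"
proof -
  have "Pi\<^sub>E {..<k} (\<lambda>r. cell n (\<sigma> r)) \<subseteq> space (kpow k \<mu>)" for \<sigma>
    by (auto simp: space_PiM PiE_def Pi_def cell_def)
  moreover have "u \<in> Pi\<^sub>E {..<k} (\<lambda>r. cell n (\<sigma> r)) \<longleftrightarrow> tup n u = \<sigma>" if "u \<in> space (kpow k \<mu>)" "\<sigma> \<in> T" for u \<sigma>
    using rect_iff that assms by blast
  ultimately show ?thesis by blast
qed

lemma rect_in_offdiag_rects:
  assumes "\<sigma> \<in> Sig n"
  shows "Pi\<^sub>E {..<k} (\<lambda>r. cell n (\<sigma> r)) \<in> offdiag_rects k \<mu>" "disjoint_family_on (\<lambda>r. cell n (\<sigma> r)) {..<k}"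
proof -
  show "disjoint_family_on (\<lambda>r. cell n (\<sigma> r)) {..<k}"
    unfolding disjoint_family_on_def
  proof (intro ballI impI)
    fix i j assume "i \<in> {..<k}" "j \<in> {..<k}" "i \<noteq> j"
    then have "\<sigma> i \<noteq> \<sigma> j" using SigD(2)[OF assms] by (auto dest: inj_onD)
    then show "cell n (\<sigma> i) \<inter> cell n (\<sigma> j) = {}" by (rule cell_disjoint)
  qed
  then show "Pi\<^sub>E {..<k} (\<lambda>r. cell n (\<sigma> r)) \<in> offdiag_rects k \<mu>"
    by (auto simp: offdiag_rects_def)
qed

lemma rect_in_offdiag_sets:
  assumes "\<sigma> \<in> Sig n"
  shows "Pi\<^sub>E {..<k} (\<lambda>r. cell n (\<sigma> r)) \<in> offdiag_sets k \<mu>"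
  unfolding offdiag_sets_eq
proof
  show "Pi\<^sub>E {..<k} (\<lambda>r. cell n (\<sigma> r)) \<in> sets (kpow k \<mu>)" by (intro sets_PiM_I_finite) auto
  show "Pi\<^sub>E {..<k} (\<lambda>r. cell n (\<sigma> r)) \<subseteq> offdiag k \<mu>"
  proof
    fix u assume u: "u \<in> Pi\<^sub>E {..<k} (\<lambda>r. cell n (\<sigma> r))"
    have "inj_on u {..<k}"
    proof (rule inj_onI)
      fix i j assume ij: "i \<in> {..<k}" "j \<in> {..<k}" "u i = u j"
      have "lab n (u r) = \<sigma> r" if "r \<in> {..<k}" for r using u that by (auto simp: cell_def PiE_def Pi_def)
      then have "\<sigma> i = \<sigma> j" using ij by metis
      then show "i = j" using SigD(2)[OF assms] ij by (auto dest: inj_onD)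
    qed
    then show "u \<in> offdiag k \<mu>" using u by (auto simp: offdiag_def space_PiM PiE_def Pi_def cell_def)
  qed
qed

section \<open>The product sup measure on unions of rectangles of cells\<close>

lemma M_empty: "AE w in P. M {} w = 0"
proof -
  have "AE w in P. M {} w \<le> ennreal (1 / Suc n)" for n
  proof -
    have "prob {w\<in>space P. M {} w \<le> ennreal (1 / Suc n)} = 1"
      by (subst M_cdf) auto
    then show ?thesis by (subst (asm) prob_eq_1) auto
  qed
  then have "AE w in P. \<forall>n. M {} w \<le> ennreal (1 / Suc n)" by (simp add: AE_all_countable)
  then show ?thesis
  proof eventually_elim
    case (elim w)
    have "(\<lambda>n. ennreal (1 / real (Suc n))) \<longlonglongrightarrow> ennreal 0"
      by (intro tendsto_ennrealI) real_asymp
    then have "M {} w \<le> ennreal 0" using elim by (intro LIMSEQ_le_const) auto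
    then show ?case by simp
  qed
qed

text \<open>All points of a class lie in the same layer, so the exhaustion never cuts through a
  cell.\<close>

lemma cell_Int_E: "cell n i \<inter> E L = (if lay (snd i) \<le> L then cell n i else {})"
  by (auto simp: cell_def E_eq lab_def)

lemma N'_measurable: "A \<in> offdiag_sets k \<mu> \<Longrightarrow> N' L A \<in> borel_measurable P"
  using product[of L] by (simp add: product_sup_measure_finite_def offdiag_sets_density)

lemma N'_rect:
  assumes "\<sigma> \<in> Sig n"
  shows "AE w in P. N' L (Pi\<^sub>E {..<k} (\<lambda>r. cell n (\<sigma> r))) w = (\<Prod>r<k. M (cell n (\<sigma> r) \<inter> E L) w)"
proof -
  have "\<forall>A. (\<forall>i<k. A i \<in> sets (\<mu>E L)) \<longrightarrow> disjoint_family_on A {..<k} \<longrightarrow>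
      (AE w in P. N' L (Pi\<^sub>E {..<k} A) w = (\<Prod>i<k. M (A i \<inter> E L) w))"
    using product[of L] unfolding product_sup_measure_finite_def by simp
  from this[rule_format, of "\<lambda>r. cell n (\<sigma> r)"] show ?thesis using rect_in_offdiag_rects(2)[OF assms] by simp
qed

text \<open>The defining clauses for rectangles and finite unions identify the product sup measure
  with \<open>J\<close> for 0-1 coefficients. Tuples with a cell outside \<open>E L\<close> get
  coefficient 0, since the mass of the empty set is almost surely 0.\<close>

lemma N'_Union:
  assumes T: "T \<subseteq> Sig n"
  shows "AE w in P. N' L {u\<in>space (kpow k \<mu>). tup n u \<in> T} w =
    J n (\<lambda>\<sigma>. if \<sigma> \<in> T \<and> (\<forall>r<k. lay (snd (\<sigma> r)) \<le> L) then 1 else 0) w"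
proof -
  let ?R = "\<lambda>\<sigma>. Pi\<^sub>E {..<k} (\<lambda>r. cell n (\<sigma> r))"
  have fT: "finite T" using T finite_Sig by (rule finite_subset)
  have "\<forall>\<B>. finite \<B> \<longrightarrow> \<B> \<subseteq> offdiag_rects k \<mu> \<longrightarrow> (AE w in P. N' L (\<Union>\<B>) w = (SUP B\<in>\<B>. N' L B w))"
    using product[of L] unfolding product_sup_measure_finite_def by (simp add: offdiag_rects_density)
  from this[rule_format, of "?R ` T"]
  have 1: "AE w in P. N' L {u\<in>space (kpow k \<mu>). tup n u \<in> T} w = (SUP B\<in>?R ` T. N' L B w)"
    using fT T rect_in_offdiag_rects(1) unfolding rects_Union[OF T] by auto
  have 2: "AE w in P. \<forall>\<sigma>\<in>T. N' L (?R \<sigma>) w = (\<Prod>r<k. M (cell n (\<sigma> r) \<inter> E L) w)"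
    using fT T N'_rect by (intro AE_finite_allI) auto
  from 1 2 M_empty show ?thesis
  proof eventually_elim
    case (elim w)
    have *: "(\<Prod>r<k. M (cell n (\<sigma> r) \<inter> E L) w) =
        ennreal (if \<forall>r<k. lay (snd (\<sigma> r)) \<le> L then 1 else 0) * (\<Prod>r<k. M (cell n (\<sigma> r)) w)" for \<sigma>
    proof (cases "\<forall>r<k. lay (snd (\<sigma> r)) \<le> L")
      case True
      then show ?thesis by (simp add: cell_Int_E)
    next
      case False
      then obtain r where "r < k" "\<not> lay (snd (\<sigma> r)) \<le> L" by auto
      then have "(\<Prod>r<k. M (cell n (\<sigma> r) \<inter> E L) w) = 0"
        using elim(3) by (intro prod_zero bexI[of _ r]) (auto simp: cell_Int_E)
      then show ?thesis by (simp only: if_not_P[OF False] ennreal_0 mult_zero_left)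
    qed
    have "N' L {u\<in>space (kpow k \<mu>). tup n u \<in> T} w = (SUP \<sigma>\<in>T. N' L (?R \<sigma>) w)"
      using elim(1) by (simp add: image_image)
    also have "\<dots> = (SUP \<sigma>\<in>T. ennreal (if \<forall>r<k. lay (snd (\<sigma> r)) \<le> L then 1 else 0) * (\<Prod>r<k. M (cell n (\<sigma> r)) w))"
      using elim(2) by (intro SUP_cong refl) (simp only: *)
    also have "\<dots> = J n (\<lambda>\<sigma>. if \<sigma> \<in> T \<and> (\<forall>r<k. lay (snd (\<sigma> r)) \<le> L) then 1 else 0) w"
      unfolding J_def
    proof (intro antisym SUP_least)
      fix \<sigma> assume "\<sigma> \<in> T"
      then show "ennreal (if \<forall>r<k. lay (snd (\<sigma> r)) \<le> L then 1 else 0) * (\<Prod>r<k. M (cell n (\<sigma> r)) w) \<le>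
        (SUP \<sigma>\<in>Sig n. ennreal (if \<sigma> \<in> T \<and> (\<forall>r<k. lay (snd (\<sigma> r)) \<le> L) then 1 else 0) * (\<Prod>r<k. M (cell n (\<sigma> r)) w))"
        using T by (intro SUP_upper2[of \<sigma>]) auto
    next
      fix \<sigma> assume "\<sigma> \<in> Sig n"
      show "ennreal (if \<sigma> \<in> T \<and> (\<forall>r<k. lay (snd (\<sigma> r)) \<le> L) then 1 else 0) * (\<Prod>r<k. M (cell n (\<sigma> r)) w) \<le>
        (SUP \<sigma>\<in>T. ennreal (if \<forall>r<k. lay (snd (\<sigma> r)) \<le> L then 1 else 0) * (\<Prod>r<k. M (cell n (\<sigma> r)) w))"
      proof (cases "\<sigma> \<in> T")
        case True
        then show ?thesis by (intro SUP_upper2[of \<sigma>]) auto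
      qed simp
    qed
    finally show ?case .
  qed
qed

text \<open>Cell sets that converge to \<open>A\<close> in measure give convergence of the values of
  \<open>N' L\<close> in the mean of order \<open>\<gamma>\<close>, hence in probability by Markov's
  inequality. The gauge of a difference of indicators is at most a constant times the measure of the
  symmetric difference, because the weight is bounded on the layers up to \<open>L\<close>.\<close>

lemma Approx_N':
  assumes A: "A \<in> offdiag_sets k \<mu>"
  shows "Approx (N' L A) (indicator (A \<inter> EP L))"
proof -
  have A': "A \<in> sets (kpow k \<mu>)" using A by (auto simp: offdiag_sets_eq)
  have EP: "EP L \<in> sets (kpow k \<mu>)" by (intro sets_PiM_I_finite) auto
  obtain T where T: "\<And>n. T n \<subseteq> Sig n"
    and lim: "(\<lambda>n. emeasure (kpow k (\<mu>E L)) (sym_diff {u\<in>space (kpow k \<mu>). tup n u \<in> T n} A)) \<longlonglongrightarrow> 0"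
    using exists_cell_approx[OF A, of L] by blast
  define S where "S n = {u\<in>space (kpow k \<mu>). tup n u \<in> T n}" for n
  have Sm: "S n \<in> sets (kpow k \<mu>)" for n
    unfolding S_def using cylI[of n "T n"] sets_kpow_cyl by auto
  have Srects: "S n \<in> offdiag_rect_unions k \<mu>" for n
    unfolding S_def rects_Union[OF T] offdiag_rect_unions_def
  proof (intro CollectI exI conjI)
    show "finite ((\<lambda>\<sigma>. Pi\<^sub>E {..<k} (\<lambda>r. cell n (\<sigma> r))) ` T n)"
      by (intro finite_imageI finite_subset[OF T finite_Sig])
    show "(\<lambda>\<sigma>. Pi\<^sub>E {..<k} (\<lambda>r. cell n (\<sigma> r))) ` T n \<subseteq> offdiag_rects k \<mu>"
    proof (rule image_subsetI)
      fix \<sigma> assume "\<sigma> \<in> T n"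
      then show "Pi\<^sub>E {..<k} (\<lambda>r. cell n (\<sigma> r)) \<in> offdiag_rects k \<mu>"
        using T by (intro rect_in_offdiag_rects(1)) blast
    qed
  qed (rule refl)
  have Soff: "S n \<in> offdiag_sets k \<mu>" for n
  proof -
    have "S n \<subseteq> offdiag k \<mu>"
      unfolding S_def rects_Union[OF T]
    proof (intro Union_least, elim imageE, simp only:)
      fix \<sigma> assume "\<sigma> \<in> T n"
      then have "\<sigma> \<in> Sig n" using T by blast
      from rect_in_offdiag_sets[OF this] show "Pi\<^sub>E {..<k} (\<lambda>r. cell n (\<sigma> r)) \<subseteq> offdiag k \<mu>"
        unfolding offdiag_sets_eq by (rule conjunct2)
    qed
    then show ?thesis using Sm by (simp add: offdiag_sets_eq)
  qed
  define a where "a n \<sigma> = (if \<sigma> \<in> T n \<and> (\<forall>r<k. lay (snd (\<sigma> r)) \<le> L) then 1 else 0 :: real)" for n \<sigma>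
  have JS: "AE w in P. N' L (S n) w = J n (a n) w" for n
    using N'_Union[OF T, of L n] by (simp add: S_def a_def[abs_def])
  note [measurable] = N'_measurable[OF A, of L] N'_measurable[OF Soff, of L]
  \<comment> \<open>Any exponent strictly between 0 and \<open>\<alpha>\<close> serves; Markov's
    inequality uses just one.\<close>
  define \<gamma> where "\<gamma> = \<alpha> / 2"
  have \<gamma>: "0 < \<gamma>" "\<gamma> < \<alpha>" using \<alpha> by (auto simp: \<gamma>_def)
  have Lg: "(\<lambda>n. \<integral>\<^sup>+ w. epowr (max (N' L (S n) w - N' L A w) (N' L A w - N' L (S n) w)) \<gamma> \<partial>P) \<longlonglongrightarrow> 0"
  proof -
    have "\<forall>A\<in>offdiag_sets k \<mu>. \<forall>S. (\<forall>n. S n \<in> offdiag_rect_unions k \<mu>) \<longrightarrow>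
        (\<lambda>n. emeasure (kpow k (\<mu>E L)) (sym_diff (S n) A)) \<longlonglongrightarrow> 0 \<longrightarrow>
        (\<forall>\<gamma>. 0 < \<gamma> \<longrightarrow> \<gamma> < \<alpha> \<longrightarrow>
           (\<lambda>n. \<integral>\<^sup>+ w. epowr (max (N' L (S n) w - N' L A w) (N' L A w - N' L (S n) w)) \<gamma> \<partial>P) \<longlonglongrightarrow> 0)"
      using product[of L] unfolding product_sup_measure_finite_def
      by (simp add: offdiag_sets_density offdiag_rect_unions_def offdiag_rects_density)
    from this[rule_format, OF A Srects _ \<gamma>] lim show ?thesis by (simp add: S_def)
  qed
  obtain C where C: "\<And>c. lay c \<le> L \<Longrightarrow> rho c \<le> C" using rho_bounded by blast
  \<comment> \<open>The value of \<open>theta\<close> at \<open>y = 1\<close> for the largest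
    possible weight. The maximum with 0 guards against a negative \<open>C\<close>, which is
    possible when no class has layer at most \<open>L\<close>.\<close>
  define q where "q = (1 + ln_plus (max C 0 ^ k)) ^ (k - 1)"
  have q: "0 \<le> q" unfolding q_def by (intro zero_le_power add_nonneg_nonneg) auto
  have Th: "Theta (\<lambda>u. indicator (A \<inter> EP L) u - G n (a n) u) \<le> ennreal q * emeasure (kpow k (\<mu>E L)) (sym_diff (S n) A)" for n
  proof -
    have sd: "sym_diff (S n) A \<in> sets (kpow k \<mu>)" using Sm A' by auto
    have "Theta (\<lambda>u. indicator (A \<inter> EP L) u - G n (a n) u) \<le> (\<integral>\<^sup>+u. ennreal q * indicator (sym_diff (S n) A \<inter> EP L) u \<partial>kpow k \<mu>)"
      unfolding Theta_def
    proof (intro nn_integral_mono)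
      fix u assume u: "u \<in> space (kpow k \<mu>)"
      have EPiff: "u \<in> EP L \<longleftrightarrow> (\<forall>r<k. lay (snd (tup n u r)) \<le> L)"
        using u by (auto simp: space_PiM PiE_def Pi_def tup_def lab_def E_eq)
      have "G n (a n) u = indicator (S n \<inter> EP L) u"
        using u T[of n] by (auto simp: G_def a_def S_def EPiff split: split_indicator)
      then have le: "\<bar>indicator (A \<inter> EP L) u - G n (a n) u\<bar> \<le> indicator (sym_diff (S n) A \<inter> EP L) u"
        by (auto split: split_indicator)
      show "ennreal (theta \<alpha> k (indicator (A \<inter> EP L) u - G n (a n) u) (V u)) \<le> ennreal q * indicator (sym_diff (S n) A \<inter> EP L) u"
      proof (cases "u \<in> sym_diff (S n) A \<inter> EP L")
        case True
        have "V u \<le> (\<Prod>r<k. max C 0)"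
          unfolding V_tup[of u n] using True EPiff rho_pos C
          by (intro prod_mono) (auto simp: less_imp_le le_max_iff_disj)
        then have "theta \<alpha> k (indicator (A \<inter> EP L) u - G n (a n) u) (V u) \<le> theta \<alpha> k 1 (max C 0 ^ k)"
          using le True V_pos[of u] \<alpha> by (intro theta_mono) auto
        also have "\<dots> = q" by (simp add: theta_def q_def)
        finally show ?thesis using True by (simp add: ennreal_leI)
      next
        case False
        then have "indicator (A \<inter> EP L) u - G n (a n) u = 0" using le by simp
        then show ?thesis by simp
      qed
    qed
    also have "\<dots> = ennreal q * emeasure (kpow k \<mu>) (sym_diff (S n) A \<inter> EP L)"
      using sd EP by (subst nn_integral_cmult_indicator) auto
    also have "\<dots> = ennreal q * emeasure (kpow k (\<mu>E L)) (sym_diff (S n) A)"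
      using sd by (simp add: emeasure_kpow_\<mu>E)
    finally show ?thesis .
  qed
  have ThL: "(\<lambda>n. ennreal q * emeasure (kpow k (\<mu>E L)) (sym_diff (S n) A)) \<longlonglongrightarrow> 0"
    using tendsto_mult_ennreal[OF tendsto_const[of "ennreal q"] lim] by (simp add: S_def)
  show ?thesis
    unfolding Approx_def
  proof (intro conjI allI impI)
    show "N' L A \<in> borel_measurable P" by measurable
    show "indicator (A \<inter> EP L) \<in> borel_measurable (kpow k \<mu>)" using A' EP by measurable
    fix \<delta> :: real assume \<delta>: "0 < \<delta>"
    \<comment> \<open>Markov's inequality at threshold \<open>\<delta>\<close> divides by
      \<open>\<delta> powr \<gamma>\<close>, so this bound leaves a probability of at most
      \<open>\<delta>\<close>.\<close>
    have "eventually (\<lambda>n. (\<integral>\<^sup>+ w. epowr (max (N' L (S n) w - N' L A w) (N' L A w - N' L (S n) w)) \<gamma> \<partial>P) < ennreal (\<delta> * \<delta> powr \<gamma>)) sequentially"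
      using Lg \<delta> by (intro order_tendstoD(2)) auto
    moreover have "eventually (\<lambda>n. ennreal q * emeasure (kpow k (\<mu>E L)) (sym_diff (S n) A) < ennreal \<delta>) sequentially"
      using ThL \<delta> by (intro order_tendstoD(2)) auto
    ultimately have "eventually (\<lambda>n. (\<integral>\<^sup>+ w. epowr (max (N' L (S n) w - N' L A w) (N' L A w - N' L (S n) w)) \<gamma> \<partial>P) < ennreal (\<delta> * \<delta> powr \<gamma>) \<and>
      ennreal q * emeasure (kpow k (\<mu>E L)) (sym_diff (S n) A) < ennreal \<delta>) sequentially"
      by eventually_elim simp
    then obtain n0 where n0: "\<And>n. n \<ge> n0 \<Longrightarrow> (\<integral>\<^sup>+ w. epowr (max (N' L (S n) w - N' L A w) (N' L A w - N' L (S n) w)) \<gamma> \<partial>P) < ennreal (\<delta> * \<delta> powr \<gamma>)"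
      "\<And>n. n \<ge> n0 \<Longrightarrow> ennreal q * emeasure (kpow k (\<mu>E L)) (sym_diff (S n) A) < ennreal \<delta>"
      by (auto simp: eventually_sequentially)
    show "\<exists>n0. \<forall>n\<ge>n0. \<exists>a. near \<delta> (N' L A) (\<lambda>u. indicator (A \<inter> EP L) u) n a"
    proof (intro exI[of _ n0] allI impI)
      fix n assume n: "n0 \<le> n"
      let ?B = "{w\<in>space P. \<not> (N' L A w \<le> N' L (S n) w + ennreal \<delta> \<and> N' L (S n) w \<le> N' L A w + ennreal \<delta>)}"
      let ?d = "\<lambda>w. max (N' L (S n) w - N' L A w) (N' L A w - N' L (S n) w)"
      have "ennreal (\<delta> powr \<gamma>) * emeasure P ?B = (\<integral>\<^sup>+w. ennreal (\<delta> powr \<gamma>) * indicator ?B w \<partial>P)"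
        by (rule nn_integral_cmult_indicator[symmetric]) measurable
      also have "\<dots> \<le> (\<integral>\<^sup>+ w. epowr (?d w) \<gamma> \<partial>P)"
      proof (intro nn_integral_mono)
        fix w
        show "ennreal (\<delta> powr \<gamma>) * indicator ?B w \<le> epowr (?d w) \<gamma>"
        proof (cases "w \<in> ?B")
          case True
          have "ennreal \<delta> \<le> ?d w"
          proof (rule ccontr)
            assume "\<not> ennreal \<delta> \<le> ?d w"
            then have "?d w \<le> ennreal \<delta>" by (meson nle_le)
            then have "N' L (S n) w - N' L A w \<le> ennreal \<delta>" "N' L A w - N' L (S n) w \<le> ennreal \<delta>"
              unfolding max.bounded_iff by blast+
            then show False using True by (auto simp: ennreal_minus_le_iff)
          qed
          then have "ennreal (\<delta> powr \<gamma>) \<le> epowr (?d w) \<gamma>"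
          proof (cases "?d w")
            case (real x)
            then have "\<delta> \<le> x" using \<open>ennreal \<delta> \<le> ?d w\<close> by simp
            then show ?thesis unfolding real epowr_def using \<delta> \<gamma> real(1) by (auto intro!: ennreal_leI powr_mono2)
          qed (simp add: epowr_def)
          then show ?thesis using True by simp
        qed simp
      qed
      also have "\<dots> \<le> ennreal (\<delta> * \<delta> powr \<gamma>)" using n0(1)[OF n] by simp
      finally have "ennreal (\<delta> powr \<gamma> * prob ?B) \<le> ennreal (\<delta> powr \<gamma> * \<delta>)"
        using \<delta> by (simp add: emeasure_eq_measure ennreal_mult mult.commute)
      then have PB: "prob ?B \<le> \<delta>" using \<delta> by (simp add: ennreal_le_iff)
      have "prob {w\<in>space P. \<not> (N' L A w \<le> J n (a n) w + ennreal \<delta> \<and> J n (a n) w \<le> N' L A w + ennreal \<delta>)} = prob ?B"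
      proof (rule finite_measure_eq_AE)
        show "AE w in P. w \<in> {w\<in>space P. \<not> (N' L A w \<le> J n (a n) w + ennreal \<delta> \<and> J n (a n) w \<le> N' L A w + ennreal \<delta>)} \<longleftrightarrow> w \<in> ?B"
          using JS[of n] by eventually_elim auto
      qed measurable
      moreover have "Theta (\<lambda>u. indicator (A \<inter> EP L) u - G n (a n) u) \<le> ennreal \<delta>"
        using Th[of n] n0(2)[OF n] by simp
      ultimately show "\<exists>a. near \<delta> (N' L A) (\<lambda>u. indicator (A \<inter> EP L) u) n a"
        using PB by (intro exI[of _ "a n"]) (simp add: a_def)
    qed
  qed
qed

text \<open>For \<open>L\<close> above the layers of all \<open>k\<close> cells the restriction to
  \<open>E L\<close> changes nothing, so the product is a value of \<open>N' L\<close>.\<close>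

lemma Approx_rect:
  assumes \<sigma>: "\<sigma> \<in> Sig n"
  shows "Approx (\<lambda>w. \<Prod>r<k. M (cell n (\<sigma> r)) w) (\<lambda>u. if tup n u = \<sigma> then 1 else 0)"
proof -
  let ?R = "Pi\<^sub>E {..<k} (\<lambda>r. cell n (\<sigma> r))"
  define L where "L = Max ((\<lambda>r. lay (snd (\<sigma> r))) ` {..<k})"
  have L: "lay (snd (\<sigma> r)) \<le> L" if "r < k" for r using that by (auto simp: L_def)
  show ?thesis
  proof (rule Approx_cong_AE[OF Approx_N'[OF rect_in_offdiag_sets[OF \<sigma>], of L]])
    show "(\<lambda>w. \<Prod>r<k. M (cell n (\<sigma> r)) w) \<in> borel_measurable P"
      by (intro borel_measurable_prod_ennreal) auto
    have "(\<lambda>u. (\<lambda>\<tau>. if \<tau> = \<sigma> then 1 else 0 :: real) (tup n u)) \<in> borel_measurable (kpow k \<mu>)"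
      by (rule measurable_compose[OF tup_measurable]) simp
    then show "(\<lambda>u. if tup n u = \<sigma> then 1 else 0 :: real) \<in> borel_measurable (kpow k \<mu>)" by simp
    show "AE w in P. N' L ?R w = (\<Prod>r<k. M (cell n (\<sigma> r)) w)"
      using N'_rect[OF \<sigma>, of L] by eventually_elim (simp add: cell_Int_E L)
    show "AE u in kpow k \<mu>. indicator (?R \<inter> EP L) u = (if tup n u = \<sigma> then 1 else 0 :: real)"
    proof (rule AE_I2)
      fix u assume u: "u \<in> space (kpow k \<mu>)"
      have "cell n (\<sigma> r) \<subseteq> E L" if "r < k" for r using cell_Int_E[of n "\<sigma> r" L] L[OF that] by auto
      then have "?R \<subseteq> EP L" by (intro PiE_mono) auto
      then have "?R \<inter> EP L = ?R" by auto
      then show "indicator (?R \<inter> EP L) u = (if tup n u = \<sigma> then 1 else 0 :: real)"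
        using rect_iff[OF u \<sigma>] by (simp add: indicator_def)
    qed
  qed
qed

text \<open>Approximability asks for approximants at every large level, so even a maximum at a fixed
  level has to be re-expressed on finer cells. The product sup measure does this for each rectangle,
  and finite maxima do the rest.\<close>

lemma Approx_J:
  assumes a: "\<And>\<sigma>. 0 \<le> a \<sigma>"
  shows "Approx (J n a) (G n a)"
proof (cases "Sig n = {}")
  case True
  then have "J n a = (\<lambda>_. 0)" "G n a = (\<lambda>_. 0)" by (auto simp: J_def[abs_def] G_def[abs_def] bot_ennreal)
  then show ?thesis using Approx_0 by simp
next
  case False
  have "Approx (\<lambda>w. SUP \<sigma>\<in>Sig n. ennreal (a \<sigma>) * (\<Prod>r<k. M (cell n (\<sigma> r)) w)) (G n a)"
  proof (rule Approx_SUP[OF finite_Sig False])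
    show "Approx (\<lambda>w. ennreal (a \<sigma>) * (\<Prod>r<k. M (cell n (\<sigma> r)) w)) (\<lambda>u. a \<sigma> * (if tup n u = \<sigma> then 1 else 0))"
      if "\<sigma> \<in> Sig n" for \<sigma> by (intro Approx_scale Approx_rect that a)
    show "a \<sigma> * (if tup n u = \<sigma> then 1 else 0) \<le> G n a u" if "\<sigma> \<in> Sig n" for u \<sigma>
      using that a by (auto simp: G_def)
    show "\<exists>\<sigma>\<in>Sig n. G n a u = a \<sigma> * (if tup n u = \<sigma> then 1 else 0)" for u
    proof (cases "tup n u \<in> Sig n")
      case True
      then show ?thesis by (intro bexI[of _ "tup n u"]) (auto simp: G_def)
    next
      case 2: False
      obtain \<sigma> where "\<sigma> \<in> Sig n" using False by auto
      then show ?thesis using 2 by (intro bexI[of _ \<sigma>]) (auto simp: G_def)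
    qed
  qed measurable
  then show ?thesis by (simp add: J_def[abs_def])
qed

end

section \<open>Transfer of the tail asymptotics\<close>

text \<open>Either \<open>y\<close> and \<open>z\<close> agree up to the relative error
  \<open>\<epsilon>\<close>, or the absolute value of \<open>y\<close> is at most that of
  \<open>y - z\<close> divided by \<open>\<epsilon>\<close>. The first factor tends to 1 with
  \<open>\<epsilon>\<close>, which a quasi-triangle inequality with a fixed constant could not
  give.\<close>

lemma powr_le_split:
  fixes y z \<epsilon> a :: real
  assumes "0 < \<epsilon>" "\<epsilon> < 1" "0 < a"
  shows "\<bar>y\<bar> powr a \<le> (1 - \<epsilon>) powr (- a) * \<bar>z\<bar> powr a + \<epsilon> powr (- a) * \<bar>y - z\<bar> powr a"
proof (cases "\<bar>y - z\<bar> \<le> \<epsilon> * \<bar>y\<bar>")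
  case True
  then have "(1 - \<epsilon>) * \<bar>y\<bar> \<le> \<bar>z\<bar>" by (simp add: left_diff_distrib)
  then have "((1 - \<epsilon>) * \<bar>y\<bar>) powr a \<le> \<bar>z\<bar> powr a" using assms by (intro powr_mono2) auto
  then have "(1 - \<epsilon>) powr a * \<bar>y\<bar> powr a \<le> \<bar>z\<bar> powr a" using assms by (simp add: powr_mult)
  then have "(1 - \<epsilon>) powr (- a) * ((1 - \<epsilon>) powr a * \<bar>y\<bar> powr a) \<le> (1 - \<epsilon>) powr (- a) * \<bar>z\<bar> powr a"
    by (intro mult_left_mono) auto
  then have "\<bar>y\<bar> powr a \<le> (1 - \<epsilon>) powr (- a) * \<bar>z\<bar> powr a"
    using assms by (simp add: mult.assoc[symmetric] powr_add[symmetric])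
  moreover have "0 \<le> \<epsilon> powr (- a) * \<bar>y - z\<bar> powr a" by simp
  ultimately show ?thesis by linarith
next
  case False
  then have "(\<epsilon> * \<bar>y\<bar>) powr a \<le> \<bar>y - z\<bar> powr a" using assms by (intro powr_mono2) auto
  then have "\<epsilon> powr a * \<bar>y\<bar> powr a \<le> \<bar>y - z\<bar> powr a" using assms by (simp add: powr_mult)
  then have "\<epsilon> powr (- a) * (\<epsilon> powr a * \<bar>y\<bar> powr a) \<le> \<epsilon> powr (- a) * \<bar>y - z\<bar> powr a"
    by (intro mult_left_mono) auto
  then have "\<bar>y\<bar> powr a \<le> \<epsilon> powr (- a) * \<bar>y - z\<bar> powr a"
    using assms by (simp add: mult.assoc[symmetric] powr_add[symmetric])
  moreover have "0 \<le> (1 - \<epsilon>) powr (- a) * \<bar>z\<bar> powr a" by simp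
  ultimately show ?thesis by linarith
qed

context extremal_setup
begin

section \<open>Continuity of the symmetrised integral in the gauge\<close>

lemma finite_perms: "finite {\<pi>. \<pi> permutes {..<k}}" "{\<pi>. \<pi> permutes {..<k}} \<noteq> {}"
proof -
  show "finite {\<pi>. \<pi> permutes {..<k}}" by (rule finite_permutations) simp
  have "id \<in> {\<pi>. \<pi> permutes {..<k}}" by (simp add: permutes_id)
  then show "{\<pi>. \<pi> permutes {..<k}} \<noteq> {}" by blast
qed

lemma symP_measurable [measurable]:
  assumes F: "F \<in> borel_measurable (kpow k \<mu>)"
  shows "symP F \<in> borel_measurable (kpow k \<mu>)"
  unfolding symP_def
proof (intro borel_measurable_Max finite_perms(1))
  fix \<pi> assume "\<pi> \<in> {\<pi>. \<pi> permutes {..<k}}"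
  then have [measurable]: "(\<lambda>u. F (u \<circ> \<pi>)) \<in> borel_measurable (kpow k \<mu>)"
    by (intro measurable_compose[OF measurable_comp_permute F]) simp
  show "(\<lambda>u. \<bar>F (u \<circ> \<pi>)\<bar> powr \<alpha>) \<in> borel_measurable (kpow k \<mu>)" by measurable
qed

lemma symP_nonneg: "0 \<le> symP F u"
proof -
  have "id \<in> {\<pi>. \<pi> permutes {..<k}}" by (simp only: mem_Collect_eq permutes_id)
  from imageI[OF this, of "\<lambda>\<pi>. \<bar>F (u \<circ> \<pi>)\<bar> powr \<alpha>"]
  have "\<bar>F (u \<circ> id)\<bar> powr \<alpha> \<le> symP F u"
    unfolding symP_def by (intro Max_ge finite_imageI finite_perms)
  moreover have "0 \<le> \<bar>F (u \<circ> id)\<bar> powr \<alpha>" by simp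
  ultimately show ?thesis by (rule order_trans[rotated])
qed

definition symI :: "((nat \<Rightarrow> 'a) \<Rightarrow> real) \<Rightarrow> ennreal" where
  "symI F = (\<integral>\<^sup>+u. ennreal (symP F u) \<partial>kpow k \<mu>)"

text \<open>The splitting inequality holds at each rearrangement of \<open>u\<close> with the same
  constants, so it passes to the maximum and to the integral.\<close>

lemma symI_split:
  assumes [measurable]: "F \<in> borel_measurable (kpow k \<mu>)" "H \<in> borel_measurable (kpow k \<mu>)"
    and \<epsilon>: "0 < \<epsilon>" "\<epsilon> < 1"
  shows "symI F \<le> ennreal ((1 - \<epsilon>) powr (- \<alpha>)) * symI H + ennreal (\<epsilon> powr (- \<alpha>)) * symI (\<lambda>u. F u - H u)"
proof -
  have "symP F u \<le> (1 - \<epsilon>) powr (- \<alpha>) * symP H u + \<epsilon> powr (- \<alpha>) * symP (\<lambda>u. F u - H u) u" for u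
  proof -
    have "\<bar>F (u \<circ> \<pi>)\<bar> powr \<alpha> \<le> (1 - \<epsilon>) powr (- \<alpha>) * symP H u + \<epsilon> powr (- \<alpha>) * symP (\<lambda>u. F u - H u) u"
      if "\<pi> permutes {..<k}" for \<pi>
    proof -
      have "\<bar>F (u \<circ> \<pi>)\<bar> powr \<alpha> \<le> (1 - \<epsilon>) powr (- \<alpha>) * \<bar>H (u \<circ> \<pi>)\<bar> powr \<alpha> + \<epsilon> powr (- \<alpha>) * \<bar>F (u \<circ> \<pi>) - H (u \<circ> \<pi>)\<bar> powr \<alpha>"
        by (rule powr_le_split) (use \<epsilon> \<alpha> in auto)
      also have "\<dots> \<le> (1 - \<epsilon>) powr (- \<alpha>) * symP H u + \<epsilon> powr (- \<alpha>) * symP (\<lambda>u. F u - H u) u"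
        unfolding symP_def using that finite_perms by (intro add_mono mult_left_mono Max_ge finite_imageI) auto
      finally show ?thesis .
    qed
    then show ?thesis
      unfolding symP_def[of F] using finite_perms by (subst Max_le_iff) auto
  qed
  then have "symI F \<le> (\<integral>\<^sup>+u. ennreal ((1 - \<epsilon>) powr (- \<alpha>)) * ennreal (symP H u) + ennreal (\<epsilon> powr (- \<alpha>)) * ennreal (symP (\<lambda>u. F u - H u) u) \<partial>kpow k \<mu>)"
    unfolding symI_def
    by (intro nn_integral_mono) (simp add: ennreal_mult[symmetric] ennreal_plus[symmetric] symP_nonneg ennreal_leI del: ennreal_plus)
  also have "\<dots> = ennreal ((1 - \<epsilon>) powr (- \<alpha>)) * symI H + ennreal (\<epsilon> powr (- \<alpha>)) * symI (\<lambda>u. F u - H u)"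
    unfolding symI_def by (subst nn_integral_add) (auto simp: nn_integral_cmult)
  finally show ?thesis .
qed

text \<open>A maximum over permutations is at most the sum, each permutation preserves the product
  measure, and \<open>theta\<close> dominates the plain power.\<close>

lemma symI_le_Theta:
  assumes F[measurable]: "F \<in> borel_measurable (kpow k \<mu>)"
  shows "symI F \<le> ennreal (fact k) * Theta F"
proof -
  have Fm: "(\<lambda>u. F (u \<circ> \<pi>)) \<in> borel_measurable (kpow k \<mu>)" if "\<pi> permutes {..<k}" for \<pi>
    using that by (intro measurable_compose[OF measurable_comp_permute F])
  have "symI F \<le> (\<integral>\<^sup>+u. (\<Sum>\<pi> | \<pi> permutes {..<k}. ennreal (\<bar>F (u \<circ> \<pi>)\<bar> powr \<alpha>)) \<partial>kpow k \<mu>)"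
    unfolding symI_def
  proof (intro nn_integral_mono)
    fix u
    have "symP F u \<in> (\<lambda>\<pi>. \<bar>F (u \<circ> \<pi>)\<bar> powr \<alpha>) ` {\<pi>. \<pi> permutes {..<k}}"
      unfolding symP_def using finite_perms by (intro Max_in) auto
    then obtain \<pi> where \<pi>: "\<pi> permutes {..<k}" "symP F u = \<bar>F (u \<circ> \<pi>)\<bar> powr \<alpha>" by auto
    show "ennreal (symP F u) \<le> (\<Sum>\<pi> | \<pi> permutes {..<k}. ennreal (\<bar>F (u \<circ> \<pi>)\<bar> powr \<alpha>))"
      unfolding \<pi>(2) by (rule member_le_sum[where f="\<lambda>\<pi>. ennreal (\<bar>F (u \<circ> \<pi>)\<bar> powr \<alpha>)"]) (use \<pi> finite_perms in auto)
  qed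
  also have "\<dots> = (\<Sum>\<pi> | \<pi> permutes {..<k}. \<integral>\<^sup>+u. ennreal (\<bar>F (u \<circ> \<pi>)\<bar> powr \<alpha>) \<partial>kpow k \<mu>)"
    by (intro nn_integral_sum) (use Fm in auto)
  also have "\<dots> = (\<Sum>\<pi> | \<pi> permutes {..<k}. \<integral>\<^sup>+u. ennreal (\<bar>F u\<bar> powr \<alpha>) \<partial>kpow k \<mu>)"
    by (intro sum.cong refl nn_integral_PiM_permute sigma_finite) auto
  also have "\<dots> = ennreal (fact k) * (\<integral>\<^sup>+u. ennreal (\<bar>F u\<bar> powr \<alpha>) \<partial>kpow k \<mu>)"
  proof -
    have "of_nat (card {\<pi>. \<pi> permutes {..<k}}) = (of_nat (fact k) :: ennreal)"
      by (simp only: card_permutations[OF card_lessThan finite_lessThan])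
    also have "\<dots> = ennreal (real (fact k))" by (rule ennreal_of_nat_eq_real_of_nat)
    also have "real (fact k) = fact k" by (rule of_nat_fact)
    finally have "of_nat (card {\<pi>. \<pi> permutes {..<k}}) = ennreal (fact k)" .
    then show ?thesis by (simp only: sum_constant)
  qed
  also have "\<dots> \<le> ennreal (fact k) * Theta F"
    unfolding Theta_def by (intro mult_left_mono nn_integral_mono ennreal_leI theta_ge_powr) auto
  finally show ?thesis .
qed

lemma symI_real_split:
  assumes F: "F \<in> borel_measurable (kpow k \<mu>)" "H \<in> borel_measurable (kpow k \<mu>)"
    and \<epsilon>: "0 < \<epsilon>" "\<epsilon> < 1" and \<eta>: "0 \<le> \<eta>" "Theta (\<lambda>u. F u - H u) \<le> ennreal \<eta>" and fin: "symI H < \<infinity>"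
  shows "symI F < \<infinity>"
    "enn2real (symI F) \<le> (1 - \<epsilon>) powr (- \<alpha>) * enn2real (symI H) + \<epsilon> powr (- \<alpha>) * (fact k * \<eta>)"
proof -
  obtain h where h: "symI H = ennreal h" "0 \<le> h" using fin by (cases "symI H") auto
  have "symI F \<le> ennreal ((1 - \<epsilon>) powr (- \<alpha>)) * symI H + ennreal (\<epsilon> powr (- \<alpha>)) * symI (\<lambda>u. F u - H u)"
    by (rule symI_split) fact+
  also have "\<dots> \<le> ennreal ((1 - \<epsilon>) powr (- \<alpha>)) * symI H + ennreal (\<epsilon> powr (- \<alpha>)) * (ennreal (fact k) * ennreal \<eta>)"
    using F \<eta> by (intro add_left_mono mult_left_mono order_trans[OF symI_le_Theta]) auto
  also have "\<dots> = ennreal ((1 - \<epsilon>) powr (- \<alpha>) * h + \<epsilon> powr (- \<alpha>) * (fact k * \<eta>))"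
    using h(2) \<eta>(1) by (simp only: h(1) ennreal_plus ennreal_mult mult_nonneg_nonneg powr_ge_zero fact_ge_zero)
  finally have le: "symI F \<le> ennreal ((1 - \<epsilon>) powr (- \<alpha>) * h + \<epsilon> powr (- \<alpha>) * (fact k * \<eta>))" .
  then show "symI F < \<infinity>" by (rule order_le_less_trans) simp
  have "0 \<le> (1 - \<epsilon>) powr (- \<alpha>) * h + \<epsilon> powr (- \<alpha>) * (fact k * \<eta>)" using h \<eta> by simp
  then show "enn2real (symI F) \<le> (1 - \<epsilon>) powr (- \<alpha>) * enn2real (symI H) + \<epsilon> powr (- \<alpha>) * (fact k * \<eta>)"
    using le h by (simp add: enn2real_leI)
qed

text \<open>Parametrised by the \<open>\<alpha>\<close>-th power \<open>s\<close> of the threshold,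
  in which tails are of order \<open>ln s ^ (k - 1) / s\<close>.\<close>

abbreviation tail :: "('w \<Rightarrow> ennreal) \<Rightarrow> real \<Rightarrow> real" where
  "tail X s \<equiv> prob {w\<in>space P. ennreal (s powr (1 / \<alpha>)) < X w}"

text \<open>The comparison bound is applied at the level \<open>s / q\<close>, and \<open>q\<close>
  is fixed by requiring that \<open>2 * (s / q) powr (1 / \<alpha>)\<close> equal
  \<open>\<epsilon> * s powr (1 / \<alpha>)\<close>. The contribution of \<open>K\<close> vanishes
  because \<open>k \<ge> 2\<close> leaves at least one logarithm in the normalisation.\<close>

lemma Approx_tail_diff:
  assumes X: "Approx X F" and Y: "Approx Y H" and \<eta>: "0 \<le> \<eta>" "Theta (\<lambda>u. F u - H u) \<le> ennreal \<eta>"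
    and \<epsilon>: "0 < \<epsilon>" and q: "q = (2 / \<epsilon>) powr \<alpha>"
  shows "\<exists>g. (g \<longlongrightarrow> q * (real k ^ (k - 1) * (D\<^sup>2 * \<eta>))) at_top \<and>
    eventually (\<lambda>s. s / ln s ^ (k - 1) * prob {w\<in>space P. \<not> X w \<le> Y w + ennreal (\<epsilon> * s powr (1 / \<alpha>))} \<le> g s) at_top"
proof -
  have q0: "0 < q" using \<epsilon> by (simp add: q)
  define B where "B = D\<^sup>2 * \<eta>"
  have B0: "0 \<le> B" using \<eta> by (simp add: B_def)
  define g where "g s = q * (K / ln s ^ (k - 1)) + q * (real k ^ (k - 1) * B) * (ln (1 / q * s) / ln s) ^ (k - 1)" for s
  have "(g \<longlongrightarrow> q * 0 + q * (real k ^ (k - 1) * B) * 1) at_top"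
    unfolding g_def using q0 k
    by (intro tendsto_intros ln_mult_ratio_tendsto tendsto_divide_0[OF tendsto_const] filterlim_at_top_imp_at_infinity
        filterlim_pow_at_top ln_at_top) auto
  moreover have "eventually (\<lambda>s. s / ln s ^ (k - 1) * prob {w\<in>space P. \<not> X w \<le> Y w + ennreal (\<epsilon> * s powr (1 / \<alpha>))} \<le> g s) at_top"
    using eventually_gt_at_top[of 1] eventually_ge_at_top[of "q * exp 1"]
  proof eventually_elim
    case (elim s)
    define s' where "s' = 1 / q * s"
    have s': "0 < s'" "exp 1 \<le> s'" using q0 elim by (auto simp: s'_def field_simps)
    then have ln1: "1 \<le> ln s'" by (simp add: ln_ge_iff)
    have "2 * s' powr (1 / \<alpha>) = 2 * ((1 / q) powr (1 / \<alpha>) * s powr (1 / \<alpha>))"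
      unfolding s'_def using q0 elim by (subst powr_mult) auto
    also have "(1 / q) powr (1 / \<alpha>) = \<epsilon> / 2"
    proof -
      have "1 / q = (\<epsilon> / 2) powr \<alpha>" using \<epsilon> by (simp add: q powr_divide)
      then show ?thesis using \<alpha> \<epsilon> by (simp add: powr_powr)
    qed
    finally have t: "2 * s' powr (1 / \<alpha>) = \<epsilon> * s powr (1 / \<alpha>)" by simp
    have C0: "0 \<le> (real k * ln s') ^ (k - 1) / s'"
      using ln1 s' by (intro divide_nonneg_pos zero_le_power mult_nonneg_nonneg) linarith+
    have "ennreal (prob {w\<in>space P. \<not> X w \<le> Y w + ennreal (2 * s' powr (1 / \<alpha>))}) \<le>
      ennreal (K / s') + ennreal ((real k * ln s') ^ (k - 1) / s') * (ennreal (D\<^sup>2) * Theta (\<lambda>u. F u - H u))"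
      by (rule Approx_compare[OF X Y s'(1) ln1])
    also have "\<dots> \<le> ennreal (K / s') + ennreal ((real k * ln s') ^ (k - 1) / s') * (ennreal (D\<^sup>2) * ennreal \<eta>)"
      using \<eta> by (intro add_left_mono mult_left_mono) auto
    also have "\<dots> = ennreal (K / s' + (real k * ln s') ^ (k - 1) / s' * B)"
      unfolding B_def using C0 \<eta>(1) K s'(1) by (simp only: ennreal_plus ennreal_mult mult_nonneg_nonneg divide_nonneg_pos zero_le_power2)
    finally have "prob {w\<in>space P. \<not> X w \<le> Y w + ennreal (\<epsilon> * s powr (1 / \<alpha>))} \<le> K / s' + (real k * ln s') ^ (k - 1) / s' * B"
      unfolding t using C0 B0 K s'(1)
      by (subst (asm) ennreal_le_iff) (simp_all only: add_nonneg_nonneg mult_nonneg_nonneg divide_nonneg_pos)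
    then have "s / ln s ^ (k - 1) * prob {w\<in>space P. \<not> X w \<le> Y w + ennreal (\<epsilon> * s powr (1 / \<alpha>))} \<le>
       s / ln s ^ (k - 1) * (K / s' + (real k * ln s') ^ (k - 1) / s' * B)"
      using elim by (intro mult_left_mono) auto
    also have "\<dots> = g s"
    proof -
      have "ln s \<noteq> 0" using elim by simp
      then show ?thesis unfolding g_def s'_def[symmetric] using q0 elim s'(1)
        by (simp add: s'_def[symmetric] distrib_left power_mult_distrib power_divide)
          (simp add: s'_def field_simps)
    qed
    finally show ?case .
  qed
  ultimately show ?thesis unfolding B_def by auto
qed

lemma tail_events:
  fixes X Y :: "'w \<Rightarrow> ennreal"
  assumes "X \<in> borel_measurable P" "Y \<in> borel_measurable P"
  shows "{w\<in>space P. c < X w} \<in> events" "{w\<in>space P. \<not> X w \<le> Y w + c} \<in> events"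
  using assms by measurable

text \<open>If \<open>X\<close> exceeds a threshold, then \<open>Y\<close> exceeds the fraction
  \<open>1 - \<epsilon>\<close> of it or \<open>X\<close> exceeds \<open>Y\<close> by the fraction
  \<open>\<epsilon>\<close>. Lowering the threshold multiplies the limit by
  \<open>(1 - \<epsilon>) powr (- \<alpha>)\<close>.\<close>

lemma Approx_tail_upper:
  assumes X: "Approx X F" and Y: "Approx Y H" and \<eta>: "0 \<le> \<eta>" "Theta (\<lambda>u. F u - H u) \<le> ennreal \<eta>"
    and \<epsilon>: "0 < \<epsilon>" "\<epsilon> < 1" and lim: "((\<lambda>s. s / ln s ^ (k - 1) * tail Y s) \<longlongrightarrow> l) at_top"
  shows "\<exists>g. (g \<longlongrightarrow> (1 - \<epsilon>) powr (- \<alpha>) * l + (2 / \<epsilon>) powr \<alpha> * (real k ^ (k - 1) * (D\<^sup>2 * \<eta>))) at_top \<and>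
    eventually (\<lambda>s. s / ln s ^ (k - 1) * tail X s \<le> g s) at_top"
proof -
  note XY = ApproxD(1)[OF X] ApproxD(1)[OF Y]
  note ev = tail_events(1)[OF XY(2,1)] tail_events(2)[OF XY]
  define b where "b = (1 - \<epsilon>) powr (- \<alpha>)"
  have b: "0 < b" using \<epsilon> by (simp add: b_def)
  obtain g where g: "(g \<longlongrightarrow> (2 / \<epsilon>) powr \<alpha> * (real k ^ (k - 1) * (D\<^sup>2 * \<eta>))) at_top"
    "eventually (\<lambda>s. s / ln s ^ (k - 1) * prob {w\<in>space P. \<not> X w \<le> Y w + ennreal (\<epsilon> * s powr (1 / \<alpha>))} \<le> g s) at_top"
    using Approx_tail_diff[OF X Y \<eta> \<epsilon>(1) refl] by blast
  have "((\<lambda>s. s / ln s ^ (k - 1) * tail Y (s / b) + g s) \<longlongrightarrow> b * l + (2 / \<epsilon>) powr \<alpha> * (real k ^ (k - 1) * (D\<^sup>2 * \<eta>))) at_top"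
    by (intro tendsto_add g(1) tail_asymp_scale[OF lim b])
  moreover have "eventually (\<lambda>s. s / ln s ^ (k - 1) * tail X s \<le> s / ln s ^ (k - 1) * tail Y (s / b) + g s) at_top"
    using g(2) eventually_gt_at_top[of 1]
  proof eventually_elim
    case (elim s)
    let ?t = "s powr (1 / \<alpha>)"
    have "(s / b) powr (1 / \<alpha>) = ((1 - \<epsilon>) powr \<alpha>) powr (1 / \<alpha>) * ?t"
      using elim \<epsilon> unfolding b_def powr_minus divide_inverse inverse_inverse_eq by (subst powr_mult) auto
    then have t: "(s / b) powr (1 / \<alpha>) = (1 - \<epsilon>) * ?t" using \<alpha> \<epsilon> by (simp add: powr_powr)
    let ?E = "{w\<in>space P. \<not> X w \<le> Y w + ennreal (\<epsilon> * ?t)}"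
    have "tail X s \<le> prob ({w\<in>space P. ennreal ((s / b) powr (1 / \<alpha>)) < Y w} \<union> ?E)"
    proof (intro finite_measure_mono subsetI)
      fix w assume w: "w \<in> {w\<in>space P. ennreal ?t < X w}"
      show "w \<in> {w\<in>space P. ennreal ((s / b) powr (1 / \<alpha>)) < Y w} \<union> ?E"
      proof (rule ccontr)
        assume "w \<notin> {w\<in>space P. ennreal ((s / b) powr (1 / \<alpha>)) < Y w} \<union> ?E"
        then have le: "X w \<le> Y w + ennreal (\<epsilon> * ?t)" "Y w \<le> ennreal ((1 - \<epsilon>) * ?t)"
          using w by (auto simp: t not_less)
        have "X w \<le> ennreal ((1 - \<epsilon>) * ?t) + ennreal (\<epsilon> * ?t)" using le by (meson add_right_mono order_trans)
        also have "\<dots> = ennreal ((1 - \<epsilon>) * ?t + \<epsilon> * ?t)" using \<epsilon> by (intro ennreal_plus[symmetric]) auto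
        also have "(1 - \<epsilon>) * ?t + \<epsilon> * ?t = ?t" by (simp add: algebra_simps)
        finally show False using w by auto
      qed
    qed (rule sets.Un[OF ev])
    also have "\<dots> \<le> tail Y (s / b) + prob ?E" by (rule measure_Un_le[OF ev])
    finally have "s / ln s ^ (k - 1) * tail X s \<le> s / ln s ^ (k - 1) * (tail Y (s / b) + prob ?E)"
      using elim by (intro mult_left_mono) auto
    then show ?case using elim(1) by (simp add: distrib_left)
  qed
  ultimately show ?thesis unfolding b_def by blast
qed

text \<open>If \<open>Y\<close> exceeds \<open>1 + \<epsilon>\<close> times a threshold, then
  \<open>X\<close> exceeds the threshold or \<open>Y\<close> exceeds \<open>X\<close> by the
  fraction \<open>\<epsilon>\<close> of it.\<close>

lemma Approx_tail_lower:
  assumes X: "Approx X F" and Y: "Approx Y H" and \<eta>: "0 \<le> \<eta>" "Theta (\<lambda>u. F u - H u) \<le> ennreal \<eta>"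
    and \<epsilon>: "0 < \<epsilon>" and lim: "((\<lambda>s. s / ln s ^ (k - 1) * tail Y s) \<longlongrightarrow> l) at_top"
  shows "\<exists>g. (g \<longlongrightarrow> (1 + \<epsilon>) powr (- \<alpha>) * l - (2 / \<epsilon>) powr \<alpha> * (real k ^ (k - 1) * (D\<^sup>2 * \<eta>))) at_top \<and>
    eventually (\<lambda>s. g s \<le> s / ln s ^ (k - 1) * tail X s) at_top"
proof -
  note XY = ApproxD(1)[OF X] ApproxD(1)[OF Y]
  note ev = tail_events(1)[OF XY] tail_events(2)[OF XY(2,1)]
  define b where "b = (1 + \<epsilon>) powr (- \<alpha>)"
  have b: "0 < b" using \<epsilon> by (simp add: b_def)
  have \<eta>': "Theta (\<lambda>u. H u - F u) \<le> ennreal \<eta>" using \<eta>(2) by (subst Theta_uminus)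
  obtain g where g: "(g \<longlongrightarrow> (2 / \<epsilon>) powr \<alpha> * (real k ^ (k - 1) * (D\<^sup>2 * \<eta>))) at_top"
    "eventually (\<lambda>s. s / ln s ^ (k - 1) * prob {w\<in>space P. \<not> Y w \<le> X w + ennreal (\<epsilon> * s powr (1 / \<alpha>))} \<le> g s) at_top"
    using Approx_tail_diff[OF Y X \<eta>(1) \<eta>' \<epsilon>(1) refl] by blast
  have "((\<lambda>s. s / ln s ^ (k - 1) * tail Y (s / b) - g s) \<longlongrightarrow> b * l - (2 / \<epsilon>) powr \<alpha> * (real k ^ (k - 1) * (D\<^sup>2 * \<eta>))) at_top"
    by (intro tendsto_diff g(1) tail_asymp_scale[OF lim b])
  moreover have "eventually (\<lambda>s. s / ln s ^ (k - 1) * tail Y (s / b) - g s \<le> s / ln s ^ (k - 1) * tail X s) at_top"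
    using g(2) eventually_gt_at_top[of 1]
  proof eventually_elim
    case (elim s)
    let ?t = "s powr (1 / \<alpha>)"
    have "(s / b) powr (1 / \<alpha>) = ((1 + \<epsilon>) powr \<alpha>) powr (1 / \<alpha>) * ?t"
      using elim \<epsilon> unfolding b_def powr_minus divide_inverse inverse_inverse_eq by (subst powr_mult) auto
    then have t: "(s / b) powr (1 / \<alpha>) = (1 + \<epsilon>) * ?t" using \<alpha> \<epsilon> by (simp add: powr_powr)
    let ?E = "{w\<in>space P. \<not> Y w \<le> X w + ennreal (\<epsilon> * ?t)}"
    have "tail Y (s / b) \<le> prob ({w\<in>space P. ennreal ?t < X w} \<union> ?E)"
    proof (intro finite_measure_mono subsetI)
      fix w assume w: "w \<in> {w\<in>space P. ennreal ((s / b) powr (1 / \<alpha>)) < Y w}"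
      show "w \<in> {w\<in>space P. ennreal ?t < X w} \<union> ?E"
      proof (rule ccontr)
        assume "w \<notin> {w\<in>space P. ennreal ?t < X w} \<union> ?E"
        then have le: "Y w \<le> X w + ennreal (\<epsilon> * ?t)" "X w \<le> ennreal ?t"
          using w by (auto simp: not_less)
        have "Y w \<le> ennreal ?t + ennreal (\<epsilon> * ?t)" using le by (meson add_right_mono order_trans)
        also have "\<dots> = ennreal (?t + \<epsilon> * ?t)" using \<epsilon> by (intro ennreal_plus[symmetric]) auto
        also have "?t + \<epsilon> * ?t = (1 + \<epsilon>) * ?t" by (simp add: algebra_simps)
        finally show False using w by (auto simp: t)
      qed
    qed (rule sets.Un[OF ev])
    also have "\<dots> \<le> tail X s + prob ?E" by (rule measure_Un_le[OF ev])
    finally have "s / ln s ^ (k - 1) * tail Y (s / b) \<le> s / ln s ^ (k - 1) * (tail X s + prob ?E)"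
      using elim by (intro mult_left_mono) auto
    then show ?case using elim(1) by (simp add: distrib_left)
  qed
  ultimately show ?thesis unfolding b_def by blast
qed

text \<open>Cell maxima have the asserted limit and are approximable themselves, so \<open>X\<close>
  is compared with one whose integrand is \<open>\<eta>\<close>-close in the gauge. The order of
  choices matters: \<open>\<epsilon>\<close> is fixed before \<open>\<eta>\<close>, because the
  comparison error carries the factor \<open>(2 / \<epsilon>) powr \<alpha>\<close>.\<close>

theorem Approx_tail_asymp:
  assumes X: "Approx X F"
  shows "symI F < \<infinity>"
    and "((\<lambda>s. s / ln s ^ (k - 1) * tail X s) \<longlongrightarrow> real k / (fact k)\<^sup>2 * enn2real (symI F)) at_top"
proof -
  note F = ApproxD(2)[OF X]
  have approx: "\<exists>n a. (\<forall>\<sigma>. 0 \<le> a \<sigma>) \<and> Theta (\<lambda>u. F u - G n a u) \<le> ennreal \<eta>" if \<eta>: "0 < \<eta>" for \<eta>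
    using ApproxD(3)[OF X \<eta>] by (meson order_refl)
  have Glim: "symI (G n a) < \<infinity>"
    "((\<lambda>s. s / ln s ^ (k - 1) * tail (J n a) s) \<longlongrightarrow> real k / (fact k)\<^sup>2 * enn2real (symI (G n a))) at_top"
    if "\<And>\<sigma>. 0 \<le> a \<sigma>" for n a
    using J_asymp[where n=n and a=a, OF that] by (simp_all only: symI_def)
  show fin: "symI F < \<infinity>"
  proof -
    obtain n a where a: "\<And>\<sigma>. 0 \<le> a \<sigma>" "Theta (\<lambda>u. F u - G n a u) \<le> ennreal 1" using approx[of 1] by auto
    show ?thesis
      by (rule symI_real_split(1)[OF F G_measurable, of "1/2" 1]) (use a Glim(1) in auto)
  qed
  define c where "c = real k / (fact k)\<^sup>2"
  have c: "0 \<le> c" by (simp add: c_def)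
  define iF where "iF = enn2real (symI F)"
  define \<kappa> where "\<kappa> = real k ^ (k - 1) * D\<^sup>2"
  have \<kappa>: "0 \<le> \<kappa>" by (simp add: \<kappa>_def)
  show "((\<lambda>s. s / ln s ^ (k - 1) * tail X s) \<longlongrightarrow> real k / (fact k)\<^sup>2 * enn2real (symI F)) at_top"
    unfolding c_def[symmetric] iF_def[symmetric]
  proof (rule tendsto_squeeze_eps)
    fix e :: real assume e: "0 < e"
    have "((\<lambda>\<epsilon>. (1 + \<epsilon>) powr (- \<alpha>) * (c * ((1 - \<epsilon>) powr \<alpha> * iF))) \<longlongrightarrow> (1 + 0) powr (- \<alpha>) * (c * ((1 - 0) powr \<alpha> * iF))) (at_right 0)"
      by (intro tendsto_intros) auto
    then have "eventually (\<lambda>\<epsilon>. c * iF - e / 2 < (1 + \<epsilon>) powr (- \<alpha>) * (c * ((1 - \<epsilon>) powr \<alpha> * iF))) (at_right 0)"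
      using e by (intro order_tendstoD(1)) auto
    moreover have "eventually (\<lambda>\<epsilon>::real. 0 < \<epsilon> \<and> \<epsilon> < 1) (at_right 0)"
      unfolding eventually_at_right_field by (intro exI[of _ 1]) auto
    ultimately have "eventually (\<lambda>\<epsilon>. c * iF - e / 2 < (1 + \<epsilon>) powr (- \<alpha>) * (c * ((1 - \<epsilon>) powr \<alpha> * iF)) \<and> 0 < \<epsilon> \<and> \<epsilon> < 1) (at_right 0)"
      by eventually_elim simp
    then obtain \<epsilon> where \<epsilon>: "c * iF - e / 2 < (1 + \<epsilon>) powr (- \<alpha>) * (c * ((1 - \<epsilon>) powr \<alpha> * iF))" "0 < \<epsilon>" "\<epsilon> < 1"
      using eventually_happens'[OF trivial_limit_at_right_real] by blast
    \<comment> \<open>\<open>r\<close> collects every coefficient of \<open>\<eta>\<close> in the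
      lower bound: from the change of the symmetrised integral and from the comparison of
      tails.\<close>
    define r where "r = (1 + \<epsilon>) powr (- \<alpha>) * (c * ((1 - \<epsilon>) powr \<alpha> * (\<epsilon> powr (- \<alpha>) * fact k))) + (2 / \<epsilon>) powr \<alpha> * \<kappa>"
    have r: "0 \<le> r" using c \<kappa> \<epsilon> by (simp add: r_def)
    define \<eta> where "\<eta> = e / (2 * (r + 1))"
    have \<eta>: "0 < \<eta>" "r * \<eta> \<le> e / 2"
      using e r by (auto simp: \<eta>_def field_simps)
    obtain n a where a: "\<And>\<sigma>. 0 \<le> a \<sigma>" "Theta (\<lambda>u. F u - G n a u) \<le> ennreal \<eta>" using approx[OF \<eta>(1)] by blast
    define iG where "iG = enn2real (symI (G n a))"
    have "iF \<le> (1 - \<epsilon>) powr (- \<alpha>) * iG + \<epsilon> powr (- \<alpha>) * (fact k * \<eta>)"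
      unfolding iF_def iG_def by (rule symI_real_split(2)[OF F G_measurable]) (use \<epsilon> \<eta> a Glim(1) in auto)
    then have "(1 - \<epsilon>) powr \<alpha> * iF \<le> (1 - \<epsilon>) powr \<alpha> * ((1 - \<epsilon>) powr (- \<alpha>) * iG + \<epsilon> powr (- \<alpha>) * (fact k * \<eta>))"
      by (intro mult_left_mono) auto
    also have "\<dots> = iG + (1 - \<epsilon>) powr \<alpha> * (\<epsilon> powr (- \<alpha>) * (fact k * \<eta>))"
      using \<epsilon> by (simp add: distrib_left mult.assoc[symmetric] powr_add[symmetric])
    finally have "(1 - \<epsilon>) powr \<alpha> * iF - (1 - \<epsilon>) powr \<alpha> * (\<epsilon> powr (- \<alpha>) * (fact k * \<eta>)) \<le> iG" by simp
    then have "(1 + \<epsilon>) powr (- \<alpha>) * (c * ((1 - \<epsilon>) powr \<alpha> * iF - (1 - \<epsilon>) powr \<alpha> * (\<epsilon> powr (- \<alpha>) * (fact k * \<eta>)))) \<le> (1 + \<epsilon>) powr (- \<alpha>) * (c * iG)"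
      using c by (intro mult_left_mono) auto
    then have "(1 + \<epsilon>) powr (- \<alpha>) * (c * ((1 - \<epsilon>) powr \<alpha> * iF)) - r * \<eta> \<le> (1 + \<epsilon>) powr (- \<alpha>) * (c * iG) - (2 / \<epsilon>) powr \<alpha> * (\<kappa> * \<eta>)"
      unfolding r_def by (simp only: right_diff_distrib distrib_left distrib_right mult_ac)
    then have "c * iF - e < (1 + \<epsilon>) powr (- \<alpha>) * (c * iG) - (2 / \<epsilon>) powr \<alpha> * (real k ^ (k - 1) * (D\<^sup>2 * \<eta>))"
      using \<epsilon>(1) \<eta>(2) unfolding \<kappa>_def mult.assoc by linarith
    moreover have "\<exists>g. (g \<longlongrightarrow> (1 + \<epsilon>) powr (- \<alpha>) * (c * iG) - (2 / \<epsilon>) powr \<alpha> * (real k ^ (k - 1) * (D\<^sup>2 * \<eta>))) at_top \<and>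
        eventually (\<lambda>s. g s \<le> s / ln s ^ (k - 1) * tail X s) at_top"
      unfolding c_def iG_def
      by (rule Approx_tail_lower[OF X Approx_J _ a(2) \<epsilon>(2) Glim(2)]) (use a \<eta> in auto)
    ultimately show "\<exists>g l. (g \<longlongrightarrow> l) at_top \<and> c * iF - e < l \<and> (\<forall>\<^sub>F s in at_top. g s \<le> s / ln s ^ (k - 1) * tail X s)"
      by blast
  next
    fix e :: real assume e: "0 < e"
    have "((\<lambda>\<epsilon>. (1 - \<epsilon>) powr (- \<alpha>) * (c * ((1 - \<epsilon>) powr (- \<alpha>) * iF))) \<longlongrightarrow> (1 - 0) powr (- \<alpha>) * (c * ((1 - 0) powr (- \<alpha>) * iF))) (at_right 0)"
      by (intro tendsto_intros) auto
    then have "eventually (\<lambda>\<epsilon>. (1 - \<epsilon>) powr (- \<alpha>) * (c * ((1 - \<epsilon>) powr (- \<alpha>) * iF)) < c * iF + e / 2) (at_right 0)"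
      using e by (intro order_tendstoD(2)) auto
    moreover have "eventually (\<lambda>\<epsilon>::real. 0 < \<epsilon> \<and> \<epsilon> < 1) (at_right 0)"
      unfolding eventually_at_right_field by (intro exI[of _ 1]) auto
    ultimately have "eventually (\<lambda>\<epsilon>. (1 - \<epsilon>) powr (- \<alpha>) * (c * ((1 - \<epsilon>) powr (- \<alpha>) * iF)) < c * iF + e / 2 \<and> 0 < \<epsilon> \<and> \<epsilon> < 1) (at_right 0)"
      by eventually_elim simp
    then obtain \<epsilon> where \<epsilon>: "(1 - \<epsilon>) powr (- \<alpha>) * (c * ((1 - \<epsilon>) powr (- \<alpha>) * iF)) < c * iF + e / 2" "0 < \<epsilon>" "\<epsilon> < 1"
      using eventually_happens'[OF trivial_limit_at_right_real] by blast
    \<comment> \<open>The corresponding coefficient for the upper bound, where the symmetrised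
      integrals are estimated in the opposite direction.\<close>
    define r where "r = (1 - \<epsilon>) powr (- \<alpha>) * (c * (\<epsilon> powr (- \<alpha>) * fact k)) + (2 / \<epsilon>) powr \<alpha> * \<kappa>"
    have r: "0 \<le> r" using c \<kappa> \<epsilon> by (simp add: r_def)
    define \<eta> where "\<eta> = e / (2 * (r + 1))"
    have \<eta>: "0 < \<eta>" "r * \<eta> \<le> e / 2"
      using e r by (auto simp: \<eta>_def field_simps)
    obtain n a where a: "\<And>\<sigma>. 0 \<le> a \<sigma>" "Theta (\<lambda>u. F u - G n a u) \<le> ennreal \<eta>" using approx[OF \<eta>(1)] by blast
    define iG where "iG = enn2real (symI (G n a))"
    have a': "Theta (\<lambda>u. G n a u - F u) \<le> ennreal \<eta>" using a(2) by (subst Theta_uminus)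
    have "iG \<le> (1 - \<epsilon>) powr (- \<alpha>) * iF + \<epsilon> powr (- \<alpha>) * (fact k * \<eta>)"
      unfolding iF_def iG_def by (rule symI_real_split(2)[OF G_measurable F]) (use \<epsilon> \<eta> a' fin in auto)
    then have "(1 - \<epsilon>) powr (- \<alpha>) * (c * iG) \<le> (1 - \<epsilon>) powr (- \<alpha>) * (c * ((1 - \<epsilon>) powr (- \<alpha>) * iF + \<epsilon> powr (- \<alpha>) * (fact k * \<eta>)))"
      using c by (intro mult_left_mono) auto
    then have "(1 - \<epsilon>) powr (- \<alpha>) * (c * iG) + (2 / \<epsilon>) powr \<alpha> * (\<kappa> * \<eta>) \<le> (1 - \<epsilon>) powr (- \<alpha>) * (c * ((1 - \<epsilon>) powr (- \<alpha>) * iF)) + r * \<eta>"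
      unfolding r_def by (simp only: distrib_left distrib_right mult_ac)
    then have "(1 - \<epsilon>) powr (- \<alpha>) * (c * iG) + (2 / \<epsilon>) powr \<alpha> * (real k ^ (k - 1) * (D\<^sup>2 * \<eta>)) < c * iF + e"
      using \<epsilon>(1) \<eta>(2) unfolding \<kappa>_def mult.assoc by linarith
    moreover have "\<exists>g. (g \<longlongrightarrow> (1 - \<epsilon>) powr (- \<alpha>) * (c * iG) + (2 / \<epsilon>) powr \<alpha> * (real k ^ (k - 1) * (D\<^sup>2 * \<eta>))) at_top \<and>
        eventually (\<lambda>s. s / ln s ^ (k - 1) * tail X s \<le> g s) at_top"
      unfolding c_def iG_def
      by (rule Approx_tail_upper[OF X Approx_J _ a(2) \<epsilon>(2,3) Glim(2)]) (use a \<eta> in auto)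
    ultimately show "\<exists>g l. (g \<longlongrightarrow> l) at_top \<and> l < c * iF + e \<and> (\<forall>\<^sub>F s in at_top. s / ln s ^ (k - 1) * tail X s \<le> g s)"
      by blast
  qed
qed

end

section \<open>Multiple extremal integrals\<close>

text \<open>Eventually the absolute value of \<open>y j\<close> is below 1; then the logarithmic
  factor is bounded by its value at \<open>v\<close>, and the power tends to 0.\<close>

lemma theta_tendsto_0:
  assumes y: "(y \<longlongrightarrow> 0) G" and a: "0 < a" and v: "0 \<le> v"
  shows "((\<lambda>j. theta a k (y j) v) \<longlongrightarrow> 0) G"
proof (rule tendsto_sandwich[OF _ _ tendsto_const])
  have y': "((\<lambda>j. \<bar>y j\<bar>) \<longlongrightarrow> 0) G" using y by (rule tendsto_rabs_zero)
  have "((\<lambda>j. \<bar>y j\<bar> powr a) \<longlongrightarrow> 0) G"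
    by (rule tendsto_zero_powrI[OF y' tendsto_const]) (use a in auto)
  then show "((\<lambda>j. \<bar>y j\<bar> powr a * (1 + ln_plus v) ^ (k - 1)) \<longlongrightarrow> 0) G"
    by (rule tendsto_mult_left_zero)
  have "eventually (\<lambda>j. \<bar>y j\<bar> < 1) G" using y' by (intro order_tendstoD(2)) auto
  then show "eventually (\<lambda>j. theta a k (y j) v \<le> \<bar>y j\<bar> powr a * (1 + ln_plus v) ^ (k - 1)) G"
  proof eventually_elim
    case (elim j)
    have "\<bar>y j\<bar> powr a \<le> 1" using elim a by (simp add: powr_le1)
    then have "\<bar>y j\<bar> powr a * v \<le> v" using v by (intro mult_left_le_one_le) auto
    then show ?case
      unfolding theta_def by (intro mult_left_mono power_mono add_left_mono ln_plus_mono) auto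
  qed
qed simp

text \<open>The sets are the level sets of the nonzero values: disjoint, and off-diagonal because
  \<open>g\<close> vanishes on the diagonal. Finiteness of \<open>g\<close> makes the coefficients
  positive reals.\<close>

lemma simple_function_data:
  assumes g: "simple_function (kpow k \<mu>) g" and fin: "\<And>u. u \<in> space (kpow k \<mu>) \<Longrightarrow> g u < \<infinity>"
    and off: "\<And>u. u \<in> space (kpow k \<mu>) - offdiag k \<mu> \<Longrightarrow> g u = 0"
  shows "\<exists>n a A. simple_data k \<mu> n a A \<and> (\<forall>u\<in>space (kpow k \<mu>). simple_fun n a A u = g u)"
proof -
  define S where "S = g ` space (kpow k \<mu>) - {0}"
  have "finite S" using g by (auto simp: S_def simple_function_def)
  then obtain h where h: "bij_betw h {..<card S} S"
    using ex_bij_betw_nat_finite by (auto simp: atLeast0LessThan)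
  define A where "A i = g -` {h i} \<inter> space (kpow k \<mu>)" for i
  define a where "a i = enn2real (h i)" for i
  have hS: "h i \<in> S" if "i < card S" for i using h that by (auto simp: bij_betw_def)
  have hfin: "h i < \<infinity>" "h i \<noteq> 0" if "i < card S" for i
    using hS[OF that] fin by (auto simp: S_def)
  have a: "ennreal (a i) = h i" if "i < card S" for i using hfin[OF that] by (simp add: a_def)
  have "simple_data k \<mu> (card S) a A"
    unfolding simple_data_def
  proof (intro conjI allI impI)
    fix i assume i: "i < card S"
    show "0 < a i" using hfin[OF i] by (simp add: a_def enn2real_positive_iff zero_less_iff_neq_zero)
    have "A i \<in> sets (kpow k \<mu>)" unfolding A_def using simple_functionD(2)[OF g] by simp
    moreover have "A i \<subseteq> offdiag k \<mu>"
    proof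
      fix u assume "u \<in> A i"
      then have "u \<in> space (kpow k \<mu>)" "g u \<noteq> 0" using hfin[OF i] by (auto simp: A_def)
      then show "u \<in> offdiag k \<mu>" using off by blast
    qed
    ultimately show "A i \<in> offdiag_sets k \<mu>" unfolding offdiag_sets_def by blast
  next
    show "disjoint_family_on A {..<card S}"
      unfolding disjoint_family_on_def
    proof (intro ballI impI)
      fix i j assume "i \<in> {..<card S}" "j \<in> {..<card S}" "i \<noteq> j"
      then have "h i \<noteq> h j" using h by (auto simp: bij_betw_def dest: inj_onD)
      then show "A i \<inter> A j = {}" by (auto simp: A_def)
    qed
  qed
  moreover have "simple_fun (card S) a A u = g u" if u: "u \<in> space (kpow k \<mu>)" for u
  proof -
    have "simple_fun (card S) a A u = (\<Sum>i<card S. if g u = h i then h i else 0)"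
      unfolding simple_fun_def using u by (intro sum.cong) (auto simp: a A_def)
    also have "\<dots> = (\<Sum>y\<in>S. if g u = y then y else 0)"
      by (rule sum.reindex_bij_betw[OF h, of "\<lambda>y. if g u = y then y else 0"])
    also have "\<dots> = (if g u \<in> S then g u else 0)" using \<open>finite S\<close> by simp
    also have "\<dots> = g u" using u by (auto simp: S_def)
    finally show ?thesis .
  qed
  ultimately show ?thesis by blast
qed

context extremal_setup
begin

text \<open>Dominated convergence: since \<open>0 \<le> F j \<le> H\<close>, the gauge integrand of
  the difference lies below that of \<open>H\<close>.\<close>

lemma Theta_diff_tendsto_0:
  assumes F[measurable]: "\<And>j. F j \<in> borel_measurable (kpow k \<mu>)" and H[measurable]: "H \<in> borel_measurable (kpow k \<mu>)"
    and HT: "Theta H < \<infinity>" and le: "AE u in kpow k \<mu>. \<forall>j. 0 \<le> F j u \<and> F j u \<le> H u"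
    and lim: "AE u in kpow k \<mu>. (\<lambda>j. F j u) \<longlonglongrightarrow> H u"
  shows "(\<lambda>j. Theta (\<lambda>u. H u - F j u)) \<longlonglongrightarrow> 0"
proof -
  have "(\<lambda>j. Theta (\<lambda>u. H u - F j u)) \<longlonglongrightarrow> (\<integral>\<^sup>+u. 0 \<partial>kpow k \<mu>)"
    unfolding Theta_def
  proof (rule nn_integral_dominated_convergence[where w="\<lambda>u. ennreal (theta \<alpha> k (H u) (V u))"])
    show "AE u in kpow k \<mu>. ennreal (theta \<alpha> k (H u - F j u) (V u)) \<le> ennreal (theta \<alpha> k (H u) (V u))" for j
      using le
    proof eventually_elim
      case (elim u)
      then have "0 \<le> F j u \<and> F j u \<le> H u" by blast
      then show ?case using V_pos[of u] \<alpha> by (intro ennreal_leI theta_mono) auto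
    qed
    show "(\<integral>\<^sup>+u. ennreal (theta \<alpha> k (H u) (V u)) \<partial>kpow k \<mu>) < \<infinity>" using HT by (simp add: Theta_def)
    show "AE u in kpow k \<mu>. (\<lambda>j. ennreal (theta \<alpha> k (H u - F j u) (V u))) \<longlonglongrightarrow> 0"
      using lim
    proof eventually_elim
      case (elim u)
      have "(\<lambda>j. H u - F j u) \<longlonglongrightarrow> H u - H u" using elim by (intro tendsto_intros)
      then have "(\<lambda>j. theta \<alpha> k (H u - F j u) (V u)) \<longlonglongrightarrow> 0"
        using V_pos[of u] \<alpha> by (intro theta_tendsto_0) auto
      then show ?case using tendsto_ennrealI by fastforce
    qed
  qed measurable
  then show ?thesis by simp
qed

section \<open>From indicators to extremal integrals\<close>

lemma E_mono: "n \<le> n' \<Longrightarrow> E n \<subseteq> E n'"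
  by (auto simp: E_eq)

text \<open>Running maxima are used because only the supremum of the \<open>N' n\<close> is given,
  not their monotonicity. Their integrands are the indicators of \<open>A \<inter> EP j\<close>,
  which increase to that of \<open>A\<close>.\<close>

lemma Approx_N:
  assumes N: "\<And>A. A \<in> offdiag_sets k \<mu> \<Longrightarrow> N A \<in> borel_measurable P"
      "\<And>A. A \<in> offdiag_sets k \<mu> \<Longrightarrow> AE w in P. N A w = (SUP n. N' n A w)"
    and A: "A \<in> offdiag_sets k \<mu>" and T: "Theta (indicator A) < \<infinity>"
  shows "Approx (N A) (indicator A)"
proof (rule Approx_limit(2))
  have A'[measurable]: "A \<in> sets (kpow k \<mu>)" using A by (simp add: offdiag_sets_eq)
  have EP[measurable]: "EP L \<in> sets (kpow k \<mu>)" for L by (intro sets_PiM_I_finite) auto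
  have EPmono: "EP n \<subseteq> EP n'" if "n \<le> n'" for n n' using E_mono[OF that] by (intro PiE_mono)
  show "Approx (\<lambda>w. SUP n\<in>{..j}. N' n A w) (indicator (A \<inter> EP j))" for j
  proof (rule Approx_SUP)
    show "Approx (N' n A) (indicator (A \<inter> EP n))" for n using A by (rule Approx_N')
    show "(indicator (A \<inter> EP n) u :: real) \<le> indicator (A \<inter> EP j) u" if "n \<in> {..j}" for n u
      using EPmono[of n j] that by (auto split: split_indicator)
    show "\<exists>n\<in>{..j}. (indicator (A \<inter> EP j) u :: real) = indicator (A \<inter> EP n) u" for u by auto
  qed auto
  show "N A \<in> borel_measurable P" using N A by blast
  show "AE w in P. (\<lambda>j. SUP n\<in>{..j}. N' n A w) \<longlonglongrightarrow> N A w"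
    using N(2)[OF A]
  proof eventually_elim
    case (elim w)
    have "(\<lambda>j. SUP n\<in>{..j}. N' n A w) \<longlonglongrightarrow> (SUP j. SUP n\<in>{..j}. N' n A w)"
      by (intro LIMSEQ_SUP incseq_SucI SUP_subset_mono) auto
    also have "(SUP j. SUP n\<in>{..j}. N' n A w) = (SUP n. N' n A w)"
    proof (intro antisym)
      show "(SUP j. SUP n\<in>{..j}. N' n A w) \<le> (SUP n. N' n A w)"
        by (intro SUP_least SUP_upper) auto
      show "(SUP n. N' n A w) \<le> (SUP j. SUP n\<in>{..j}. N' n A w)"
      proof (rule SUP_least)
        fix n
        have "N' n A w \<le> (SUP m\<in>{..n}. N' m A w)" by (intro SUP_upper) auto
        also have "\<dots> \<le> (SUP j. SUP n\<in>{..j}. N' n A w)" by (intro SUP_upper) auto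
        finally show "N' n A w \<le> (SUP j. SUP n\<in>{..j}. N' n A w)" .
      qed
    qed
    finally show ?case using elim by simp
  qed
  show "(\<lambda>j. Theta (\<lambda>u. indicator A u - indicator (A \<inter> EP j) u)) \<longlonglongrightarrow> 0"
  proof (rule Theta_diff_tendsto_0)
    show "AE u in kpow k \<mu>. \<forall>j. 0 \<le> (indicator (A \<inter> EP j) u :: real) \<and> indicator (A \<inter> EP j) u \<le> (indicator A u :: real)"
      by (auto split: split_indicator)
    show "AE u in kpow k \<mu>. (\<lambda>j. indicator (A \<inter> EP j) u :: real) \<longlonglongrightarrow> indicator A u"
    proof (rule AE_I2)
      fix u assume u: "u \<in> space (kpow k \<mu>)"
      \<comment> \<open>The sum of the layers serves as a common upper bound for the layers of all
        coordinates.\<close>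
      define n where "n = (\<Sum>r<k. lay (cl (u r)))"
      have "lay (cl (u r)) \<le> n" if "r < k" for r
        unfolding n_def using that by (intro member_le_sum) auto
      then have un: "u \<in> EP n" using u by (auto simp: space_PiM PiE_def Pi_def E_eq)
      have "eventually (\<lambda>j. (indicator (A \<inter> EP j) u :: real) = indicator A u) sequentially"
        using eventually_ge_at_top[of n]
      proof eventually_elim
        case (elim j)
        then have "u \<in> EP j" using EPmono un by blast
        then show ?case by (simp add: indicator_def)
      qed
      then show "(\<lambda>j. indicator (A \<inter> EP j) u :: real) \<longlonglongrightarrow> indicator A u" by (rule tendsto_eventually)
    qed
  qed (use T in auto)
qed (use A T in \<open>auto simp: offdiag_sets_eq\<close>)

text \<open>The sets are disjoint, so the sum is a maximum of its terms and closure under finite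
  maxima applies. Each term lies below the simple function, which makes its gauge finite.\<close>

lemma Approx_simple:
  assumes N: "\<And>A. A \<in> offdiag_sets k \<mu> \<Longrightarrow> N A \<in> borel_measurable P"
      "\<And>A. A \<in> offdiag_sets k \<mu> \<Longrightarrow> AE w in P. N A w = (SUP n. N' n A w)"
    and data: "simple_data k \<mu> n a A" and T: "Theta (\<lambda>u. enn2real (simple_fun n a A u)) < \<infinity>"
  shows "Approx (simple_extremal_integral N n a A) (\<lambda>u. enn2real (simple_fun n a A u))"
proof -
  have a: "0 < a i" "A i \<in> offdiag_sets k \<mu>" if "i < n" for i using data that by (auto simp: simple_data_def)
  have dis: "disjoint_family_on A {..<n}" using data by (simp add: simple_data_def)
  have sf: "enn2real (simple_fun n a A u) = (\<Sum>i<n. a i * indicator (A i) u)" for u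
  proof -
    have "simple_fun n a A u = (\<Sum>i<n. ennreal (a i * indicator (A i) u))"
      unfolding simple_fun_def using a(1)
      by (intro sum.cong) (auto simp: ennreal_mult ennreal_indicator less_imp_le)
    also have "\<dots> = ennreal (\<Sum>i<n. a i * indicator (A i) u)"
      using a(1) by (intro sum_ennreal) (auto simp: less_imp_le)
    finally have "simple_fun n a A u = ennreal (\<Sum>i<n. a i * indicator (A i) u)" .
    moreover have "0 \<le> (\<Sum>i<n. a i * indicator (A i) u)"
      using a(1) by (intro sum_nonneg mult_nonneg_nonneg) (auto simp: less_imp_le)
    ultimately show ?thesis by (simp only: enn2real_ennreal)
  qed
  have Am: "A i \<in> sets (kpow k \<mu>)" if "i < n" for i using a(2)[OF that] by (simp add: offdiag_sets_eq)
  have le: "a i * indicator (A i) u \<le> (\<Sum>i<n. a i * indicator (A i) u)" if "i < n" for i u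
    using that a(1) by (intro member_le_sum) (auto simp: less_imp_le)
  show ?thesis
  proof (cases "n = 0")
    case True
    have "simple_extremal_integral N n a A = (\<lambda>_. 0)" "(\<lambda>u. enn2real (simple_fun n a A u)) = (\<lambda>_. 0)"
      using True by (auto simp: simple_extremal_integral_def[abs_def] simple_fun_def bot_ennreal)
    then show ?thesis using Approx_0 by simp
  next
    case False
    have "Approx (\<lambda>w. SUP i\<in>{..<n}. ennreal (a i) * N (A i) w) (\<lambda>u. \<Sum>i<n. a i * indicator (A i) u)"
    proof (rule Approx_SUP)
      fix i assume i: "i \<in> {..<n}"
      have "Theta (indicator (A i)) = Theta (\<lambda>u. (1 / a i) * (a i * indicator (A i) u))"
        using a(1)[of i] i by simp
      also have "\<dots> \<le> ennreal (theta_const \<alpha> k (max 1 (1 / a i))) * Theta (\<lambda>u. a i * indicator (A i) u)"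
        using a(1)[of i] Am[of i] i by (intro Theta_scale borel_measurable_times borel_measurable_const borel_measurable_indicator) auto
      also have "\<dots> \<le> ennreal (theta_const \<alpha> k (max 1 (1 / a i))) * Theta (\<lambda>u. enn2real (simple_fun n a A u))"
      proof (intro mult_left_mono Theta_mono_AE AE_I2)
        fix u
        have "0 \<le> a i * indicator (A i) u" using a(1)[of i] i by simp
        then show "\<bar>a i * indicator (A i) u\<bar> \<le> \<bar>enn2real (simple_fun n a A u)\<bar>"
          unfolding sf using le[of i u] i by simp
      qed auto
      also have "\<dots> < \<infinity>" using T by (simp add: ennreal_mult_less_top)
      finally have "Approx (N (A i)) (indicator (A i))"
        using a(2)[of i] i by (intro Approx_N N) auto
      then show "Approx (\<lambda>w. ennreal (a i) * N (A i) w) (\<lambda>u. a i * indicator (A i) u)"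
        using a(1)[of i] i by (intro Approx_scale) auto
    next
      show "(\<lambda>u. \<Sum>i<n. a i * indicator (A i) u) \<in> borel_measurable (kpow k \<mu>)"
        using Am by (intro borel_measurable_sum borel_measurable_times borel_measurable_const borel_measurable_indicator) auto
      show "a i * indicator (A i) u \<le> (\<Sum>i<n. a i * indicator (A i) u)" if "i \<in> {..<n}" for i u using le that by simp
      show "\<exists>i\<in>{..<n}. (\<Sum>i<n. a i * indicator (A i) u) = a i * indicator (A i) u" for u
      proof (cases "\<exists>i<n. u \<in> A i")
        case True
        then obtain i where i: "i < n" "u \<in> A i" by auto
        have "(\<Sum>j<n. a j * indicator (A j) u) = (\<Sum>j<n. if j = i then a i * indicator (A i) u else 0)"
        proof (intro sum.cong refl)
          fix j assume j: "j \<in> {..<n}"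
          show "a j * indicator (A j) u = (if j = i then a i * indicator (A i) u else 0)"
          proof (cases "j = i")
            case 2: False
            then have "A j \<inter> A i = {}" using dis i(1) j by (auto simp: disjoint_family_on_def)
            then have "u \<notin> A j" using i(2) by blast
            then show ?thesis using 2 by simp
          qed simp
        qed
        also have "\<dots> = a i * indicator (A i) u" using i(1) by simp
        finally show ?thesis using i(1) by (intro bexI[of _ i]) auto
      next
        case 2: False
        then have "(\<Sum>i<n. a i * indicator (A i) u) = 0" "a 0 * indicator (A 0) u = 0" using False by (auto intro!: sum.neutral)
        then show ?thesis using False by (intro bexI[of _ 0]) auto
      qed
    qed (use False in \<open>auto simp: lessThan_empty_iff\<close>)
    then show ?thesis by (simp add: simple_extremal_integral_def[abs_def] sf)
  qed
qed

text \<open>The defining property of the extremal integral is applied to one increasing sequence of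
  simple functions, admissible because functions below \<open>f\<close> vanish on the diagonal.
  Dominated convergence gives convergence in the gauge.\<close>

lemma Approx_integral:
  assumes N: "\<And>A. A \<in> offdiag_sets k \<mu> \<Longrightarrow> N A \<in> borel_measurable P"
      "\<And>A. A \<in> offdiag_sets k \<mu> \<Longrightarrow> AE w in P. N A w = (SUP n. N' n A w)"
    and f: "f \<in> L_class k \<mu>" and fin: "AE u in kpow k \<mu>. f u < \<infinity>"
    and T: "Theta (\<lambda>u. enn2real (f u)) < \<infinity>" and I: "is_extremal_integral P \<mu> k N f I"
  shows "AE w in P. I w < \<infinity>" "Approx I (\<lambda>u. enn2real (f u))"
proof -
  have fm[measurable]: "f \<in> borel_measurable (kpow k \<mu>)" and f0: "\<And>u. u \<in> space (kpow k \<mu>) - offdiag k \<mu> \<Longrightarrow> f u = 0"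
    using f by (auto simp: L_class_def)
  obtain g where g: "\<And>j. simple_function (kpow k \<mu>) (g j)" "incseq g" "\<And>j u. g j u < top" "\<And>u. (SUP j. g j u) = f u"
    using borel_measurable_implies_simple_function_sequence'[OF fm] by metis
  have gle: "g j u \<le> f u" for j u unfolding g(4)[symmetric] by (intro SUP_upper) auto
  have "\<exists>n a A. simple_data k \<mu> n a A \<and> (\<forall>u\<in>space (kpow k \<mu>). simple_fun n a A u = g j u)" for j
  proof (rule simple_function_data[OF g(1)])
    show "g j u = 0" if "u \<in> space (kpow k \<mu>) - offdiag k \<mu>" for u using gle[of j u] f0[OF that] by simp
  qed (use g(3) in auto)
  then obtain n a A where d: "\<And>j. simple_data k \<mu> (n j) (a j) (A j)"
      "\<And>j u. u \<in> space (kpow k \<mu>) \<Longrightarrow> simple_fun (n j) (a j) (A j) u = g j u" by metis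
  have glim: "(\<lambda>j. g j u) \<longlonglongrightarrow> f u" for u
    unfolding g(4)[symmetric] using g(2) by (intro LIMSEQ_SUP) (auto simp: incseq_def le_fun_def)
  have lim: "AE w in P. (\<lambda>j. simple_extremal_integral N (n j) (a j) (A j) w) \<longlonglongrightarrow> I w"
  proof -
    have 1: "\<forall>j. simple_data k \<mu> (n j) (a j) (A j)" using d(1) by blast
    have 2: "\<forall>j. \<forall>u\<in>space (kpow k \<mu>). simple_fun (n j) (a j) (A j) u \<le> simple_fun (n (Suc j)) (a (Suc j)) (A (Suc j)) u"
      using d(2) g(2) by (auto simp: incseq_Suc_iff le_fun_def)
    have 3: "AE u in kpow k \<mu>. (\<lambda>j. simple_fun (n j) (a j) (A j) u) \<longlonglongrightarrow> f u"
      using glim by (intro AE_I2) (simp add: d(2))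
    show ?thesis using I[unfolded is_extremal_integral_def] 1 2 3 by blast
  qed
  define F where "F j u = enn2real (simple_fun (n j) (a j) (A j) u)" for j u
  have Fg: "F j u = enn2real (g j u)" if "u \<in> space (kpow k \<mu>)" for j u using d(2)[OF that] by (simp add: F_def)
  have le: "AE u in kpow k \<mu>. \<forall>j. 0 \<le> F j u \<and> F j u \<le> enn2real (f u)"
    using fin AE_space
  proof eventually_elim
    case (elim u)
    then show ?case using gle[of _ u] by (auto simp: Fg intro!: enn2real_mono)
  qed
  have FT: "Theta (F j) < \<infinity>" for j
  proof -
    have "Theta (F j) \<le> Theta (\<lambda>u. enn2real (f u))"
      using le by (intro Theta_mono_AE) (auto elim!: eventually_mono)
    then show ?thesis using T by (rule order_le_less_trans)
  qed
  have ap: "Approx (simple_extremal_integral N (n j) (a j) (A j)) (F j)" for j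
    using FT[of j] unfolding F_def[abs_def] by (intro Approx_simple N d(1))
  have Flim: "AE u in kpow k \<mu>. (\<lambda>j. F j u) \<longlonglongrightarrow> enn2real (f u)"
    using fin AE_space
  proof eventually_elim
    case (elim u)
    have "(\<lambda>j. enn2real (g j u)) \<longlonglongrightarrow> enn2real (f u)"
      using glim[of u] elim by (intro tendsto_enn2real) auto
    then show ?case using elim by (simp add: Fg)
  qed
  have Im: "I \<in> borel_measurable P" using I by (simp add: is_extremal_integral_def)
  have Tlim: "(\<lambda>j. Theta (\<lambda>u. enn2real (f u) - F j u)) \<longlonglongrightarrow> 0"
    by (rule Theta_diff_tendsto_0[OF _ _ T le Flim]) (use ApproxD(2)[OF ap] in auto)
  show "AE w in P. I w < \<infinity>"
    by (rule Approx_limit(1)[OF ap Im lim _ Tlim T]) measurable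
  show "Approx I (\<lambda>u. enn2real (f u))"
    by (rule Approx_limit(2)[OF ap Im lim _ Tlim T]) measurable
qed

text \<open>The maximum of the \<open>I i / x i\<close> exceeds \<open>t\<close> exactly when the
  vector leaves the box with corner \<open>t\<close> times \<open>x\<close>; so the joint statement
  becomes a one-dimensional tail.\<close>

lemma Approx_max:
  fixes I :: "'d::finite \<Rightarrow> 'w \<Rightarrow> ennreal" and F :: "'d \<Rightarrow> (nat \<Rightarrow> 'a) \<Rightarrow> real"
  assumes I: "\<And>i. Approx (I i) (F i)" and x: "\<And>i. 0 < x i"
  shows "Approx (\<lambda>w. SUP i. ennreal (1 / x i) * I i w) (\<lambda>u. Max (range (\<lambda>i. F i u / x i)))"
proof (rule Approx_SUP[where F="\<lambda>i u. (1 / x i) * F i u"])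
  note [measurable] = ApproxD(2)[OF I]
  show "Approx (\<lambda>w. ennreal (1 / x i) * I i w) (\<lambda>u. 1 / x i * F i u)" for i
    using x[of i] by (intro Approx_scale I) simp
  show "(\<lambda>u. Max (range (\<lambda>i. F i u / x i))) \<in> borel_measurable (kpow k \<mu>)"
    by (intro borel_measurable_Max) auto
  show "1 / x i * F i u \<le> Max (range (\<lambda>i. F i u / x i))" for i u
    by (intro Max_ge) auto
  show "\<exists>i\<in>UNIV. Max (range (\<lambda>i. F i u / x i)) = 1 / x i * F i u" for u
  proof -
    have "Max (range (\<lambda>i. F i u / x i)) \<in> range (\<lambda>i. F i u / x i)" by (intro Max_in) auto
    then obtain i where "Max (range (\<lambda>i. F i u / x i)) = F i u / x i" by (rule rangeE)
    then show ?thesis by (intro bexI[of _ i]) simp_all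
  qed
qed auto

text \<open>Substitute \<open>s = t powr \<alpha>\<close>: the logarithm becomes
  \<open>\<alpha> * ln t\<close>, which is the origin of the factor
  \<open>\<alpha> ^ (k - 1)\<close>.\<close>

lemma tail_asymp_t:
  assumes X: "Approx X F"
  shows "((\<lambda>t. t powr \<alpha> / ln t ^ (k - 1) * prob {w\<in>space P. ennreal t < X w}) \<longlongrightarrow>
    real k * \<alpha> ^ (k - 1) / (fact k)\<^sup>2 * enn2real (symI F)) at_top"
proof -
  have "filterlim (\<lambda>t. t powr \<alpha>) at_top at_top" using \<alpha> by real_asymp
  from filterlim_compose[OF Approx_tail_asymp(2)[OF X] this]
  have "((\<lambda>t. \<alpha> ^ (k - 1) * (t powr \<alpha> / ln (t powr \<alpha>) ^ (k - 1) * tail X (t powr \<alpha>))) \<longlongrightarrow>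
    \<alpha> ^ (k - 1) * (real k / (fact k)\<^sup>2 * enn2real (symI F))) at_top"
    by (rule tendsto_mult_left)
  moreover have "eventually (\<lambda>t. \<alpha> ^ (k - 1) * (t powr \<alpha> / ln (t powr \<alpha>) ^ (k - 1) * tail X (t powr \<alpha>)) =
     t powr \<alpha> / ln t ^ (k - 1) * prob {w\<in>space P. ennreal t < X w}) at_top"
    using eventually_gt_at_top[of 1]
  proof eventually_elim
    case (elim t)
    have "(t powr \<alpha>) powr (1 / \<alpha>) = t" using elim \<alpha> by (simp add: powr_powr)
    moreover have "ln (t powr \<alpha>) = \<alpha> * ln t" using elim by (simp add: ln_powr)
    ultimately show ?case using \<alpha> by (simp add: power_mult_distrib)
  qed
  ultimately show ?thesis by (simp add: tendsto_cong mult_ac)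
qed

text \<open>Maxima over permutations and over components commute, and an increasing power commutes
  with both. Finiteness at every rearrangement of \<open>u\<close> permits the passage between
  \<open>ennreal\<close> and real values.\<close>

lemma symP_max_sym:
  fixes f :: "'d::finite \<Rightarrow> (nat \<Rightarrow> 'a) \<Rightarrow> ennreal"
  assumes fin: "\<And>i \<pi>. \<pi> permutes {..<k} \<Longrightarrow> f i (u \<circ> \<pi>) < \<infinity>" and x: "\<And>i. 0 < x i"
  shows "ennreal (symP (\<lambda>u. Max (range (\<lambda>i. enn2real (f i u) / x i))) u) =
    (SUP i. epowr (max_sym k (f i) u) \<alpha> / ennreal (x i powr \<alpha>))"
proof -
  define F where "F u = Max (range (\<lambda>i. enn2real (f i u) / x i))" for u
  have F0: "0 \<le> F u" for u
  proof -
    obtain i :: 'd where True by blast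
    have "0 \<le> enn2real (f i u) / x i" using x[of i] by simp
    also have "\<dots> \<le> F u" unfolding F_def by (intro Max_ge) auto
    finally show ?thesis .
  qed
  have conv: "epowr y \<alpha> / ennreal (x i powr \<alpha>) = ennreal ((enn2real y / x i) powr \<alpha>)" if "y < \<infinity>" for y i
    using that x[of i] by (simp add: epowr_def less_top divide_ennreal powr_divide)
  have ms: "\<exists>\<pi>. \<pi> permutes {..<k} \<and> max_sym k (f i) u = f i (u \<circ> \<pi>)" for i
  proof -
    have "Max ((\<lambda>\<pi>. f i (u \<circ> \<pi>)) ` {\<pi>. \<pi> permutes {..<k}}) \<in> (\<lambda>\<pi>. f i (u \<circ> \<pi>)) ` {\<pi>. \<pi> permutes {..<k}}"
      using finite_perms by (intro Max_in) auto
    moreover have "max_sym k (f i) u = Max ((\<lambda>\<pi>. f i (u \<circ> \<pi>)) ` {\<pi>. \<pi> permutes {..<k}})"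
      unfolding max_sym_def using finite_perms by (intro Max_Sup[symmetric]) auto
    ultimately show ?thesis by auto
  qed
  show ?thesis
    unfolding F_def[symmetric]
  proof (intro antisym SUP_least)
    have "symP F u \<in> (\<lambda>\<pi>. \<bar>F (u \<circ> \<pi>)\<bar> powr \<alpha>) ` {\<pi>. \<pi> permutes {..<k}}"
      unfolding symP_def using finite_perms by (intro Max_in) auto
    then obtain \<pi> where \<pi>: "\<pi> permutes {..<k}" "symP F u = F (u \<circ> \<pi>) powr \<alpha>" using F0 by auto
    have "F (u \<circ> \<pi>) \<in> range (\<lambda>i. enn2real (f i (u \<circ> \<pi>)) / x i)" unfolding F_def by (intro Max_in) auto
    then obtain i where i: "F (u \<circ> \<pi>) = enn2real (f i (u \<circ> \<pi>)) / x i" by auto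
    obtain \<pi>' where \<pi>': "\<pi>' permutes {..<k}" "max_sym k (f i) u = f i (u \<circ> \<pi>')" using ms by blast
    have "f i (u \<circ> \<pi>) \<le> max_sym k (f i) u" unfolding max_sym_def using \<pi>(1) by (intro SUP_upper) auto
    then have "enn2real (f i (u \<circ> \<pi>)) / x i \<le> enn2real (max_sym k (f i) u) / x i"
      using x[of i] fin[OF \<pi>'(1)] \<pi>'(2) by (intro divide_right_mono enn2real_mono) (auto simp: less_imp_le)
    then have "symP F u \<le> (enn2real (max_sym k (f i) u) / x i) powr \<alpha>"
      unfolding \<pi>(2) i using \<alpha> x[of i] by (intro powr_mono2) auto
    then have "ennreal (symP F u) \<le> epowr (max_sym k (f i) u) \<alpha> / ennreal (x i powr \<alpha>)"
      using fin[OF \<pi>'(1)] \<pi>'(2) by (subst conv) (auto intro: ennreal_leI)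
    also have "\<dots> \<le> (SUP i. epowr (max_sym k (f i) u) \<alpha> / ennreal (x i powr \<alpha>))" by (intro SUP_upper) auto
    finally show "ennreal (symP F u) \<le> \<dots>" .
  next
    fix i
    obtain \<pi> where \<pi>: "\<pi> permutes {..<k}" "max_sym k (f i) u = f i (u \<circ> \<pi>)" using ms by blast
    have "enn2real (f i (u \<circ> \<pi>)) / x i \<le> F (u \<circ> \<pi>)" unfolding F_def by (intro Max_ge) auto
    then have "(enn2real (f i (u \<circ> \<pi>)) / x i) powr \<alpha> \<le> \<bar>F (u \<circ> \<pi>)\<bar> powr \<alpha>"
      using \<alpha> x[of i] by (intro powr_mono2) auto
    also have "\<dots> \<le> symP F u" unfolding symP_def using \<pi>(1) finite_perms by (intro Max_ge finite_imageI) auto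
    finally show "epowr (max_sym k (f i) u) \<alpha> / ennreal (x i powr \<alpha>) \<le> ennreal (symP F u)"
      unfolding \<pi>(2) using fin[OF \<pi>(1)] by (subst conv) (auto intro: ennreal_leI)
  qed
qed

lemma symP_cmult:
  assumes "0 \<le> c"
  shows "symP (\<lambda>u. c * F u) u = c powr \<alpha> * symP F u"
proof (rule antisym)
  have le: "\<bar>F (u \<circ> \<pi>)\<bar> powr \<alpha> \<le> symP F u" if "\<pi> permutes {..<k}" for \<pi>
    unfolding symP_def using that finite_perms by (intro Max_ge finite_imageI) auto
  show "symP (\<lambda>u. c * F u) u \<le> c powr \<alpha> * symP F u"
    unfolding symP_def[of "\<lambda>u. c * F u"] using finite_perms le assms
    by (subst Max_le_iff) (auto simp: abs_mult powr_mult intro!: mult_left_mono)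
  have "symP F u \<in> (\<lambda>\<pi>. \<bar>F (u \<circ> \<pi>)\<bar> powr \<alpha>) ` {\<pi>. \<pi> permutes {..<k}}"
    unfolding symP_def using finite_perms by (intro Max_in) auto
  then obtain \<pi> where \<pi>: "\<pi> permutes {..<k}" "symP F u = \<bar>F (u \<circ> \<pi>)\<bar> powr \<alpha>" by auto
  have "c powr \<alpha> * symP F u = \<bar>c * F (u \<circ> \<pi>)\<bar> powr \<alpha>"
    using assms by (simp add: \<pi>(2) abs_mult powr_mult)
  also have "\<dots> \<le> symP (\<lambda>u. c * F u) u"
    unfolding symP_def using \<pi>(1) finite_perms by (intro Max_ge finite_imageI) auto
  finally show "c powr \<alpha> * symP F u \<le> symP (\<lambda>u. c * F u) u" .
qed

text \<open>Integrability enters only as finiteness almost everywhere and finite gauge of the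
  \<open>f i\<close>; both are derived from the logarithmic class afterwards.\<close>

theorem extremal_integral_tail:
  fixes f :: "'d::finite \<Rightarrow> (nat \<Rightarrow> 'a) \<Rightarrow> ennreal" and I :: "'d \<Rightarrow> 'w \<Rightarrow> ennreal"
  assumes N: "\<And>A. A \<in> offdiag_sets k \<mu> \<Longrightarrow> N A \<in> borel_measurable P"
      "\<And>A. A \<in> offdiag_sets k \<mu> \<Longrightarrow> AE w in P. N A w = (SUP n. N' n A w)"
    and f: "\<And>i. f i \<in> L_class k \<mu>" and fin: "\<And>i. AE u in kpow k \<mu>. f i u < \<infinity>"
    and pos: "\<And>i. 0 < emeasure (kpow k \<mu>) {u \<in> space (kpow k \<mu>). 0 < f i u}"
    and T: "\<And>i. Theta (\<lambda>u. enn2real (f i u)) < \<infinity>" and I: "\<And>i. is_extremal_integral P \<mu> k N (f i) (I i)"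
  shows "(AE w in P. \<forall>i. I i w < \<infinity>) \<and>
    MRV P \<alpha> (\<lambda>w. \<chi> i. enn2real (I i w)) \<and>
    (\<forall>x :: real ^ 'd. (\<forall>i. 0 < x $ i) \<longrightarrow>
      ((\<lambda>t. ennreal (t powr \<alpha> / ln t ^ (k - 1) *
              measure P {w \<in> space P. \<not> (\<forall>i. I i w \<le> ennreal (t * x $ i))}))
        \<longlongrightarrow> ennreal (real k * \<alpha> ^ (k - 1) / (fact k)\<^sup>2) *
            (\<integral>\<^sup>+ u. (SUP i. epowr (max_sym k (f i) u) \<alpha> / ennreal (x $ i powr \<alpha>)) \<partial>kpow k \<mu>))
        at_top)"
proof -
  have AI: "Approx (I i) (\<lambda>u. enn2real (f i u))" and If: "AE w in P. I i w < \<infinity>" for i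
    using Approx_integral[OF N f fin T I] by auto
  have [measurable]: "I i \<in> borel_measurable P" for i using ApproxD(1)[OF AI] .
  have [measurable]: "f i \<in> borel_measurable (kpow k \<mu>)" for i using f[of i] by (simp add: L_class_def)
  have Ifin: "AE w in P. \<forall>i. I i w < \<infinity>"
    using AE_finite_allI[of UNIV "\<lambda>i w. I i w < \<infinity>" P] If by simp
  define F where "F x u = Max (range (\<lambda>i. enn2real (f i u) / x $ i))" for x :: "real ^ 'd" and u
  define X where "X x w = (SUP i. ennreal (1 / x $ i) * I i w)" for x :: "real ^ 'd" and w
  define c where "c = real k * \<alpha> ^ (k - 1) / (fact k)\<^sup>2"
  have c: "0 < c" unfolding c_def using \<alpha> k by simp
  define L where "L x = c * enn2real (symI (F x))" for x
  have AX: "Approx (X x) (F x)" if "\<And>i. 0 < x $ i" for x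
    unfolding X_def F_def using that by (intro Approx_max AI)
  have Xiff: "ennreal t < X x w \<longleftrightarrow> \<not> (\<forall>i. I i w \<le> ennreal (t * x $ i))" if x: "\<And>i. 0 < x $ i" and t: "0 < t" for x t w
  proof -
    have eq: "ennreal (1 / x $ i) * I i w \<le> ennreal t \<longleftrightarrow> I i w \<le> ennreal (t * x $ i)" for i
    proof -
      have "ennreal (x $ i) * ennreal (1 / x $ i) = ennreal (x $ i * (1 / x $ i))"
        using x[of i] by (intro ennreal_mult[symmetric]) auto
      also have "x $ i * (1 / x $ i) = 1" using x[of i] by simp
      finally have inv: "ennreal (x $ i) * ennreal (1 / x $ i) = 1" by (simp only: ennreal_1)
      have t': "ennreal (t * x $ i) = ennreal (x $ i) * ennreal t"
        unfolding mult.commute[of t] using t x[of i] by (intro ennreal_mult) auto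
      show ?thesis
      proof
        assume "ennreal (1 / x $ i) * I i w \<le> ennreal t"
        then have "ennreal (x $ i) * (ennreal (1 / x $ i) * I i w) \<le> ennreal (x $ i) * ennreal t" by (intro mult_left_mono) auto
        then show "I i w \<le> ennreal (t * x $ i)" unfolding mult.assoc[symmetric] inv t' by (simp only: mult_1)
      next
        assume "I i w \<le> ennreal (t * x $ i)"
        then have "ennreal (1 / x $ i) * I i w \<le> ennreal (1 / x $ i) * (ennreal (x $ i) * ennreal t)"
          unfolding t' by (intro mult_left_mono) auto
        also have "\<dots> = (ennreal (x $ i) * ennreal (1 / x $ i)) * ennreal t" by (simp only: mult_ac)
        finally show "ennreal (1 / x $ i) * I i w \<le> ennreal t" unfolding inv by (simp only: mult_1)
      qed
    qed
    have "ennreal t < X x w \<longleftrightarrow> (\<exists>i. \<not> ennreal (1 / x $ i) * I i w \<le> ennreal t)"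
      by (simp only: X_def less_SUP_iff not_le) simp
    then show ?thesis by (simp only: eq not_all)
  qed
  define p where "p x t = prob {w \<in> space P. \<not> (\<forall>i. I i w \<le> ennreal (t * x $ i))}" for x :: "real ^ 'd" and t
  have lim: "((\<lambda>t. t powr \<alpha> / ln t ^ (k - 1) * p x t) \<longlongrightarrow> L x) at_top" if x: "\<And>i. 0 < x $ i" for x
  proof -
    have "((\<lambda>t. t powr \<alpha> / ln t ^ (k - 1) * prob {w\<in>space P. ennreal t < X x w}) \<longlongrightarrow> L x) at_top"
      unfolding L_def c_def by (rule tail_asymp_t[OF AX[OF x]])
    moreover have "eventually (\<lambda>t. t powr \<alpha> / ln t ^ (k - 1) * prob {w\<in>space P. ennreal t < X x w} = t powr \<alpha> / ln t ^ (k - 1) * p x t) at_top"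
      using eventually_gt_at_top[of 0] by eventually_elim (simp add: p_def Xiff[OF x])
    ultimately show ?thesis by (rule Lim_transform_eventually)
  qed
  \<comment> \<open>A null set stays null under each of the finitely many permutations, so at almost
    every point all rearrangements have finite values.\<close>
  have finp: "AE u in kpow k \<mu>. \<forall>\<pi>\<in>{\<pi>. \<pi> permutes {..<k}}. \<forall>i\<in>UNIV. f i (u \<circ> \<pi>) < \<infinity>"
  proof (intro AE_finite_allI finite_perms finite)
    fix \<pi> i assume "\<pi> \<in> {\<pi>. \<pi> permutes {..<k}}"
    then show "AE u in kpow k \<mu>. f i (u \<circ> \<pi>) < \<infinity>"
      by (intro AE_PiM_permute[OF sigma_finite _ _ fin]) auto
  qed
  have symI: "symI (F x) = (\<integral>\<^sup>+ u. (SUP i. epowr (max_sym k (f i) u) \<alpha> / ennreal (x $ i powr \<alpha>)) \<partial>kpow k \<mu>)"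
    if x: "\<And>i. 0 < x $ i" for x
    unfolding symI_def
  proof (rule nn_integral_cong_AE)
    show "AE u in kpow k \<mu>. ennreal (symP (F x) u) = (SUP i. epowr (max_sym k (f i) u) \<alpha> / ennreal (x $ i powr \<alpha>))"
      using finp
    proof eventually_elim
      case (elim u)
      show ?case unfolding F_def using elim x by (intro symP_max_sym) auto
    qed
  qed
  have symI_fin: "symI (F x) < \<infinity>" if x: "\<And>i. 0 < x $ i" for x
    by (rule Approx_tail_asymp(1)[OF AX[OF x]])
  \<comment> \<open>A vanishing integral would make every \<open>f i\<close> vanish almost
    everywhere, already through the identity permutation. Positivity of the limit permits the
    division in the definition of regular variation.\<close>
  have Lpos: "0 < L x" if x: "\<And>i. 0 < x $ i" for x
  proof -
    have "symI (F x) \<noteq> 0"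
    proof
      assume "symI (F x) = 0"
      then have "AE u in kpow k \<mu>. ennreal (symP (F x) u) = 0"
        unfolding symI_def using ApproxD(2)[OF AX[OF x]] by (subst (asm) nn_integral_0_iff_AE) auto
      then have "AE u in kpow k \<mu>. \<not> 0 < f i u" for i
        using fin[of i]
      proof eventually_elim
        case (elim u)
        have "(enn2real (f i u) / x $ i) powr \<alpha> \<le> \<bar>F x (u \<circ> id)\<bar> powr \<alpha>"
        proof (rule powr_mono2)
          show "enn2real (f i u) / x $ i \<le> \<bar>F x (u \<circ> id)\<bar>"
            unfolding F_def by (rule order_trans[OF Max_ge abs_ge_self]) auto
        qed (use \<alpha> x[of i] in auto)
        also have "\<dots> \<le> symP (F x) u"
          unfolding symP_def by (intro Max_ge finite_imageI finite_perms imageI) (simp only: mem_Collect_eq permutes_id)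
        also have "\<dots> \<le> 0" using elim(1) by (simp add: ennreal_eq_0_iff)
        finally have "enn2real (f i u) = 0" using x[of i] by simp
        then show ?case using elim(2) by (auto simp: enn2real_eq_0_iff)
      qed
      then have "emeasure (kpow k \<mu>) {u \<in> space (kpow k \<mu>). 0 < f i u} = 0" for i
        by (subst (asm) AE_iff_measurable[OF _ refl]) (auto simp: zero_less_iff_neq_zero)
      then show False using pos by (metis less_irrefl)
    qed
    then have "0 < enn2real (symI (F x))" using symI_fin[OF x] by (simp add: enn2real_positive_iff zero_less_iff_neq_zero)
    then show ?thesis using c by (simp add: L_def)
  qed
  \<comment> \<open>Multiplying \<open>x\<close> by \<open>q\<close> divides the integrand by
    \<open>q\<close>, and the power \<open>\<alpha>\<close> gives the index of regular
    variation.\<close>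
  have hom: "L (q *\<^sub>R x) = q powr (- \<alpha>) * L x" if x: "\<And>i. 0 < x $ i" and q: "0 < q" for x q
  proof -
    have "F (q *\<^sub>R x) u = (1 / q) * F x u" for u
    proof -
      have "(\<lambda>i. enn2real (f i u) / (q *\<^sub>R x) $ i) = (\<lambda>i. (1 / q) * (enn2real (f i u) / x $ i))" by auto
      then have "F (q *\<^sub>R x) u = Max ((\<lambda>y. (1 / q) * y) ` range (\<lambda>i. enn2real (f i u) / x $ i))"
        unfolding F_def by (simp add: image_image mult.commute)
      also have "\<dots> = (1 / q) * Max (range (\<lambda>i. enn2real (f i u) / x $ i))"
        using q by (intro mono_Max_commute[symmetric]) (auto simp: mono_def divide_right_mono)
      finally show ?thesis by (simp add: F_def)
    qed
    then have "F (q *\<^sub>R x) = (\<lambda>u. (1 / q) * F x u)" by blast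
    then have "symI (F (q *\<^sub>R x)) = (\<integral>\<^sup>+u. ennreal ((1 / q) powr \<alpha>) * ennreal (symP (F x) u) \<partial>kpow k \<mu>)"
      unfolding symI_def using q by (simp only: symP_cmult less_imp_le zero_less_divide_1_iff) (simp add: ennreal_mult' symP_nonneg)
    also have "\<dots> = ennreal ((1 / q) powr \<alpha>) * symI (F x)"
      unfolding symI_def using ApproxD(2)[OF AX[OF x]] by (intro nn_integral_cmult) auto
    finally have "enn2real (symI (F (q *\<^sub>R x))) = (1 / q) powr \<alpha> * enn2real (symI (F x))"
      by (simp add: enn2real_mult)
    also have "(1 / q) powr \<alpha> = q powr (- \<alpha>)" using q by (simp add: powr_divide powr_minus_divide)
    finally show ?thesis by (simp add: L_def)
  qed
  \<comment> \<open>The real vector has 0 in place of infinite values, so the two events are matched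
    only almost surely.\<close>
  have out: "measure P {w \<in> space P. (\<chi> i. enn2real (I i w)) \<notin> cbox 0 (t *\<^sub>R x)} = p x t"
    if x: "\<And>i. 0 < x $ i" and t: "0 < t" for x t
    unfolding p_def
  proof (rule finite_measure_eq_AE)
    have mem: "(\<chi> i. enn2real (I i w)) \<in> cbox 0 (t *\<^sub>R x) \<longleftrightarrow> (\<forall>i. enn2real (I i w) \<le> t * x $ i)" for w
      by (auto simp: mem_box_cart)
    show "{w \<in> space P. (\<chi> i. enn2real (I i w)) \<notin> cbox 0 (t *\<^sub>R x)} \<in> events"
      unfolding mem by measurable
    show "{w \<in> space P. \<not> (\<forall>i. I i w \<le> ennreal (t * x $ i))} \<in> events" by measurable
    show "AE w in P. w \<in> {w \<in> space P. (\<chi> i. enn2real (I i w)) \<notin> cbox 0 (t *\<^sub>R x)} \<longleftrightarrow>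
        w \<in> {w \<in> space P. \<not> (\<forall>i. I i w \<le> ennreal (t * x $ i))}"
      using Ifin
    proof eventually_elim
      case (elim w)
      have "enn2real (I i w) \<le> t * x $ i \<longleftrightarrow> I i w \<le> ennreal (t * x $ i)" for i
      proof -
        have "I i w = ennreal (enn2real (I i w))" using elim by (simp add: less_top)
        then show ?thesis using t x[of i] by (metis ennreal_le_iff less_imp_le mult_pos_pos)
      qed
      then show ?case by (simp add: mem)
    qed
  qed
  have MRV: "MRV P \<alpha> (\<lambda>w. \<chi> i. enn2real (I i w))"
    unfolding MRV_def
  \<comment> \<open>The limit function is the ratio of the tail constants at \<open>x\<close> and at
    the all-ones vector; the normalisation cancels in the quotient.\<close>
  proof (intro conjI exI[of _ "\<lambda>x. L x / L 1"] allI impI)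
    show "(\<lambda>w. \<chi> i. enn2real (I i w)) \<in> borel_measurable P"
      by (subst borel_measurable_euclidean_space) (auto simp: Basis_vec_def inner_axis)
    show "AE w in P. \<forall>i. 0 \<le> (\<chi> i. enn2real (I i w)) $ i" by simp
    fix x :: "real ^ 'd" assume "\<forall>i. 0 < x $ i"
    then have x: "\<And>i. 0 < x $ i" by blast
    have one: "\<And>i. 0 < (1 :: real ^ 'd) $ i" by simp
    show "0 < L x / L 1" using Lpos[OF x] Lpos[OF one] by simp
    have "((\<lambda>t. (t powr \<alpha> / ln t ^ (k - 1) * p x t) / (t powr \<alpha> / ln t ^ (k - 1) * p 1 t)) \<longlongrightarrow> L x / L 1) at_top"
      using Lpos[OF one] by (intro tendsto_divide lim x one) auto
    moreover have "eventually (\<lambda>t. (t powr \<alpha> / ln t ^ (k - 1) * p x t) / (t powr \<alpha> / ln t ^ (k - 1) * p 1 t) =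
        measure P {w \<in> space P. (\<chi> i. enn2real (I i w)) \<notin> cbox 0 (t *\<^sub>R x)} /
        measure P {w \<in> space P. (\<chi> i. enn2real (I i w)) \<notin> cbox 0 (t *\<^sub>R 1)}) at_top"
      using eventually_gt_at_top[of 1]
    proof eventually_elim
      case (elim t)
      have c: "t powr \<alpha> / ln t ^ (k - 1) \<noteq> 0" using elim by simp
      have t: "0 < t" using elim by simp
      show ?case unfolding out[OF x t] out[OF one t] using c by (rule nonzero_mult_divide_mult_cancel_left)
    qed
    ultimately show "((\<lambda>t. measure P {w \<in> space P. (\<chi> i. enn2real (I i w)) \<notin> cbox 0 (t *\<^sub>R x)} /
        measure P {w \<in> space P. (\<chi> i. enn2real (I i w)) \<notin> cbox 0 (t *\<^sub>R 1)}) \<longlongrightarrow> L x / L 1) at_top"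
      by (rule Lim_transform_eventually)
  next
    fix x :: "real ^ 'd" and q :: real assume "\<forall>i. 0 < x $ i" "0 < q"
    then show "L (q *\<^sub>R x) / L 1 = q powr - \<alpha> * (L x / L 1)" using hom by simp
  qed
  show ?thesis
  proof (intro conjI allI impI Ifin MRV)
    fix x :: "real ^ 'd" assume "\<forall>i. 0 < x $ i"
    then have x: "\<And>i. 0 < x $ i" by blast
    have "((\<lambda>t. ennreal (t powr \<alpha> / ln t ^ (k - 1) * p x t)) \<longlongrightarrow> ennreal (L x)) at_top"
      by (intro tendsto_ennrealI lim x)
    also have "ennreal (L x) = ennreal c * symI (F x)"
      unfolding L_def using c symI_fin[OF x] by (simp add: ennreal_mult less_top)
    finally show "((\<lambda>t. ennreal (t powr \<alpha> / ln t ^ (k - 1) *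
              measure P {w \<in> space P. \<not> (\<forall>i. I i w \<le> ennreal (t * x $ i))}))
        \<longlongrightarrow> ennreal (real k * \<alpha> ^ (k - 1) / (fact k)\<^sup>2) *
            (\<integral>\<^sup>+ u. (SUP i. epowr (max_sym k (f i) u) \<alpha> / ennreal (x $ i powr \<alpha>)) \<partial>kpow k \<mu>)) at_top"
      unfolding p_def c_def symI[OF x] .
  qed
qed

end

section \<open>The coordinate, the weight and the gauge from the hypotheses of the theorem\<close>

lemma borel_spaceD:
  fixes \<mu> :: "'a measure"
  assumes "borel_space \<mu>"
  shows "\<exists>\<phi> :: 'a \<Rightarrow> real. \<phi> \<in> borel_measurable \<mu> \<and> (\<forall>x\<in>space \<mu>. 0 \<le> \<phi> x \<and> \<phi> x \<le> 1) \<and>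
    inj_on \<phi> (space \<mu>) \<and> (\<forall>A\<in>sets \<mu>. \<exists>B\<in>sets borel. A = {x\<in>space \<mu>. \<phi> x \<in> B})"
proof -
  obtain \<phi> :: "'a \<Rightarrow> real" and B where B: "B \<in> sets borel" "B \<subseteq> {0..1}" and bij: "bij_betw \<phi> (space \<mu>) B"
    and \<phi>: "\<phi> \<in> measurable \<mu> (restrict_space borel B)"
    and inv: "the_inv_into (space \<mu>) \<phi> \<in> measurable (restrict_space borel B) \<mu>"
    using assms unfolding borel_space_def by blast
  have inj: "inj_on \<phi> (space \<mu>)" and im: "\<phi> ` space \<mu> = B" using bij by (auto simp: bij_betw_def)
  have "\<phi> \<in> borel_measurable \<mu>" using \<phi> by (rule measurable_restrict_space2_iff[THEN iffD1, THEN conjunct1])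
  moreover have "0 \<le> \<phi> x \<and> \<phi> x \<le> 1" if "x \<in> space \<mu>" for x using im B(2) that by fastforce
  moreover have "\<exists>C\<in>sets borel. A = {x\<in>space \<mu>. \<phi> x \<in> C}" if A: "A \<in> sets \<mu>" for A
  proof -
    let ?C = "the_inv_into (space \<mu>) \<phi> -` A \<inter> space (restrict_space borel B)"
    have "?C \<in> sets (restrict_space borel B)" using measurable_sets[OF inv A] .
    then have "?C \<in> sets borel" using B(1) by (subst (asm) sets_restrict_space_iff) auto
    moreover have "A = {x\<in>space \<mu>. \<phi> x \<in> ?C}"
    proof (intro set_eqI)
      fix x
      have "\<phi> x \<in> ?C \<longleftrightarrow> x \<in> A" if "x \<in> space \<mu>"
        using the_inv_into_f_f[OF inj that] im that by (simp add: space_restrict_space) blast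
      then show "x \<in> A \<longleftrightarrow> x \<in> {x\<in>space \<mu>. \<phi> x \<in> ?C}"
        using sets.sets_into_space[OF A] by blast
    qed
    ultimately show ?thesis by blast
  qed
  ultimately show ?thesis using inj by blast
qed

text \<open>For \<open>k > 2\<close> the two sides are comparable powers of the logarithm. For
  \<open>k = 2\<close> split at \<open>ln_plus r = exp 1\<close>: below it the left side is bounded,
  and above it the iterated logarithm is at least 1.\<close>

lemma power_one_plus_ln_plus_le:
  fixes \<alpha> :: real
  assumes "0 < \<alpha>" "2 \<le> k"
  shows "\<exists>C\<ge>0. \<forall>r\<ge>0. (1 + \<alpha> * ln_plus r) ^ (k - 1) \<le>
    C * (1 + (if k = 2 then ln_plus r * ln_plus \<bar>ln r\<bar> else ln_plus r ^ (k - 1)))"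
proof (cases "k = 2")
  case True
  have "1 + \<alpha> * ln_plus r \<le> (1 + \<alpha> * exp 1) * (1 + ln_plus r * ln_plus \<bar>ln r\<bar>)" for r
  proof (cases "ln_plus r \<le> exp 1")
    case True
    have "1 + \<alpha> * ln_plus r \<le> (1 + \<alpha> * exp 1) * 1" using True assms by simp
    also have "\<dots> \<le> (1 + \<alpha> * exp 1) * (1 + ln_plus r * ln_plus \<bar>ln r\<bar>)"
      using assms by (intro mult_left_mono) (auto intro!: add_nonneg_nonneg mult_nonneg_nonneg)
    finally show ?thesis .
  next
    case False
    have "(0::real) \<le> exp 1" by simp
    then have "0 < ln_plus r" using False by linarith
    then have "1 < max r 1" unfolding ln_plus_def by (subst (asm) ln_gt_zero_iff) auto
    then have "max r 1 = r" by (simp add: max_def split: if_splits)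
    then have eq: "ln_plus r = ln r" by (simp add: ln_plus_def)
    have e1: "(1::real) \<le> exp 1" by simp
    have big: "exp 1 \<le> ln r" using False eq by simp
    have "1 \<le> ln (ln r)" using big e1 by (subst ln_ge_iff) linarith+
    also have "\<dots> = ln_plus \<bar>ln r\<bar>"
    proof -
      have "1 \<le> ln r" using big e1 by linarith
      then have "\<bar>ln r\<bar> = ln r" by (simp only: abs_of_nonneg)
      then show ?thesis using \<open>1 \<le> ln r\<close> by (simp only: ln_plus_eq)
    qed
    finally have l: "1 \<le> ln_plus \<bar>ln r\<bar>" .
    have "\<alpha> * ln_plus r \<le> \<alpha> * exp 1 * (ln_plus r * ln_plus \<bar>ln r\<bar>)"
    proof -
      have "\<alpha> * ln_plus r * 1 \<le> \<alpha> * ln_plus r * (exp 1 * ln_plus \<bar>ln r\<bar>)"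
        using assms l e1 mult_mono[OF e1 l] by (intro mult_left_mono) auto
      then show ?thesis by (simp add: mult_ac)
    qed
    moreover have "1 \<le> 1 + ln_plus r * ln_plus \<bar>ln r\<bar>" by simp
    moreover have "0 \<le> \<alpha> * exp 1" using assms by simp
    ultimately show ?thesis by (simp only: distrib_left distrib_right mult_1 mult_1_right)
  qed
  moreover have "0 \<le> 1 + \<alpha> * exp 1" using assms by (intro add_nonneg_nonneg) auto
  ultimately show ?thesis using True by (intro exI[of _ "1 + \<alpha> * exp 1"]) simp
next
  case False
  define m where "m = max 1 \<alpha>"
  have "(1 + \<alpha> * ln_plus r) ^ (k - 1) \<le> (2 * m) ^ (k - 1) * (1 + ln_plus r ^ (k - 1))" for r
  proof -
    define l where "l = max 1 (ln_plus r)"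
    have "1 * 1 \<le> m * l" by (intro mult_mono) (auto simp: m_def l_def)
    moreover have "\<alpha> * ln_plus r \<le> m * l" using assms by (intro mult_mono) (auto simp: m_def l_def)
    ultimately have "1 + \<alpha> * ln_plus r \<le> 2 * m * l" by simp
    then have "(1 + \<alpha> * ln_plus r) ^ (k - 1) \<le> (2 * m * l) ^ (k - 1)"
      using assms by (intro power_mono add_nonneg_nonneg mult_nonneg_nonneg) auto
    also have "\<dots> = (2 * m) ^ (k - 1) * l ^ (k - 1)" by (rule power_mult_distrib)
    also have "l ^ (k - 1) \<le> 1 + ln_plus r ^ (k - 1)" by (cases "ln_plus r \<le> 1") (auto simp: l_def max_def)
    finally show ?thesis by (simp add: m_def mult_left_mono)
  qed
  moreover have "0 \<le> (2 * m) ^ (k - 1)" by (simp add: m_def)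
  ultimately show ?thesis using False by (intro exI[of _ "(2 * m) ^ (k - 1)"]) simp
qed

text \<open>With \<open>r = F * p powr (1 / \<alpha>)\<close> one has
  \<open>r powr \<alpha> = F powr \<alpha> * p\<close> and
  \<open>ln_plus (r powr \<alpha>) = \<alpha> * ln_plus r\<close>. Here \<open>p\<close> stands for
  the product density, and \<open>v\<close> may be replaced by \<open>p\<close> because
  \<open>theta\<close> is monotone in the weight.\<close>

lemma theta_le_L_plus_integrand:
  assumes \<alpha>: "0 < \<alpha>" and F: "0 \<le> F" and p: "0 < p" and v: "0 \<le> v" "v \<le> p"
    and C: "\<And>r. 0 \<le> r \<Longrightarrow> (1 + \<alpha> * ln_plus r) ^ (k - 1) \<le>
      C * (1 + (if k = 2 then ln_plus r * ln_plus \<bar>ln r\<bar> else ln_plus r ^ (k - 1)))" "0 \<le> C"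
  shows "ennreal p * ennreal (theta \<alpha> k F v) \<le> ennreal C * L_plus_integrand k \<alpha> (ennreal F * epowr (ennreal p) (1 / \<alpha>))"
proof -
  define r where "r = F * p powr (1 / \<alpha>)"
  have r: "0 \<le> r" using F by (simp add: r_def)
  have ra: "r powr \<alpha> = F powr \<alpha> * p" using F p \<alpha> by (simp add: r_def powr_mult powr_powr)
  have lnr: "ln_plus (r powr \<alpha>) = \<alpha> * ln_plus r"
  proof (cases "r \<le> 1")
    case True
    then have "r powr \<alpha> \<le> 1" using r \<alpha> by (simp add: powr_le1)
    then show ?thesis using True by (simp add: ln_plus_def max_def)
  next
    case False
    then have "1 \<le> r powr \<alpha>" using \<alpha> by (simp add: ge_one_powr_ge_zero)
    then show ?thesis using False by (simp add: ln_plus_eq ln_powr)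
  qed
  have "p * theta \<alpha> k F v \<le> p * theta \<alpha> k F p" using p v \<alpha> by (intro mult_left_mono theta_mono) auto
  also have "\<dots> = r powr \<alpha> * (1 + \<alpha> * ln_plus r) ^ (k - 1)"
    unfolding theta_def lnr[symmetric] ra using F by simp
  also have "\<dots> \<le> r powr \<alpha> * (C * (1 + (if k = 2 then ln_plus r * ln_plus \<bar>ln r\<bar> else ln_plus r ^ (k - 1))))"
    using r by (intro mult_left_mono C) auto
  finally have le: "p * theta \<alpha> k F v \<le> C * (r powr \<alpha> * (1 + (if k = 2 then ln_plus r * ln_plus \<bar>ln r\<bar> else ln_plus r ^ (k - 1))))"
    by (simp add: mult_ac)
  have "epowr (ennreal p) (1 / \<alpha>) = ennreal (p powr (1 / \<alpha>))" using p by (simp add: epowr_def)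
  then have h: "ennreal F * epowr (ennreal p) (1 / \<alpha>) = ennreal r" using F by (simp add: r_def ennreal_mult)
  have "ennreal p * ennreal (theta \<alpha> k F v) = ennreal (p * theta \<alpha> k F v)" using p by (simp add: ennreal_mult)
  also have "\<dots> \<le> ennreal (C * (r powr \<alpha> * (1 + (if k = 2 then ln_plus r * ln_plus \<bar>ln r\<bar> else ln_plus r ^ (k - 1)))))"
    using le by (rule ennreal_leI)
  also have "\<dots> = ennreal C * L_plus_integrand k \<alpha> (ennreal F * epowr (ennreal p) (1 / \<alpha>))"
    unfolding h L_plus_integrand_def Let_def using r C(2) by (simp add: ennreal_mult')
  finally show ?thesis .
qed

text \<open>The weight is \<open>\<psi>\<close> rounded down to a power of two and capped on the \<open>n\<close>-th layer
  \<open>E n - E (n - 1)\<close>; the caps grow so fast that its reciprocal stays integrable.\<close>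

lemma exists_layered_weight:
  fixes \<mu> m :: "'a measure" and \<psi> :: "'a \<Rightarrow> real"
  assumes m: "prob_space m" and sets: "sets m = sets \<mu>" and \<psi>[measurable]: "\<psi> \<in> borel_measurable m"
    and pos: "\<And>x. 0 < \<psi> x" and dens: "density m (\<lambda>x. ennreal (\<psi> x)) = \<mu>"
    and E[measurable]: "\<And>n. E n \<in> sets \<mu>" and Efin: "\<And>n. emeasure \<mu> (E n) < \<infinity>" and inc: "incseq E" and UN: "(\<Union>n. E n) = space \<mu>"
  shows "\<exists>(cl :: 'a \<Rightarrow> nat) lay rho. cl \<in> measurable \<mu> (count_space UNIV) \<and>
    (\<forall>n. E n = {x\<in>space \<mu>. lay (cl x) \<le> n}) \<and> (\<forall>c. 0 < rho c) \<and> (\<forall>x. rho (cl x) \<le> \<psi> x) \<and>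
    (\<integral>\<^sup>+x. ennreal (1 / rho (cl x)) \<partial>\<mu>) \<le> ennreal 4 \<and> (\<forall>n. \<exists>C. \<forall>c. lay c \<le> n \<longrightarrow> rho c \<le> (C :: real))"
proof -
  have [measurable]: "\<psi> \<in> borel_measurable \<mu>" using \<psi> by (simp add: measurable_cong_sets[OF sets refl])
  define ex where "ex x = \<lfloor>log 2 (\<psi> x)\<rfloor>" for x
  define ly where "ly x = (LEAST n. x \<in> E n)" for x
  \<comment> \<open>The cap makes layer \<open>n\<close> contribute at most
    \<open>(1 / 2) ^ n\<close> to the integral of the reciprocal weight. The added 1 keeps it
    positive when \<open>E n\<close> is null.\<close>
  define cap where "cap n = 2 ^ n * (measure \<mu> (E n) + 1)" for n
  have cap: "1 \<le> cap n" for n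
  proof -
    have "1 * 1 \<le> 2 ^ n * (measure \<mu> (E n) + 1)" by (intro mult_mono) auto
    then show ?thesis by (simp add: cap_def)
  qed
  \<comment> \<open>One natural number encodes the exponent and the layer, so that classes are
    countable, determine both, and can be enumerated by the cells.\<close>
  define cl where "cl x = prod_encode (int_encode (ex x), ly x)" for x
  define lay where "lay c = snd (prod_decode c)" for c
  define rho where "rho c = min (2 powr real_of_int (int_decode (fst (prod_decode c)))) (cap (lay c))" for c
  have lay: "lay (cl x) = ly x" and rho: "rho (cl x) = min (2 powr real_of_int (ex x)) (cap (ly x))" for x
    by (auto simp: lay_def cl_def rho_def)
  have ex_le: "2 powr real_of_int (ex x) \<le> \<psi> x" "\<psi> x \<le> 2 * 2 powr real_of_int (ex x)" for x
  proof -
    have "2 powr real_of_int (ex x) \<le> 2 powr log 2 (\<psi> x)" by (intro powr_mono) (auto simp: ex_def)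
    then show "2 powr real_of_int (ex x) \<le> \<psi> x" using pos[of x] by simp
    have "\<psi> x = 2 powr log 2 (\<psi> x)" using pos[of x] by simp
    also have "\<dots> \<le> 2 powr (real_of_int (ex x) + 1)"
    proof (rule powr_mono)
      show "log 2 (\<psi> x) \<le> real_of_int (ex x) + 1" unfolding ex_def by linarith
    qed simp
    finally show "\<psi> x \<le> 2 * 2 powr real_of_int (ex x)" by (simp add: powr_add)
  qed
  have E_eq: "E n = {x\<in>space \<mu>. lay (cl x) \<le> n}" for n
  proof (intro set_eqI iffI)
    fix x assume x: "x \<in> E n"
    then have "ly x \<le> n" unfolding ly_def by (rule Least_le)
    then show "x \<in> {x\<in>space \<mu>. lay (cl x) \<le> n}" using x UN by (auto simp: lay)
  next
    fix x assume x: "x \<in> {x\<in>space \<mu>. lay (cl x) \<le> n}"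
    then obtain j where "x \<in> E j" using UN by auto
    then have "x \<in> E (ly x)" unfolding ly_def by (rule LeastI)
    moreover have "E (ly x) \<subseteq> E n" using inc x by (auto simp: lay incseq_def)
    ultimately show "x \<in> E n" by blast
  qed
  have ly_m[measurable]: "ly \<in> measurable \<mu> (count_space UNIV)" unfolding ly_def by measurable
  have ex_m[measurable]: "ex \<in> measurable \<mu> (count_space UNIV)" unfolding ex_def by measurable
  have cl_m: "cl \<in> measurable \<mu> (count_space UNIV)" unfolding cl_def by measurable
  \<comment> \<open>Where the cap is inactive the reciprocal is at most \<open>2 / \<psi> x\<close>,
    the 2 coming from the rounding; elsewhere it is the reciprocal cap of the layer. Each of the two
    parts integrates to at most 2, whence the bound 4.\<close>
  have "(\<integral>\<^sup>+x. ennreal (1 / rho (cl x)) \<partial>\<mu>) \<le> (\<integral>\<^sup>+x. ennreal (2 / \<psi> x) + (\<Sum>n. ennreal (1 / cap n) * indicator (E n) x) \<partial>\<mu>)"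
  proof (intro nn_integral_mono)
    fix x assume x: "x \<in> space \<mu>"
    show "ennreal (1 / rho (cl x)) \<le> ennreal (2 / \<psi> x) + (\<Sum>n. ennreal (1 / cap n) * indicator (E n) x)"
    proof (cases "2 powr real_of_int (ex x) \<le> cap (ly x)")
      case True
      have "1 / rho (cl x) = 1 / 2 powr real_of_int (ex x)" using True by (simp add: rho min_def)
      also have "\<dots> \<le> 2 / \<psi> x" using ex_le(2)[of x] pos[of x] by (simp add: field_simps)
      finally have "ennreal (1 / rho (cl x)) \<le> ennreal (2 / \<psi> x)" by (rule ennreal_leI)
      then show ?thesis by (rule add_increasing2[rotated]) simp
    next
      case False
      have "x \<in> E (ly x)" using x E_eq[of "ly x"] by (simp add: lay)
      then have "ennreal (1 / rho (cl x)) = ennreal (1 / cap (ly x)) * indicator (E (ly x)) x"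
        using False by (simp add: rho min_def)
      also have "\<dots> = (\<Sum>n\<in>{ly x}. ennreal (1 / cap n) * indicator (E n) x)"
        by (simp only: sum.insert finite.emptyI empty_iff not_False_eq_True sum.empty add_0_right)
      also have "\<dots> \<le> (\<Sum>n. ennreal (1 / cap n) * indicator (E n) x)"
        by (rule sum_le_suminf) auto
      finally show ?thesis by (rule add_increasing[rotated]) simp
    qed
  qed
  also have "\<dots> = (\<integral>\<^sup>+x. ennreal (2 / \<psi> x) \<partial>\<mu>) + (\<integral>\<^sup>+x. (\<Sum>n. ennreal (1 / cap n) * indicator (E n) x) \<partial>\<mu>)"
    by (intro nn_integral_add) measurable
  also have "(\<integral>\<^sup>+x. ennreal (2 / \<psi> x) \<partial>\<mu>) = 2"
  proof -
    interpret m: prob_space m by (rule m)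
    have "(\<integral>\<^sup>+x. ennreal (2 / \<psi> x) \<partial>\<mu>) = (\<integral>\<^sup>+x. ennreal (\<psi> x) * ennreal (2 / \<psi> x) \<partial>m)"
      unfolding dens[symmetric] by (intro nn_integral_density) measurable
    also have "\<dots> = (\<integral>\<^sup>+x. 2 \<partial>m)"
    proof (intro nn_integral_cong)
      fix x
      show "ennreal (\<psi> x) * ennreal (2 / \<psi> x) = 2" using pos[of x] by (simp add: ennreal_mult[symmetric])
    qed
    also have "\<dots> = 2" by (simp add: m.emeasure_space_1)
    finally show ?thesis .
  qed
  also have "(\<integral>\<^sup>+x. (\<Sum>n. ennreal (1 / cap n) * indicator (E n) x) \<partial>\<mu>) = (\<Sum>n. \<integral>\<^sup>+x. ennreal (1 / cap n) * indicator (E n) x \<partial>\<mu>)"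
    by (intro nn_integral_suminf) measurable
  also have "\<dots> \<le> (\<Sum>n. ennreal ((1 / 2) ^ n))"
  proof (intro suminf_le summableI)
    fix n
    have "(\<integral>\<^sup>+x. ennreal (1 / cap n) * indicator (E n) x \<partial>\<mu>) = ennreal (1 / cap n) * emeasure \<mu> (E n)"
      by (intro nn_integral_cmult_indicator) measurable
    also have "\<dots> = ennreal (1 / cap n) * ennreal (measure \<mu> (E n))"
      using Efin[of n] by (simp add: emeasure_eq_ennreal_measure less_top)
    also have "\<dots> = ennreal (1 / cap n * measure \<mu> (E n))" using cap[of n] by (intro ennreal_mult[symmetric]) auto
    also have "1 / cap n * measure \<mu> (E n) \<le> (1 / 2) ^ n"
    proof -
      have "measure \<mu> (E n) / (measure \<mu> (E n) + 1) \<le> 1" by (simp add: divide_le_eq_1 add_nonneg_pos)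
      then have "(1 / 2) ^ n * (measure \<mu> (E n) / (measure \<mu> (E n) + 1)) \<le> (1 / 2) ^ n * 1"
        by (intro mult_left_mono) auto
      then show ?thesis by (simp add: cap_def power_divide)
    qed
    finally show "(\<integral>\<^sup>+x. ennreal (1 / cap n) * indicator (E n) x \<partial>\<mu>) \<le> ennreal ((1 / 2) ^ n)"
      by (simp add: ennreal_leI)
  qed
  also have "(\<Sum>n. ennreal ((1 / 2) ^ n)) = ennreal 2"
    using suminf_geometric[of "1/2 :: real"] by (subst suminf_ennreal2) (auto simp: summable_geometric)
  also have "2 + ennreal 2 = ennreal 4"
  proof -
    have "(2::ennreal) = ennreal 2" by simp
    then have "2 + ennreal 2 = ennreal 2 + ennreal 2" by (simp only:)
    also have "\<dots> = ennreal (2 + 2)" by (intro ennreal_plus[symmetric]) auto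
    finally show ?thesis by simp
  qed
  finally have int: "(\<integral>\<^sup>+x. ennreal (1 / rho (cl x)) \<partial>\<mu>) \<le> ennreal 4" by (simp add: add_left_mono)
  have bound: "\<exists>C. \<forall>c. lay c \<le> n \<longrightarrow> rho c \<le> C" for n
  proof (intro exI[of _ "\<Sum>j\<le>n. cap j"] allI impI)
    fix c assume "lay c \<le> n"
    have "rho c \<le> cap (lay c)" by (simp add: rho_def)
    also have "\<dots> \<le> (\<Sum>j\<le>n. cap j)" using \<open>lay c \<le> n\<close> cap by (intro member_le_sum) (auto intro: order_trans[OF zero_le_one])
    finally show "rho c \<le> (\<Sum>j\<le>n. cap j)" .
  qed
  have rho_pos: "0 < rho c" for c using cap[of "lay c"] by (simp add: rho_def)
  have rho_le: "rho (cl x) \<le> \<psi> x" for x using ex_le(1)[of x] by (simp add: rho min_le_iff_disj)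
  show ?thesis using cl_m E_eq rho_pos rho_le int bound by blast
qed

text \<open>The coordinate comes from the Borel space, the exhaustion and the \<open>N'\<close> from
  the product sup measure, and the weight from the density together with this exhaustion. The
  logarithmic class is used to show that the gauges of the \<open>f i\<close> are finite.\<close>

theorem theorem5p4:
  fixes P :: "'w measure" and \<mu> :: "'a measure" and \<alpha> :: real and k :: nat
    and M :: "'a set \<Rightarrow> 'w \<Rightarrow> ennreal"
    and N :: "(nat \<Rightarrow> 'a) set \<Rightarrow> 'w \<Rightarrow> ennreal"
    and f :: "'d::finite \<Rightarrow> (nat \<Rightarrow> 'a) \<Rightarrow> ennreal"
    and I :: "'d \<Rightarrow> 'w \<Rightarrow> ennreal"
  assumes "prob_space P"
    and "borel_space \<mu>" and "sigma_finite_measure \<mu>" and "emeasure \<mu> (space \<mu>) \<noteq> 0"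
    and "0 < \<alpha>" and "2 \<le> k"
    and "frechet_sup_measure P \<mu> \<alpha> M"
    and "product_sup_measure P \<mu> \<alpha> k M N"
    and "\<And>i. f i \<in> L_class k \<mu>"
    and "\<And>i. 0 < emeasure (kpow k \<mu>) {u \<in> space (kpow k \<mu>). 0 < f i u}"
    and "\<exists>m \<psi>. equivalent_prob_density \<mu> m \<psi> \<and>
           (\<forall>i. (\<lambda>u. f i u * epowr (\<Prod>r<k. \<psi> (u r)) (1 / \<alpha>)) \<in> L_plus_class k \<alpha> m)"
    and "\<And>i. is_extremal_integral P \<mu> k N (f i) (I i)"
  shows "(AE w in P. \<forall>i. I i w < \<infinity>) \<and>
    MRV P \<alpha> (\<lambda>w. \<chi> i. enn2real (I i w)) \<and>
    (\<forall>x :: real ^ 'd. (\<forall>i. 0 < x $ i) \<longrightarrow>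
      ((\<lambda>t. ennreal (t powr \<alpha> / ln t ^ (k - 1) *
              measure P {w \<in> space P. \<not> (\<forall>i. I i w \<le> ennreal (t * x $ i))}))
        \<longlongrightarrow> ennreal (real k * \<alpha> ^ (k - 1) / (fact k)\<^sup>2) *
            (\<integral>\<^sup>+ u. (SUP i. epowr (max_sym k (f i) u) \<alpha> / ennreal (x $ i powr \<alpha>)) \<partial>kpow k \<mu>))
        at_top)"
proof -
  obtain \<phi> :: "'a \<Rightarrow> real" where \<phi>: "\<phi> \<in> borel_measurable \<mu>" "\<And>x. x \<in> space \<mu> \<Longrightarrow> 0 \<le> \<phi> x \<and> \<phi> x \<le> 1"
    "inj_on \<phi> (space \<mu>)" "\<And>A. A \<in> sets \<mu> \<Longrightarrow> \<exists>B\<in>sets borel. A = {x\<in>space \<mu>. \<phi> x \<in> B}"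
    using borel_spaceD[OF assms(2)] by (elim exE conjE) (simp only: Ball_def)
  obtain m \<psi>0 where m: "equivalent_prob_density \<mu> m \<psi>0"
    and Lp: "\<And>i. (\<lambda>u. f i u * epowr (\<Prod>r<k. \<psi>0 (u r)) (1 / \<alpha>)) \<in> L_plus_class k \<alpha> m"
    using assms(11) by blast
  have mp: "prob_space m" and setsm: "sets m = sets \<mu>" and \<psi>0[measurable]: "\<psi>0 \<in> borel_measurable m"
    and dens0: "density m \<psi>0 = \<mu>" and \<psi>0_pos: "AE x in m. 0 < \<psi>0 x \<and> \<psi>0 x < \<infinity>"
    using m by (auto simp: equivalent_prob_density_def)
  interpret m: prob_space m by (rule mp)
  \<comment> \<open>The density is set to 1 on the null set where it is 0 or infinite, so that real
    arithmetic holds everywhere and not just almost everywhere.\<close>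
  define \<psi> where "\<psi> x = (if 0 < \<psi>0 x \<and> \<psi>0 x < \<infinity> then enn2real (\<psi>0 x) else 1)" for x
  have \<psi>m[measurable]: "\<psi> \<in> borel_measurable m" unfolding \<psi>_def by measurable
  have \<psi>_pos: "0 < \<psi> x" for x by (auto simp: \<psi>_def enn2real_positive_iff)
  have \<psi>_eq: "AE x in m. \<psi>0 x = ennreal (\<psi> x)"
    using \<psi>0_pos by eventually_elim (auto simp: \<psi>_def)
  have dens: "density m (\<lambda>x. ennreal (\<psi> x)) = \<mu>"
    unfolding dens0[symmetric] using \<psi>_eq by (intro density_cong) auto
  obtain E N' where EN0: "(\<forall>n. E n \<in> sets \<mu> \<and> 0 < emeasure \<mu> (E n) \<and> emeasure \<mu> (E n) < \<infinity>) \<and>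
    incseq E \<and> (\<Union>n. E n) = space \<mu> \<and>
    (\<forall>n. product_sup_measure_finite P (density \<mu> (indicator (E n))) \<alpha> k (\<lambda>A. M (A \<inter> E n)) (N' n)) \<and>
    (\<forall>A\<in>offdiag_sets k \<mu>. AE w in P. N A w = (SUP n. N' n A w))"
    using assms(8)[unfolded product_sup_measure_def, THEN conjunct2] by (elim exE) (rule that)
  then have EN: "\<And>n. E n \<in> sets \<mu> \<and> 0 < emeasure \<mu> (E n) \<and> emeasure \<mu> (E n) < \<infinity>"
    "incseq E" "(\<Union>n. E n) = space \<mu>"
    "\<And>n. product_sup_measure_finite P (density \<mu> (indicator (E n))) \<alpha> k (\<lambda>A. M (A \<inter> E n)) (N' n)"
    "\<And>A. A \<in> offdiag_sets k \<mu> \<Longrightarrow> AE w in P. N A w = (SUP n. N' n A w)"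
    by simp_all
  have Nm: "N A \<in> borel_measurable P" if "A \<in> offdiag_sets k \<mu>" for A
    using assms(8) that by (simp add: product_sup_measure_def)
  have E: "E n \<in> sets \<mu>" "emeasure \<mu> (E n) < \<infinity>" for n using EN(1) by simp_all
  obtain cl :: "'a \<Rightarrow> nat" and lay rho where cl0: "cl \<in> measurable \<mu> (count_space UNIV) \<and>
    (\<forall>n. E n = {x\<in>space \<mu>. lay (cl x) \<le> n}) \<and> (\<forall>c. 0 < rho c) \<and> (\<forall>x. rho (cl x) \<le> \<psi> x) \<and>
    (\<integral>\<^sup>+x. ennreal (1 / rho (cl x)) \<partial>\<mu>) \<le> ennreal 4 \<and> (\<forall>n. \<exists>C. \<forall>c. lay c \<le> n \<longrightarrow> rho c \<le> C)"
    using exists_layered_weight[OF mp setsm \<psi>m \<psi>_pos dens E EN(2,3)] by (elim exE) (rule that)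
  then have clw: "cl \<in> measurable \<mu> (count_space UNIV)"
    "\<And>n. E n = {x\<in>space \<mu>. lay (cl x) \<le> n}" "\<And>c. 0 < rho c" "\<And>x. rho (cl x) \<le> \<psi> x"
    "(\<integral>\<^sup>+x. ennreal (1 / rho (cl x)) \<partial>\<mu>) \<le> ennreal 4" "\<And>n. \<exists>C. \<forall>c. lay c \<le> n \<longrightarrow> rho c \<le> C"
    by blast+
  interpret extremal_setup P \<mu> \<alpha> k M \<phi> cl lay rho 4 E N'
  proof (intro extremal_setup.intro extremal_setup_axioms.intro)
    show "emeasure \<mu> (E n) < \<infinity>" for n using EN(1) by blast
  qed (fact assms \<phi> clw EN | simp)+
  have dens_k: "kpow k \<mu> = density (kpow k m) (\<lambda>u. \<Prod>r<k. ennreal (\<psi> (u r)))"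
    using PiM_density[OF m.sigma_finite_measure_axioms, of "\<lambda>x. ennreal (\<psi> x)" "{..<k}"] assms(3) dens by simp
  have sets_k: "sets (kpow k m) = sets (kpow k \<mu>)" by (intro sets_PiM_cong) (simp_all add: setsm)
  interpret mk: product_prob_space "\<lambda>_. m" "{..<k}"
    by (simp add: product_prob_space_def product_prob_space_axioms_def product_sigma_finite_def mp m.sigma_finite_measure_axioms)
  have \<psi>k: "AE u in kpow k m. \<forall>r\<in>{..<k}. \<psi>0 (u r) = ennreal (\<psi> (u r))"
    by (intro AE_finite_allI AE_PiM_component) (use mp \<psi>_eq in auto)
  have \<psi>prod: "AE u in kpow k m. (\<Prod>r<k. \<psi>0 (u r)) = ennreal (\<Prod>r<k. \<psi> (u r))"
    using \<psi>k by eventually_elim (simp add: prod_ennreal \<psi>_pos less_imp_le)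
  have Lfin: "(\<integral>\<^sup>+ u. L_plus_integrand k \<alpha> (f i u * epowr (\<Prod>r<k. \<psi>0 (u r)) (1 / \<alpha>)) \<partial>kpow k m) < \<infinity>"
    and Lmeas: "(\<lambda>u. f i u * epowr (\<Prod>r<k. \<psi>0 (u r)) (1 / \<alpha>)) \<in> borel_measurable (kpow k m)" for i
    using Lp[of i] by (auto simp: L_plus_class_def L_class_def)
  have Lint_meas: "L_plus_integrand k \<alpha> \<in> borel_measurable borel"
    unfolding L_plus_integrand_def Let_def by measurable
  \<comment> \<open>The integrand is infinite where its argument is, and the factor from the density
    is positive; so integrability forces \<open>f i\<close> to be finite almost everywhere.\<close>
  have f_fin: "AE u in kpow k \<mu>. f i u < \<infinity>" for i
  proof -
    have "AE u in kpow k m. L_plus_integrand k \<alpha> (f i u * epowr (\<Prod>r<k. \<psi>0 (u r)) (1 / \<alpha>)) \<noteq> \<infinity>"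
      using Lfin[of i] by (intro nn_integral_PInf_AE measurable_compose[OF Lmeas Lint_meas]) auto
    then have "AE u in kpow k m. f i u < \<infinity>"
      using \<psi>prod
    proof eventually_elim
      case (elim u)
      have p: "0 < (\<Prod>r<k. \<psi> (u r))" by (intro prod_pos \<psi>_pos)
      have "epowr (ennreal y) (1 / \<alpha>) \<noteq> 0" if "0 < y" for y using that by (simp add: epowr_def)
      from this[OF p] have "epowr (\<Prod>r<k. \<psi>0 (u r)) (1 / \<alpha>) \<noteq> 0" unfolding elim(2) .
      then have "f i u * epowr (\<Prod>r<k. \<psi>0 (u r)) (1 / \<alpha>) = \<infinity>" if "f i u = \<infinity>"
        using that by (simp add: ennreal_top_mult)
      then have "f i u \<noteq> \<infinity>" using elim(1) by (auto simp: L_plus_integrand_def)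
      then show ?case by (simp add: less_top)
    qed
    then show ?thesis unfolding dens_k
      by (subst AE_density) (auto intro!: borel_measurable_prod_ennreal measurable_compose[OF measurable_component_singleton])
  qed
  obtain C where C: "0 \<le> C" "\<And>r. 0 \<le> r \<Longrightarrow> (1 + \<alpha> * ln_plus r) ^ (k - 1) \<le>
      C * (1 + (if k = 2 then ln_plus r * ln_plus \<bar>ln r\<bar> else ln_plus r ^ (k - 1)))"
    using power_one_plus_ln_plus_le[OF assms(5,6)] by blast
  \<comment> \<open>Changing from \<open>\<mu>\<close> to \<open>m\<close> multiplies
    \<open>theta\<close> by the product density, and \<open>V\<close> lies below that density
    because \<open>rho\<close> lies below \<open>\<psi>\<close>.\<close>
  have fT: "Theta (\<lambda>u. enn2real (f i u)) < \<infinity>" for i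
  proof -
    have fm: "f i \<in> borel_measurable (kpow k m)"
      using assms(9)[of i] by (simp add: L_class_def measurable_cong_sets[OF sets_k refl])
    have Vm: "V \<in> borel_measurable (kpow k m)"
      using V_measurable by (simp add: measurable_cong_sets[OF sets_k refl])
    have "Theta (\<lambda>u. enn2real (f i u)) =
        (\<integral>\<^sup>+u. (\<Prod>r<k. ennreal (\<psi> (u r))) * ennreal (theta \<alpha> k (enn2real (f i u)) (V u)) \<partial>kpow k m)"
      unfolding Theta_def by (subst dens_k, rule nn_integral_density)
        (use fm Vm in \<open>auto intro!: borel_measurable_prod_ennreal measurable_compose[OF measurable_component_singleton] theta_measurable measurable_compose[OF _ measurable_ennreal]\<close>)
    also have "\<dots> \<le> (\<integral>\<^sup>+u. ennreal C * L_plus_integrand k \<alpha> (f i u * epowr (\<Prod>r<k. \<psi>0 (u r)) (1 / \<alpha>)) \<partial>kpow k m)"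
    proof (rule nn_integral_mono_AE)
      show "AE u in kpow k m. (\<Prod>r<k. ennreal (\<psi> (u r))) * ennreal (theta \<alpha> k (enn2real (f i u)) (V u)) \<le>
        ennreal C * L_plus_integrand k \<alpha> (f i u * epowr (\<Prod>r<k. \<psi>0 (u r)) (1 / \<alpha>))"
        using \<psi>prod
      proof eventually_elim
        case (elim u)
        define p where "p = (\<Prod>r<k. \<psi> (u r))"
        have p: "0 < p" unfolding p_def by (intro prod_pos \<psi>_pos)
        have pe: "(\<Prod>r<k. ennreal (\<psi> (u r))) = ennreal p"
          unfolding p_def by (intro prod_ennreal) (simp add: \<psi>_pos less_imp_le)
        show ?case
        proof (cases "f i u = \<infinity>")
          case True
          then show ?thesis by simp
        next
          case False
          then have fu: "f i u = ennreal (enn2real (f i u))" by (simp add: less_top)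
          have "V u \<le> p" unfolding V_def p_def
            using clw(3,4) by (intro prod_mono) (auto simp: less_imp_le)
          then have "ennreal p * ennreal (theta \<alpha> k (enn2real (f i u)) (V u)) \<le>
             ennreal C * L_plus_integrand k \<alpha> (ennreal (enn2real (f i u)) * epowr (ennreal p) (1 / \<alpha>))"
            using V_pos[of u] p C assms(5) by (intro theta_le_L_plus_integrand) auto
          then show ?thesis unfolding pe elim p_def[symmetric] using fu by simp
        qed
      qed
    qed
    also have "\<dots> = ennreal C * (\<integral>\<^sup>+u. L_plus_integrand k \<alpha> (f i u * epowr (\<Prod>r<k. \<psi>0 (u r)) (1 / \<alpha>)) \<partial>kpow k m)"
      by (intro nn_integral_cmult measurable_compose[OF Lmeas Lint_meas])
    also have "\<dots> < \<infinity>" using Lfin[of i] by (simp add: ennreal_mult_less_top)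
    finally show ?thesis .
  qed
  show ?thesis
    by (rule extremal_integral_tail[OF Nm EN(5) assms(9) f_fin assms(10) fT assms(12)])
qed

end
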